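(* Suppose there is a pseudogroup generated by $k$ pairings with $\mathbb{Z}^d$-valued weights, $\{g_i\}_{i=1}^k$ on $[1,N]$, such that there is a partition of $[1,N]$ into $m$ disjoint subintervals in which the weights are constant, and such that the total weight is at most $D$. Then the weighted orbit counting algorithm (the explicit procedure, Steps (1)–(7), given in the context) outputs a list with one point for each orbit and corresponding orbit weights, and runs in time polynomial in $k\,m\,d\,\log D\,\log N$.
   Context: **Pairings and orbits.** Intervals are intervals of integers, $[a,b]=\{a,a+1,\dots,b\}$, of width $b-a+1$. A pairing $g:[a,b]\to[c,d]$ between subintervals of $[1,N]$ is a bijection that is either increasing (orientation preserving: $a\mapsto c$, $b\mapsto d$) or decreasing (orientation reversing: $a\mapsto d$, $b\mapsto c$). Of the two paired intervals, the left one $[a,b]$ ($a<c$) is called the domain and $[c,d]$ the range. (The endpoint $d$ is not to be confused with the dimension $d$ of the weights.) An orientation preserving pairing has translation distance $t=c-a$. The pairings generate a pseudogroup under composition where defined, inverses, and restriction to subintervals; the orbits are the equivalence classes into which this action divides $[1,N]$. **Weights.** A weight function assigns to each point of $[1,N]$ a vector in $\mathbb{Z}^d$. It is given by a list $L=\{([p_1,q_1],z_1),\dots,([p_m,q_m],z_m)\}$, $1\le p_i\le q_i<p_{i+1}\le N$, the weight being $z_j$ on $[p_j,q_j]$. The total weight of $L$ is $\sum_{i=1}^m|z_i|$. The orbit weight of an orbit is the sum of the weights of its points. The output is a list $L'=\{([r_1,s_1],v_1),\dots,([r_n,s_n],v_n)\}$, $1\le r_i\le s_i<r_{i+1}$,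 where $([r_i,s_i],v_i)$ represents $s_i-r_i+1$ orbits, one for each point of $[r_i,s_i]$, each with orbit weight $v_i$. **Terminology.** $N'$ denotes the current interval length, initially $N$. An interval is static if it meets neither the domain nor the range of any pairing. A pairing $g_i$ is maximal if $d_i=N'$ and $[c_i,N']$ contains the range of any other pairing with an endpoint at $N'$; more precisely, it is maximal in the lexicographical order on $(d_i,-c_i,-a_i,-\text{orientation})$. A pairing $g:[a,b]\to[c,d]$ is periodic with period $t$ if it is orientation preserving with translation distance $t$ and $a<c=a+t\le b+1$; then $[a,d]$ is its periodic interval. **Operations.** - Periodic merger: if $g_1,g_2$ are periodic with periods $t_1,t_2$ and overlapping periodic intervals $R_1,R_2$, and width$(R_1\cap R_2)\ge t_1+t_2$, replace them by a single periodic pairing with periodic interval $R_1\cup R_2$ and period $\mathrm{GCD}(t_1,t_2)$. - Contraction of a static interval $[r,s]$: eliminate it, replace $[1,N']$ by $[1,N'-(s-r+1)]$, and replace any point $x>s$ in a domain or range of a pairing by $x-(s-r+1)$. - Trimming of an orientation reversing $g:[a,b]\to[c,d]$ with $b\ge c$: replace $g$ by its restriction $g':[a,(a+d)/2)\to((a+d)/2,d]$. - Truncation: suppose $g:[a,b]\to[c,N']$ is a pairing and $M$ satisfies $c\le M+1\le N'$, with all points of $[M+1,N']$ in the range of no pairing other than $g$. Replace $[1,N']$ by $[1,M]$, leaving other pairings unchanged. If $c=M+1$, eliminate $g$. Otherwise, if $g$ is orientation preserving, replace it by $g':[a,b-(N'-M)]\to[c,M]$. If $g$ is orientation reversing, truncation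 is applied only when $b<c$ and $[M+1,N']$ is disjoint from the domains and ranges of all other pairings, and $g$ is replaced by its restriction with domain $[a+N'-M,b]$ and range $[c,M]$. - Transmission of $g_2$ by $g_1$, where the range $[c_2,d_2]$ of $g_2$ is contained in the range of $g_1$: if $g_1$ is orientation reversing with overlapping domain and range, first trim $g_1$. Let $r=1$ if $g_1$ is orientation reversing; otherwise let $r\ge1$ be the largest integer such that $g_1^{-r+1}([c_2,d_2])$ is contained in the range of $g_1$. If the domain $[a_2,b_2]$ of $g_2$ is not contained in the range of $g_1$, replace $g_2$ by $g_1^{-r}\circ g_2$. If it is, replace $g_2$ by $g_1^{-r}\circ g_2\circ g_1^{s}:g_1^{-s}([a_2,b_2])\to g_1^{-r}([c_2,d_2])$, where $s=1$ if $g_1$ is orientation reversing, and otherwise $s\ge1$ is the largest integer such that $g_1^{-s+1}([a_2,b_2])$ is contained in the range of $g_1$. - Transferring weights by $g:[a,b]\to[c,d]$, where the weights on $[c,d]$ are given by $\{([c=r_1,s_1],v_1),\dots,([r_n,s_n=d],v_n)\}$. Case 1, $g$ orientation preserving and $b<c$: set the weights on $[c,d]$ to zero and, for each $1\le j\le n$, add $v_j$ to the weights on $g^{-1}([r_j,s_j])$. Case 2, $g$ orientation preserving and $b\ge c$ (so $g$ is periodic of period $t=c-a$): set the weights on $[c,d]$ to zero and, for each $j$, with $w_j$ the width of $[r_j,s_j]$ and $[[\cdot]]$ the integer part, add $[[w_j/t]]\,v_j$ to the weight of each point of $[a,c-1]$, and add an additional $v_j$ to the weight of each point of $[a,c-1]$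 congruent mod $t$ to a point of $[r_j+[[w_j/t]]t,\,s_j]$, if any such point exists. Case 3, $g$ orientation reversing: first trim $g$ (if its domain and range overlap); then, for the trimmed pairing $g:[a,b]\to[c,d]$, set the weights on $[c,d]$ to zero and, for each $j$, add $v_j$ to the weights on $g^{-1}([r_j,s_j])$. **Weighted orbit counting algorithm.** The input is the pairings $g_i:[a_i,b_i]\to[c_i,d_i]$, $1\le i\le k$, and the list $L$. Initialize $L'$ to be empty. The lists $L,L'$ are left unchanged in Steps (1), (3), (4), (5). (1) Delete any pairings which are restrictions of the identity. (2) Search for and contract static intervals. If the interval $[r,s]$ is contracted, has constant weight $z$, and is not contained in a larger contracted interval with the same weight $z$, add to the end of $L'$ an interval of width $s-r+1$ with associated weight $z$. Alter $L$ by replacing $[1,N']$ by $[1,N'-(s-r+1)]$, alter each $g_i$ as in the definition of contraction, and replace the weight function $w$ by the function $w'$ with $w'(x)=w(x)$ for $x<r$ and $w'(x)=w(x+(s-r+1))$ for $x\ge r$. (3) Trim all orientation reversing pairings whose domain and range overlap. (4) Search for pairs of periodic pairings $g_i,g_j$ satisfying the condition for a periodic merger; if any such pair exists, merge them into a single periodic pairing with translation distance $\mathrm{GCD}(t_i,t_j)$ acting on the union of their domains and ranges. Repeat until no mergers can be performed. (5) Find a maximal $g_i$. For each $g_j$ with $j\ne i$, if the range of $g_j$ is contained in $[c_i,N']$, transmit $g_j$ by $g_i$. (6) Find the smallest value of $c$ such that the interval $[c,N']$ intersects the range of at most one pairing $g_i$, with $g_i:[a_i,b_i]\to[c_i,N']$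 and $[c,N']$ contained in $[c_i,N']$. Transfer the weights on $[c_i,N']$ by $g_i$, and then truncate the pairing $g_i$, removing the points of $[c,N']$. (7) If the interval size $N'$ has decreased to zero, output the list $L'$ and stop. Otherwise start again with Step (1). *)

theory Defs
  imports "HOL-Analysis.L2_Norm" "HOL-Library.Log_Nat" "HOL-Library.Monad_Syntax"
    "HOL-Library.While_Combinator"
begin

section \<open>Pairings, pseudogroups, orbits and weights\<close>

text \<open>
  Between integer intervals of equal width there are exactly two monotone bijections, so
  a pairing \<open>[a,b] \<rightarrow> [c,d]\<close> is stored as its four endpoints and an orientation flag
  (\<open>True\<close> for orientation preserving).
\<close>

datatype pairing =
  Pairing (dom_lo: int) (dom_hi: int) (ran_lo: int) (ran_hi: int) (preserving: bool)

text \<open>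
  The domain is the left one of the two intervals. The case \<open>a = c\<close> is kept, since it
  arises in the algorithm (identities, and reflections of an interval onto itself).
\<close>

fun is_pairing :: "int \<Rightarrow> pairing \<Rightarrow> bool" where
  "is_pairing N (Pairing a b c d p) \<longleftrightarrow>
     1 \<le> a \<and> a \<le> b \<and> a \<le> c \<and> d \<le> N \<and> d - c = b - a"

fun pairing_map :: "pairing \<Rightarrow> int \<rightharpoonup> int" where
  "pairing_map (Pairing a b c d p) =
     (\<lambda>x. if x \<in> {a..b} then Some (if p then c + (x - a) else d - (x - a)) else None)"

definition partial_inverse :: "(int \<rightharpoonup> int) \<Rightarrow> int \<rightharpoonup> int" where
  "partial_inverse h =
     (\<lambda>y. if \<exists>x. h x = Some y then Some (THE x. h x = Some y) else None)"

inductive_set pseudogroup :: "int \<Rightarrow> pairing list \<Rightarrow> (int \<rightharpoonup> int) set"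
  for N :: int and ps :: "pairing list" where
  identity: "(Some |` {1..N}) \<in> pseudogroup N ps"
| generator: "g \<in> set ps \<Longrightarrow> pairing_map g \<in> pseudogroup N ps"
| inverse: "h \<in> pseudogroup N ps \<Longrightarrow> partial_inverse h \<in> pseudogroup N ps"
| composition: "g \<in> pseudogroup N ps \<Longrightarrow> h \<in> pseudogroup N ps \<Longrightarrow> g \<circ>\<^sub>m h \<in> pseudogroup N ps"
| restriction: "h \<in> pseudogroup N ps \<Longrightarrow> h |` {x..y} \<in> pseudogroup N ps"

definition orbit_rel :: "int \<Rightarrow> pairing list \<Rightarrow> (int \<times> int) set" where
  "orbit_rel N ps = {(x, y). x \<in> {1..N} \<and> y \<in> {1..N} \<and> (\<exists>h \<in> pseudogroup N ps. h x = Some y)}"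

definition orbits :: "int \<Rightarrow> pairing list \<Rightarrow> int set set" where
  "orbits N ps = {1..N} // orbit_rel N ps"

text \<open>Vectors in \<open>\<int>\<^sup>d\<close> are integer lists of length \<open>d\<close>.\<close>

type_synonym weights = "((int \<times> int) \<times> int list) list"

definition weight_list :: "nat \<Rightarrow> weights \<Rightarrow> bool" where
  "weight_list d L \<longleftrightarrow>
     (\<forall>((p, q), z) \<in> set L. 1 \<le> p \<and> p \<le> q \<and> length z = d) \<and>
     sorted_wrt (\<lambda>((p, q), z) ((p', q'), z'). q < p') L"

definition support :: "weights \<Rightarrow> int set" where
  "support L = (\<Union>((p, q), z) \<in> set L. {p..q})"

fun weight_at :: "nat \<Rightarrow> weights \<Rightarrow> int \<Rightarrow> int list" where
  "weight_at d [] x = replicate d 0"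
| "weight_at d (((p, q), z) # L) x = (if p \<le> x \<and> x \<le> q then z else weight_at d L x)"

definition orbit_weight :: "nat \<Rightarrow> weights \<Rightarrow> int set \<Rightarrow> int list" where
  "orbit_weight d L X = map (\<lambda>i. \<Sum>x\<in>X. weight_at d L x ! i) [0..<d]"

definition vec_norm :: "int list \<Rightarrow> real" where
  "vec_norm z = L2_set (\<lambda>i. real_of_int (z ! i)) {..<length z}"

definition total_weight :: "weights \<Rightarrow> real" where
  "total_weight L = (\<Sum>(I, z)\<leftarrow>L. vec_norm z)"

definition lists_orbits :: "int \<Rightarrow> pairing list \<Rightarrow> nat \<Rightarrow> weights \<Rightarrow> weights \<Rightarrow> bool" where
  "lists_orbits N ps d L L' \<longleftrightarrow>
     weight_list d L' \<and>
     (\<exists>f. bij_betw f (support L') (orbits N ps) \<and>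
          (\<forall>((r, s), v) \<in> set L'. \<forall>x \<in> {r..s}. orbit_weight d L (f x) = v))"


section \<open>Computations with a bit-cost\<close>

text \<open>
  A value of type \<open>'a tm\<close> is a result together with the number of elementary steps spent
  on it. The cost is logarithmic: arithmetic and comparisons are charged as schoolbook
  operations on the binary representations. Returning a value costs one step, so every call
  of a program below costs at least one step. The only uncharged operations are the bounded
  number of constructor applications, projections and Boolean tests between two charged ones.
\<close>

datatype 'a tm = TM (result: 'a) (cost: nat)

definition ret :: "'a \<Rightarrow> 'a tm" where
  "ret x = TM x 1"

definition bind_tm :: "'a tm \<Rightarrow> ('a \<Rightarrow> 'b tm) \<Rightarrow> 'b tm" where
  "bind_tm m f = TM (result (f (result m))) (cost m + cost (f (result m)))"

adhoc_overloading Monad_Syntax.bind \<rightleftharpoons> bind_tm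

lemma bind_tm_cong [fundef_cong]:
  assumes "m = m'" and "\<And>x. x = result m' \<Longrightarrow> f x = g x"
  shows "bind_tm m f = bind_tm m' g"
  using assms by (simp add: bind_tm_def)

definition isize :: "int \<Rightarrow> nat" where
  "isize x = nat (bitlen \<bar>x\<bar>) + 1"

definition add_t :: "int \<Rightarrow> int \<Rightarrow> int tm" where
  "add_t x y = TM (x + y) (isize x + isize y)"

definition sub_t :: "int \<Rightarrow> int \<Rightarrow> int tm" where
  "sub_t x y = TM (x - y) (isize x + isize y)"

definition le_t :: "int \<Rightarrow> int \<Rightarrow> bool tm" where
  "le_t x y = TM (x \<le> y) (isize x + isize y)"

definition less_t :: "int \<Rightarrow> int \<Rightarrow> bool tm" where
  "less_t x y = TM (x < y) (isize x + isize y)"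

definition eq_t :: "int \<Rightarrow> int \<Rightarrow> bool tm" where
  "eq_t x y = TM (x = y) (isize x + isize y)"

definition mul_t :: "int \<Rightarrow> int \<Rightarrow> int tm" where
  "mul_t x y = TM (x * y) (isize x * isize y)"

definition div_t :: "int \<Rightarrow> int \<Rightarrow> int tm" where
  "div_t x y = TM (x div y) (isize x * isize y)"

definition mod_t :: "int \<Rightarrow> int \<Rightarrow> int tm" where
  "mod_t x y = TM (x mod y) (isize x * isize y)"

definition min_t :: "int \<Rightarrow> int \<Rightarrow> int tm" where
  "min_t x y = do { b \<leftarrow> le_t x y; ret (if b then x else y) }"

definition max_t :: "int \<Rightarrow> int \<Rightarrow> int tm" where
  "max_t x y = do { b \<leftarrow> le_t x y; ret (if b then y else x) }"

function gcd_t :: "int \<Rightarrow> int \<Rightarrow> int tm" where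
  "gcd_t x y = do {
     z \<leftarrow> eq_t y 0;
     if z then ret x else do { r \<leftarrow> mod_t x y; gcd_t y r }
   }"
  by pat_completeness auto
termination
  by (relation "Wellfounded.measure (\<lambda>(x, y). nat \<bar>y\<bar>)")
    (auto simp: eq_t_def mod_t_def abs_mod_less)

fun map_t :: "('a \<Rightarrow> 'b tm) \<Rightarrow> 'a list \<Rightarrow> 'b list tm" where
  "map_t f [] = ret []"
| "map_t f (x # xs) = do { y \<leftarrow> f x; ys \<leftarrow> map_t f xs; ret (y # ys) }"

fun append_t :: "'a list \<Rightarrow> 'a list \<Rightarrow> 'a list tm" where
  "append_t [] ys = ret ys"
| "append_t (x # xs) ys = do { zs \<leftarrow> append_t xs ys; ret (x # zs) }"

fun vec_add_t :: "int list \<Rightarrow> int list \<Rightarrow> int list tm" where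
  "vec_add_t (x # xs) (y # ys) = do { z \<leftarrow> add_t x y; zs \<leftarrow> vec_add_t xs ys; ret (z # zs) }"
| "vec_add_t _ _ = ret []"

fun vec_eq_t :: "int list \<Rightarrow> int list \<Rightarrow> bool tm" where
  "vec_eq_t [] [] = ret True"
| "vec_eq_t (x # xs) (y # ys) = do { e \<leftarrow> eq_t x y; if e then vec_eq_t xs ys else ret False }"
| "vec_eq_t _ _ = ret False"


section \<open>Operations on weight lists\<close>

text \<open>
  During the algorithm the list \<open>L\<close> is always a partition of the current interval
  \<open>[1,N']\<close>; points of zero weight lie in intervals labelled with the zero vector.
\<close>

definition piece_t :: "int \<Rightarrow> int \<Rightarrow> int list \<Rightarrow> weights \<Rightarrow> weights tm" where
  "piece_t p q z L = do { b \<leftarrow> le_t p q; ret (if b then ((p, q), z) # L else L) }"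

fun restrict_weights_t :: "int \<Rightarrow> int \<Rightarrow> weights \<Rightarrow> weights tm" where
  "restrict_weights_t x y [] = ret []"
| "restrict_weights_t x y (((p, q), z) # L) = do {
     L' \<leftarrow> restrict_weights_t x y L;
     p' \<leftarrow> max_t p x;
     q' \<leftarrow> min_t q y;
     piece_t p' q' z L'
   }"

fun add_weight_t :: "int \<Rightarrow> int \<Rightarrow> int list \<Rightarrow> weights \<Rightarrow> weights tm" where
  "add_weight_t x y v [] = ret []"
| "add_weight_t x y v (((p, q), z) # L) = do {
     L0 \<leftarrow> add_weight_t x y v L;
     y' \<leftarrow> add_t y 1;
     p3 \<leftarrow> max_t p y';
     L1 \<leftarrow> piece_t p3 q z L0;
     p2 \<leftarrow> max_t p x;
     q2 \<leftarrow> min_t q y;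
     zv \<leftarrow> vec_add_t z v;
     L2 \<leftarrow> piece_t p2 q2 zv L1;
     x' \<leftarrow> sub_t x 1;
     q1 \<leftarrow> min_t q x';
     piece_t p q1 z L2
   }"

text \<open>The interval \<open>[c,d]\<close> becomes a single entry of the list, of weight zero.\<close>

definition zero_weights_t :: "int \<Rightarrow> int \<Rightarrow> int \<Rightarrow> weights \<Rightarrow> weights tm" where
  "zero_weights_t N c d L = do {
     c' \<leftarrow> sub_t c 1;
     d' \<leftarrow> add_t d 1;
     L1 \<leftarrow> restrict_weights_t 1 c' L;
     L2 \<leftarrow> restrict_weights_t d' N L;
     zero \<leftarrow> (case L of [] \<Rightarrow> ret [] | (I, z) # _ \<Rightarrow> map_t (mul_t 0) z);
     append_t L1 (((c, d), zero) # L2)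
   }"

text \<open>Deletes \<open>[r,s]\<close>, whose width is \<open>w\<close>, and shifts what lies to the right of it.\<close>

fun contract_weights_t :: "int \<Rightarrow> int \<Rightarrow> int \<Rightarrow> weights \<Rightarrow> weights tm" where
  "contract_weights_t r s w [] = ret []"
| "contract_weights_t r s w (((p, q), z) # L) = do {
     L0 \<leftarrow> contract_weights_t r s w L;
     s' \<leftarrow> add_t s 1;
     p2 \<leftarrow> max_t p s';
     p2' \<leftarrow> sub_t p2 w;
     q2' \<leftarrow> sub_t q w;
     L1 \<leftarrow> piece_t p2' q2' z L0;
     r' \<leftarrow> sub_t r 1;
     q1 \<leftarrow> min_t q r';
     piece_t p q1 z L1
   }"

text \<open>Adds an interval of width \<open>w\<close> at the end; \<open>e\<close> is the point preceding the list.\<close>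

fun add_at_end_t :: "int \<Rightarrow> weights \<Rightarrow> int \<Rightarrow> int list \<Rightarrow> weights tm" where
  "add_at_end_t e [] w z = do { r \<leftarrow> add_t e 1; s \<leftarrow> add_t e w; ret [((r, s), z)] }"
| "add_at_end_t e (((r, s), v) # L) w z = do {
     L' \<leftarrow> add_at_end_t s L w z;
     ret (((r, s), v) # L')
   }"


section \<open>Operations on pairings\<close>

fun is_identity_t :: "pairing \<Rightarrow> bool tm" where
  "is_identity_t (Pairing a b c d p) = do {
     e \<leftarrow> eq_t a c;
     if \<not> e then ret False else if p then ret True else eq_t a b
   }"

fun delete_identities_t :: "pairing list \<Rightarrow> pairing list tm" where
  "delete_identities_t [] = ret []"
| "delete_identities_t (g # gs) = do {
     gs' \<leftarrow> delete_identities_t gs;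
     e \<leftarrow> is_identity_t g;
     ret (if e then gs' else g # gs')
   }"

text \<open>
  Trimming, if it applies: for \<open>\<sigma> = a + d\<close>, the largest integer below \<open>\<sigma> / 2\<close> is
  \<open>(\<sigma> - 1) div 2\<close> and the smallest one above is \<open>\<sigma> div 2 + 1\<close>.
\<close>

fun trim_t :: "pairing \<Rightarrow> pairing tm" where
  "trim_t (Pairing a b c d p) =
     (if p then ret (Pairing a b c d p)
      else do {
        overlap \<leftarrow> le_t c b;
        if \<not> overlap then ret (Pairing a b c d p)
        else do {
          \<sigma> \<leftarrow> add_t a d;
          \<sigma>' \<leftarrow> sub_t \<sigma> 1;
          b' \<leftarrow> div_t \<sigma>' 2;
          h \<leftarrow> div_t \<sigma> 2;
          c' \<leftarrow> add_t h 1;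
          ret (Pairing a b' c' d False)
        }
      })"

fun periodic_t :: "pairing \<Rightarrow> bool tm" where
  "periodic_t (Pairing a b c d p) =
     (if \<not> p then ret False
      else do {
        l \<leftarrow> less_t a c;
        b' \<leftarrow> add_t b 1;
        u \<leftarrow> le_t c b';
        ret (l \<and> u)
      })"

text \<open>
  The merged pairing if the condition for a periodic merger holds; that condition makes
  the intersection nonempty, so the periodic intervals overlap.
\<close>

fun merge_pair_t :: "pairing \<Rightarrow> pairing \<Rightarrow> pairing option tm" where
  "merge_pair_t (Pairing a1 b1 c1 d1 p1) (Pairing a2 b2 c2 d2 p2) = do {
     per1 \<leftarrow> periodic_t (Pairing a1 b1 c1 d1 p1);
     per2 \<leftarrow> periodic_t (Pairing a2 b2 c2 d2 p2);
     if \<not> (per1 \<and> per2) then ret None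
     else do {
       t1 \<leftarrow> sub_t c1 a1;
       t2 \<leftarrow> sub_t c2 a2;
       lo \<leftarrow> max_t a1 a2;
       hi \<leftarrow> min_t d1 d2;
       hi' \<leftarrow> add_t hi 1;
       width \<leftarrow> sub_t hi' lo;
       t12 \<leftarrow> add_t t1 t2;
       ok \<leftarrow> le_t t12 width;
       if \<not> ok then ret None
       else do {
         t \<leftarrow> gcd_t t1 t2;
         a \<leftarrow> min_t a1 a2;
         d \<leftarrow> max_t d1 d2;
         b \<leftarrow> sub_t d t;
         c \<leftarrow> add_t a t;
         ret (Some (Pairing a b c d True))
       }
     }
   }"

fun merge_into_t :: "pairing \<Rightarrow> pairing list \<Rightarrow> pairing list option tm" where
  "merge_into_t g [] = ret None"
| "merge_into_t g (h # hs) = do {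
     m \<leftarrow> merge_pair_t g h;
     case m of
       Some g' \<Rightarrow> ret (Some (g' # hs))
     | None \<Rightarrow> do {
         r \<leftarrow> merge_into_t g hs;
         ret (case r of None \<Rightarrow> None | Some hs' \<Rightarrow> Some (h # hs'))
       }
   }"

fun merge_once_t :: "pairing list \<Rightarrow> pairing list option tm" where
  "merge_once_t [] = ret None"
| "merge_once_t (g # gs) = do {
     m \<leftarrow> merge_into_t g gs;
     case m of
       Some gs' \<Rightarrow> ret (Some gs')
     | None \<Rightarrow> do {
         r \<leftarrow> merge_once_t gs;
         ret (case r of None \<Rightarrow> None | Some gs' \<Rightarrow> Some (g # gs'))
       }
   }"

lemma length_merge_into:
  "result (merge_into_t g hs) = Some hs' \<Longrightarrow> length hs' = length hs"
  by (induction g hs arbitrary: hs' rule: merge_into_t.induct)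
    (auto simp: bind_tm_def ret_def split: option.splits)

lemma length_merge_once:
  "result (merge_once_t gs) = Some gs' \<Longrightarrow> length gs = Suc (length gs')"
  by (induction gs arbitrary: gs' rule: merge_once_t.induct)
    (auto simp: bind_tm_def ret_def length_merge_into split: option.splits)

function merge_all_t :: "pairing list \<Rightarrow> pairing list tm" where
  "merge_all_t gs = do {
     m \<leftarrow> merge_once_t gs;
     case m of None \<Rightarrow> ret gs | Some gs' \<Rightarrow> merge_all_t gs'
   }"
  by pat_completeness auto
termination
  by (relation "Wellfounded.measure length") (auto dest: length_merge_once[OF sym])

text \<open>
  Strict comparison in the lexicographical order on \<open>(d, -c, -a, -orientation)\<close>, with
  orientation \<open>1\<close> for preserving and \<open>-1\<close> for reversing pairings.
\<close>

fun less_maximal_t :: "pairing \<Rightarrow> pairing \<Rightarrow> bool tm" where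
  "less_maximal_t (Pairing a1 b1 c1 d1 p1) (Pairing a2 b2 c2 d2 p2) = do {
     d_less \<leftarrow> less_t d1 d2;
     d_eq \<leftarrow> eq_t d1 d2;
     c_less \<leftarrow> less_t c2 c1;
     c_eq \<leftarrow> eq_t c1 c2;
     a_less \<leftarrow> less_t a2 a1;
     a_eq \<leftarrow> eq_t a1 a2;
     ret (d_less \<or> d_eq \<and> (c_less \<or> c_eq \<and> (a_less \<or> a_eq \<and> p1 \<and> \<not> p2)))
   }"

fun extract_maximal_t :: "pairing list \<Rightarrow> (pairing \<times> pairing list) option tm" where
  "extract_maximal_t [] = ret None"
| "extract_maximal_t (g # gs) = do {
     r \<leftarrow> extract_maximal_t gs;
     case r of
       None \<Rightarrow> ret (Some (g, []))
     | Some (h, hs) \<Rightarrow> do {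
         l \<leftarrow> less_maximal_t g h;
         ret (Some (if l then (h, g # hs) else (g, h # hs)))
       }
   }"

definition contained_t :: "int \<Rightarrow> int \<Rightarrow> int \<Rightarrow> int \<Rightarrow> bool tm" where
  "contained_t x y l u = do { p \<leftarrow> le_t l x; q \<leftarrow> le_t y u; ret (p \<and> q) }"

text \<open>Renames the two intervals so that the left one is the domain.\<close>

definition orient_t :: "int \<Rightarrow> int \<Rightarrow> int \<Rightarrow> int \<Rightarrow> bool \<Rightarrow> pairing tm" where
  "orient_t a b c d p = do {
     l \<leftarrow> less_t c a;
     ret (if l then Pairing c d a b p else Pairing a b c d p)
   }"

text \<open>
  Image of \<open>[x,y] \<subseteq> [c,d]\<close> under \<open>g\<^sup>-\<^sup>r\<close>, where \<open>r \<ge> 1\<close> is the largest integer such that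
  \<open>g\<^sup>-\<^sup>r\<^sup>+\<^sup>1\<close> maps \<open>[x,y]\<close> into \<open>[c,d]\<close> if \<open>g : [a,b] \<rightarrow> [c,d]\<close> preserves orientation, and
  \<open>r = 1\<close> otherwise. In the former case \<open>x - (r - 1) t \<ge> c\<close> yields \<open>r - 1 = (x - c) div t\<close>.
\<close>

fun pull_back_t :: "pairing \<Rightarrow> int \<Rightarrow> int \<Rightarrow> (int \<times> int) tm" where
  "pull_back_t (Pairing a b c d p) x y =
     (if p then do {
        t \<leftarrow> sub_t c a;
        u \<leftarrow> sub_t x c;
        r' \<leftarrow> div_t u t;
        r \<leftarrow> add_t r' 1;
        k \<leftarrow> mul_t r t;
        x' \<leftarrow> sub_t x k;
        y' \<leftarrow> sub_t y k;
        ret (x', y')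
      }
      else do {
        \<sigma> \<leftarrow> add_t a d;
        x' \<leftarrow> sub_t \<sigma> y;
        y' \<leftarrow> sub_t \<sigma> x;
        ret (x', y')
      })"

fun transmit_t :: "pairing \<Rightarrow> pairing \<Rightarrow> pairing tm" where
  "transmit_t g1 (Pairing a2 b2 c2 d2 p2) = do {
     g \<leftarrow> trim_t g1;
     (c', d') \<leftarrow> pull_back_t g c2 d2;
     both \<leftarrow> contained_t a2 b2 (ran_lo g) (ran_hi g);
     if both
     then do { (a', b') \<leftarrow> pull_back_t g a2 b2; orient_t a' b' c' d' p2 }
     else orient_t a2 b2 c' d' (p2 = preserving g)
   }"

fun truncate_t :: "int \<Rightarrow> int \<Rightarrow> pairing \<Rightarrow> pairing option tm" where
  "truncate_t N M (Pairing a b c d p) = do {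
     M' \<leftarrow> add_t M 1;
     e \<leftarrow> eq_t c M';
     if e then ret None
     else do {
       l \<leftarrow> sub_t N M;
       if p then do { b' \<leftarrow> sub_t b l; ret (Some (Pairing a b' c M p)) }
       else do { a' \<leftarrow> add_t a l; ret (Some (Pairing a' b c M p)) }
     }
   }"


section \<open>Transferring weights\<close>

text \<open>
  One entry \<open>([r,s],v)\<close> of the weights on the range of a periodic pairing of period
  \<open>t = c - a\<close>. The points of \<open>[a,c-1]\<close> congruent to one of the last \<open>(s - r + 1) mod t\<close>
  points of \<open>[r,s]\<close> form a cyclic interval of \<open>[a,c-1]\<close>, starting at the representative of
  \<open>r\<close>, since \<open>r + [[w/t]] t\<close> and \<open>r\<close> are congruent.
\<close>

fun transfer_periodic_t :: "int \<Rightarrow> int \<Rightarrow> (int \<times> int) \<times> int list \<Rightarrow> weights \<Rightarrow> weights tm" where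
  "transfer_periodic_t a c ((r, s), v) L = do {
     t \<leftarrow> sub_t c a;
     c' \<leftarrow> sub_t c 1;
     s' \<leftarrow> add_t s 1;
     w \<leftarrow> sub_t s' r;
     n \<leftarrow> div_t w t;
     nv \<leftarrow> map_t (mul_t n) v;
     L1 \<leftarrow> add_weight_t a c' nv L;
     m \<leftarrow> mod_t w t;
     none \<leftarrow> eq_t m 0;
     if none then ret L1
     else do {
       ra \<leftarrow> sub_t r a;
       off \<leftarrow> mod_t ra t;
       x \<leftarrow> add_t a off;
       x' \<leftarrow> add_t x m;
       y \<leftarrow> sub_t x' 1;
       inside \<leftarrow> le_t y c';
       if inside then add_weight_t x y v L1
       else do {
         L2 \<leftarrow> add_weight_t x c' v L1;
         y' \<leftarrow> sub_t y t;
         add_weight_t a y' v L2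
       }
     }
   }"

fun transfer_entry_t :: "pairing \<Rightarrow> (int \<times> int) \<times> int list \<Rightarrow> weights \<Rightarrow> weights tm" where
  "transfer_entry_t (Pairing a b c d p) ((r, s), v) L =
     (if p then do {
        disjoint \<leftarrow> less_t b c;
        if disjoint then do {
          t \<leftarrow> sub_t c a;
          x \<leftarrow> sub_t r t;
          y \<leftarrow> sub_t s t;
          add_weight_t x y v L
        }
        else transfer_periodic_t a c ((r, s), v) L
      }
      else do {
        \<sigma> \<leftarrow> add_t a d;
        x \<leftarrow> sub_t \<sigma> s;
        y \<leftarrow> sub_t \<sigma> r;
        add_weight_t x y v L
      })"

fun transfer_entries_t :: "pairing \<Rightarrow> weights \<Rightarrow> weights \<Rightarrow> weights tm" where
  "transfer_entries_t g [] L = ret L"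
| "transfer_entries_t g (e # es) L = do {
     L' \<leftarrow> transfer_entry_t g e L;
     transfer_entries_t g es L'
   }"

definition transfer_t :: "int \<Rightarrow> pairing \<Rightarrow> weights \<Rightarrow> weights tm" where
  "transfer_t N g L = do {
     h \<leftarrow> trim_t g;
     es \<leftarrow> restrict_weights_t (ran_lo h) (ran_hi h) L;
     L' \<leftarrow> zero_weights_t N (ran_lo h) (ran_hi h) L;
     transfer_entries_t h es L'
   }"


section \<open>Static intervals\<close>

fun covered_t :: "int \<Rightarrow> pairing list \<Rightarrow> bool tm" where
  "covered_t x [] = ret False"
| "covered_t x (Pairing a b c d p # gs) = do {
     u \<leftarrow> contained_t x x a b;
     v \<leftarrow> contained_t x x c d;
     if u \<or> v then ret True else covered_t x gs
   }"

text \<open>A maximal static interval starts at \<open>1\<close> or immediately after a domain or range.\<close>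

fun start_points_t :: "pairing list \<Rightarrow> int list tm" where
  "start_points_t [] = ret [1]"
| "start_points_t (Pairing a b c d p # gs) = do {
     xs \<leftarrow> start_points_t gs;
     b' \<leftarrow> add_t b 1;
     d' \<leftarrow> add_t d 1;
     ret (b' # d' # xs)
   }"

fun find_static_t :: "int \<Rightarrow> pairing list \<Rightarrow> int list \<Rightarrow> int option tm" where
  "find_static_t N gs [] = ret None"
| "find_static_t N gs (x # xs) = do {
     l \<leftarrow> le_t x N;
     if \<not> l then find_static_t N gs xs
     else do {
       u \<leftarrow> covered_t x gs;
       if u then find_static_t N gs xs else ret (Some x)
     }
   }"

definition stop_before_t :: "int \<Rightarrow> int \<Rightarrow> int \<Rightarrow> int tm" where
  "stop_before_t r x e = do {
     l \<leftarrow> less_t r x;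
     if l then do { x' \<leftarrow> sub_t x 1; min_t x' e } else ret e
   }"

text \<open>Right endpoint, at most \<open>e\<close>, of the static interval starting at the static point \<open>r\<close>.\<close>

fun static_end_t :: "int \<Rightarrow> pairing list \<Rightarrow> int \<Rightarrow> int tm" where
  "static_end_t r [] e = ret e"
| "static_end_t r (Pairing a b c d p # gs) e = do {
     e1 \<leftarrow> stop_before_t r a e;
     e2 \<leftarrow> stop_before_t r c e1;
     static_end_t r gs e2
   }"

fun extend_run_t :: "int list \<Rightarrow> int \<Rightarrow> weights \<Rightarrow> int tm" where
  "extend_run_t z s [] = ret s"
| "extend_run_t z s (((p, q), v) # L) = do {
     e \<leftarrow> vec_eq_t v z;
     if e then extend_run_t z q L else ret s
   }"

text \<open>Weight at \<open>r\<close>, and right endpoint of the interval of constant weight starting at \<open>r\<close>.\<close>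

fun weight_run_t :: "int \<Rightarrow> weights \<Rightarrow> (int list \<times> int) tm" where
  "weight_run_t r [] = ret ([], r)"
| "weight_run_t r (((p, q), z) # L) = do {
     l \<leftarrow> le_t r q;
     if l then do { s \<leftarrow> extend_run_t z q L; ret (z, s) } else weight_run_t r L
   }"

definition shift_t :: "int \<Rightarrow> int \<Rightarrow> int \<Rightarrow> int tm" where
  "shift_t s w x = do { l \<leftarrow> less_t s x; if l then sub_t x w else ret x }"

fun contract_pairing_t :: "int \<Rightarrow> int \<Rightarrow> pairing \<Rightarrow> pairing tm" where
  "contract_pairing_t s w (Pairing a b c d p) = do {
     a' \<leftarrow> shift_t s w a;
     b' \<leftarrow> shift_t s w b;
     c' \<leftarrow> shift_t s w c;
     d' \<leftarrow> shift_t s w d;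
     ret (Pairing a' b' c' d' p)
   }"


section \<open>The weighted orbit counting algorithm\<close>

datatype state = State (len: int) (pairings: "pairing list") (wts: weights) (outp: weights)

text \<open>
  Each maximal static interval of constant weight is contracted separately; what is left of a
  static interval whose weight is not constant is found in the next round. The tests
  \<open>0 < N'\<close> (for \<open>N' = 0\<close> nothing is left to contract) and \<open>0 < w\<close> (true for the nonempty
  intervals found in actual runs) make the recursion total on arbitrary data.
\<close>

function contract_static_t :: "state \<Rightarrow> state tm" where
  "contract_static_t (State N gs L L') = do {
     pos \<leftarrow> less_t 0 N;
     if \<not> pos then ret (State N gs L L')
     else do {
       xs \<leftarrow> start_points_t gs;
       f \<leftarrow> find_static_t N gs xs;
       case f of
         None \<Rightarrow> ret (State N gs L L')
       | Some r \<Rightarrow> do {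
           e \<leftarrow> static_end_t r gs N;
           (z, e') \<leftarrow> weight_run_t r L;
           s \<leftarrow> min_t e e';
           s' \<leftarrow> add_t s 1;
           w \<leftarrow> sub_t s' r;
           nonempty \<leftarrow> less_t 0 w;
           if \<not> nonempty then ret (State N gs L L')
           else do {
             L1' \<leftarrow> add_at_end_t 0 L' w z;
             gs1 \<leftarrow> map_t (contract_pairing_t s w) gs;
             L1 \<leftarrow> contract_weights_t r s w L;
             N1 \<leftarrow> sub_t N w;
             contract_static_t (State N1 gs1 L1 L1')
           }
         }
     }
   }"
  by pat_completeness auto
termination
  by (relation "Wellfounded.measure (\<lambda>S. nat (len S))") (auto simp: less_t_def sub_t_def)

definition transmit_if_contained_t :: "int \<Rightarrow> pairing \<Rightarrow> pairing \<Rightarrow> pairing tm" where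
  "transmit_if_contained_t N g h = do {
     u \<leftarrow> contained_t (ran_lo h) (ran_hi h) (ran_lo g) N;
     if u then transmit_t g h else ret h
   }"

text \<open>
  The interval \<open>[x,N']\<close> is disjoint from the ranges of all \<open>h \<in> set hs\<close> if and only if
  \<open>x > ran_hi h\<close> for all of them; the value is the smallest such \<open>x\<close> that is at least \<open>x\<^sub>0\<close>.
\<close>

fun cut_point_t :: "int \<Rightarrow> pairing list \<Rightarrow> int tm" where
  "cut_point_t x\<^sub>0 [] = ret x\<^sub>0"
| "cut_point_t x\<^sub>0 (h # hs) = do {
     d' \<leftarrow> add_t (ran_hi h) 1;
     x \<leftarrow> max_t x\<^sub>0 d';
     cut_point_t x hs
   }"

text \<open>
  After contraction of all static intervals, \<open>N'\<close> is the right endpoint of the range of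
  some pairing unless \<open>N' = 0\<close>, in which case no pairing is left.
  The comparison with \<open>0\<close> at the end charges for the stopping test of the main loop.
\<close>

definition cycle_t :: "state \<Rightarrow> state tm" where
  "cycle_t S0 = do {
     gs1 \<leftarrow> delete_identities_t (pairings S0);
     S \<leftarrow> contract_static_t (State (len S0) gs1 (wts S0) (outp S0));
     gs3 \<leftarrow> map_t trim_t (pairings S);
     gs4 \<leftarrow> merge_all_t gs3;
     f \<leftarrow> extract_maximal_t gs4;
     case f of
       None \<Rightarrow> do { _ \<leftarrow> eq_t (len S) 0; ret (State (len S) gs4 (wts S) (outp S)) }
     | Some (g, hs) \<Rightarrow> do {
         hs5 \<leftarrow> map_t (transmit_if_contained_t (len S) g) hs;
         c \<leftarrow> cut_point_t (ran_lo g) hs5;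
         L1 \<leftarrow> transfer_t (len S) g (wts S);
         M \<leftarrow> sub_t c 1;
         L2 \<leftarrow> restrict_weights_t 1 M L1;
         g' \<leftarrow> truncate_t (len S) M g;
         _ \<leftarrow> eq_t M 0;
         ret (State M (case g' of None \<Rightarrow> hs5 | Some g'' \<Rightarrow> g'' # hs5) L2 (outp S))
       }
   }"

text \<open>\<open>None\<close> if the algorithm does not terminate; otherwise the output and the running time.\<close>

definition weighted_orbit_counting :: "int \<Rightarrow> pairing list \<Rightarrow> weights \<Rightarrow> weights tm option" where
  "weighted_orbit_counting N ps L =
     map_option (\<lambda>m. do { S \<leftarrow> m; ret (outp S) })
       (while_option (\<lambda>m. len (result m) \<noteq> 0) (\<lambda>m. do { S \<leftarrow> m; cycle_t S }) (ret (State N ps L [])))"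

end

theory Submission
  imports Defs "HOL-Library.Multiset"
begin

text \<open>
  Orbits are the connected components of the graph on \<open>[1,N]\<close> in which the pairings are sets of
  edges (\<open>orbits_conn\<close>). The algorithm leaves a multiset of vectors invariant: the weights that it has
  recorded so far, together with the weights of the orbits of the current interval. Deleting
  identities, trimming, periodic mergers and transmissions do not change the components at
  all (\<open>conn_trim\<close>, \<open>merge_pair\<close>, \<open>transmit\<close>); the contraction of a static interval removes
  one-point orbits and records their weights (\<open>orbit_weights_contract\<close>); a transfer of weights preserves
  the sum over each orbit, and the truncation after it retracts the interval along the maximal
  pairing, so that the orbits of the shorter interval are the intersections of the old ones
  with it (\<open>truncation_orbit_weights\<close>). Once the interval is empty, the recorded
  weights are those of the original orbits, each with the right multiplicity, and this yields the
  bijection between the points of the output and the orbits (\<open>final_lists_orbits\<close>).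

  The number of cycles is bounded by looking at the widths of the \<open>k\<close> pairings, which never increase.
  Consider a phase, in which no pairing disappears and no width shrinks by more than the factor
  \<open>1 - 1 / (32 k\<^sup>2)\<close>. Then few points are truncated, compared with the widths of the maximal pairings.
  The maximal pairing changes after \<open>O(log N)\<close> cycles, since each cycle in which it stays
  the same halves a certain overlap. When it changes, the old maximal pairing is transmitted by a
  distance of at least half its width, unless the new one has a small period; in that case, since
  all possible mergers have been performed, the new one is moved far at the next change. An interval
  moved far from the right end is spent, in the sense that it stays too far away for its pairing to
  become maximal by means of it. A pairing has two intervals, so there are at most \<open>2 k\<close>
  such events, and a phase has length \<open>O(k log N)\<close> (\<open>phase_length\<close>). The sum of the logarithms of the
  widths is at most \<open>k ln N\<close> and drops by \<open>1 / (32 k\<^sup>2)\<close> with each phase; hence the number of cycles is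
  polynomial in \<open>k\<close> and \<open>log N\<close> (\<open>terminates\<close>).

  For the cost of one cycle, each coordinate of the weights, summed in absolute value over all points,
  never increases, so it stays below \<open>N D\<close>; all integers that occur therefore have \<open>O(log N + log D)\<close>
  bits. The lists of weights grow by \<open>O(k)\<close> entries in each cycle, because
  every operation creates boundedly many new breakpoints or moves old ones. So every cycle has
  polynomial cost (\<open>steps_cycle_t\<close>), and so has the whole run (\<open>running_time\<close>).
\<close>

section \<open>Results and costs of programs\<close>

lemma result_bind [simp]: "result (bind_tm m f) = result (f (result m))"
  and cost_bind [simp]: "cost (bind_tm m f) = cost m + cost (f (result m))"
  by (simp_all add: bind_tm_def)

lemma result_ret [simp]: "result (ret x) = x" and cost_ret [simp]: "cost (ret x) = 1"
  by (simp_all add: ret_def)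

lemma result_arith [simp]:
  "result (add_t x y) = x + y" "result (sub_t x y) = x - y" "result (mul_t x y) = x * y"
  "result (div_t x y) = x div y" "result (mod_t x y) = x mod y"
  "result (le_t x y) = (x \<le> y)" "result (less_t x y) = (x < y)" "result (eq_t x y) = (x = y)"
  "result (min_t x y) = min x y" "result (max_t x y) = max x y"
  by (simp_all add: add_t_def sub_t_def mul_t_def div_t_def mod_t_def le_t_def less_t_def
      eq_t_def min_t_def max_t_def min_def max_def)

lemma cost_arith [simp]:
  "cost (add_t x y) = isize x + isize y" "cost (sub_t x y) = isize x + isize y"
  "cost (mul_t x y) = isize x * isize y" "cost (div_t x y) = isize x * isize y"
  "cost (mod_t x y) = isize x * isize y" "cost (le_t x y) = isize x + isize y"
  "cost (less_t x y) = isize x + isize y" "cost (eq_t x y) = isize x + isize y"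
  "cost (min_t x y) = isize x + isize y + 1" "cost (max_t x y) = isize x + isize y + 1"
  by (simp_all add: add_t_def sub_t_def mul_t_def div_t_def mod_t_def le_t_def less_t_def
      eq_t_def min_t_def max_t_def)

declare gcd_t.simps [simp del] merge_all_t.simps [simp del] contract_static_t.simps [simp del]

lemma result_if: "result (if b then m else m') = (if b then result m else result m')"
  by simp

lemma result_map_t [simp]: "result (map_t f xs) = map (\<lambda>x. result (f x)) xs"
  by (induction xs) simp_all

lemma result_append_t [simp]: "result (append_t xs ys) = xs @ ys"
  by (induction xs ys rule: append_t.induct) simp_all

lemma result_vec_add_t [simp]: "result (vec_add_t xs ys) = map2 (+) xs ys"
  by (induction xs ys rule: vec_add_t.induct) simp_all

lemma result_vec_eq_t [simp]: "result (vec_eq_t xs ys) = (xs = ys)"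
  by (induction xs ys rule: vec_eq_t.induct) simp_all

lemma result_gcd_t [simp]: "0 \<le> x \<Longrightarrow> 0 \<le> y \<Longrightarrow> result (gcd_t x y) = gcd x y"
proof (induction x y rule: gcd_t.induct)
  case (1 x y)
  show ?case
  proof (cases "y = 0")
    case True
    then show ?thesis using 1 by (subst gcd_t.simps) (simp add: eq_t_def)
  next
    case False
    have "result (gcd_t y (x mod y)) = gcd y (x mod y)"
      using 1 False by (intro "1.IH"[of False "x mod y"]) (simp_all add: eq_t_def mod_t_def)
    then show ?thesis using False by (subst gcd_t.simps) (simp add: gcd_red_int[of x y])
  qed
qed

section \<open>Orbits as connected components\<close>

definition edge :: "pairing \<Rightarrow> (int \<times> int) set" where
  "edge g = {(x, y). pairing_map g x = Some y}"

definition conn :: "pairing list \<Rightarrow> (int \<times> int) set" where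
  "conn gs = (\<Union>g\<in>set gs. edge g \<union> (edge g)\<inverse>)\<^sup>*"

lemma edge_Pairing:
  "edge (Pairing a b c d p) = (\<lambda>x. (x, if p then c + (x - a) else d - (x - a))) ` {a..b}"
  by (auto simp: edge_def split: if_splits)

lemma conn_refl [simp]: "(x, x) \<in> conn gs"
  by (simp add: conn_def)

lemma conn_sym: "(x, y) \<in> conn gs \<Longrightarrow> (y, x) \<in> conn gs"
proof -
  have "sym (\<Union>g\<in>set gs. edge g \<union> (edge g)\<inverse>)" by (auto simp: sym_def)
  then show "(x, y) \<in> conn gs \<Longrightarrow> (y, x) \<in> conn gs"
    unfolding conn_def using sym_rtrancl symD by metis
qed

lemma conn_trans: "(x, y) \<in> conn gs \<Longrightarrow> (y, z) \<in> conn gs \<Longrightarrow> (x, z) \<in> conn gs"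
  unfolding conn_def by (rule rtrancl_trans)

lemma edge_conn: "g \<in> set gs \<Longrightarrow> edge g \<subseteq> conn gs"
  unfolding conn_def by blast

lemma conn_subsetI:
  assumes "\<And>g. g \<in> set gs \<Longrightarrow> edge g \<subseteq> conn hs"
  shows "conn gs \<subseteq> conn hs"
proof
  fix e assume "e \<in> conn gs"
  then obtain x y where e: "e = (x, y)" and "(x, y) \<in> conn gs" by (cases e) auto
  from this(2) have "(x, y) \<in> conn hs"
    unfolding conn_def[of gs]
  proof (induction rule: rtrancl_induct)
    case (step y z)
    then have "(y, z) \<in> conn hs" using assms by (auto intro: conn_sym)
    with step show ?case by (blast intro: conn_trans)
  qed simp
  then show "e \<in> conn hs" using e by simp
qed

lemma conn_mono:
  assumes "set gs \<subseteq> set hs"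
  shows "conn gs \<subseteq> conn hs"
proof (rule conn_subsetI)
  fix g assume "g \<in> set gs"
  then have "g \<in> set hs" using assms by blast
  then show "edge g \<subseteq> conn hs" by (rule edge_conn)
qed

lemma conn_eqI:
  assumes "\<And>g. g \<in> set gs \<Longrightarrow> edge g \<subseteq> conn hs" and "\<And>g. g \<in> set hs \<Longrightarrow> edge g \<subseteq> conn gs"
  shows "conn gs = conn hs"
  by (intro equalityI conn_subsetI assms)

lemma conn_cong: "set gs = set hs \<Longrightarrow> conn gs = conn hs"
  by (simp add: conn_def)

lemma conn_Cons_cong: "conn gs = conn hs \<Longrightarrow> conn (g # gs) = conn (g # hs)"
proof -
  assume eq: "conn gs = conn hs"
  have sub: "conn gs \<subseteq> conn (g # gs)" "conn hs \<subseteq> conn (g # hs)"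
    by (simp_all add: conn_mono subset_insertI)
  have "edge h \<subseteq> conn (g # hs)" if "h \<in> set (g # gs)" for h
    using that edge_conn[of h gs] edge_conn[of g "g # hs"] eq sub
    by (metis order_trans set_ConsD list.set_intros(1))
  moreover have "edge h \<subseteq> conn (g # gs)" if "h \<in> set (g # hs)" for h
    using that edge_conn[of h hs] edge_conn[of g "g # gs"] eq sub
    by (metis order_trans set_ConsD list.set_intros(1))
  ultimately show ?thesis by (intro conn_eqI) auto
qed

text \<open>
  An orbit-preserving modification of the pairings can be verified one pairing at a time.
\<close>

lemma conn_map_eq:
  assumes "\<And>g. g \<in> set gs \<Longrightarrow> conn (xs @ [f g]) = conn (xs @ [g])"
  shows "conn (xs @ map f gs) = conn (xs @ gs)"
proof (rule conn_eqI)
  fix h assume h: "h \<in> set (xs @ map f gs)"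
  show "edge h \<subseteq> conn (xs @ gs)"
  proof (cases "h \<in> set xs")
    case True
    then show ?thesis using edge_conn[of h "xs @ gs"] by simp
  next
    case False
    then obtain g where g: "g \<in> set gs" "h = f g" using h by auto
    have "edge h \<subseteq> conn (xs @ [f g])" using g by (intro edge_conn) simp
    also have "\<dots> \<subseteq> conn (xs @ gs)" using g by (subst assms) (auto intro!: conn_mono)
    finally show ?thesis .
  qed
next
  fix h assume h: "h \<in> set (xs @ gs)"
  show "edge h \<subseteq> conn (xs @ map f gs)"
  proof (cases "h \<in> set xs")
    case True
    then show ?thesis using edge_conn[of h "xs @ map f gs"] by simp
  next
    case False
    then have g: "h \<in> set gs" using h by auto
    have "edge h \<subseteq> conn (xs @ [h])" by (intro edge_conn) simp
    also have "\<dots> = conn (xs @ [f h])" using g by (rule assms[symmetric])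
    also have "\<dots> \<subseteq> conn (xs @ map f gs)" using g by (auto intro!: conn_mono)
    finally show ?thesis .
  qed
qed

lemma partial_inverse_iff:
  assumes "\<And>x y z. h x = Some z \<Longrightarrow> h y = Some z \<Longrightarrow> x = y"
  shows "partial_inverse h y = Some x \<longleftrightarrow> h x = Some y"
proof
  assume "partial_inverse h y = Some x"
  then have ex: "\<exists>x. h x = Some y" and x: "x = (THE x. h x = Some y)"
    by (auto simp: partial_inverse_def split: if_splits)
  then have "\<exists>!x. h x = Some y" using assms by blast
  then show "h x = Some y" unfolding x by (rule theI')
next
  assume h: "h x = Some y"
  then have "(THE x. h x = Some y) = x" using assms by blast
  with h show "partial_inverse h y = Some x" by (auto simp: partial_inverse_def)
qed

lemma pairing_map_inj: "pairing_map g x = Some z \<Longrightarrow> pairing_map g y = Some z \<Longrightarrow> x = y"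
  by (cases g) (auto split: if_splits)

lemma pseudogroup_inj:
  "h \<in> pseudogroup N ps \<Longrightarrow> h x = Some z \<Longrightarrow> h y = Some z \<Longrightarrow> x = y"
proof (induction arbitrary: x y z rule: pseudogroup.induct)
  case identity
  then show ?case by (auto simp: restrict_map_def split: if_splits)
next
  case (generator g)
  then show ?case by (blast intro: pairing_map_inj)
next
  case (inverse h)
  have "partial_inverse h y = Some x \<longleftrightarrow> h x = Some y" for x y
    by (rule partial_inverse_iff) (use inverse.IH in blast)
  with inverse.prems show ?case by auto
next
  case (composition g h)
  from composition.prems obtain u v where
    "h x = Some u" "g u = Some z" "h y = Some v" "g v = Some z"
    by (auto simp: map_comp_Some_iff)
  with composition.IH(1)[of u z v] composition.IH(2)[of x u y] show ?case by simp
next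
  case (restriction h u v)
  then show ?case by (auto simp: restrict_map_def split: if_splits)
qed

lemma pseudogroup_partial_inverse:
  "h \<in> pseudogroup N ps \<Longrightarrow> partial_inverse h y = Some x \<longleftrightarrow> h x = Some y"
  using partial_inverse_iff[of h y x] pseudogroup_inj by blast

lemma pseudogroup_conn: "h \<in> pseudogroup N ps \<Longrightarrow> h x = Some y \<Longrightarrow> (x, y) \<in> conn ps"
proof (induction arbitrary: x y rule: pseudogroup.induct)
  case identity
  then show ?case by (auto simp: restrict_map_def split: if_splits)
next
  case (generator g)
  then show ?case using edge_conn[of g ps] by (auto simp: edge_def)
next
  case (inverse h)
  then show ?case by (simp add: pseudogroup_partial_inverse conn_sym)
next
  case (composition g h)
  from composition.prems obtain u where "h x = Some u" "g u = Some y"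
    by (auto simp: map_comp_Some_iff)
  with composition.IH show ?case using conn_trans[of x u ps y] by blast
next
  case (restriction h u v)
  then show ?case by (auto simp: restrict_map_def split: if_splits)
qed

lemma conn_pseudogroup:
  assumes "(x, y) \<in> conn ps" and "x \<in> {1..N}"
  shows "\<exists>h \<in> pseudogroup N ps. h x = Some y"
  using assms(1) unfolding conn_def
proof (induction rule: rtrancl_induct)
  case base
  show ?case using assms(2) by (intro bexI[OF _ pseudogroup.identity]) simp
next
  case (step y z)
  then obtain h where h: "h \<in> pseudogroup N ps" "h x = Some y" by blast
  from step.hyps(2) obtain g where g: "g \<in> set ps" and
    "pairing_map g y = Some z \<or> pairing_map g z = Some y" by (auto simp: edge_def)
  then consider "pairing_map g y = Some z" | "partial_inverse (pairing_map g) y = Some z"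
    using pseudogroup_partial_inverse[OF pseudogroup.generator[OF g]] by blast
  then show ?case
  proof cases
    case 1
    with h show ?thesis
      by (intro bexI[OF _ pseudogroup.composition[OF pseudogroup.generator[OF g] h(1)]]) simp
  next
    case 2
    with h show ?thesis
      by (intro bexI[OF _ pseudogroup.composition[OF
            pseudogroup.inverse[OF pseudogroup.generator[OF g]] h(1)]]) simp
  qed
qed

lemma orbit_rel_conn: "orbit_rel N ps = conn ps \<inter> {1..N} \<times> {1..N}"
  unfolding orbit_rel_def using pseudogroup_conn conn_pseudogroup by blast

lemma orbits_conn: "orbits N ps = (\<lambda>x. conn ps `` {x} \<inter> {1..N}) ` {1..N}"
  unfolding orbits_def quotient_def orbit_rel_conn by (auto simp: image_iff)

lemma finite_orbits [simp]: "finite (orbits N ps)"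
  by (simp add: orbits_conn)

lemma orbits_closed:
  assumes "X \<in> orbits N gs" "(x, y) \<in> conn gs" "x \<in> {1..N}" "y \<in> {1..N}"
  shows "x \<in> X \<longleftrightarrow> y \<in> X"
proof -
  obtain z where "X = conn gs `` {z} \<inter> {1..N}" using assms(1) by (auto simp: orbits_conn)
  then show ?thesis
    using assms(2-4) conn_trans[of z x gs y] conn_trans[of z y gs x] conn_sym[of x y gs] by auto
qed

lemma orbits_subset: "X \<in> orbits N gs \<Longrightarrow> X \<subseteq> {1..N}"
  by (auto simp: orbits_conn)

text \<open>
  All that the output has to record about the orbits is the multiset of their weights, as
  a bijection matching the weights can be recovered from it. The algorithm keeps the sum of
  this multiset and of the multiset of weights already recorded constant.
\<close>

definition orbit_weights :: "int \<Rightarrow> pairing list \<Rightarrow> nat \<Rightarrow> weights \<Rightarrow> int list multiset" where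
  "orbit_weights N gs d L = image_mset (orbit_weight d L) (mset_set (orbits N gs))"

lemma image_mset_eq_bij:
  assumes "finite A" "finite B"
    and "image_mset f (mset_set A) = image_mset g (mset_set B)"
  shows "\<exists>h. bij_betw h A B \<and> (\<forall>x\<in>A. g (h x) = f x)"
  using assms
proof (induction A arbitrary: B rule: finite_induct)
  case empty
  then have "B = {}" by (metis image_mset_is_empty_iff mset_set.empty mset_set_empty_iff)
  then show ?case by (auto simp: bij_betw_def)
next
  case (insert a A)
  then have "f a \<in># image_mset g (mset_set B)" by (metis image_mset_add_mset mset_set.insert union_single_eq_member)
  then obtain b where b: "b \<in> B" "g b = f a" using insert.prems by auto
  have "mset_set B = add_mset b (mset_set (B - {b}))"
    using b insert.prems by (simp add: mset_set.remove)
  then have "image_mset f (mset_set A) = image_mset g (mset_set (B - {b}))"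
    using insert b by simp
  then obtain h where h: "bij_betw h A (B - {b})" "\<forall>x\<in>A. g (h x) = f x"
    using insert.IH[of "B - {b}"] insert.prems by auto
  have "bij_betw (h(a := b)) A (B - {b})"
    using h(1) insert.hyps by (subst bij_betw_cong[of _ _ h]) auto
  then have "bij_betw (h(a := b)) (insert a A) (insert b (B - {b}))"
    using insert.hyps by (simp add: notIn_Un_bij_betw[of a A "h(a := b)" "B - {b}", simplified])
  then have "bij_betw (h(a := b)) (insert a A) B" using b by (simp add: insert_absorb)
  moreover have "\<forall>x\<in>insert a A. g ((h(a := b)) x) = f x" using h b insert.hyps by auto
  ultimately show ?case by blast
qed

lemma orbit_weights_restrict:
  assumes MN: "M \<le> N"
    and reach: "\<And>x. x \<in> {1..N} \<Longrightarrow> \<exists>y\<in>{1..M}. (x, y) \<in> conn gs"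
    and same: "\<And>x y. x \<in> {1..M} \<Longrightarrow> y \<in> {1..M} \<Longrightarrow> (x, y) \<in> conn gs \<longleftrightarrow> (x, y) \<in> conn gs'"
    and weight: "\<And>X. X \<in> orbits N gs \<Longrightarrow> orbit_weight d L' (X \<inter> {1..M}) = orbit_weight d L X"
  shows "orbit_weights M gs' d L' = orbit_weights N gs d L"
proof -
  let ?r = "\<lambda>X. X \<inter> {1..M}"
  have cls: "?r (conn gs `` {x} \<inter> {1..N}) = conn gs' `` {x} \<inter> {1..M}" if "x \<in> {1..M}" for x
    using that same[of x] MN by auto
  have cls2: "conn gs `` {x} = conn gs `` {y}" if "(x, y) \<in> conn gs" for x y
    using that conn_trans[of x y gs] conn_trans[of y x gs] conn_sym[of x y gs] by auto
  have "orbits M gs' = ?r ` orbits N gs"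
  proof (intro equalityI subsetI)
    fix X assume "X \<in> orbits M gs'"
    then obtain x where x: "x \<in> {1..M}" "X = conn gs' `` {x} \<inter> {1..M}" by (auto simp: orbits_conn)
    then have "X = ?r (conn gs `` {x} \<inter> {1..N})" using cls by simp
    then show "X \<in> ?r ` orbits N gs" using x MN by (auto simp: orbits_conn)
  next
    fix X assume "X \<in> ?r ` orbits N gs"
    then obtain x where x: "x \<in> {1..N}" "X = ?r (conn gs `` {x} \<inter> {1..N})" by (auto simp: orbits_conn)
    then obtain y where y: "y \<in> {1..M}" "(x, y) \<in> conn gs" using reach by blast
    then have "X = conn gs' `` {y} \<inter> {1..M}" using x cls cls2 by metis
    then show "X \<in> orbits M gs'" using y by (auto simp: orbits_conn)
  qed
  moreover have "inj_on ?r (orbits N gs)"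
  proof (rule inj_onI)
    fix X Y assume XY: "X \<in> orbits N gs" "Y \<in> orbits N gs" "?r X = ?r Y"
    obtain x where x: "x \<in> {1..N}" "X = conn gs `` {x} \<inter> {1..N}" using XY by (auto simp: orbits_conn)
    obtain y where y: "y \<in> {1..N}" "Y = conn gs `` {y} \<inter> {1..N}" using XY by (auto simp: orbits_conn)
    obtain u where u: "u \<in> {1..M}" "(x, u) \<in> conn gs" using reach x by blast
    then have "u \<in> ?r X" using x MN by auto
    then have "(y, u) \<in> conn gs" using XY(3) y by auto
    then show "X = Y" using x y cls2 u by metis
  qed
  ultimately show ?thesis
    by (auto simp: orbit_weights_def image_mset_mset_set[symmetric] multiset.map_comp o_def weight
        intro!: image_mset_cong)
qed

section \<open>Weight lists as contiguous chains\<close>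

text \<open>
  The lists of weights that occur in the algorithm, including its output, consist of adjacent
  intervals. The following recursive form of this property is preserved by all
  operations, by a structural induction in each case.
\<close>

fun chain :: "nat \<Rightarrow> int \<Rightarrow> weights \<Rightarrow> int \<Rightarrow> bool" where
  "chain d l [] u \<longleftrightarrow> u = l - 1"
| "chain d l (((p, q), z) # L) u \<longleftrightarrow> p = l \<and> l \<le> q \<and> length z = d \<and> chain d (q + 1) L u"

definition starts :: "weights \<Rightarrow> int set" where
  "starts L = (fst \<circ> fst) ` set L"

lemma starts_simps [simp]:
  "starts [] = {}" "starts (((p, q), z) # L) = insert p (starts L)"
  "starts (L @ L') = starts L \<union> starts L'" "finite (starts L)"
  by (auto simp: starts_def)

lemma support_simps [simp]:
  "support [] = {}" "support (((p, q), z) # L) = {p..q} \<union> support L"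
  by (auto simp: support_def)

lemma chain_le: "chain d l L u \<Longrightarrow> l \<le> u + 1"
  by (induction d l L u rule: chain.induct) auto

lemma chain_support: "chain d l L u \<Longrightarrow> support L = {l..u}"
proof (induction d l L u rule: chain.induct)
  case (2 d l p q z L u)
  then show ?case using chain_le[of d "q + 1" L u] by auto
qed auto

lemma chain_starts: "chain d l L u \<Longrightarrow> starts L \<subseteq> {l..u} \<and> card (starts L) = length L"
proof (induction d l L u rule: chain.induct)
  case (2 d l p q z L u)
  moreover have "l \<notin> starts L" using 2 by auto
  ultimately show ?case using chain_le[of d "q + 1" L u] by fastforce
qed auto

lemma chain_entries:
  "chain d l L u \<Longrightarrow> ((p, q), z) \<in> set L \<Longrightarrow>
    l \<le> p \<and> p \<le> q \<and> q \<le> u \<and> length z = d \<and> (\<forall>x\<in>{p..q}. weight_at d L x = z)"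
proof (induction d l L u rule: chain.induct)
  case (2 d l p' q' z' L u)
  then show ?case using chain_le[of d "q' + 1" L u] by fastforce
qed auto

lemma length_weight_at [simp]: "chain d l L u \<Longrightarrow> length (weight_at d L x) = d"
  by (induction d l L u rule: chain.induct) auto

lemma weight_at_outside: "chain d l L u \<Longrightarrow> x \<notin> {l..u} \<Longrightarrow> weight_at d L x = replicate d 0"
proof (induction d l L u rule: chain.induct)
  case (2 d l p q z L u)
  then show ?case using chain_le[of d "q + 1" L u] by auto
qed auto

lemma chain_weight_list: "chain d l L u \<Longrightarrow> 1 \<le> l \<Longrightarrow> weight_list d L"
proof (induction d l L u rule: chain.induct)
  case (2 d l p q z L u)
  then have "weight_list d L" by simp
  moreover have "q < p'" if "((p', q'), z') \<in> set L" for p' q' z'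
    using chain_entries[of d "q + 1" L u p' q' z'] that 2 by auto
  ultimately show ?case using 2 by (auto simp: weight_list_def)
qed (simp add: weight_list_def)

lemma weight_list_chain:
  "weight_list d L \<Longrightarrow> support L = {l..u} \<Longrightarrow> l \<le> u + 1 \<Longrightarrow> chain d l L u"
proof (induction L arbitrary: l)
  case (Cons e L)
  obtain p q z where e: "e = ((p, q), z)" by (metis surj_pair)
  have tail: "weight_list d L" and pq: "p \<le> q" "length z = d"
    and later: "\<And>x. x \<in> support L \<Longrightarrow> q < x"
    using Cons.prems(1) unfolding e weight_list_def support_def by fastforce+
  have sup: "{p..q} \<union> support L = {l..u}" using Cons.prems(2) e by simp
  then have "p \<in> {l..u}" "q \<in> {l..u}" using pq by auto
  moreover from this have "l \<in> {p..q} \<union> support L" using sup by simp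
  ultimately have "p = l" "q \<le> u" using later[of l] pq by auto
  moreover have "support L = {q + 1..u}"
  proof (intro equalityI subsetI)
    fix x assume "x \<in> support L"
    then show "x \<in> {q + 1..u}" using later[of x] sup by auto
  next
    fix x assume "x \<in> {q + 1..u}"
    then have "x \<in> {p..q} \<union> support L" unfolding sup using pq \<open>p \<in> {l..u}\<close> by auto
    then show "x \<in> support L" using \<open>x \<in> {q + 1..u}\<close> by auto
  qed
  ultimately show ?case using Cons.IH[of "q + 1"] tail pq e by simp
qed (auto simp: weight_list_def)

lemma chain_sum:
  fixes f :: "int \<Rightarrow> int list \<Rightarrow> int"
  shows "chain d l L u \<Longrightarrow>
    (\<Sum>((p, q), z)\<leftarrow>L. \<Sum>x\<in>{p..q}. f x z) = (\<Sum>x\<in>{l..u}. f x (weight_at d L x))"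
proof (induction d l L u rule: chain.induct)
  case (2 d l p q z L u)
  then have le: "q \<le> u" and IH: "(\<Sum>((p, q), z)\<leftarrow>L. \<Sum>x\<in>{p..q}. f x z) =
      (\<Sum>x\<in>{q + 1..u}. f x (weight_at d L x))"
    using chain_le[of d "q + 1" L u] by auto
  have "{l..u} = {l..q} \<union> {q + 1..u}" using 2 le by auto
  then have "(\<Sum>x\<in>{l..u}. f x (weight_at d (((p, q), z) # L) x)) =
      (\<Sum>x\<in>{l..q}. f x (weight_at d (((p, q), z) # L) x)) +
      (\<Sum>x\<in>{q + 1..u}. f x (weight_at d (((p, q), z) # L) x))"
    by (simp add: sum.union_disjoint)
  also have "\<dots> = (\<Sum>x\<in>{l..q}. f x z) + (\<Sum>x\<in>{q + 1..u}. f x (weight_at d L x))"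
    using 2 by (intro arg_cong2[of _ _ _ _ "(+)"] sum.cong) auto
  finally show ?case using 2 IH by simp
qed auto

lemma chain_append: "chain d l A m \<Longrightarrow> chain d (m + 1) B u \<Longrightarrow> chain d l (A @ B) u"
  by (induction d l A m rule: chain.induct) auto

lemma weight_at_append:
  "chain d l A m \<Longrightarrow> weight_at d (A @ B) x = (if x \<in> {l..m} then weight_at d A x else weight_at d B x)"
proof (induction d l A m rule: chain.induct)
  case (2 d l p q z A m)
  then show ?case using chain_le[of d "q + 1" A m] by auto
qed auto

lemma chain_singleton_weight:
  "chain d 1 L N \<Longrightarrow> x \<in> {1..N} \<Longrightarrow> \<exists>p q. ((p, q), weight_at d L x) \<in> set L \<and> p \<le> x \<and> x \<le> q"
proof -
  have "chain d l L u \<Longrightarrow> x \<in> {l..u} \<Longrightarrow>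
    \<exists>p q. ((p, q), weight_at d L x) \<in> set L \<and> p \<le> x \<and> x \<le> q" for l u
  proof (induction d l L u rule: chain.induct)
    case (2 d l p q z L u)
    then show ?case by (cases "x \<le> q") auto
  qed auto
  then show "chain d 1 L N \<Longrightarrow> x \<in> {1..N} \<Longrightarrow> ?thesis" by blast
qed

definition piece :: "int \<Rightarrow> int \<Rightarrow> int list \<Rightarrow> weights \<Rightarrow> weights" where
  "piece p q z L = (if p \<le> q then ((p, q), z) # L else L)"

lemma result_piece_t [simp]: "result (piece_t p q z L) = piece p q z L"
  by (simp add: piece_t_def piece_def)

lemma weight_at_piece [simp]:
  "weight_at d (piece p q z L) x = (if p \<le> x \<and> x \<le> q then z else weight_at d L x)"
  by (simp add: piece_def)

lemma starts_piece [simp]: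
  "starts (piece p q z L) = (if p \<le> q then insert p (starts L) else starts L)"
  by (simp add: piece_def)

lemma piece_nonempty: "p \<le> q \<Longrightarrow> piece p q z L = ((p, q), z) # L"
  and piece_empty: "\<not> p \<le> q \<Longrightarrow> piece p q z L = L"
  by (simp_all add: piece_def)

subsection \<open>Restriction\<close>

abbreviation restrict_weights :: "int \<Rightarrow> int \<Rightarrow> weights \<Rightarrow> weights" where
  "restrict_weights x y L \<equiv> result (restrict_weights_t x y L)"

lemma weight_at_restrict:
  "weight_at d (restrict_weights x y L) u =
    (if x \<le> u \<and> u \<le> y then weight_at d L u else replicate d 0)"
  by (induction x y L rule: restrict_weights_t.induct) auto

lemma chain_restrict_clamp:
  "chain d l L u \<Longrightarrow> x \<le> y + 1 \<Longrightarrow>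
    chain d (min (max l x) (y + 1)) (restrict_weights x y L) (min (max (u + 1) x) (y + 1) - 1)"
proof (induction d l L u rule: chain.induct)
  case (2 d l p q z L u)
  then have IH: "chain d (min (max (q + 1) x) (y + 1)) (restrict_weights x y L)
      (min (max (u + 1) x) (y + 1) - 1)" by simp
  show ?case
  proof (cases "max l x \<le> min q y")
    case True
    then have "min (max (q + 1) x) (y + 1) = min q y + 1" by linarith
    then show ?thesis using IH 2 True by (simp add: piece_nonempty[OF True])
  next
    case False
    then have "min (max (q + 1) x) (y + 1) = min (max l x) (y + 1)" using "2.prems" by auto
    then show ?thesis using IH "2.prems" by (simp add: piece_empty[OF False])
  qed
qed auto

lemma chain_restrict:
  assumes "chain d l L u" "l \<le> x" "x \<le> y + 1" "y \<le> u"
  shows "chain d x (restrict_weights x y L) y"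
proof -
  have "min (max l x) (y + 1) = x" "min (max (u + 1) x) (y + 1) - 1 = y" using assms by auto
  then show ?thesis using chain_restrict_clamp[OF assms(1,3)] by simp
qed

lemma starts_restrict: "starts (restrict_weights x y L) \<subseteq> insert x (starts L \<inter> {x..y})"
  by (induction x y L rule: restrict_weights_t.induct) (auto split: if_splits)

subsection \<open>Adding a weight on an interval\<close>

abbreviation add_weight :: "int \<Rightarrow> int \<Rightarrow> int list \<Rightarrow> weights \<Rightarrow> weights" where
  "add_weight x y v L \<equiv> result (add_weight_t x y v L)"

lemma weight_at_add_weight:
  "chain d l L u \<Longrightarrow> x \<le> y \<Longrightarrow> weight_at d (add_weight x y v L) w =
    (if x \<le> w \<and> w \<le> y \<and> w \<in> {l..u} then map2 (+) (weight_at d L w) v else weight_at d L w)"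
proof (induction d l L u rule: chain.induct)
  case (2 d l p q z L u)
  then have le: "q \<le> u" and IH: "weight_at d (add_weight x y v L) w =
    (if x \<le> w \<and> w \<le> y \<and> w \<in> {q + 1..u} then map2 (+) (weight_at d L w) v else weight_at d L w)"
    using chain_le[of d "q + 1" L u] by auto
  show ?case
  proof (cases "w \<in> {l..q}")
    case True
    then show ?thesis using "2.prems" le by auto
  next
    case False
    then have "\<not> (p \<le> w \<and> w \<le> min q (x - 1))" "\<not> (max p x \<le> w \<and> w \<le> min q y)"
      "\<not> (max p (y + 1) \<le> w \<and> w \<le> q)"
      using "2.prems"(1) by auto
    then have "weight_at d (add_weight x y v (((p, q), z) # L)) w = weight_at d (add_weight x y v L) w"
      by (simp only: add_weight_t.simps result_bind result_arith result_piece_t weight_at_piece if_False)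
    moreover have "weight_at d (((p, q), z) # L) w = weight_at d L w"
      using False "2.prems"(1) by auto
    moreover have "w \<in> {q + 1..u} \<longleftrightarrow> w \<in> {l..u}" using False le "2.prems"(1) by auto
    ultimately show ?thesis using IH by (simp only:)
  qed
qed auto

lemma chain_add_weight:
  "chain d l L u \<Longrightarrow> x \<le> y \<Longrightarrow> length v = d \<Longrightarrow> chain d l (add_weight x y v L) u"
proof (induction d l L u rule: chain.induct)
  case (2 d l p q z L u)
  then have IH: "chain d (q + 1) (add_weight x y v L) u" by simp
  have 1: "chain d (min (max l (y + 1)) (q + 1)) (piece (max l (y + 1)) q z (add_weight x y v L)) u"
  proof (cases "max l (y + 1) \<le> q")
    case True
    then have "min (max l (y + 1)) (q + 1) = max l (y + 1)" by auto
    then show ?thesis using IH 2 True by (simp add: piece_nonempty[OF True])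
  next
    case False
    then have "min (max l (y + 1)) (q + 1) = q + 1" by auto
    then show ?thesis using IH by (simp add: piece_empty[OF False])
  qed
  let ?L1 = "piece (max l (y + 1)) q z (add_weight x y v L)"
  let ?L2 = "piece (max l x) (min q y) (map2 (+) z v) ?L1"
  have 2: "chain d (min (max l x) (q + 1)) ?L2 u"
  proof (cases "max l x \<le> min q y")
    case True
    then have "min (max l (y + 1)) (q + 1) = min q y + 1" "min (max l x) (q + 1) = max l x" by auto
    then show ?thesis using 1 2 True by (simp add: piece_nonempty[OF True])
  next
    case False
    then have "min (max l (y + 1)) (q + 1) = min (max l x) (q + 1)" using 2 by auto
    then show ?thesis using 1 by (simp only: piece_empty[OF False])
  qed
  have "chain d l (piece l (min q (x - 1)) z ?L2) u"
  proof (cases "l \<le> min q (x - 1)")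
    case True
    then have "min (max l x) (q + 1) = min q (x - 1) + 1" by auto
    then show ?thesis using 2 "2.prems" True by (simp add: piece_nonempty[OF True])
  next
    case False
    then have "min (max l x) (q + 1) = l" using "2.prems" by auto
    then show ?thesis using 2 by (simp only: piece_empty[OF False])
  qed
  then show ?case using "2.prems" by simp
qed auto

lemma starts_add_weight: "starts (add_weight x y v L) \<subseteq> starts L \<union> {x, y + 1}"
  by (induction x y v L rule: add_weight_t.induct) (auto split: if_splits)

subsection \<open>Erasing the weights of an interval\<close>

abbreviation zero_weights :: "int \<Rightarrow> int \<Rightarrow> int \<Rightarrow> weights \<Rightarrow> weights" where
  "zero_weights N x y L \<equiv> result (zero_weights_t N x y L)"

lemma map_mult_zero: "length z = d \<Longrightarrow> map (\<lambda>x::int. 0) z = replicate d 0"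
  by (simp add: map_replicate_const)

lemma zero_weights_eq:
  assumes "chain d 1 L N" "1 \<le> N"
  shows "zero_weights N x y L =
    restrict_weights 1 (x - 1) L @ ((x, y), replicate d 0) # restrict_weights (y + 1) N L"
proof -
  obtain p q z L0 where "L = ((p, q), z) # L0" using assms by (cases L) auto
  then show ?thesis using assms by (simp add: zero_weights_t_def map_mult_zero)
qed

lemma zero_weights:
  assumes L: "chain d 1 L N" and xy: "1 \<le> x" "x \<le> y" "y \<le> N"
  shows "chain d 1 (zero_weights N x y L) N"
    and "weight_at d (zero_weights N x y L) u =
      (if x \<le> u \<and> u \<le> y then replicate d 0 else weight_at d L u)"
    and "starts (zero_weights N x y L) \<subseteq> (starts L - {x..y}) \<union> {1, x, y + 1}"
proof -
  have eq: "zero_weights N x y L =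
    restrict_weights 1 (x - 1) L @ ((x, y), replicate d 0) # restrict_weights (y + 1) N L"
    using L xy by (intro zero_weights_eq) auto
  have c1: "chain d 1 (restrict_weights 1 (x - 1) L) (x - 1)"
    using L xy by (intro chain_restrict) auto
  have c2: "chain d (y + 1) (restrict_weights (y + 1) N L) N"
    using L xy by (intro chain_restrict) auto
  show "chain d 1 (zero_weights N x y L) N"
    unfolding eq using c1 c2 xy by (intro chain_append) auto
  show "weight_at d (zero_weights N x y L) u =
      (if x \<le> u \<and> u \<le> y then replicate d 0 else weight_at d L u)"
    unfolding eq weight_at_append[OF c1] using weight_at_outside[OF L, of u]
    by (auto simp: weight_at_restrict)
  show "starts (zero_weights N x y L) \<subseteq> (starts L - {x..y}) \<union> {1, x, y + 1}"
    unfolding eq using starts_restrict[of 1 "x - 1" L] starts_restrict[of "y + 1" N L] by auto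
qed

subsection \<open>Deleting an interval\<close>

abbreviation contract_weights :: "int \<Rightarrow> int \<Rightarrow> int \<Rightarrow> weights \<Rightarrow> weights" where
  "contract_weights r s w L \<equiv> result (contract_weights_t r s w L)"

lemma weight_at_contract:
  "r \<le> s \<Longrightarrow> w = s - r + 1 \<Longrightarrow>
    weight_at d (contract_weights r s w L) u = weight_at d L (if u < r then u else u + w)"
proof (induction r s w L rule: contract_weights_t.induct)
  case (2 r s w p q z L)
  then show ?case by (cases "u < r") auto
qed simp

text \<open>The collapse of \<open>[r,s+1]\<close> to the point \<open>r\<close>.\<close>

definition collapse :: "int \<Rightarrow> int \<Rightarrow> int \<Rightarrow> int" where
  "collapse r s x = (if x < r then x else if x \<le> s then r else x - (s - r + 1))"

lemma chain_contract_collapse: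
  "chain d l L u \<Longrightarrow> r \<le> s \<Longrightarrow> w = s - r + 1 \<Longrightarrow>
    chain d (collapse r s l) (contract_weights r s w L) (collapse r s (u + 1) - 1)"
proof (induction d l L u rule: chain.induct)
  case (2 d l p q z L u)
  then have IH: "chain d (collapse r s (q + 1)) (contract_weights r s w L) (collapse r s (u + 1) - 1)"
    by simp
  have z: "length z = d" "p = l" "l \<le> q" using "2.prems" by auto
  define m where "m = (if q \<le> s then min (q + 1) r else max l (s + 1) - w)"
  define L1 where "L1 = piece (max l (s + 1) - w) (q - w) z (contract_weights r s w L)"
  have 1: "chain d m L1 (collapse r s (u + 1) - 1)"
  proof (cases "max l (s + 1) - w \<le> q - w")
    case True
    then have "collapse r s (q + 1) = q - w + 1" "m = max l (s + 1) - w"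
      using "2.prems"(2,3) by (auto simp: collapse_def m_def)
    then show ?thesis using IH z True unfolding L1_def by (simp add: piece_nonempty)
  next
    case False
    then have "collapse r s (q + 1) = m"
      using "2.prems"(2,3) z by (auto simp: collapse_def m_def)
    then show ?thesis using IH False unfolding L1_def by (simp add: piece_empty)
  qed
  have "chain d (collapse r s l) (piece l (min q (r - 1)) z L1) (collapse r s (u + 1) - 1)"
  proof (cases "l \<le> min q (r - 1)")
    case True
    then have "m = min q (r - 1) + 1" "collapse r s l = l"
      using "2.prems"(2,3) by (auto simp: collapse_def m_def)
    then show ?thesis using 1 z True by (simp add: piece_nonempty)
  next
    case False
    then have "m = collapse r s l"
      using "2.prems"(2,3) z by (auto simp: collapse_def m_def)
    then show ?thesis using 1 False by (simp add: piece_empty)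
  qed
  then show ?case using z by (simp add: L1_def)
qed (auto simp: collapse_def)

lemma chain_contract:
  assumes "chain d 1 L N" "1 \<le> r" "r \<le> s" "s \<le> N" "w = s - r + 1"
  shows "chain d 1 (contract_weights r s w L) (N - w)"
proof -
  have *: "chain d (collapse r s 1) (contract_weights r s w L) (collapse r s (N + 1) - 1)"
    by (rule chain_contract_collapse) (use assms in auto)
  have "collapse r s 1 = 1" "collapse r s (N + 1) - 1 = N - w"
    using assms by (auto simp: collapse_def)
  with * show ?thesis by (simp only:)
qed

lemma starts_contract:
  "chain d l L u \<Longrightarrow> r \<le> s \<Longrightarrow> w = s - r + 1 \<Longrightarrow>
    starts (contract_weights r s w L) \<subseteq> insert r (collapse r s ` starts L)"
proof (induction d l L u rule: chain.induct)
  case (2 d l p q z L u)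
  then have IH: "starts (contract_weights r s w L) \<subseteq> insert r (collapse r s ` starts L)" by simp
  have "max l (s + 1) - w \<in> {r, collapse r s l}" using 2 by (auto simp: collapse_def)
  moreover have "l \<le> min q (r - 1) \<Longrightarrow> l = collapse r s l" using 2 by (auto simp: collapse_def)
  ultimately show ?case using 2 IH by auto
qed auto

subsection \<open>The recorded orbit weights\<close>

lemma add_at_end:
  "chain d (e + 1) L n \<Longrightarrow> result (add_at_end_t e L w z) = L @ [((n + 1, n + w), z)]"
proof (induction e L w z arbitrary: rule: add_at_end_t.induct)
  case (2 e r s v L w z)
  then show ?case by auto
qed auto

definition output_weights :: "nat \<Rightarrow> weights \<Rightarrow> int list multiset" where
  "output_weights d L = image_mset (weight_at d L) (mset_set (support L))"

lemma output_weights_add_at_end: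
  assumes "chain d 1 L n" "0 < w" "length z = d"
  shows "chain d 1 (result (add_at_end_t 0 L w z)) (n + w)"
    and "output_weights d (result (add_at_end_t 0 L w z)) = output_weights d L + replicate_mset (nat w) z"
proof -
  have eq: "result (add_at_end_t 0 L w z) = L @ [((n + 1, n + w), z)]"
    using assms by (intro add_at_end) simp
  show c: "chain d 1 (result (add_at_end_t 0 L w z)) (n + w)"
    unfolding eq using assms by (intro chain_append) auto
  have "0 \<le> n" using chain_le[OF assms(1)] by simp
  then have un: "{1..n + w} = {1..n} \<union> {n + 1..n + w}" using assms(2) by auto
  have "image_mset (weight_at d (L @ [((n + 1, n + w), z)])) (mset_set {1..n + w}) =
      image_mset (weight_at d (L @ [((n + 1, n + w), z)])) (mset_set {1..n}) +
      image_mset (weight_at d (L @ [((n + 1, n + w), z)])) (mset_set {n + 1..n + w})"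
    unfolding un by (subst mset_set_Union) auto
  also have "image_mset (weight_at d (L @ [((n + 1, n + w), z)])) (mset_set {1..n}) =
      image_mset (weight_at d L) (mset_set {1..n})"
    by (intro image_mset_cong) (auto simp: weight_at_append[OF assms(1)])
  also have "image_mset (weight_at d (L @ [((n + 1, n + w), z)])) (mset_set {n + 1..n + w}) =
      image_mset (\<lambda>_. z) (mset_set {n + 1..n + w})"
    by (intro image_mset_cong) (auto simp: weight_at_append[OF assms(1)])
  finally show "output_weights d (result (add_at_end_t 0 L w z)) =
      output_weights d L + replicate_mset (nat w) z"
    using assms chain_support[OF assms(1)] chain_support[OF c]
    by (simp add: output_weights_def eq image_mset_const_eq)
qed

subsection \<open>Runs of constant weight\<close>

lemma extend_run:
  "chain d (s + 1) L u \<Longrightarrow> s' = result (extend_run_t z s L) \<Longrightarrow>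
    s \<le> s' \<and> s' \<le> u \<and> (\<forall>x\<in>{s + 1..s'}. weight_at d L x = z) \<and> (s' = u \<or> s' + 1 \<in> starts L)"
proof (induction z s L rule: extend_run_t.induct)
  case (2 z s p q v L)
  show ?case
  proof (cases "v = z")
    case True
    then have "q \<le> s' \<and> s' \<le> u \<and> (\<forall>x\<in>{q + 1..s'}. weight_at d L x = z) \<and> (s' = u \<or> s' + 1 \<in> starts L)"
      using "2.prems" by (intro "2.IH") auto
    then show ?thesis using True "2.prems" by auto
  next
    case False
    then show ?thesis using "2.prems" chain_le[of d "q + 1" L u] by auto
  qed
qed auto

lemma weight_run:
  "chain d l L u \<Longrightarrow> l \<le> r \<Longrightarrow> r \<le> u \<Longrightarrow> (z, s) = result (weight_run_t r L) \<Longrightarrow>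
    r \<le> s \<and> s \<le> u \<and> length z = d \<and> (\<forall>x\<in>{r..s}. weight_at d L x = z) \<and> (s = u \<or> s + 1 \<in> starts L)"
proof (induction r L arbitrary: l rule: weight_run_t.induct)
  case (2 r p q v L)
  show ?case
  proof (cases "r \<le> q")
    case True
    then have zs: "z = v" "s = result (extend_run_t v q L)" using 2 by auto
    have "q \<le> s \<and> s \<le> u \<and> (\<forall>x\<in>{q + 1..s}. weight_at d L x = v) \<and> (s = u \<or> s + 1 \<in> starts L)"
      by (rule extend_run[OF _ zs(2)]) (use 2 in simp)
    then show ?thesis using 2 True zs by auto
  next
    case False
    then have "r \<le> s \<and> s \<le> u \<and> length z = d \<and> (\<forall>x\<in>{r..s}. weight_at d L x = z) \<and>
        (s = u \<or> s + 1 \<in> starts L)"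
      using 2 by (intro "2.IH"[of _ "q + 1"]) auto
    then show ?thesis using 2 False by auto
  qed
qed auto

section \<open>Orbit-preserving modifications of the pairings\<close>

text \<open>
  The pairings which reach the transmission step: not an identity, and reversing pairings are trimmed.
\<close>

fun normal :: "int \<Rightarrow> pairing \<Rightarrow> bool" where
  "normal N (Pairing a b c d p) \<longleftrightarrow>
     1 \<le> a \<and> a \<le> b \<and> a < c \<and> d \<le> N \<and> d - c = b - a \<and> (\<not> p \<longrightarrow> b < c)"

lemma normal_is_pairing: "normal N g \<Longrightarrow> is_pairing N g"
  by (cases g) auto

subsection \<open>Deleting identities and trimming\<close>

abbreviation is_identity :: "pairing \<Rightarrow> bool" where
  "is_identity g \<equiv> result (is_identity_t g)"

lemma is_identity_Pairing: "is_identity (Pairing a b c d p) \<longleftrightarrow> a = c \<and> (p \<or> a = b)"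
  by auto

lemma result_delete_identities [simp]:
  "result (delete_identities_t gs) = filter (\<lambda>g. \<not> is_identity g) gs"
  by (induction gs) auto

lemma conn_delete_identities:
  assumes "\<forall>g\<in>set gs. is_pairing N g"
  shows "conn (filter (\<lambda>g. \<not> is_identity g) gs) = conn gs"
proof (rule conn_eqI)
  fix g assume g: "g \<in> set gs"
  show "edge g \<subseteq> conn (filter (\<lambda>g. \<not> is_identity g) gs)"
  proof (cases "is_identity g")
    case True
    then have "edge g \<subseteq> Id" using assms g by (cases g) (auto simp: edge_Pairing split: if_splits)
    then show ?thesis by auto
  next
    case False
    then show ?thesis using g by (intro edge_conn) auto
  qed
qed (use edge_conn in auto)

abbreviation trim :: "pairing \<Rightarrow> pairing" where
  "trim g \<equiv> result (trim_t g)"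

lemma trim_Pairing:
  "trim (Pairing a b c d p) = (if p \<or> b < c then Pairing a b c d p
    else Pairing a ((a + d - 1) div 2) ((a + d) div 2 + 1) d False)"
  by auto

declare is_identity_t.simps [simp del] trim_t.simps [simp del]

lemma trim_normal:
  assumes "is_pairing N g" "\<not> is_identity g"
  shows "normal N (trim g)"
proof (cases g)
  case (Pairing a b c d p)
  show ?thesis
  proof (cases "p \<or> b < c")
    case True
    then show ?thesis using assms Pairing by (auto simp: trim_Pairing is_identity_Pairing)
  next
    case False
    then have "a < d" using assms Pairing by (auto simp: is_identity_Pairing)
    moreover have "(a + d - 1) div 2 + ((a + d) div 2 + 1) = a + d" by presburger
    ultimately show ?thesis using assms False Pairing
      by (auto simp: trim_Pairing is_identity_Pairing)
  qed
qed

text \<open>A reversing pairing exchanges \<open>x\<close> and \<open>a + d - x\<close>; one point of each such pair is kept.\<close>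

lemma conn_trim:
  assumes "is_pairing N g"
  shows "conn [trim g] = conn [g]"
proof (cases g)
  case (Pairing a b c d p)
  show ?thesis
  proof (cases "p \<or> b < c")
    case True
    then show ?thesis using Pairing by (simp add: trim_Pairing)
  next
    case False
    let ?h = "Pairing a ((a + d - 1) div 2) ((a + d) div 2 + 1) d False"
    have h: "trim g = ?h" using False Pairing by (simp add: trim_Pairing)
    have eh: "edge ?h = (\<lambda>x. (x, a + d - x)) ` {a..(a + d - 1) div 2}"
      unfolding edge_Pairing by (intro image_cong) auto
    have eg: "edge g = (\<lambda>x. (x, a + d - x)) ` {a..b}"
      unfolding Pairing edge_Pairing using False by (intro image_cong) auto
    have ab: "(a + d - 1) div 2 \<le> b" using assms Pairing False by auto
    have "edge ?h \<subseteq> conn [g]"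
      using edge_conn[of g "[g]"] ab unfolding eh eg by fastforce
    moreover have "edge g \<subseteq> conn [?h]"
    proof
      fix e assume "e \<in> edge g"
      then obtain x where x: "a \<le> x" "x \<le> b" "e = (x, a + d - x)" unfolding eg by auto
      have *: "(u, a + d - u) \<in> conn [?h]" if "a \<le> u" "u \<le> (a + d - 1) div 2" for u
        using edge_conn[of ?h "[?h]"] that unfolding eh by auto
      consider "x \<le> (a + d - 1) div 2" | "a + d - x = x" | "a + d - x \<le> (a + d - 1) div 2" by linarith
      then show "e \<in> conn [?h]"
      proof cases
        case 3
        then have "(a + d - x, x) \<in> conn [?h]" using *[of "a + d - x"] x assms Pairing by auto
        then show ?thesis using x by (auto intro: conn_sym)
      qed (use * x in auto)
    qed
    ultimately show ?thesis unfolding h by (intro conn_eqI) auto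
  qed
qed

subsection \<open>Periodic mergers\<close>

abbreviation periodic :: "pairing \<Rightarrow> bool" where
  "periodic g \<equiv> result (periodic_t g)"

lemma periodic_Pairing: "periodic (Pairing a b c d p) \<longleftrightarrow> p \<and> a < c \<and> c \<le> b + 1"
  by auto

declare periodic_t.simps [simp del]

text \<open>
  The theorem of Fine and Wilf, by the Euclidean algorithm: on a window of width at least
  \<open>s + t\<close>, the periods \<open>s < t\<close> give the period \<open>t - s\<close>, as from every point a
  step of \<open>t\<close> upwards or a step of \<open>s\<close> downwards stays inside the window.
\<close>

lemma gcd_period:
  fixes s t :: int
  assumes "0 < s" "0 < t" "s + t \<le> u - l + 1"
    and "\<And>z. l \<le> z \<Longrightarrow> z + s \<le> u \<Longrightarrow> (z, z + s) \<in> conn gs"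
    and "\<And>z. l \<le> z \<Longrightarrow> z + t \<le> u \<Longrightarrow> (z, z + t) \<in> conn gs"
    and "l \<le> x" "x + gcd s t \<le> u"
  shows "(x, x + gcd s t) \<in> conn gs"
  using assms
proof (induction "nat (s + t)" arbitrary: s t rule: less_induct)
  case less
  have step: "(z, z + (t' - s')) \<in> conn gs"
    if "0 < s'" "s' < t'" "s' + t' \<le> u - l + 1" "l \<le> z" "z + (t' - s') \<le> u"
      and s': "\<And>z. l \<le> z \<Longrightarrow> z + s' \<le> u \<Longrightarrow> (z, z + s') \<in> conn gs"
      and t': "\<And>z. l \<le> z \<Longrightarrow> z + t' \<le> u \<Longrightarrow> (z, z + t') \<in> conn gs" for s' t' z
  proof (cases "z + t' \<le> u")
    case True
    then have "(z, z + t') \<in> conn gs" "(z + (t' - s'), z + t') \<in> conn gs"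
      using t'[of z] s'[of "z + (t' - s')"] that(1-5) by auto
    then show ?thesis by (blast intro: conn_trans conn_sym)
  next
    case False
    then have "(z - s', z) \<in> conn gs" "(z - s', z + (t' - s')) \<in> conn gs"
      using s'[of "z - s'"] t'[of "z - s'"] that(1-5) by (auto simp: algebra_simps)
    then show ?thesis by (blast intro: conn_trans conn_sym)
  qed
  consider "s = t" | "s < t" | "t < s" by linarith
  then show ?case
  proof cases
    case 1
    then show ?thesis using less.prems by simp
  next
    case 2
    have "gcd s (t - s) = gcd s t" by (metis gcd.commute gcd_diff1)
    then show ?thesis
      using less.hyps[of s "t - s"] step[of s t] 2 less.prems by simp
  next
    case 3
    have "gcd (s - t) t = gcd s t" by (rule gcd_diff1)
    then show ?thesis
      using less.hyps[of "s - t" t] step[of t s] 3 less.prems by (simp add: add.commute)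
  qed
qed

lemma conn_multiples:
  assumes "\<And>z. l \<le> z \<Longrightarrow> z + t \<le> u \<Longrightarrow> (z, z + t) \<in> conn gs" and "0 < t"
  shows "l \<le> x \<Longrightarrow> x + int n * t \<le> u \<Longrightarrow> (x, x + int n * t) \<in> conn gs"
proof (induction n)
  case (Suc n)
  have "0 \<le> int n * t" using assms(2) by simp
  then have l: "l \<le> x + int n * t" using Suc.prems(1) by linarith
  have u: "x + int n * t + t \<le> u" using Suc.prems(2) by (simp add: algebra_simps)
  have "(x, x + int n * t) \<in> conn gs" using Suc u assms(2) by simp
  then have "(x, x + int n * t + t) \<in> conn gs" using assms(1)[OF l u] by (rule conn_trans)
  then show ?case by (simp add: algebra_simps)
qed simp

text \<open>A period of a window extends to any longer interval that has a multiple of it as a period.\<close>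

lemma extend_period:
  assumes per: "\<And>z. l \<le> z \<Longrightarrow> z + T \<le> u \<Longrightarrow> (z, z + T) \<in> conn gs" and "0 < T"
    and window: "\<And>z. lo \<le> z \<Longrightarrow> z + t \<le> hi \<Longrightarrow> (z, z + t) \<in> conn gs"
    and "l \<le> lo" "hi \<le> u" "T + t \<le> hi - lo + 1" "0 < t" "t \<le> T"
    and "l \<le> x" "x + t \<le> u"
  shows "(x, x + t) \<in> conn gs"
proof -
  define y where "y = lo + (x - lo) mod T"
  have y: "lo \<le> y" "y + t \<le> hi" using \<open>T + t \<le> hi - lo + 1\<close> pos_mod_bound[OF \<open>0 < T\<close>, of "x - lo"]
      pos_mod_sign[OF \<open>0 < T\<close>, of "x - lo"] unfolding y_def by linarith+
  then have yt: "(y, y + t) \<in> conn gs" by (rule window)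
  have "y - x = - (T * ((x - lo) div T))"
    unfolding y_def using minus_mult_div_eq_mod[of "x - lo" T] by linarith
  then obtain k where k: "y = x + k * T" by (metis add.commute diff_add_cancel mult.commute mult_minus_left)
  have "(x, y) \<in> conn gs \<and> (x + t, y + t) \<in> conn gs"
  proof (cases "0 \<le> k")
    case True
    then have "y = x + int (nat k) * T" using k by simp
    then show ?thesis
      using conn_multiples[where x = x and n = "nat k", OF per \<open>0 < T\<close>] conn_multiples[where x = "x + t" and n = "nat k", OF per \<open>0 < T\<close>]
        assms y by (simp add: algebra_simps)
  next
    case False
    then have "x = y + int (nat (- k)) * T" using k by simp
    then have "(y, x) \<in> conn gs \<and> (y + t, x + t) \<in> conn gs"
      using conn_multiples[where x = y and n = "nat (- k)", OF per \<open>0 < T\<close>] conn_multiples[where x = "y + t" and n = "nat (- k)", OF per \<open>0 < T\<close>]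
        assms y by (simp add: algebra_simps)
    then show ?thesis by (blast intro: conn_sym)
  qed
  then show ?thesis using yt by (blast intro: conn_trans conn_sym)
qed

lemma edge_preserving:
  "d - c = b - a \<Longrightarrow> edge (Pairing a b c d True) = {(x, x + (c - a)) | x. a \<le> x \<and> x + (c - a) \<le> d}"
  by (auto simp: edge_Pairing)

lemma conn_preserving:
  assumes "Pairing a b c d True \<in> set gs" "d - c = b - a" "a \<le> z" "z + (c - a) \<le> d"
  shows "(z, z + (c - a)) \<in> conn gs"
  using edge_conn[OF assms(1)] assms(2-4) by (auto simp: edge_preserving)

abbreviation merge_pair :: "pairing \<Rightarrow> pairing \<Rightarrow> pairing option" where
  "merge_pair g h \<equiv> result (merge_pair_t g h)"

lemma merge_pair_Pairing:
  "merge_pair (Pairing a1 b1 c1 d1 p1) (Pairing a2 b2 c2 d2 p2) =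
    (if periodic (Pairing a1 b1 c1 d1 p1) \<and> periodic (Pairing a2 b2 c2 d2 p2) \<and>
        (c1 - a1) + (c2 - a2) \<le> min d1 d2 + 1 - max a1 a2
     then Some (Pairing (min a1 a2) (max d1 d2 - gcd (c1 - a1) (c2 - a2))
                  (min a1 a2 + gcd (c1 - a1) (c2 - a2)) (max d1 d2) True)
     else None)"
proof -
  have "0 \<le> c1 - a1 \<and> 0 \<le> c2 - a2"
    if "periodic (Pairing a1 b1 c1 d1 p1)" "periodic (Pairing a2 b2 c2 d2 p2)"
    using that by (auto simp: periodic_Pairing)
  then show ?thesis by (simp add: result_if)
qed

declare merge_pair_t.simps [simp del]

text \<open>
  On the common part of the two periodic intervals the greatest common divisor of the periods is a
  period, by \<open>gcd_period\<close>; by \<open>extend_period\<close> it is one on each interval, and hence on their union.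
\<close>

lemma merge_pair:
  assumes g1: "normal N g1" and g2: "normal N g2" and m: "merge_pair g1 g2 = Some g"
  shows "normal N g \<and> conn [g] = conn [g1, g2]"
proof -
  obtain a1 b1 c1 d1 p1 where 1: "g1 = Pairing a1 b1 c1 d1 p1" by (cases g1)
  obtain a2 b2 c2 d2 p2 where 2: "g2 = Pairing a2 b2 c2 d2 p2" by (cases g2)
  define t1 t2 t where t: "t1 = c1 - a1" "t2 = c2 - a2" "t = gcd t1 t2"
  define lo hi where lh: "lo = max a1 a2" "hi = min d1 d2"
  have ok: "p1" "a1 < c1" "c1 \<le> b1 + 1" "p2" "a2 < c2" "c2 \<le> b2 + 1" "t1 + t2 \<le> hi - lo + 1"
    and g: "g = Pairing (min a1 a2) (max d1 d2 - t) (min a1 a2 + t) (max d1 d2) True"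
    using m unfolding 1 2 merge_pair_Pairing
    by (simp_all add: periodic_Pairing t lh split: if_splits)
  have eqs: "d1 - c1 = b1 - a1" "d2 - c2 = b2 - a2" "1 \<le> a1" "1 \<le> a2" "d1 \<le> N" "d2 \<le> N"
    using g1 g2 1 2 by auto
  have t0: "0 < t1" "0 < t2" using ok t by auto
  then have tpos: "0 < t" "t \<le> t1" "t \<le> t2" by (auto simp: t gcd_le1_int gcd_le2_int)
  have P1: "(z, z + t1) \<in> conn [g1, g2]" if "a1 \<le> z" "z + t1 \<le> d1" for z
    using that ok eqs unfolding 1 t by (intro conn_preserving[where b = b1 and d = d1]) auto
  have P2: "(z, z + t2) \<in> conn [g1, g2]" if "a2 \<le> z" "z + t2 \<le> d2" for z
    using that ok eqs unfolding 2 t by (intro conn_preserving[where b = b2 and d = d2]) auto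
  have W: "(z, z + t) \<in> conn [g1, g2]" if "lo \<le> z" "z + t \<le> hi" for z
    unfolding t(3)
    by (rule gcd_period[where l = lo and u = hi])
      (use P1 P2 t0 ok that t(3) in \<open>auto simp: lh\<close>)
  have E1: "(z, z + t) \<in> conn [g1, g2]" if "a1 \<le> z" "z + t \<le> d1" for z
    by (rule extend_period[where l = a1 and u = d1 and lo = lo and hi = hi and T = t1])
      (use P1 W t0 tpos ok that in \<open>auto simp: lh\<close>)
  have E2: "(z, z + t) \<in> conn [g1, g2]" if "a2 \<le> z" "z + t \<le> d2" for z
    by (rule extend_period[where l = a2 and u = d2 and lo = lo and hi = hi and T = t2])
      (use P2 W t0 tpos ok that in \<open>auto simp: lh\<close>)
  have E: "(z, z + t) \<in> conn [g1, g2]" if "min a1 a2 \<le> z" "z + t \<le> max d1 d2" for z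
  proof -
    have "a1 \<le> z \<and> z + t \<le> d1 \<or> a2 \<le> z \<and> z + t \<le> d2"
      using that ok(7) tpos t0 unfolding lh by linarith
    then show ?thesis using E1 E2 by blast
  qed
  have bd: "max d1 d2 - (min a1 a2 + t) = max d1 d2 - t - min a1 a2" by simp
  have G: "(z, z + t) \<in> conn [g]" if "min a1 a2 \<le> z" "z + t \<le> max d1 d2" for z
    using that edge_conn[of g "[g]"] by (auto simp: g edge_preserving)
  have sub: "edge g \<subseteq> conn [g1, g2]"
    unfolding g using E by (auto simp: edge_preserving)
  have dvd: "\<exists>n. t1 = int n * t" "\<exists>n. t2 = int n * t"
    using t0 tpos t(3) by (metis dvd_def gcd_dvd1 gcd_dvd2 mult.commute zero_less_mult_pos zero_less_imp_eq_int)+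
  then obtain n1 n2 where n: "t1 = int n1 * t" "t2 = int n2 * t" by blast
  have sub1: "edge g1 \<subseteq> conn [g]"
    unfolding 1 using ok(1) eqs(1) conn_multiples[where l = "min a1 a2" and u = "max d1 d2" and n = n1, OF G tpos(1)]
    by (auto simp: edge_preserving simp flip: t(1) n(1))
  have sub2: "edge g2 \<subseteq> conn [g]"
    unfolding 2 using ok(4) eqs(2) conn_multiples[where l = "min a1 a2" and u = "max d1 d2" and n = n2, OF G tpos(1)]
    by (auto simp: edge_preserving simp flip: t(2) n(2))
  have "conn [g] = conn [g1, g2]" using sub sub1 sub2 by (intro conn_eqI) auto
  moreover have "t \<le> max d1 d2 - min a1 a2" using ok(7) tpos t0 unfolding lh by linarith
  ultimately show ?thesis using eqs tpos unfolding g by auto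
qed

lemma conn_Cons_swap: "conn (g # h # hs) = conn (h # g # hs)"
  by (rule conn_cong) auto

lemma conn_append_cong: "conn gs = conn gs' \<Longrightarrow> conn (gs @ hs) = conn (gs' @ hs)"
proof (induction hs arbitrary: gs gs')
  case (Cons h hs)
  have "conn (gs @ h # hs) = conn ((h # gs) @ hs)" by (rule conn_cong) auto
  also have "\<dots> = conn ((h # gs') @ hs)" by (intro Cons.IH conn_Cons_cong Cons.prems)
  also have "\<dots> = conn (gs' @ h # hs)" by (rule conn_cong) auto
  finally show ?case .
qed simp

lemma merge_into:
  assumes "normal N g" "\<forall>h\<in>set hs. normal N h" "result (merge_into_t g hs) = Some hs'"
  shows "(\<forall>h\<in>set hs'. normal N h) \<and> conn hs' = conn (g # hs)"
  using assms
proof (induction g hs arbitrary: hs' rule: merge_into_t.induct)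
  case (2 g h hs)
  show ?case
  proof (cases "merge_pair g h")
    case None
    then obtain hs'' where hs'': "result (merge_into_t g hs) = Some hs''" "hs' = h # hs''"
      using 2 by (auto split: option.splits)
    then have IH: "(\<forall>h\<in>set hs''. normal N h) \<and> conn hs'' = conn (g # hs)"
      using 2 None by auto
    then have "conn hs' = conn (h # g # hs)" unfolding hs''(2) by (intro conn_Cons_cong) simp
    then show ?thesis using IH hs'' 2 by (simp add: conn_Cons_swap[of h g])
  next
    case (Some g')
    then have m: "normal N g'" "conn [g'] = conn [g, h]" "hs' = g' # hs"
      using merge_pair[of N g h g'] 2 by auto
    then show ?thesis using conn_append_cong[OF m(2), of hs] 2 by simp
  qed
qed simp

lemma merge_into_None:
  "result (merge_into_t g hs) = None \<Longrightarrow> h \<in> set hs \<Longrightarrow> merge_pair g h = None"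
  by (induction g hs rule: merge_into_t.induct) (auto split: option.splits)

lemma merge_once:
  assumes "\<forall>h\<in>set gs. normal N h" "result (merge_once_t gs) = Some gs'"
  shows "(\<forall>h\<in>set gs'. normal N h) \<and> conn gs' = conn gs"
  using assms
proof (induction gs arbitrary: gs' rule: merge_once_t.induct)
  case (2 g gs)
  show ?case
  proof (cases "result (merge_into_t g gs)")
    case None
    then obtain gs'' where gs'': "result (merge_once_t gs) = Some gs''" "gs' = g # gs''"
      using 2 by (auto split: option.splits)
    then have "(\<forall>h\<in>set gs''. normal N h) \<and> conn gs'' = conn gs" using 2 None by auto
    then show ?thesis using gs'' 2 conn_Cons_cong[of gs'' gs g] by simp
  next
    case (Some gs'')
    then show ?thesis using merge_into[of N g gs gs''] 2 by auto
  qed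
qed simp

lemma merge_once_None:
  "result (merge_once_t gs) = None \<Longrightarrow> sorted_wrt (\<lambda>g h. merge_pair g h = None) gs"
  by (induction gs rule: merge_once_t.induct) (auto split: option.splits simp: merge_into_None)

abbreviation merge_all :: "pairing list \<Rightarrow> pairing list" where
  "merge_all gs \<equiv> result (merge_all_t gs)"

lemma merge_all:
  assumes "\<forall>h\<in>set gs. normal N h"
  shows "(\<forall>h\<in>set (merge_all gs). normal N h) \<and> conn (merge_all gs) = conn gs \<and>
    sorted_wrt (\<lambda>g h. merge_pair g h = None) (merge_all gs) \<and>
    length (merge_all gs) \<le> length gs \<and> (length (merge_all gs) = length gs \<longrightarrow> merge_all gs = gs)"
  using assms
proof (induction gs rule: length_induct)
  case (1 gs)
  show ?case
  proof (cases "result (merge_once_t gs)")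
    case None
    then have "merge_all gs = gs" by (simp add: merge_all_t.simps[of gs])
    then show ?thesis using 1 merge_once_None[OF None] by simp
  next
    case (Some gs')
    then have eq: "merge_all gs = merge_all gs'" by (simp add: merge_all_t.simps[of gs])
    have len: "length gs = Suc (length gs')" by (rule length_merge_once[OF Some])
    have m: "\<forall>h\<in>set gs'. normal N h" "conn gs' = conn gs" using merge_once[OF 1(2) Some] by auto
    have "length gs' < length gs" using len by simp
    then have IH: "(\<forall>h\<in>set (merge_all gs'). normal N h) \<and> conn (merge_all gs') = conn gs' \<and>
      sorted_wrt (\<lambda>g h. merge_pair g h = None) (merge_all gs') \<and>
      length (merge_all gs') \<le> length gs'"
      using 1(1) m(1) by blast
    then show ?thesis unfolding eq using len m by auto
  qed
qed

subsection \<open>Transmission\<close>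

text \<open>The displacement of \<open>[x,y]\<close> when it is pulled back.\<close>

lemma pull_back_preserving:
  assumes "normal N (Pairing a b c d True)" "c \<le> x" "x \<le> y" "y \<le> d"
  obtains k where "result (pull_back_t (Pairing a b c d True) x y) = (x - k, y - k)"
    and "c - a \<le> k" "a \<le> x - k" "x - k < c"
    and "\<And>u. x \<le> u \<Longrightarrow> u \<le> y \<Longrightarrow> (u, u - k) \<in> conn [Pairing a b c d True]"
proof
  define t where "t = c - a"
  define q where "q = (x - c) div t"
  have t: "0 < t" using assms by (simp add: t_def)
  have q: "0 \<le> q" using assms t by (simp add: q_def pos_imp_zdiv_nonneg_iff)
  have x: "x - c = q * t + (x - c) mod t" "0 \<le> (x - c) mod t" "(x - c) mod t < t"
    using t by (simp_all add: q_def)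
  let ?k = "(q + 1) * t"
  show "result (pull_back_t (Pairing a b c d True) x y) = (x - ?k, y - ?k)"
    by (simp add: q_def t_def)
  have "0 \<le> q * t" using q t by simp
  then show "c - a \<le> ?k" by (simp add: t_def algebra_simps)
  have k: "?k = q * t + t" by (simp add: algebra_simps)
  show "a \<le> x - ?k" "x - ?k < c" using x k t_def by linarith+
  show "(u, u - ?k) \<in> conn [Pairing a b c d True]" if u: "x \<le> u" "u \<le> y" for u
  proof -
    have "(u - ?k, u - ?k + int (nat (q + 1)) * t) \<in> conn [Pairing a b c d True]"
    proof (rule conn_multiples[where l = a and u = d])
      fix z assume "a \<le> z" "z + t \<le> d"
      then show "(z, z + t) \<in> conn [Pairing a b c d True]"
        unfolding t_def using assms by (intro conn_preserving[where b = b and d = d]) auto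
    qed (use t q u \<open>a \<le> x - ?k\<close> assms in auto)
    then show ?thesis using q by (simp add: conn_sym)
  qed
qed

lemma pull_back_reversing:
  assumes "normal N (Pairing a b c d False)" "c \<le> x" "x \<le> y" "y \<le> d"
  shows "result (pull_back_t (Pairing a b c d False) x y) = (a + d - y, a + d - x)"
    and "a \<le> a + d - y" "a + d - x \<le> b"
    and "\<And>u. x \<le> u \<Longrightarrow> u \<le> y \<Longrightarrow> (u, a + d - u) \<in> conn [Pairing a b c d False]"
proof -
  show "(u, a + d - u) \<in> conn [Pairing a b c d False]" if "x \<le> u" "u \<le> y" for u
  proof -
    have "(a + d - u, u) \<in> edge (Pairing a b c d False)"
      using that assms by (auto simp: edge_Pairing image_iff)
    then show ?thesis using edge_conn[of "Pairing a b c d False" "[Pairing a b c d False]"]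
      by (intro conn_sym[of "a + d - u"]) auto
  qed
qed (use assms in auto)

text \<open>
  An edge of \<open>h\<close> may be replaced by one between the images of its end points under \<open>g\<close>: either of
  the two edges is the composite of the other one with moves along \<open>g\<close>.
\<close>

lemma conn_transport:
  assumes edge: "edge h' = (\<lambda>(x, y). (f x, f' y)) ` edge h"
    and "\<And>x y. (x, y) \<in> edge h \<Longrightarrow> (x, f x) \<in> conn [g]"
    and "\<And>x y. (x, y) \<in> edge h \<Longrightarrow> (y, f' y) \<in> conn [g]"
  shows "conn [g, h'] = conn [g, h]"
proof -
  have mono: "conn [g] \<subseteq> conn [g, k]" for k by (intro conn_mono) auto
  have "edge h' \<subseteq> conn [g, h]"
  proof
    fix e assume "e \<in> edge h'"
    then obtain x y where xy: "(x, y) \<in> edge h" "e = (f x, f' y)" unfolding edge by auto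
    have "(x, y) \<in> conn [g, h]" using edge_conn[of h "[g, h]"] xy by auto
    moreover have "(x, f x) \<in> conn [g, h]" "(y, f' y) \<in> conn [g, h]"
      using assms(2,3)[OF xy(1)] mono[of h] by auto
    ultimately show "e \<in> conn [g, h]" unfolding xy by (blast intro: conn_trans conn_sym)
  qed
  moreover have "edge h \<subseteq> conn [g, h']"
  proof
    fix e assume e: "e \<in> edge h"
    then obtain x y where xy: "(x, y) \<in> edge h" "e = (x, y)" by (cases e) auto
    then have "(f x, f' y) \<in> edge h'" unfolding edge by force
    then have "(f x, f' y) \<in> conn [g, h']" using edge_conn[of h' "[g, h']"] by auto
    moreover have "(x, f x) \<in> conn [g, h']" "(y, f' y) \<in> conn [g, h']"
      using assms(2,3)[OF xy(1)] mono[of h'] by auto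
    ultimately show "e \<in> conn [g, h']" unfolding xy by (blast intro: conn_trans conn_sym)
  qed
  moreover have "edge g \<subseteq> conn [g, h]" "edge g \<subseteq> conn [g, h']" by (simp_all add: edge_conn)
  ultimately show ?thesis by (intro conn_eqI) auto
qed

lemma edge_Pairing_iff:
  "(x, y) \<in> edge (Pairing a b c d p) \<longleftrightarrow>
    a \<le> x \<and> x \<le> b \<and> y = (if p then c + (x - a) else d - (x - a))"
  by (auto simp: edge_Pairing)

lemma edge_swap: "d - c = b - a \<Longrightarrow> edge (Pairing c d a b p) = (edge (Pairing a b c d p))\<inverse>"
  by (auto simp: edge_Pairing_iff split: if_splits)

lemma conn_swap:
  assumes "edge h' = (edge h)\<inverse>"
  shows "conn [g, h'] = conn [g, h]"
  using assms by (auto simp: conn_def Un_ac)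

lemma result_orient:
  "result (orient_t a b c d p) = (if c < a then Pairing c d a b p else Pairing a b c d p)"
  by (simp add: orient_t_def)

lemma conn_orient:
  "d - c = b - a \<Longrightarrow> conn [g, result (orient_t a b c d p)] = conn [g, Pairing a b c d p]"
  using conn_swap[OF edge_swap, of d c b a g p] by (simp add: result_orient)

lemma edge_translate:
  "edge (Pairing (a - l) (b - l) (c - k) (d - k) p) =
    (\<lambda>(x, y). (x - l, y - k)) ` edge (Pairing a b c d p)"
  unfolding edge_Pairing image_minus_const_atLeastAtMost'[symmetric] image_image
  by (intro image_cong) auto

lemma edge_reflect:
  "d - c = b - a \<Longrightarrow> edge (Pairing (s - b) (s - a) (s - d) (s - c) p) =
    (\<lambda>(x, y). (s - x, s - y)) ` edge (Pairing a b c d p)"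
  unfolding edge_Pairing image_diff_atLeastAtMost[symmetric] image_image
  by (intro image_cong) auto

lemma edge_reflect_range:
  "d - c = b - a \<Longrightarrow> edge (Pairing a b (s - d) (s - c) (\<not> p)) =
    (\<lambda>(x, y). (x, s - y)) ` edge (Pairing a b c d p)"
  unfolding edge_Pairing image_image by (intro image_cong) auto

text \<open>
  Both intervals of the transmitted pairing are images of the original ones under maps
  along \<open>g\<close>; the displaced ones start to the left of the range of \<open>g\<close>. The last clauses record how
  far they move, for the estimate of the number of cycles.
\<close>

lemma transmit:
  assumes g: "normal N g" and h: "normal N h"
    and cont: "ran_lo g \<le> ran_lo h" "ran_hi h \<le> ran_hi g"
  obtains a' b' c' d' p' where "result (transmit_t g h) = result (orient_t a' b' c' d' p')"
    and "1 \<le> a'" "1 \<le> c'" "a' < ran_lo g" "c' < ran_lo g" "b' \<le> dom_hi h"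
    and "b' - a' = dom_hi h - dom_lo h" "d' - c' = dom_hi h - dom_lo h"
    and "conn [g, result (transmit_t g h)] = conn [g, h]"
    and "preserving g \<Longrightarrow> p' = preserving h"
    and "preserving g \<Longrightarrow> d' \<le> ran_hi h - (ran_lo g - dom_lo g)"
    and "\<not> preserving g \<Longrightarrow> d' < ran_lo g"
    and "\<not> preserving g \<Longrightarrow> p' = (\<not> preserving h) \<or> b' < ran_lo g"
proof -
  obtain a b c d p where G: "g = Pairing a b c d p" by (cases g)
  obtain a2 b2 c2 d2 p2 where H: "h = Pairing a2 b2 c2 d2 p2" by (cases h)
  have tg: "trim g = g" using g by (auto simp: G trim_Pairing)
  have hb: "a2 \<le> b2" "d2 - c2 = b2 - a2" "1 \<le> a2" "a2 < c2" "d2 \<le> N" and cd: "c \<le> c2" "d2 \<le> d"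
    and gb: "d - c = b - a" "1 \<le> a" "a < c"
    using g h cont unfolding G H by auto
  let ?both = "c \<le> a2 \<and> b2 \<le> d"
  have both_iff: "?both \<longleftrightarrow> c \<le> a2" using hb cd by auto
  show thesis
  proof (cases p)
    case True
    then obtain k where k: "result (pull_back_t g c2 d2) = (c2 - k, d2 - k)" "c - a \<le> k"
      "a \<le> c2 - k" "c2 - k < c" "\<And>u. c2 \<le> u \<Longrightarrow> u \<le> d2 \<Longrightarrow> (u, u - k) \<in> conn [g]"
      using pull_back_preserving[of N a b c d c2 d2] g hb cd unfolding G by auto
    show thesis
    proof (cases ?both)
      case True
      then obtain l where l: "result (pull_back_t g a2 b2) = (a2 - l, b2 - l)" "c - a \<le> l"
        "a \<le> a2 - l" "a2 - l < c" "\<And>u. a2 \<le> u \<Longrightarrow> u \<le> b2 \<Longrightarrow> (u, u - l) \<in> conn [g]"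
        using pull_back_preserving[of N a b c d a2 b2] g hb \<open>p\<close> unfolding G by auto
      have r: "result (transmit_t g h) = result (orient_t (a2 - l) (b2 - l) (c2 - k) (d2 - k) p2)"
        using True k(1) l(1) tg by (simp add: H G contained_t_def)
      have "edge (Pairing (a2 - l) (b2 - l) (c2 - k) (d2 - k) p2) = (\<lambda>(x, y). (x - l, y - k)) ` edge h"
        unfolding H by (rule edge_translate)
      then have "conn [g, Pairing (a2 - l) (b2 - l) (c2 - k) (d2 - k) p2] = conn [g, h]"
        by (rule conn_transport) (use k(5) l(5) hb in \<open>auto simp: H edge_Pairing_iff\<close>)
      then have C: "conn [g, result (transmit_t g h)] = conn [g, h]"
        unfolding r using hb(2) by (subst conn_orient) simp_all
      show thesis
        by (rule that[OF r _ _ _ _ _ _ _ C])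
          (use k(2-4) l(2-4) hb cd gb True \<open>p\<close> in \<open>simp_all add: G H\<close>)
    next
      case False
      have r: "result (transmit_t g h) = result (orient_t a2 b2 (c2 - k) (d2 - k) p2)"
        using False k(1) tg \<open>p\<close> by (auto simp: H G contained_t_def)
      have "edge (Pairing a2 b2 (c2 - k) (d2 - k) p2) = (\<lambda>(x, y). (x, y - k)) ` edge h"
        using edge_translate[of a2 0 b2 c2 k d2 p2] by (simp add: H)
      then have "conn [g, Pairing a2 b2 (c2 - k) (d2 - k) p2] = conn [g, h]"
        by (rule conn_transport) (use k(5) hb in \<open>auto simp: H edge_Pairing_iff\<close>)
      then have C: "conn [g, result (transmit_t g h)] = conn [g, h]"
        unfolding r using hb(2) by (subst conn_orient) simp_all
      show thesis
        by (rule that[OF r _ _ _ _ _ _ _ C])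
          (use k(2-4) hb cd gb False both_iff \<open>p\<close> in \<open>simp_all add: G H\<close>)
    qed
  next
    case False
    then have gn: "normal N (Pairing a b c d False)" using g G by simp
    have bc: "b < c" using gn by simp
    define s where "s = a + d"
    note k = pull_back_reversing[OF gn cd(1) _ cd(2), folded s_def]
    have c2d2: "c2 \<le> d2" using hb by simp
    show thesis
    proof (cases ?both)
      case True
      then have ab: "c \<le> a2" "a2 \<le> b2" "b2 \<le> d" using hb by auto
      note l = pull_back_reversing[OF gn ab, folded s_def]
      have r: "result (transmit_t g h) = result (orient_t (s - b2) (s - a2) (s - d2) (s - c2) p2)"
        using True k(1)[OF c2d2] l(1) tg False by (simp add: H G contained_t_def)
      have "edge (Pairing (s - b2) (s - a2) (s - d2) (s - c2) p2) = (\<lambda>(x, y). (s - x, s - y)) ` edge h"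
        unfolding H by (rule edge_reflect) (rule hb(2))
      then have "conn [g, Pairing (s - b2) (s - a2) (s - d2) (s - c2) p2] = conn [g, h]"
        by (rule conn_transport) (use k(4)[OF c2d2] l(4) hb False in \<open>auto simp: H G edge_Pairing_iff\<close>)
      then have C: "conn [g, result (transmit_t g h)] = conn [g, h]"
        unfolding r using hb(2) by (subst conn_orient) simp_all
      show thesis
        by (rule that[OF r _ _ _ _ _ _ _ C])
          (use k(2,3)[OF c2d2] l(2,3) hb cd gb bc False True in \<open>simp_all add: G H\<close>)
    next
      case both: False
      have r: "result (transmit_t g h) = result (orient_t a2 b2 (s - d2) (s - c2) (\<not> p2))"
        using both k(1)[OF c2d2] tg False by (auto simp: H G contained_t_def)
      have "edge (Pairing a2 b2 (s - d2) (s - c2) (\<not> p2)) = (\<lambda>(x, y). (x, s - y)) ` edge h"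
        unfolding H by (rule edge_reflect_range) (rule hb(2))
      then have "conn [g, Pairing a2 b2 (s - d2) (s - c2) (\<not> p2)] = conn [g, h]"
        by (rule conn_transport) (use k(4)[OF c2d2] hb False in \<open>auto simp: H G edge_Pairing_iff\<close>)
      then have C: "conn [g, result (transmit_t g h)] = conn [g, h]"
        unfolding r using hb(2) by (subst conn_orient) simp_all
      show thesis
        by (rule that[OF r _ _ _ _ _ _ _ C])
          (use k(2,3)[OF c2d2] hb cd gb bc both both_iff False in \<open>simp_all add: G H\<close>)
    qed
  qed
qed

section \<open>Truncation and transfer of weights\<close>

text \<open>
  Points above \<open>M\<close> are moved into \<open>[1,M]\<close> along \<open>g\<close>. This is a retraction: it fixes the
  edges of the other pairings, and an edge of \<open>g\<close> either survives the truncation or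
  is contracted to a point.
\<close>

definition retraction :: "pairing \<Rightarrow> int \<Rightarrow> int \<Rightarrow> int" where
  "retraction g M x = (if x \<le> M then x
     else if preserving g
       then x - ((x - M - 1) div (ran_lo g - dom_lo g) + 1) * (ran_lo g - dom_lo g)
       else dom_lo g + ran_hi g - x)"

lemma conn_retraction:
  assumes "(x, y) \<in> conn gs"
    and "\<And>g u v. g \<in> set gs \<Longrightarrow> (u, v) \<in> edge g \<Longrightarrow> (f u, f v) \<in> conn hs"
  shows "(f x, f y) \<in> conn hs"
  using assms(1) unfolding conn_def[of gs]
proof (induction rule: rtrancl_induct)
  case (step y z)
  then have "(f y, f z) \<in> conn hs" using assms(2) by (auto intro: conn_sym)
  with step show ?case by (blast intro: conn_trans)
qed simp

abbreviation truncate :: "int \<Rightarrow> int \<Rightarrow> pairing \<Rightarrow> pairing option" where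
  "truncate N M g \<equiv> result (truncate_t N M g)"

lemma truncate_Pairing:
  "truncate N M (Pairing a b c d p) = (if c = M + 1 then None
    else Some (if p then Pairing a (b - (N - M)) c M p else Pairing (a + (N - M)) b c M p))"
  by (simp add: result_if)

declare truncate_t.simps [simp del]

abbreviation with_truncated :: "int \<Rightarrow> int \<Rightarrow> pairing \<Rightarrow> pairing list \<Rightarrow> pairing list" where
  "with_truncated N M g hs \<equiv> (case truncate N M g of None \<Rightarrow> hs | Some g' \<Rightarrow> g' # hs)"

lemma truncation:
  assumes g: "normal N g" "ran_hi g = N"
    and M: "ran_lo g \<le> M + 1" "M \<le> N"
    and hs: "\<And>h u v. h \<in> set hs \<Longrightarrow> (u, v) \<in> edge h \<Longrightarrow> u \<le> M \<and> v \<le> M"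
  shows "x \<in> {1..N} \<Longrightarrow> \<exists>y\<in>{1..M}. (x, y) \<in> conn (g # hs)"
    and "x \<in> {1..M} \<Longrightarrow> y \<in> {1..M} \<Longrightarrow>
      (x, y) \<in> conn (g # hs) \<longleftrightarrow> (x, y) \<in> conn (with_truncated N M g hs)"
proof -
  obtain a b c p where G: "g = Pairing a b c N p" using g by (cases g) auto
  have gb: "1 \<le> a" "a \<le> b" "a < c" "N - c = b - a" "\<not> p \<Longrightarrow> b < c" "c \<le> M + 1"
    using g M unfolding G by auto
  define t where "t = c - a"
  have t: "0 < t" using gb by (simp add: t_def)
  have eg: "(u, v) \<in> edge g \<longleftrightarrow> a \<le> u \<and> u \<le> b \<and> v = (if p then u + t else a + N - u)" for u v
    unfolding G by (auto simp: edge_Pairing_iff t_def)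
  show reach: "\<exists>y\<in>{1..M}. (x, y) \<in> conn (g # hs)" if x: "x \<in> {1..N}" for x
  proof (cases "x \<le> M")
    case True
    then show ?thesis using x by (intro bexI[of _ x]) auto
  next
    case False
    show ?thesis
    proof (cases p)
      case True
      define q where "q = (x - M - 1) div t"
      have q: "0 \<le> q" "x - M - 1 = q * t + (x - M - 1) mod t"
        "0 \<le> (x - M - 1) mod t" "(x - M - 1) mod t < t"
        using t False by (simp_all add: q_def pos_imp_zdiv_nonneg_iff)
      define y where "y = x - (q + 1) * t"
      have yx: "y = M + 1 + (x - M - 1) mod t - t" using q(2) by (simp add: y_def algebra_simps)
      have y: "a \<le> y" "y \<le> M" using yx q(3,4) gb t_def by linarith+
      have "(y, y + int (nat (q + 1)) * t) \<in> conn (g # hs)"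
      proof (rule conn_multiples[where l = a and u = N])
        fix z assume "a \<le> z" "z + t \<le> N"
        then show "(z, z + t) \<in> conn (g # hs)"
          unfolding t_def using gb True G by (intro conn_preserving[where b = b and d = N]) auto
      qed (use t q y x in \<open>auto simp: y_def\<close>)
      then have "(x, y) \<in> conn (g # hs)" using q by (intro conn_sym[of y]) (simp add: y_def)
      then show ?thesis using y gb by (intro bexI[of _ y]) auto
    next
      case False
      have "(a + N - x, x) \<in> edge g" using False x gb \<open>\<not> x \<le> M\<close> by (auto simp: eg)
      then have "(x, a + N - x) \<in> conn (g # hs)"
        using edge_conn[of g "g # hs"] by (intro conn_sym[of "a + N - x"]) auto
      then show ?thesis using gb False x \<open>\<not> x \<le> M\<close> by (intro bexI[of _ "a + N - x"]) auto
    qed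
  qed
  let ?gs' = "with_truncated N M g hs"
  have eg': "\<exists>k \<in> set ?gs'. (u, v) \<in> edge k"
    if "c \<le> M" "a \<le> u" "u \<le> b" "v = (if p then u + t else a + N - u)" "v \<le> M" for u v
    using that gb M by (auto simp: G truncate_Pairing edge_Pairing_iff t_def)
  have trunc: "edge k \<subseteq> edge g" if "truncate N M g = Some k" for k
    using that gb M by (auto simp: G truncate_Pairing edge_Pairing_iff split: if_splits)
  have sub: "conn ?gs' \<subseteq> conn (g # hs)"
  proof (rule conn_subsetI)
    fix k assume "k \<in> set ?gs'"
    then consider "k \<in> set hs" | "truncate N M g = Some k" by (auto split: option.splits)
    then show "edge k \<subseteq> conn (g # hs)"
    proof cases
      case 1
      then show ?thesis by (intro edge_conn) simp
    next
      case 2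
      then show ?thesis using trunc[OF 2] edge_conn[of g "g # hs"] by auto
    qed
  qed
  show "(x, y) \<in> conn (g # hs) \<longleftrightarrow> (x, y) \<in> conn ?gs'" if xy: "x \<in> {1..M}" "y \<in> {1..M}" for x y
  proof
    assume xyc: "(x, y) \<in> conn (g # hs)"
    have "(retraction g M x, retraction g M y) \<in> conn ?gs'"
      using xyc
    proof (rule conn_retraction)
      fix k u v assume k: "k \<in> set (g # hs)" "(u, v) \<in> edge k"
      show "(retraction g M u, retraction g M v) \<in> conn ?gs'"
      proof (cases "k \<in> set hs")
        case True
        then have "k \<in> set ?gs'" by (auto split: option.splits)
        then have "(u, v) \<in> conn ?gs'" using edge_conn k by blast
        then show ?thesis using hs[OF True k(2)] by (simp add: retraction_def)
      next
        case False
        then have "(u, v) \<in> edge g" using k by auto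
        then have uv: "a \<le> u" "u \<le> b" "v = (if p then u + t else a + N - u)" by (simp_all add: eg)
        show ?thesis
        proof (cases "v \<le> M")
          case True
          then have "c \<le> M" using uv gb t_def by (auto split: if_splits)
          then obtain k' where "k' \<in> set ?gs'" "(u, v) \<in> edge k'" using eg'[of u v] uv True by blast
          then have "(u, v) \<in> conn ?gs'" using edge_conn by blast
          moreover have "u \<le> M" using True uv gb t by (auto split: if_splits)
          ultimately show ?thesis using True by (simp add: retraction_def)
        next
          case vM: False
          have simps: "ran_lo g - dom_lo g = t" "preserving g = p" by (simp_all add: G t_def)
          have "retraction g M v = retraction g M u"
          proof (cases p)
            case True
            have v: "v = u + t" using uv True by simp
            show ?thesis
            proof (cases "u \<le> M")
              case True
              then have "(u + t - M - 1) div t = 0" using vM v by (intro div_pos_pos_trivial) auto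
              then show ?thesis using True v vM \<open>p\<close> by (simp add: retraction_def simps)
            next
              case False
              have "(u + t - M - 1) div t = (u - M - 1) div t + 1"
                using t div_add_self2[of t "u - M - 1"] by (simp add: algebra_simps)
              then show ?thesis using False v vM \<open>p\<close>
                by (simp add: retraction_def simps algebra_simps)
            qed
          next
            case False
            then show ?thesis using uv gb vM by (auto simp: retraction_def G)
          qed
          then show ?thesis by simp
        qed
      qed
    qed
    then show "(x, y) \<in> conn ?gs'" using xy by (simp add: retraction_def)
  qed (use sub in blast)
qed

subsection \<open>Effect of a transfer on the sum of the weights of an orbit\<close>

definition coord_sum :: "nat \<Rightarrow> weights \<Rightarrow> nat \<Rightarrow> int set \<Rightarrow> int" where
  "coord_sum d L i X = (\<Sum>x\<in>X. weight_at d L x ! i)"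

lemma orbit_weight_coord_sum: "orbit_weight d L X = map (\<lambda>i. coord_sum d L i X) [0..<d]"
  by (simp add: orbit_weight_def coord_sum_def)

lemma coord_sum_add_weight:
  assumes "chain d l L u" "x \<le> y" "l \<le> x" "y \<le> u" "length v = d" "i < d" "finite X"
  shows "coord_sum d (add_weight x y v L) i X = coord_sum d L i X + v ! i * int (card (X \<inter> {x..y}))"
proof -
  have "weight_at d (add_weight x y v L) w ! i =
      weight_at d L w ! i + (if w \<in> {x..y} then v ! i else 0)" for w
    using assms by (auto simp: weight_at_add_weight[OF assms(1,2)])
  then have "coord_sum d (add_weight x y v L) i X =
      coord_sum d L i X + (\<Sum>w\<in>X. if w \<in> {x..y} then v ! i else 0)"
    by (simp add: coord_sum_def sum.distrib)
  also have "(\<Sum>w\<in>X. if w \<in> {x..y} then v ! i else 0) = v ! i * int (card (X \<inter> {x..y}))"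
    by (simp add: sum.inter_restrict[OF assms(7), symmetric] del: atLeastAtMost_iff)
  finally show ?thesis .
qed

lemma card_translate:
  assumes "\<And>u. x \<le> u \<Longrightarrow> u \<le> y \<Longrightarrow> u \<in> X \<longleftrightarrow> u - k \<in> X"
  shows "card (X \<inter> {x - k..y - k}) = card (X \<inter> {x..(y::int)})"
proof -
  have "X \<inter> {x - k..y - k} = (\<lambda>u. u - k) ` (X \<inter> {x..y})"
  proof (intro equalityI subsetI)
    fix v assume "v \<in> X \<inter> {x - k..y - k}"
    then show "v \<in> (\<lambda>u. u - k) ` (X \<inter> {x..y})"
      using assms[of "v + k"] by (intro image_eqI[of _ _ "v + k"]) auto
  qed (use assms in auto)
  then show ?thesis by (simp add: card_image inj_on_def)
qed

lemma card_reflect: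
  assumes "\<And>u. x \<le> u \<Longrightarrow> u \<le> y \<Longrightarrow> u \<in> X \<longleftrightarrow> s - u \<in> X"
  shows "card (X \<inter> {s - y..s - x}) = card (X \<inter> {x..(y::int)})"
proof -
  have "X \<inter> {s - y..s - x} = (\<lambda>u. s - u) ` (X \<inter> {x..y})"
  proof (intro equalityI subsetI)
    fix v assume "v \<in> X \<inter> {s - y..s - x}"
    then show "v \<in> (\<lambda>u. s - u) ` (X \<inter> {x..y})"
      using assms[of "s - v"] by (intro image_eqI[of _ _ "s - v"]) auto
  qed (use assms in auto)
  then show ?thesis by (simp add: card_image inj_on_def)
qed

lemma card_split:
  "x \<le> m + 1 \<Longrightarrow> m \<le> y \<Longrightarrow> card (X \<inter> {x..y}) = card (X \<inter> {x..m}) + card (X \<inter> {m + 1..(y::int)})"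
proof -
  assume "x \<le> m + 1" "m \<le> y"
  then have "X \<inter> {x..y} = (X \<inter> {x..m}) \<union> (X \<inter> {m + 1..y})" by auto
  then show ?thesis by (simp add: card_Un_disjoint disjoint_iff)
qed

text \<open>
  A set with period \<open>t\<close> has as many points in each window of width \<open>t\<close> as in the first one: move
  the window by multiples of \<open>t\<close> until it overlaps \<open>[a,a+t-1]\<close>, and rotate.
\<close>

lemma card_cyclic:
  fixes a t :: int
  assumes per: "\<And>u. a + t \<le> u \<Longrightarrow> u \<le> N \<Longrightarrow> u \<in> X \<longleftrightarrow> u - t \<in> X" and "0 < t"
    and "a \<le> x" "x \<le> y" "y \<le> N" "y - x < t"
  defines "z \<equiv> a + (x - a) mod t"
  shows "card (X \<inter> {x..y}) = card (X \<inter> {z..min (z + (y - x)) (a + t - 1)}) +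
    card (X \<inter> {a..z + (y - x) - t})"
proof -
  have per_n: "u \<in> X \<longleftrightarrow> u - int n * t \<in> X" if "a + int n * t \<le> u" "u \<le> N" for n u
    using that
  proof (induction n arbitrary: u)
    case (Suc n)
    have "0 \<le> int n * t" using \<open>0 < t\<close> by simp
    then have "u - t \<in> X \<longleftrightarrow> u - t - int n * t \<in> X" using Suc \<open>0 < t\<close> by (intro Suc.IH) (auto simp: algebra_simps)
    moreover have "u \<in> X \<longleftrightarrow> u - t \<in> X" using Suc.prems \<open>0 \<le> int n * t\<close> by (intro per) (auto simp: algebra_simps)
    ultimately show ?case by (simp add: algebra_simps)
  qed simp
  define n where "n = nat ((x - a) div t)"
  have n: "int n = (x - a) div t" using assms by (simp add: n_def pos_imp_zdiv_nonneg_iff)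
  have x: "x = z + int n * t" unfolding z_def n by (simp add: algebra_simps)
  have z: "a \<le> z" "z < a + t" using assms by (auto simp: z_def)
  have xz: "z = x - int n * t" using x by simp
  have eq: "card (X \<inter> {z..z + (y - x)}) = card (X \<inter> {x..y})"
    using card_translate[of x y X "int n * t"] per_n[of n] z x assms(5) by (simp add: algebra_simps)
  show ?thesis
  proof (cases "z + (y - x) \<le> a + t - 1")
    case True
    then have "{a..z + (y - x) - t} = {}" by auto
    then show ?thesis using eq True by simp
  next
    case False
    have n0: "0 \<le> int n * t" using \<open>0 < t\<close> by simp
    have "card (X \<inter> {z..z + (y - x)}) = card (X \<inter> {z..a + t - 1}) + card (X \<inter> {a + t..z + (y - x)})"
      using card_split[of z "a + t - 1" "z + (y - x)" X] z False by simp
    moreover have "card (X \<inter> {a + t - t..z + (y - x) - t}) = card (X \<inter> {a + t..z + (y - x)})"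
      using n0 x assms(5) by (intro card_translate per) auto
    ultimately show ?thesis using eq False by simp
  qed
qed

lemma card_full_windows:
  fixes a t :: int
  assumes per: "\<And>u. a + t \<le> u \<Longrightarrow> u \<le> N \<Longrightarrow> u \<in> X \<longleftrightarrow> u - t \<in> X" and t: "0 < t"
    and x: "a \<le> x" "x + int n * t - 1 \<le> N"
  shows "card (X \<inter> {x..x + int n * t - 1}) = n * card (X \<inter> {a..a + t - 1})"
  using x
proof (induction n)
  case (Suc n)
  let ?y = "x + int n * t"
  have n0: "0 \<le> int n * t" using t by simp
  have y: "a \<le> ?y" "?y + t - 1 \<le> N" "x + int (Suc n) * t - 1 = ?y + t - 1"
    using Suc.prems n0 by (auto simp: algebra_simps)
  define z where "z = a + (?y - a) mod t"
  have z: "a \<le> z" "z < a + t" using t by (auto simp: z_def)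
  have "card (X \<inter> {?y..?y + t - 1}) =
      card (X \<inter> {z..min (z + (t - 1)) (a + t - 1)}) + card (X \<inter> {a..z + (t - 1) - t})"
    using card_cyclic[of a t N X ?y "?y + t - 1", OF per t] y t by (simp add: z_def)
  also have "min (z + (t - 1)) (a + t - 1) = a + t - 1" using z by simp
  also have "card (X \<inter> {z..a + t - 1}) + card (X \<inter> {a..z + (t - 1) - t}) = card (X \<inter> {a..a + t - 1})"
    using card_split[of a "z - 1" "a + t - 1" X] z by simp
  finally have "card (X \<inter> {?y..?y + t - 1}) = card (X \<inter> {a..a + t - 1})" .
  moreover have "card (X \<inter> {x..?y - 1}) = n * card (X \<inter> {a..a + t - 1})"
    using Suc y t by (intro Suc.IH) auto
  moreover have "card (X \<inter> {x..?y + t - 1}) = card (X \<inter> {x..?y - 1}) + card (X \<inter> {?y..?y + t - 1})"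
    using card_split[of x "?y - 1" "?y + t - 1" X] n0 t by simp
  ultimately show ?case unfolding y(3) by simp
qed simp

lemma transfer_periodic:
  assumes L: "chain d 1 L N"
    and g: "1 \<le> a" "a < c" "c \<le> r" "r \<le> s" "s \<le> N" "length v = d"
  defines "L' \<equiv> result (transfer_periodic_t a c ((r, s), v) L)"
  shows "chain d 1 L' N"
    and "starts L' \<subseteq> starts L \<union> {a, c, a + (r - a) mod (c - a), a + (s + 1 - a) mod (c - a)}"
    and "\<And>X i. i < d \<Longrightarrow> finite X \<Longrightarrow> (\<And>u. c \<le> u \<Longrightarrow> u \<le> N \<Longrightarrow> u \<in> X \<longleftrightarrow> u - (c - a) \<in> X) \<Longrightarrow>
      coord_sum d L' i X = coord_sum d L i X + v ! i * int (card (X \<inter> {r..s}))"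
proof -
  define t where "t = c - a"
  have t: "0 < t" using g by (simp add: t_def)
  define w where "w = s + 1 - r"
  have w: "0 < w" using g by (simp add: w_def)
  define n m where "n = w div t" and "m = w mod t"
  have nm: "w = n * t + m" "0 \<le> m" "m < t" "0 \<le> n"
    using t w by (simp_all add: n_def m_def pos_imp_zdiv_nonneg_iff)
  define z where "z = a + (r - a) mod t"
  have z: "a \<le> z" "z < a + t" using t by (auto simp: z_def)
  define y where "y = z + m - 1"
  define nv where "nv = map (\<lambda>x. n * x) v"
  have nvd: "length nv = d" using g by (simp add: nv_def)
  define L1 where "L1 = add_weight a (c - 1) nv L"
  have act: "a \<le> c - 1" "c - 1 \<le> N" using g by auto
  have L1: "chain d 1 L1 N" unfolding L1_def by (rule chain_add_weight[OF L act(1) nvd])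
  have L': "L' = (if m = 0 then L1 else if y \<le> c - 1 then add_weight z y v L1
      else add_weight a (y - t) v (add_weight z (c - 1) v L1))"
    unfolding L'_def L1_def nv_def y_def z_def m_def n_def w_def t_def by (simp add: result_if Let_def)
  have zc: "z \<le> c - 1" using z t_def by simp
  have L2: "chain d 1 (add_weight z (c - 1) v L1) N" by (rule chain_add_weight[OF L1 zc g(6)])
  show "chain d 1 L' N"
    unfolding L' using L1 L2 nm z g(6) by (auto intro!: chain_add_weight simp: y_def t_def)
  have S1: "starts L1 \<subseteq> starts L \<union> {a, c}"
    using starts_add_weight[of a "c - 1" nv L] by (simp add: L1_def)
  have end_point: "(s + 1 - a) mod t = (if y + 1 < a + t then y + 1 - a else y + 1 - a - t)"
    if "m \<noteq> 0"
  proof -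
    have "s + 1 - a = (r - a) + (n * t + m)" using nm(1) by (simp add: w_def)
    then have "(s + 1 - a) mod t = ((r - a) mod t + m) mod t"
      by (metis add.assoc mod_add_left_eq mod_mult_self1 mult.commute add.commute)
    also have "(r - a) mod t + m = y + 1 - a" by (simp add: y_def z_def)
    finally have *: "(s + 1 - a) mod t = (y + 1 - a) mod t" .
    show ?thesis
    proof (cases "y + 1 < a + t")
      case True
      then show ?thesis using * z nm by (simp add: y_def)
    next
      case False
      have "(y + 1 - a) mod t = (y + 1 - a - t) mod t" by simp
      also have "\<dots> = y + 1 - a - t" using False z nm by (intro mod_pos_pos_trivial) (auto simp: y_def)
      finally show ?thesis using * False by simp
    qed
  qed
  show "starts L' \<subseteq> starts L \<union> {a, c, a + (r - a) mod (c - a), a + (s + 1 - a) mod (c - a)}"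
  proof -
    have "z = a + (r - a) mod (c - a)" by (simp add: z_def t_def)
    moreover have "m \<noteq> 0 \<Longrightarrow> y \<le> c - 1 \<Longrightarrow> y + 1 \<in> {c, a + (s + 1 - a) mod (c - a)}"
      using end_point by (auto simp: t_def split: if_splits)
    moreover have "m \<noteq> 0 \<Longrightarrow> \<not> y \<le> c - 1 \<Longrightarrow> y - t + 1 = a + (s + 1 - a) mod (c - a)"
      using end_point by (auto simp: t_def)
    ultimately show ?thesis
      unfolding L' using S1 starts_add_weight[of z y v L1] starts_add_weight[of z "c - 1" v L1]
        starts_add_weight[of a "y - t" v "add_weight z (c - 1) v L1"]
      by auto
  qed
  fix X i assume i: "i < d" and X: "finite X" and per: "\<And>u. c \<le> u \<Longrightarrow> u \<le> N \<Longrightarrow> u \<in> X \<longleftrightarrow> u - (c - a) \<in> X"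
  have per': "\<And>u. a + t \<le> u \<Longrightarrow> u \<le> N \<Longrightarrow> u \<in> X \<longleftrightarrow> u - t \<in> X" using per by (simp add: t_def)
  have nvi: "nv ! i = n * v ! i" using i g(6) by (simp add: nv_def)
  have c1: "coord_sum d L1 i X = coord_sum d L i X + n * v ! i * int (card (X \<inter> {a..a + t - 1}))"
    unfolding L1_def using coord_sum_add_weight[OF L act(1) g(1) act(2) nvd i X] nvi by (simp add: t_def)
  have nt: "0 \<le> n * t" using nm t by simp
  have full: "int (card (X \<inter> {r..r + n * t - 1})) = n * int (card (X \<inter> {a..a + t - 1}))"
    using card_full_windows[of a t N X r "nat n", OF per' t] nm g w_def by simp
  have split: "card (X \<inter> {r..s}) = card (X \<inter> {r..r + n * t - 1}) + card (X \<inter> {r + n * t..s})"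
    using card_split[of r "r + n * t - 1" s X] nm nt w_def by simp
  have rest: "card (X \<inter> {r + n * t..s}) = card (X \<inter> {z..min y (a + t - 1)}) + card (X \<inter> {a..y - t})"
    if "m \<noteq> 0"
  proof -
    have "(r + n * t - a) mod t = (r - a) mod t"
      by (metis add.commute add_diff_eq mod_mult_self1 mult.commute)
    then have z': "a + (r + n * t - a) mod t = z" by (simp add: z_def)
    have sm: "s - (r + n * t) = m - 1" using nm(1) by (simp add: w_def)
    then have y': "z + (s - (r + n * t)) = y" by (simp add: y_def)
    have "r + n * t \<le> s" "a \<le> r + n * t" "s - (r + n * t) < t"
      using sm nm(2,3) nt that g by linarith+
    from card_cyclic[OF per' t this(2,1) g(5) this(3)] show ?thesis
      unfolding z' y' .
  qed
  show "coord_sum d L' i X = coord_sum d L i X + v ! i * int (card (X \<inter> {r..s}))"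
  proof (cases "m = 0")
    case True
    then have "{r + n * t..s} = {}" using nm(1) by (auto simp: w_def)
    then show ?thesis using True c1 full split by (simp add: L' algebra_simps)
  next
    case m0: False
    show ?thesis
    proof (cases "y \<le> c - 1")
      case True
      then have "{a..y - t} = {}" by (auto simp: t_def)
      moreover have "min y (a + t - 1) = y" using True by (simp add: t_def)
      moreover have "coord_sum d (add_weight z y v L1) i X =
          coord_sum d L1 i X + v ! i * int (card (X \<inter> {z..y}))"
        using m0 nm z g act True by (intro coord_sum_add_weight[OF L1]) (auto simp: y_def i X)
      ultimately show ?thesis using True m0 c1 full split rest by (simp add: L' algebra_simps)
    next
      case False
      then have "min y (a + t - 1) = c - 1" "a + t - 1 = c - 1" by (simp_all add: t_def)
      moreover have "coord_sum d (add_weight z (c - 1) v L1) i X =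
          coord_sum d L1 i X + v ! i * int (card (X \<inter> {z..c - 1}))"
        using zc z g act by (intro coord_sum_add_weight[OF L1]) (auto simp: i X)
      moreover have "coord_sum d (add_weight a (y - t) v (add_weight z (c - 1) v L1)) i X =
          coord_sum d (add_weight z (c - 1) v L1) i X + v ! i * int (card (X \<inter> {a..y - t}))"
        using False z g act nm by (intro coord_sum_add_weight[OF L2]) (auto simp: y_def t_def i X)
      ultimately show ?thesis using False m0 c1 full split rest by (simp add: L' algebra_simps)
    qed
  qed
qed

subsection \<open>The transfer as a whole\<close>

text \<open>
  The sum of the absolute values of a coordinate over all points never increases, which
  bounds the size of all weights that occur by \<open>N D\<close>.
\<close>

definition abs_sum :: "nat \<Rightarrow> weights \<Rightarrow> nat \<Rightarrow> int \<Rightarrow> int" where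
  "abs_sum d L i N = (\<Sum>x\<in>{1..N}. \<bar>weight_at d L x ! i\<bar>)"

lemma abs_sum_nonneg: "0 \<le> abs_sum d L i N"
  by (simp add: abs_sum_def sum_nonneg)

lemma abs_sum_add_weight:
  assumes "chain d 1 L N" "x \<le> y" "1 \<le> x" "y \<le> N" "length v = d" "i < d"
  shows "abs_sum d (add_weight x y v L) i N \<le> abs_sum d L i N + \<bar>v ! i\<bar> * (y - x + 1)"
proof -
  have "\<bar>weight_at d (add_weight x y v L) w ! i\<bar> \<le>
      \<bar>weight_at d L w ! i\<bar> + (if w \<in> {x..y} then \<bar>v ! i\<bar> else 0)" for w
    using assms by (auto simp: weight_at_add_weight[OF assms(1,2)])
  then have "abs_sum d (add_weight x y v L) i N \<le>
      (\<Sum>w\<in>{1..N}. \<bar>weight_at d L w ! i\<bar> + (if w \<in> {x..y} then \<bar>v ! i\<bar> else 0))"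
    unfolding abs_sum_def by (intro sum_mono)
  also have "\<dots> = abs_sum d L i N + (\<Sum>w\<in>{1..N} \<inter> {x..y}. \<bar>v ! i\<bar>)"
    unfolding abs_sum_def sum.distrib by (subst sum.inter_restrict[symmetric]) simp_all
  also have "{1..N} \<inter> {x..y} = {x..y}" using assms by auto
  finally show ?thesis using assms by (simp add: mult.commute)
qed

lemma abs_sum_transfer_periodic:
  assumes L: "chain d 1 L N"
    and g: "1 \<le> a" "a < c" "c \<le> r" "r \<le> s" "s \<le> N" "length v = d" "i < d"
  shows "abs_sum d (result (transfer_periodic_t a c ((r, s), v) L)) i N
      \<le> abs_sum d L i N + \<bar>v ! i\<bar> * (s - r + 1)"
    and "c \<le> x \<Longrightarrow> weight_at d (result (transfer_periodic_t a c ((r, s), v) L)) x = weight_at d L x"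
proof -
  define t where "t = c - a"
  have t: "0 < t" using g by (simp add: t_def)
  define w where "w = s + 1 - r"
  have w: "0 < w" using g by (simp add: w_def)
  define n m where "n = w div t" and "m = w mod t"
  have nm: "w = n * t + m" "0 \<le> m" "m < t" "0 \<le> n"
    using t w by (simp_all add: n_def m_def pos_imp_zdiv_nonneg_iff)
  define z where "z = a + (r - a) mod t"
  have z: "a \<le> z" "z < a + t" using t by (auto simp: z_def)
  define y where "y = z + m - 1"
  define nv where "nv = map (\<lambda>x. n * x) v"
  have nvd: "length nv = d" using g by (simp add: nv_def)
  define L1 where "L1 = add_weight a (c - 1) nv L"
  have act: "a \<le> c - 1" "c - 1 \<le> N" using g by auto
  have L1: "chain d 1 L1 N" unfolding L1_def by (rule chain_add_weight[OF L act(1) nvd])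
  let ?L' = "result (transfer_periodic_t a c ((r, s), v) L)"
  have L': "?L' = (if m = 0 then L1 else if y \<le> c - 1 then add_weight z y v L1
      else add_weight a (y - t) v (add_weight z (c - 1) v L1))"
    unfolding L1_def nv_def y_def z_def m_def n_def w_def t_def by (simp add: result_if Let_def)
  have zc: "z \<le> c - 1" using z t_def by simp
  have L2: "chain d 1 (add_weight z (c - 1) v L1) N" by (rule chain_add_weight[OF L1 zc g(6)])
  have yt: "y - t < c" using z nm by (simp add: y_def t_def)
  show "weight_at d ?L' x = weight_at d L x" if "c \<le> x"
  proof -
    have "weight_at d L1 x = weight_at d L x"
      unfolding L1_def using that by (simp add: weight_at_add_weight[OF L act(1)])
    moreover have "weight_at d (add_weight z (c - 1) v L1) x = weight_at d L1 x"
      using that by (simp add: weight_at_add_weight[OF L1 zc])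
    moreover have "weight_at d (add_weight z y v L1) x = weight_at d L1 x" if "m \<noteq> 0" "y \<le> c - 1"
      using that \<open>c \<le> x\<close> nm by (subst weight_at_add_weight[OF L1]) (auto simp: y_def)
    moreover have "weight_at d (add_weight a (y - t) v (add_weight z (c - 1) v L1)) x =
        weight_at d (add_weight z (c - 1) v L1) x" if "\<not> y \<le> c - 1"
      using that \<open>c \<le> x\<close> yt by (subst weight_at_add_weight[OF L2]) (auto simp: t_def)
    ultimately show ?thesis unfolding L' by presburger
  qed
  have "\<bar>nv ! i\<bar> * (c - 1 - a + 1) = \<bar>v ! i\<bar> * (n * t)"
    using g(6,7) nm(4) by (simp add: nv_def t_def abs_mult)
  then have 1: "abs_sum d L1 i N \<le> abs_sum d L i N + \<bar>v ! i\<bar> * (n * t)"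
    using abs_sum_add_weight[OF L act(1) g(1) act(2) nvd g(7)] by (simp add: L1_def)
  have wm: "\<bar>v ! i\<bar> * (s - r + 1) = \<bar>v ! i\<bar> * (n * t) + \<bar>v ! i\<bar> * m"
    using nm(1) by (simp add: w_def algebra_simps)
  show "abs_sum d ?L' i N \<le> abs_sum d L i N + \<bar>v ! i\<bar> * (s - r + 1)"
  proof (cases "m = 0")
    case True
    then show ?thesis using 1 unfolding L' wm by simp
  next
    case m0: False
    show ?thesis
    proof (cases "y \<le> c - 1")
      case True
      then have "abs_sum d (add_weight z y v L1) i N \<le> abs_sum d L1 i N + \<bar>v ! i\<bar> * (y - z + 1)"
        using m0 nm z g act by (intro abs_sum_add_weight[OF L1]) (auto simp: y_def)
      then show ?thesis using True m0 1 wm unfolding L' by (simp add: y_def)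
    next
      case False
      have "abs_sum d (add_weight z (c - 1) v L1) i N \<le> abs_sum d L1 i N + \<bar>v ! i\<bar> * (c - 1 - z + 1)"
        using zc z g act by (intro abs_sum_add_weight[OF L1]) auto
      moreover have "abs_sum d (add_weight a (y - t) v (add_weight z (c - 1) v L1)) i N
          \<le> abs_sum d (add_weight z (c - 1) v L1) i N + \<bar>v ! i\<bar> * (y - t - a + 1)"
        using False z g act nm by (intro abs_sum_add_weight[OF L2]) (auto simp: y_def t_def)
      moreover have "\<bar>v ! i\<bar> * (c - 1 - z + 1) + \<bar>v ! i\<bar> * (y - t - a + 1) = \<bar>v ! i\<bar> * m"
        by (simp add: y_def t_def algebra_simps)
      ultimately show ?thesis using False m0 1 wm unfolding L' by simp
    qed
  qed
qed

text \<open>The image of a breakpoint under a transfer by a pairing.\<close>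

fun push :: "pairing \<Rightarrow> int \<Rightarrow> int" where
  "push (Pairing a b c d p) u =
    (if \<not> p then a + d + 1 - u else if b < c then u - (c - a) else a + (u - a) mod (c - a))"

lemma transfer_entry:
  assumes L: "chain d 1 L N" and g: "normal N g" "ran_hi g = N"
    and e: "ran_lo g \<le> r" "r \<le> s" "s \<le> N" "length v = d"
  defines "L' \<equiv> result (transfer_entry_t g ((r, s), v) L)"
  shows "chain d 1 L' N"
    and "starts L' \<subseteq> starts L \<union> {dom_lo g, ran_lo g} \<union> {push g r, push g (s + 1)}"
    and "\<And>x. ran_lo g \<le> x \<Longrightarrow> weight_at d L' x = weight_at d L x"
    and "\<And>X i. i < d \<Longrightarrow> finite X \<Longrightarrow> (\<And>x y. (x, y) \<in> edge g \<Longrightarrow> x \<in> X \<longleftrightarrow> y \<in> X) \<Longrightarrow>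
      coord_sum d L' i X = coord_sum d L i X + v ! i * int (card (X \<inter> {r..s}))"
    and "\<And>i. i < d \<Longrightarrow> abs_sum d L' i N \<le> abs_sum d L i N + \<bar>v ! i\<bar> * (s - r + 1)"
proof -
  obtain a b c p where G: "g = Pairing a b c N p" using g by (cases g) auto
  have gb: "1 \<le> a" "a \<le> b" "a < c" "N - c = b - a" "\<not> p \<Longrightarrow> b < c" "c \<le> r"
    using g e unfolding G by auto
  consider (shift) "p" "b < c" | (per) "p" "c \<le> b" | (rev) "\<not> p" by linarith
  then have "chain d 1 L' N \<and>
    starts L' \<subseteq> starts L \<union> {a, c} \<union> {push g r, push g (s + 1)} \<and>
    (\<forall>x. c \<le> x \<longrightarrow> weight_at d L' x = weight_at d L x) \<and>
    (\<forall>X i. i < d \<longrightarrow> finite X \<longrightarrow> (\<forall>x y. (x, y) \<in> edge g \<longrightarrow> (x \<in> X \<longleftrightarrow> y \<in> X)) \<longrightarrow>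
      coord_sum d L' i X = coord_sum d L i X + v ! i * int (card (X \<inter> {r..s}))) \<and>
    (\<forall>i. i < d \<longrightarrow> abs_sum d L' i N \<le> abs_sum d L i N + \<bar>v ! i\<bar> * (s - r + 1))"
  proof cases
    case shift
    define t where "t = c - a"
    have L': "L' = add_weight (r - t) (s - t) v L"
      unfolding L'_def G t_def using shift by simp
    have xy: "r - t \<le> s - t" "1 \<le> r - t" "s - t \<le> b" "s - t \<le> N" using gb e t_def by auto
    have "coord_sum d L' i X = coord_sum d L i X + v ! i * int (card (X \<inter> {r..s}))"
      if "i < d" "finite X" "\<forall>x y. (x, y) \<in> edge g \<longrightarrow> (x \<in> X \<longleftrightarrow> y \<in> X)" for X i
    proof -
      have "u \<in> X \<longleftrightarrow> u - t \<in> X" if "r \<le> u" "u \<le> s" for u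
      proof -
        have "(u - t, u) \<in> edge g"
          using that shift gb e by (auto simp: G edge_Pairing_iff t_def)
        then show ?thesis using \<open>\<forall>x y. (x, y) \<in> edge g \<longrightarrow> (x \<in> X \<longleftrightarrow> y \<in> X)\<close> by blast
      qed
      then have "card (X \<inter> {r - t..s - t}) = card (X \<inter> {r..s})" by (rule card_translate)
      then show ?thesis
        unfolding L' using coord_sum_add_weight[OF L xy(1,2,4) e(4) that(1,2)] by simp
    qed
    moreover have "chain d 1 L' N" unfolding L' by (rule chain_add_weight[OF L xy(1) e(4)])
    moreover have "starts L' \<subseteq> starts L \<union> {a, c} \<union> {push g r, push g (s + 1)}"
    proof -
      have "push g r = r - t" "push g (s + 1) = s - t + 1" using shift by (simp_all add: G t_def)
      then show ?thesis using starts_add_weight[of "r - t" "s - t" v L] unfolding L' by auto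
    qed
    moreover have "\<forall>x. c \<le> x \<longrightarrow> weight_at d L' x = weight_at d L x"
      unfolding L' weight_at_add_weight[OF L xy(1)] using xy shift by auto
    moreover have "\<forall>i. i < d \<longrightarrow> abs_sum d L' i N \<le> abs_sum d L i N + \<bar>v ! i\<bar> * (s - r + 1)"
      unfolding L' using abs_sum_add_weight[OF L xy(1,2,4) e(4)] by simp
    ultimately show ?thesis by blast
  next
    case per
    have L': "L' = result (transfer_periodic_t a c ((r, s), v) L)"
      unfolding L'_def G using per by (simp add: result_if del: transfer_periodic_t.simps)
    note tp = transfer_periodic[OF L gb(1,3,6) e(2-4), folded L']
    note ap = abs_sum_transfer_periodic[OF L gb(1,3,6) e(2-4), folded L']
    have "coord_sum d L' i X = coord_sum d L i X + v ! i * int (card (X \<inter> {r..s}))"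
      if "i < d" "finite X" "\<forall>x y. (x, y) \<in> edge g \<longrightarrow> (x \<in> X \<longleftrightarrow> y \<in> X)" for X i
    proof -
      have "u \<in> X \<longleftrightarrow> u - (c - a) \<in> X" if "c \<le> u" "u \<le> N" for u
      proof -
        have "(u - (c - a), u) \<in> edge g"
          using that per gb e by (auto simp: G edge_Pairing_iff)
        then show ?thesis using \<open>\<forall>x y. (x, y) \<in> edge g \<longrightarrow> (x \<in> X \<longleftrightarrow> y \<in> X)\<close> by blast
      qed
      then show ?thesis by (rule tp(3)[OF that(1,2)])
    qed
    moreover have "weight_at d L' x = weight_at d L x" if "c \<le> x" for x
    proof (cases "d = 0")
      case True
      then show ?thesis using length_weight_at[OF tp(1), of x] length_weight_at[OF L, of x] by simp
    next
      case False
      then show ?thesis using ap(2)[of 0 x] that by simp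
    qed
    moreover have "push g r = a + (r - a) mod (c - a)" "push g (s + 1) = a + (s + 1 - a) mod (c - a)"
      using per by (simp_all add: G)
    ultimately show ?thesis using tp(1,2) ap(1) by auto
  next
    case rev
    define \<sigma> where "\<sigma> = a + N"
    have L': "L' = add_weight (\<sigma> - s) (\<sigma> - r) v L"
      unfolding L'_def G \<sigma>_def using rev by simp
    have xy: "\<sigma> - s \<le> \<sigma> - r" "1 \<le> \<sigma> - s" "\<sigma> - r \<le> b" "\<sigma> - r \<le> N" using gb e \<sigma>_def by auto
    have "coord_sum d L' i X = coord_sum d L i X + v ! i * int (card (X \<inter> {r..s}))"
      if "i < d" "finite X" "\<forall>x y. (x, y) \<in> edge g \<longrightarrow> (x \<in> X \<longleftrightarrow> y \<in> X)" for X i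
    proof -
      have "u \<in> X \<longleftrightarrow> \<sigma> - u \<in> X" if "r \<le> u" "u \<le> s" for u
      proof -
        have "(\<sigma> - u, u) \<in> edge g"
          using that rev gb e by (auto simp: G edge_Pairing_iff \<sigma>_def)
        then show ?thesis using \<open>\<forall>x y. (x, y) \<in> edge g \<longrightarrow> (x \<in> X \<longleftrightarrow> y \<in> X)\<close> by blast
      qed
      then have "card (X \<inter> {\<sigma> - s..\<sigma> - r}) = card (X \<inter> {r..s})" by (rule card_reflect)
      then show ?thesis
        unfolding L' using coord_sum_add_weight[OF L xy(1,2,4) e(4) that(1,2)] by simp
    qed
    moreover have "chain d 1 L' N" unfolding L' by (rule chain_add_weight[OF L xy(1) e(4)])
    moreover have "starts L' \<subseteq> starts L \<union> {a, c} \<union> {push g r, push g (s + 1)}"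
    proof -
      have "push g r = \<sigma> - r + 1" "push g (s + 1) = \<sigma> - s" using rev by (simp_all add: G \<sigma>_def)
      then show ?thesis using starts_add_weight[of "\<sigma> - s" "\<sigma> - r" v L] unfolding L' by auto
    qed
    moreover have "\<forall>x. c \<le> x \<longrightarrow> weight_at d L' x = weight_at d L x"
      unfolding L' weight_at_add_weight[OF L xy(1)] using xy gb(5)[OF rev] by auto
    moreover have "\<forall>i. i < d \<longrightarrow> abs_sum d L' i N \<le> abs_sum d L i N + \<bar>v ! i\<bar> * (s - r + 1)"
      unfolding L' using abs_sum_add_weight[OF L xy(1,2,4) e(4)] by simp
    ultimately show ?thesis by blast
  qed
  then show "chain d 1 L' N"
    and "starts L' \<subseteq> starts L \<union> {dom_lo g, ran_lo g} \<union> {push g r, push g (s + 1)}"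
    and "\<And>x. ran_lo g \<le> x \<Longrightarrow> weight_at d L' x = weight_at d L x"
    and "\<And>X i. i < d \<Longrightarrow> finite X \<Longrightarrow> (\<And>x y. (x, y) \<in> edge g \<Longrightarrow> x \<in> X \<longleftrightarrow> y \<in> X) \<Longrightarrow>
      coord_sum d L' i X = coord_sum d L i X + v ! i * int (card (X \<inter> {r..s}))"
    and "\<And>i. i < d \<Longrightarrow> abs_sum d L' i N \<le> abs_sum d L i N + \<bar>v ! i\<bar> * (s - r + 1)"
    by (simp_all add: G)
qed

lemma transfer_entries:
  assumes g: "normal N g" "ran_hi g = N"
  shows "chain d 1 L N \<Longrightarrow> chain d l es N \<Longrightarrow> ran_lo g \<le> l \<Longrightarrow>
    L' = result (transfer_entries_t g es L) \<Longrightarrow>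
    chain d 1 L' N \<and>
    starts L' \<subseteq> starts L \<union> {dom_lo g, ran_lo g} \<union> push g ` (starts es \<union> {N + 1}) \<and>
    (\<forall>x. ran_lo g \<le> x \<longrightarrow> weight_at d L' x = weight_at d L x) \<and>
    (\<forall>X i. i < d \<longrightarrow> finite X \<longrightarrow> (\<forall>x y. (x, y) \<in> edge g \<longrightarrow> (x \<in> X \<longleftrightarrow> y \<in> X)) \<longrightarrow>
      coord_sum d L' i X = coord_sum d L i X + (\<Sum>((r, s), v)\<leftarrow>es. v ! i * int (card (X \<inter> {r..s})))) \<and>
    (\<forall>i. i < d \<longrightarrow> abs_sum d L' i N \<le> abs_sum d L i N + (\<Sum>((r, s), v)\<leftarrow>es. \<bar>v ! i\<bar> * (s - r + 1)))"
proof (induction es arbitrary: L l L')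
  case Nil
  then show ?case by auto
next
  case (Cons e es)
  obtain r s v where e: "e = ((r, s), v)" by (metis surj_pair)
  have ch: "r = l" "r \<le> s" "length v = d" "chain d (s + 1) es N"
    using Cons.prems(2) by (auto simp: e)
  have sN: "s \<le> N" using chain_le[OF ch(4)] by simp
  define L1 where "L1 = result (transfer_entry_t g ((r, s), v) L)"
  have cr: "ran_lo g \<le> r" "ran_lo g \<le> s + 1" using Cons.prems(3) ch by auto
  note te = transfer_entry[OF Cons.prems(1) g cr(1) ch(2) sN ch(3), folded L1_def]
  have L': "L' = result (transfer_entries_t g es L1)" using Cons.prems(4) by (simp add: e L1_def)
  note IH = Cons.IH[OF te(1) ch(4) cr(2) L']
  have next_start: "s + 1 \<in> starts es \<union> {N + 1}" using ch(4) by (cases es) auto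
  have S: "starts L' \<subseteq> starts L \<union> {dom_lo g, ran_lo g} \<union> push g ` (starts (e # es) \<union> {N + 1})"
  proof -
    have "push g (s + 1) \<in> push g ` (starts es \<union> {N + 1})" using next_start by (rule imageI)
    moreover have "push g ` (starts es \<union> {N + 1}) \<subseteq> push g ` (starts (e # es) \<union> {N + 1})"
      "push g r \<in> push g ` (starts (e # es) \<union> {N + 1})"
      unfolding e by auto
    ultimately show ?thesis using IH te(2) by blast
  qed
  have C: "coord_sum d L' i X = coord_sum d L i X +
      (\<Sum>((r, s), v)\<leftarrow>e # es. v ! i * int (card (X \<inter> {r..s})))"
    if "i < d" "finite X" "\<forall>x y. (x, y) \<in> edge g \<longrightarrow> (x \<in> X \<longleftrightarrow> y \<in> X)" for X i
  proof -
    have "coord_sum d L' i X = coord_sum d L1 i X +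
        (\<Sum>((r, s), v)\<leftarrow>es. v ! i * int (card (X \<inter> {r..s})))"
      using IH that by blast
    then show ?thesis using te(4)[OF that(1,2)] that(3) by (simp add: e)
  qed
  have A: "abs_sum d L' i N \<le> abs_sum d L i N + (\<Sum>((r, s), v)\<leftarrow>e # es. \<bar>v ! i\<bar> * (s - r + 1))"
    if "i < d" for i
  proof -
    have "abs_sum d L' i N \<le> abs_sum d L1 i N + (\<Sum>((r, s), v)\<leftarrow>es. \<bar>v ! i\<bar> * (s - r + 1))"
      using IH that by blast
    then show ?thesis using te(5)[OF that] by (simp add: e)
  qed
  have W: "weight_at d L' x = weight_at d L x" if "ran_lo g \<le> x" for x
    using IH te(3)[OF that] that by simp
  show ?case
  proof (intro conjI allI impI)
    show "chain d 1 L' N" using IH by (rule conjunct1)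
  qed (rule S W C A; assumption)+
qed

lemma abs_sum_zero_weights:
  assumes L: "chain d 1 L N" and cN: "1 \<le> c" "c \<le> N" and i: "i < d"
  shows "abs_sum d (zero_weights N c N L) i N +
    (\<Sum>((r, s), v)\<leftarrow>restrict_weights c N L. \<bar>v ! i\<bar> * (s - r + 1)) = abs_sum d L i N"
proof -
  define es where "es = restrict_weights c N L"
  define L0 where "L0 = zero_weights N c N L"
  note z = zero_weights[OF L cN order_refl, folded L0_def]
  have es: "chain d c es N" unfolding es_def using L cN by (intro chain_restrict) auto
  have zero: "weight_at d L0 x = replicate d 0" if "c \<le> x" for x
    using that z(2)[of x] weight_at_outside[OF L, of x] by auto
  have esL: "weight_at d es x = weight_at d L x" if "x \<in> {c..N}" for x
    using that by (simp add: es_def weight_at_restrict)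
  have un: "{1..N} = {1..c - 1} \<union> {c..N}" using cN by auto
  have "(\<Sum>((r, s), v)\<leftarrow>es. \<bar>v ! i\<bar> * (s - r + 1)) = (\<Sum>((r, s), v)\<leftarrow>es. \<Sum>x\<in>{r..s}. \<bar>v ! i\<bar>)"
  proof (intro arg_cong[of _ _ sum_list] map_cong refl)
    fix e assume "e \<in> set es"
    moreover obtain r s v where e: "e = ((r, s), v)" by (metis surj_pair)
    ultimately have "r \<le> s" using chain_entries[OF es, of r s v] by simp
    then show "(case e of (x, xa) \<Rightarrow> (case x of (r, s) \<Rightarrow> \<lambda>v. \<bar>v ! i\<bar> * (s - r + 1)) xa) =
      (case e of (x, xa) \<Rightarrow> (case x of (r, s) \<Rightarrow> \<lambda>v. \<Sum>x\<in>{r..s}. \<bar>v ! i\<bar>) xa)"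
      by (simp add: e mult.commute)
  qed
  also have "\<dots> = (\<Sum>x\<in>{c..N}. \<bar>weight_at d es x ! i\<bar>)"
    by (rule chain_sum[OF es])
  also have "\<dots> = (\<Sum>x\<in>{c..N}. \<bar>weight_at d L x ! i\<bar>)"
    by (intro sum.cong) (auto simp: esL)
  finally have eq: "(\<Sum>((r, s), v)\<leftarrow>es. \<bar>v ! i\<bar> * (s - r + 1)) =
    (\<Sum>x\<in>{c..N}. \<bar>weight_at d L x ! i\<bar>)" .
  moreover have "abs_sum d L0 i N = (\<Sum>x\<in>{1..c - 1}. \<bar>weight_at d L x ! i\<bar>)"
  proof -
    have "abs_sum d L0 i N = (\<Sum>x\<in>{1..c - 1}. \<bar>weight_at d L0 x ! i\<bar>) + (\<Sum>x\<in>{c..N}. \<bar>weight_at d L0 x ! i\<bar>)"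
      unfolding abs_sum_def un by (rule sum.union_disjoint) auto
    also have "(\<Sum>x\<in>{c..N}. \<bar>weight_at d L0 x ! i\<bar>) = 0"
      by (intro sum.neutral) (simp add: zero i)
    also have "(\<Sum>x\<in>{1..c - 1}. \<bar>weight_at d L0 x ! i\<bar>) = (\<Sum>x\<in>{1..c - 1}. \<bar>weight_at d L x ! i\<bar>)"
      by (intro sum.cong) (auto simp: z(2))
    finally show ?thesis by simp
  qed
  moreover have "(\<Sum>x\<in>{1..c - 1}. \<bar>weight_at d L x ! i\<bar>) + (\<Sum>x\<in>{c..N}. \<bar>weight_at d L x ! i\<bar>) = abs_sum d L i N"
    unfolding abs_sum_def un by (rule sum.union_disjoint[symmetric]) auto
  ultimately show ?thesis by (simp add: es_def L0_def)
qed

lemma transfer: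
  assumes L: "chain d 1 L N" and g: "normal N g" "ran_hi g = N"
  defines "L' \<equiv> result (transfer_t N g L)"
  shows "chain d 1 L' N" and "length L' \<le> length L + 6"
    and "\<And>x. ran_lo g \<le> x \<Longrightarrow> weight_at d L' x = replicate d 0"
    and "\<And>X i. i < d \<Longrightarrow> X \<subseteq> {1..N} \<Longrightarrow> (\<And>x y. (x, y) \<in> edge g \<Longrightarrow> x \<in> X \<longleftrightarrow> y \<in> X) \<Longrightarrow>
      coord_sum d L' i X = coord_sum d L i X"
    and "\<And>i. i < d \<Longrightarrow> abs_sum d L' i N \<le> abs_sum d L i N"
proof -
  obtain a b c p where G: "g = Pairing a b c N p" using g by (cases g) auto
  have gb: "1 \<le> a" "a \<le> b" "a < c" "N - c = b - a" "\<not> p \<Longrightarrow> b < c"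
    using g unfolding G by auto
  have cN: "1 \<le> c" "c \<le> N" using gb by auto
  have tg: "trim g = g" using g by (auto simp: G trim_Pairing)
  define es where "es = restrict_weights c N L"
  define L0 where "L0 = zero_weights N c N L"
  note z = zero_weights[OF L cN order_refl, folded L0_def]
  have es: "chain d c es N" unfolding es_def using L cN by (intro chain_restrict) auto
  have L': "L' = result (transfer_entries_t g es L0)"
    unfolding L'_def transfer_t_def es_def L0_def by (simp add: tg) (simp add: G)
  note te = transfer_entries[OF g z(1) es _ L']
  have rl: "ran_lo g = c" "dom_lo g = a" by (simp_all add: G)
  note te = te[unfolded rl, OF order_refl]
  show c': "chain d 1 L' N" using te by blast
  have zero: "weight_at d L0 x = replicate d 0" if "c \<le> x" for x
    using that z(2)[of x] weight_at_outside[OF L, of x] by auto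
  show "weight_at d L' x = replicate d 0" if "ran_lo g \<le> x" for x
    using te zero[of x] that by (simp add: rl)
  have esL: "weight_at d es x = weight_at d L x" if "x \<in> {c..N}" for x
    using that by (simp add: es_def weight_at_restrict)
  have un: "{1..N} = {1..c - 1} \<union> {c..N}" using cN by auto
  show "coord_sum d L' i X = coord_sum d L i X"
    if i: "i < d" and X: "X \<subseteq> {1..N}" and cl: "\<And>x y. (x, y) \<in> edge g \<Longrightarrow> x \<in> X \<longleftrightarrow> y \<in> X" for X i
  proof -
    have fin: "finite X" using X by (rule finite_subset) simp
    have conv: "(\<Sum>x\<in>{l..u}. if x \<in> X then f x else 0) = sum f (X \<inter> {l..u})"
      for f :: "int \<Rightarrow> int" and l u
      by (subst sum.inter_restrict[symmetric]) (simp_all add: Int_commute)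
    have "(\<Sum>((r, s), v)\<leftarrow>es. v ! i * int (card (X \<inter> {r..s}))) =
        (\<Sum>((r, s), v)\<leftarrow>es. \<Sum>x\<in>{r..s}. if x \<in> X then v ! i else 0)"
      by (intro arg_cong[of _ _ sum_list] map_cong) (auto simp: conv mult.commute)
    also have "\<dots> = (\<Sum>x\<in>{c..N}. if x \<in> X then weight_at d es x ! i else 0)"
      by (rule chain_sum[OF es])
    also have "\<dots> = (\<Sum>x\<in>X \<inter> {c..N}. weight_at d es x ! i)" by (rule conv)
    also have "\<dots> = (\<Sum>x\<in>X \<inter> {c..N}. weight_at d L x ! i)"
      by (intro sum.cong) (auto simp: esL)
    finally have "coord_sum d L' i X = coord_sum d L0 i X + (\<Sum>x\<in>X \<inter> {c..N}. weight_at d L x ! i)"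
      using te i fin cl by simp
    also have "coord_sum d L0 i X = (\<Sum>x\<in>X \<inter> {1..c - 1}. weight_at d L x ! i)"
    proof -
      have X': "X = (X \<inter> {1..c - 1}) \<union> (X \<inter> {c..N})" using X un by auto
      have "coord_sum d L0 i X = (\<Sum>x\<in>X \<inter> {1..c - 1}. weight_at d L0 x ! i) +
          (\<Sum>x\<in>X \<inter> {c..N}. weight_at d L0 x ! i)"
        unfolding coord_sum_def by (subst X', rule sum.union_disjoint) (use fin in auto)
      also have "(\<Sum>x\<in>X \<inter> {c..N}. weight_at d L0 x ! i) = 0"
        by (intro sum.neutral) (simp add: zero i)
      also have "(\<Sum>x\<in>X \<inter> {1..c - 1}. weight_at d L0 x ! i) = (\<Sum>x\<in>X \<inter> {1..c - 1}. weight_at d L x ! i)"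
        by (intro sum.cong) (auto simp: z(2))
      finally show ?thesis by simp
    qed
    also have "(\<Sum>x\<in>X \<inter> {1..c - 1}. weight_at d L x ! i) + (\<Sum>x\<in>X \<inter> {c..N}. weight_at d L x ! i) =
        coord_sum d L i X"
    proof -
      have X': "X = (X \<inter> {1..c - 1}) \<union> (X \<inter> {c..N})" using X un by auto
      show ?thesis
        unfolding coord_sum_def by (subst (3) X', rule sum.union_disjoint[symmetric]) (use fin in auto)
    qed
    finally show ?thesis .
  qed
  show "abs_sum d L' i N \<le> abs_sum d L i N" if i: "i < d" for i
  proof -
    have "abs_sum d L' i N \<le> abs_sum d L0 i N + (\<Sum>((r, s), v)\<leftarrow>es. \<bar>v ! i\<bar> * (s - r + 1))"
      using te i by blast
    then show ?thesis using abs_sum_zero_weights[OF L cN i, folded es_def L0_def] by simp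
  qed
  show "length L' \<le> length L + 6"
  proof -
    let ?S = "starts L"
    have es_starts: "starts es \<subseteq> insert c (?S \<inter> {c..N})"
      unfolding es_def by (rule starts_restrict)
    have "starts L' \<subseteq> (?S - {c..N}) \<union> ({1, c, N + 1, a} \<union> push g ` (insert c (?S \<inter> {c..N}) \<union> {N + 1}))"
      using te z(3) es_starts by blast
    then have "card (starts L') \<le> card ((?S - {c..N}) \<union> ({1, c, N + 1, a} \<union> push g ` (insert c (?S \<inter> {c..N}) \<union> {N + 1})))"
      by (intro card_mono) auto
    also have "\<dots> \<le> card (?S - {c..N}) + (card {1, c, N + 1, a} + card (push g ` (insert c (?S \<inter> {c..N}) \<union> {N + 1})))"
      by (intro order_trans[OF card_Un_le] add_mono order_refl card_Un_le)
    also have "card {1, c, N + 1, a} \<le> 4"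
      by (intro order_trans[OF card_insert_le_m1] card.empty) (auto simp: card_insert_if)
    also have "card (push g ` (insert c (?S \<inter> {c..N}) \<union> {N + 1})) \<le> card (insert c (?S \<inter> {c..N}) \<union> {N + 1})"
      by (intro card_image_le) auto
    also have "card (insert c (?S \<inter> {c..N}) \<union> {N + 1}) \<le> card (?S \<inter> {c..N}) + 2"
      by (auto simp: card_insert_if)
    also have "card (?S - {c..N}) + (4 + (card (?S \<inter> {c..N}) + 2)) = card ?S + 6"
      using card_Int_Diff[of ?S "{c..N}"] by simp
    finally show ?thesis using chain_starts[OF L] chain_starts[OF c'] by auto
  qed
qed

text \<open>
  By the retraction along \<open>g\<close>, each orbit of the longer interval meets \<open>[1,M]\<close> in exactly one orbit of
  the shorter one. The transfer leaves its weight unchanged and moves all of it to the left of the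
  range of \<open>g\<close>.
\<close>

lemma truncation_orbit_weights:
  assumes L: "chain d 1 L N" and g: "normal N g" "ran_hi g = N"
    and M: "ran_lo g \<le> M + 1" "M \<le> N"
    and hs: "\<And>h u v. h \<in> set hs \<Longrightarrow> (u, v) \<in> edge h \<Longrightarrow> u \<le> M \<and> v \<le> M"
  defines "L' \<equiv> restrict_weights 1 M (result (transfer_t N g L))"
  shows "chain d 1 L' M" and "length L' \<le> length L + 7"
    and "orbit_weights M (with_truncated N M g hs) d L' = orbit_weights N (g # hs) d L"
    and "\<And>i. i < d \<Longrightarrow> abs_sum d L' i M \<le> abs_sum d L i N"
proof -
  define L1 where "L1 = result (transfer_t N g L)"
  note tr = transfer[OF L g, folded L1_def]
  have M0: "1 \<le> M" using g M by (cases g) auto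
  show c': "chain d 1 L' M" unfolding L'_def using tr(1)[unfolded L1_def] M M0 by (intro chain_restrict) auto
  have L'L1: "weight_at d L' x = weight_at d L1 x" if "x \<in> {1..M}" for x
    using that by (simp add: L'_def L1_def weight_at_restrict)
  have zero: "weight_at d L1 x = replicate d 0" if "x > M" for x
    using tr(3)[of x] that M by simp
  show "orbit_weights M (with_truncated N M g hs) d L' = orbit_weights N (g # hs) d L"
  proof (rule orbit_weights_restrict[OF M(2)])
    fix X assume X: "X \<in> orbits N (g # hs)"
    then have XN: "X \<subseteq> {1..N}" by (rule orbits_subset)
    then have fin: "finite X" by (rule finite_subset) simp
    have "coord_sum d L' i (X \<inter> {1..M}) = coord_sum d L i X" if i: "i < d" for i
    proof -
      have "coord_sum d L' i (X \<inter> {1..M}) = coord_sum d L1 i (X \<inter> {1..M})"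
        unfolding coord_sum_def by (intro sum.cong) (auto simp: L'L1)
      also have "\<dots> = coord_sum d L1 i X"
        unfolding coord_sum_def
      proof (intro sum.mono_neutral_left ballI)
        fix x assume "x \<in> X - X \<inter> {1..M}"
        then have "x > M" using XN by auto
        then show "weight_at d L1 x ! i = 0" using i by (simp add: zero)
      qed (use fin in auto)
      also have "\<dots> = coord_sum d L i X"
      proof (rule tr(4)[OF i XN])
        fix x y assume e: "(x, y) \<in> edge g"
        obtain a b c e p where G: "g = Pairing a b c e p" by (cases g)
        have "x \<in> {1..N} \<and> y \<in> {1..N}"
          using e g(1) unfolding G edge_Pairing_iff by (cases p) auto
        then have "x \<in> {1..N}" "y \<in> {1..N}" by blast+
        moreover have "(x, y) \<in> conn (g # hs)" using e edge_conn[of g "g # hs"] by auto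
        ultimately show "x \<in> X \<longleftrightarrow> y \<in> X" using orbits_closed[OF X] by blast
      qed
      finally show ?thesis .
    qed
    then show "orbit_weight d L' (X \<inter> {1..M}) = orbit_weight d L X"
      by (simp add: orbit_weight_coord_sum)
  qed (use truncation[OF g M hs] in auto)
  show "abs_sum d L' i M \<le> abs_sum d L i N" if "i < d" for i
  proof -
    have "abs_sum d L' i M = (\<Sum>x\<in>{1..M}. \<bar>weight_at d L1 x ! i\<bar>)"
      unfolding abs_sum_def by (intro sum.cong) (auto simp: L'L1)
    also have "\<dots> \<le> abs_sum d L1 i N"
      unfolding abs_sum_def using M by (intro sum_mono2) auto
    finally show ?thesis using tr(5)[OF that] by simp
  qed
  have "card (starts L') \<le> card (insert 1 (starts L1))"
    using starts_restrict[of 1 M L1] by (intro card_mono) (auto simp: L'_def L1_def)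
  also have "\<dots> \<le> card (starts L1) + 1" by (simp add: card_insert_if)
  finally show "length L' \<le> length L + 7"
    using chain_starts[OF c'] chain_starts[OF tr(1)] tr(2) by simp
qed

section \<open>Contraction of static intervals\<close>

definition cov :: "pairing list \<Rightarrow> int set" where
  "cov gs = (\<Union>g\<in>set gs. {dom_lo g..dom_hi g} \<union> {ran_lo g..ran_hi g})"

lemma cov_simps [simp]:
  "cov [] = {}"
  "cov (Pairing a b c d p # gs) = {a..b} \<union> {c..d} \<union> cov gs"
  by (auto simp: cov_def)

lemma cov_member: "g \<in> set gs \<Longrightarrow> {dom_lo g..dom_hi g} \<subseteq> cov gs \<and> {ran_lo g..ran_hi g} \<subseteq> cov gs"
  unfolding cov_def by blast

lemma result_covered_t [simp]: "result (covered_t x gs) \<longleftrightarrow> x \<in> cov gs"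
  by (induction x gs rule: covered_t.induct) (auto simp: contained_t_def)

lemma start_points: "set (result (start_points_t gs)) = {1} \<union> (\<Union>g\<in>set gs. {dom_hi g + 1, ran_hi g + 1})"
  by (induction gs rule: start_points_t.induct) auto

lemma find_static_Some:
  "result (find_static_t N gs xs) = Some r \<Longrightarrow> r \<in> set xs \<and> r \<le> N \<and> r \<notin> cov gs"
  by (induction N gs xs rule: find_static_t.induct) (auto split: if_splits)

lemma find_static_None:
  "result (find_static_t N gs xs) = None \<Longrightarrow> x \<in> set xs \<Longrightarrow> x \<le> N \<Longrightarrow> x \<in> cov gs"
  by (induction N gs xs rule: find_static_t.induct) (auto split: if_splits)

text \<open>The smallest uncovered point is \<open>1\<close> or follows a domain or range.\<close>

lemma no_static:
  assumes "result (find_static_t N gs (result (start_points_t gs))) = None"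
  shows "{1..N} \<subseteq> cov gs"
proof
  have start: "x \<in> cov gs" if "x \<in> {1} \<union> (\<Union>g\<in>set gs. {dom_hi g + 1, ran_hi g + 1})" "x \<le> N" for x
    using find_static_None[OF assms] that start_points by blast
  fix x assume "x \<in> {1..N}"
  then have "1 \<le> x" "x \<le> N" by auto
  then show "x \<in> cov gs"
  proof (induction x rule: int_ge_induct)
    case base
    then show ?case using start by auto
  next
    case (step x)
    then have "x \<in> cov gs" by simp
    then obtain g where g: "g \<in> set gs" "x \<in> {dom_lo g..dom_hi g} \<or> x \<in> {ran_lo g..ran_hi g}"
      by (auto simp: cov_def)
    have "(x = dom_hi g \<or> x = ran_hi g) \<or> x + 1 \<in> {dom_lo g..dom_hi g} \<union> {ran_lo g..ran_hi g}"
      using g(2) unfolding atLeastAtMost_iff Un_iff by linarith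
    then consider "x = dom_hi g \<or> x = ran_hi g" | "x + 1 \<in> {dom_lo g..dom_hi g} \<union> {ran_lo g..ran_hi g}"
      by blast
    then show ?case
    proof cases
      case 1
      then show ?thesis using start[of "x + 1"] g(1) step by auto
    next
      case 2
      then show ?thesis using g(1) by (auto simp: cov_def)
    qed
  qed
qed

lemma result_stop_before [simp]: "result (stop_before_t r x e) = (if r < x then min (x - 1) e else e)"
  by (simp add: stop_before_t_def)

lemma static_end:
  "e' = result (static_end_t r gs e) \<Longrightarrow> r \<notin> cov gs \<Longrightarrow> r \<le> e \<Longrightarrow>
    \<forall>g\<in>set gs. dom_lo g \<le> dom_hi g \<and> ran_lo g \<le> ran_hi g \<Longrightarrow>
    r \<le> e' \<and> e' \<le> e \<and> {r..e'} \<inter> cov gs = {} \<and>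
    (e' = e \<or> (\<exists>g\<in>set gs. e' + 1 = dom_lo g \<or> e' + 1 = ran_lo g))"
proof (induction r gs e arbitrary: e' rule: static_end_t.induct)
  case (2 r a b c d p gs e)
  define e1 where "e1 = (if r < a then min (a - 1) e else e)"
  define e2 where "e2 = (if r < c then min (c - 1) e1 else e1)"
  have e': "e' = result (static_end_t r gs e2)"
    using 2(2) by (simp add: e1_def e2_def)
  have r: "r \<notin> {a..b}" "r \<notin> {c..d}" "r \<notin> cov gs" using "2.prems" by auto
  have re: "r \<le> e" using 2(4) by simp
  then have "r \<le> e1 \<and> e1 \<le> e" by (simp add: e1_def)
  moreover from this have "r \<le> e2 \<and> e2 \<le> e1" by (simp add: e2_def)
  ultimately have le: "r \<le> e1" "e1 \<le> e" "r \<le> e2" "e2 \<le> e1" by blast+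
  have ab: "a \<le> b" "c \<le> d" using "2.prems" by auto
  have IH: "r \<le> e' \<and> e' \<le> e2 \<and> {r..e'} \<inter> cov gs = {} \<and>
    (e' = e2 \<or> (\<exists>g\<in>set gs. e' + 1 = dom_lo g \<or> e' + 1 = ran_lo g))"
  proof -
    have s: "e1 = result (stop_before_t r a e)" "e2 = result (stop_before_t r c e1)"
      by (simp_all add: e1_def e2_def)
    show ?thesis by (rule 2(1)[OF s e' r(3) le(3)]) (use 2(5) in simp)
  qed
  have "r < a \<Longrightarrow> e1 < a" "r < c \<Longrightarrow> e2 < c" by (simp_all add: e1_def e2_def)
  then have "r < a \<Longrightarrow> e' < a" "r < c \<Longrightarrow> e' < c" using IH le by linarith+
  then have dis: "{r..e'} \<inter> {a..b} = {}" "{r..e'} \<inter> {c..d} = {}"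
    using r(1,2) by (auto simp: disjoint_iff)
  have e2: "e2 = e \<or> e2 + 1 = a \<or> e2 + 1 = c"
    by (auto simp: e1_def e2_def min_def)
  have "{r..e'} \<inter> cov gs = {}" using IH by blast
  with dis have "{r..e'} \<inter> cov (Pairing a b c d p # gs) = {}"
    unfolding cov_simps Int_Un_distrib by simp
  moreover have "e' = e \<or> (\<exists>g\<in>set (Pairing a b c d p # gs). e' + 1 = dom_lo g \<or> e' + 1 = ran_lo g)"
    using IH e2 by auto
  moreover have "r \<le> e'" "e' \<le> e" using IH le by linarith+
  ultimately show ?case by blast
qed auto

definition shift :: "int \<Rightarrow> int \<Rightarrow> int \<Rightarrow> int" where
  "shift s w x = (if s < x then x - w else x)"

fun pmap :: "(int \<Rightarrow> int) \<Rightarrow> pairing \<Rightarrow> pairing" where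
  "pmap f (Pairing a b c d p) = Pairing (f a) (f b) (f c) (f d) p"

lemma result_contract_pairing [simp]: "result (contract_pairing_t s w g) = pmap (shift s w) g"
  by (cases g) (simp add: shift_t_def shift_def)

text \<open>
  How the contraction of uncovered points moves a set \<open>C\<close> of points: the order is preserved,
  distances do not grow, and intervals inside \<open>C\<close> are moved rigidly.
\<close>

definition squeezes :: "(int \<Rightarrow> int) \<Rightarrow> int set \<Rightarrow> int set \<Rightarrow> bool" where
  "squeezes f C C' \<longleftrightarrow> f ` C = C' \<and> (\<forall>x\<in>C. 1 \<le> x \<longrightarrow> 1 \<le> f x) \<and>
    (\<forall>x\<in>C. \<forall>y\<in>C. x < y \<longrightarrow> f x < f y \<and> f y - f x \<le> y - x \<and> ({x..y} \<subseteq> C \<longrightarrow> f y - f x = y - x))"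

lemma squeezes_less: "squeezes f C C' \<Longrightarrow> x \<in> C \<Longrightarrow> y \<in> C \<Longrightarrow> x < y \<Longrightarrow> f x < f y"
  and squeezes_pos: "squeezes f C C' \<Longrightarrow> x \<in> C \<Longrightarrow> 1 \<le> x \<Longrightarrow> 1 \<le> f x"
  and squeezes_image: "squeezes f C C' \<Longrightarrow> f ` C = C'"
  unfolding squeezes_def by blast+

lemma squeezes_dist: "squeezes f C C' \<Longrightarrow> x \<in> C \<Longrightarrow> y \<in> C \<Longrightarrow> x \<le> y \<Longrightarrow> f y - f x \<le> y - x"
proof (cases "x = y")
  case False
  assume "squeezes f C C'" "x \<in> C" "y \<in> C" "x \<le> y"
  moreover have "x < y" using \<open>x \<le> y\<close> False by simp
  ultimately show ?thesis unfolding squeezes_def by blast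
qed simp

lemma squeezes_rigid: "squeezes f C C' \<Longrightarrow> {x..y} \<subseteq> C \<Longrightarrow> x \<le> y \<Longrightarrow> f y - f x = y - x"
proof (cases "x = y")
  case False
  assume *: "squeezes f C C'" "{x..y} \<subseteq> C" "x \<le> y"
  moreover have "x < y" "x \<in> C" "y \<in> C" using * False by auto
  ultimately show ?thesis unfolding squeezes_def by blast
qed simp

lemma squeezes_le: "squeezes f C C' \<Longrightarrow> x \<in> C \<Longrightarrow> y \<in> C \<Longrightarrow> x \<le> y \<Longrightarrow> f x \<le> f y"
  using squeezes_less[of f C C' x y] by (cases "x = y") auto

lemma squeezes_interval:
  assumes "squeezes f C C'" "{x..y} \<subseteq> C" "x \<le> y"
  shows "f ` {x..y} = {f x..f y}"
proof -
  have z: "f z = f x + (z - x)" if "z \<in> {x..y}" for z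
  proof -
    have "{x..z} \<subseteq> C" using that by (intro order_trans[OF _ assms(2)]) auto
    then show ?thesis using squeezes_rigid[OF assms(1), of x z] that by simp
  qed
  have "f ` {x..y} = (\<lambda>u. u + (f x - x)) ` {x..y}"
  proof (rule image_cong[OF refl])
    fix u assume "u \<in> {x..y}"
    from z[OF this] show "f u = u + (f x - x)" by linarith
  qed
  also have "\<dots> = {x + (f x - x)..y + (f x - x)}" by (rule image_add_atLeastAtMost')
  also have "y + (f x - x) = f y" using z[of y] assms(3) by simp
  finally show ?thesis by simp
qed

lemma squeezes_id: "squeezes id C C"
  by (auto simp: squeezes_def)

lemma squeezes_comp:
  assumes f: "squeezes f C C'" and g: "squeezes g C' C''"
  shows "squeezes (g \<circ> f) C C''"
  unfolding squeezes_def
proof (intro conjI ballI impI)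
  show "(g \<circ> f) ` C = C''" using f g by (auto simp: squeezes_def)
  show "1 \<le> (g \<circ> f) x" if "x \<in> C" "1 \<le> x" for x
    using that squeezes_pos[OF f, of x] squeezes_pos[OF g, of "f x"] squeezes_image[OF f] by auto
  fix x y assume xy: "x \<in> C" "y \<in> C" "x < y"
  then have f': "f x \<in> C'" "f y \<in> C'" "f x < f y" "f y - f x \<le> y - x"
    using f by (auto simp: squeezes_def)
  then have "g (f x) < g (f y)" "g (f y) - g (f x) \<le> f y - f x" using g by (auto simp: squeezes_def)
  with f' show "(g \<circ> f) x < (g \<circ> f) y" "(g \<circ> f) y - (g \<circ> f) x \<le> y - x" by auto
  assume sub: "{x..y} \<subseteq> C"
  then have "{f x..f y} \<subseteq> C'" using squeezes_interval[OF f sub] xy squeezes_image[OF f] image_mono[OF sub, of f]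
    by simp
  then show "(g \<circ> f) y - (g \<circ> f) x = y - x"
    using squeezes_rigid[OF f sub] squeezes_rigid[OF g, of "f x" "f y"] f' xy by simp
qed

lemma cov_pmap:
  assumes f: "squeezes f C C'" and "cov gs \<subseteq> C" and "\<forall>g\<in>set gs. is_pairing N g"
  shows "cov (map (pmap f) gs) = f ` cov gs"
  using assms(2,3)
proof (induction gs)
  case (Cons g gs)
  obtain a b c d p where G: "g = Pairing a b c d p" by (cases g)
  have "a \<le> b" "c \<le> d" "{a..b} \<subseteq> C" "{c..d} \<subseteq> C" using Cons.prems G by auto
  then have "f ` {a..b} = {f a..f b}" "f ` {c..d} = {f c..f d}"
    using squeezes_interval[OF f] by auto
  then show ?case using Cons G by (simp add: image_Un)
qed simp

lemma pmap_is_pairing: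
  assumes f: "squeezes f (cov gs \<union> {N + 1}) C'" "f (N + 1) = N' + 1"
    and g: "g \<in> set gs" "is_pairing N g"
  shows "is_pairing N' (pmap f g)"
proof -
  obtain a b c d p where G: "g = Pairing a b c d p" by (cases g)
  have gb: "1 \<le> a" "a \<le> b" "a \<le> c" "d \<le> N" "d - c = b - a" "c \<le> d" using g G by auto
  have sub: "{a..b} \<subseteq> cov gs \<union> {N + 1}" "{c..d} \<subseteq> cov gs \<union> {N + 1}"
    using g(1) G by (auto simp: cov_def)
  have mem: "a \<in> cov gs \<union> {N + 1}" "c \<in> cov gs \<union> {N + 1}" "d \<in> cov gs \<union> {N + 1}"
  proof -
    have "a \<in> {a..b}" "c \<in> {c..d}" "d \<in> {c..d}" using gb by auto
    then show "a \<in> cov gs \<union> {N + 1}" "c \<in> cov gs \<union> {N + 1}" "d \<in> cov gs \<union> {N + 1}"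
      using sub by blast+
  qed
  have "f b - f a = b - a" "f d - f c = d - c"
    using squeezes_rigid[OF f(1)] sub gb by auto
  moreover have "1 \<le> f a" using squeezes_pos[OF f(1) mem(1)] gb by simp
  moreover have "f a \<le> f c" using squeezes_le[OF f(1) mem(1,2)] gb by simp
  moreover have "f d < f (N + 1)" using squeezes_less[OF f(1) mem(3), of "N + 1"] gb by simp
  ultimately show ?thesis using gb f(2) G by simp
qed

lemma squeezes_shift:
  assumes "1 \<le> r" "r \<le> s" "w = s - r + 1" "{r..s} \<inter> C = {}"
  shows "squeezes (shift s w) C (shift s w ` C)"
  unfolding squeezes_def
proof (intro conjI ballI impI refl)
  fix x y assume xy: "x \<in> C" "y \<in> C" "x < y"
  have "x \<notin> {r..s}" "y \<notin> {r..s}" using xy assms(4) by auto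
  then show "shift s w x < shift s w y" "shift s w y - shift s w x \<le> y - x"
    using assms xy by (auto simp: shift_def)
  assume "{x..y} \<subseteq> C"
  moreover have "r \<in> {r..s}" using assms(2) by simp
  ultimately have "r \<notin> {x..y}" using assms(4) by blast
  then show "shift s w y - shift s w x = y - x"
    using assms xy \<open>x \<notin> {r..s}\<close> by (auto simp: shift_def)
qed (use assms in \<open>auto simp: shift_def\<close>)

text \<open>Contracting \<open>[r,s]\<close> removes the singleton orbits \<open>{x}\<close>, \<open>x \<in> [r,s]\<close>.\<close>

lemma conn_isolated: "x \<notin> cov gs \<Longrightarrow> \<forall>g\<in>set gs. is_pairing N g \<Longrightarrow> (x, y) \<in> conn gs \<Longrightarrow> y = x"
proof (rule ccontr)
  assume *: "x \<notin> cov gs" "\<forall>g\<in>set gs. is_pairing N g" "(x, y) \<in> conn gs" "y \<noteq> x"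
  then obtain z where "(x, z) \<in> (\<Union>g\<in>set gs. edge g \<union> (edge g)\<inverse>)"
    unfolding conn_def by (metis converse_rtranclE)
  then obtain g where g: "g \<in> set gs" "(x, z) \<in> edge g \<or> (z, x) \<in> edge g" by auto
  obtain a b c d p where G: "g = Pairing a b c d p" by (cases g)
  have "x \<in> {a..b} \<union> {c..d}"
    using g(2) *(2) g(1) unfolding G edge_Pairing_iff by (cases p) (auto simp: G)
  then show False using *(1) g(1) G by (auto simp: cov_def)
qed

lemma orbit_weights_contract:
  assumes rs: "1 \<le> r" "r \<le> s" "s \<le> N" "w = s - r + 1" "{r..s} \<inter> cov gs = {}"
    and gs: "\<forall>g\<in>set gs. is_pairing N g"
    and L: "chain d 1 L N" "\<forall>x\<in>{r..s}. weight_at d L x = z"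
  shows "orbit_weights N gs d L = replicate_mset (nat w) z +
    orbit_weights (N - w) (map (pmap (shift s w)) gs) d (contract_weights r s w L)"
proof -
  let ?gs = "map (pmap (shift s w)) gs" and ?L = "contract_weights r s w L"
  define \<eta> where "\<eta> u = (if u < r then u else u + w)" for u
  have w: "0 < w" using rs by simp
  have shift_\<eta>: "shift s w (\<eta> u) = u" for u using rs by (auto simp: shift_def \<eta>_def)
  have \<eta>_shift: "\<eta> (shift s w x) = x" if "x \<notin> {r..s}" for x
    using that rs by (auto simp: shift_def \<eta>_def)
  have \<eta>_out: "\<eta> u \<notin> {r..s}" for u using rs by (auto simp: \<eta>_def)
  have inj: "inj \<eta>" by (metis injI shift_\<eta>)
  have edges: "edge (pmap (shift s w) g) = (\<lambda>(x, y). (shift s w x, shift s w y)) ` edge g \<and>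
      (\<forall>x y. (x, y) \<in> edge g \<longrightarrow> x \<notin> {r..s} \<and> y \<notin> {r..s})" if "g \<in> set gs" for g
  proof -
    obtain a b c e p where G: "g = Pairing a b c e p" by (cases g)
    have gb: "a \<le> b" "e - c = b - a" using gs that G by auto
    have disj: "{r..s} \<inter> {a..b} = {}" "{r..s} \<inter> {c..e} = {}"
      using rs(5) cov_member[OF that] unfolding G pairing.sel by blast+
    have ab: "b < r \<or> s < a"
    proof (rule ccontr)
      assume "\<not> (b < r \<or> s < a)"
      then have "max r a \<in> {r..s} \<inter> {a..b}" using rs(2) gb by auto
      then show False using disj by blast
    qed
    have cd: "e < r \<or> s < c"
    proof (rule ccontr)
      assume "\<not> (e < r \<or> s < c)"
      then have "max r c \<in> {r..s} \<inter> {c..e}" using rs(2) gb by auto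
      then show False using disj by blast
    qed
    define i j where "i = (if s < a then w else 0)" and "j = (if s < c then w else 0)"
    have sh: "shift s w x = x - i" if "x \<in> {a..b}" for x
      using that ab rs(2) by (auto simp: shift_def i_def)
    have sh': "shift s w x = x - j" if "x \<in> {c..e}" for x
      using that cd rs(2) by (auto simp: shift_def j_def)
    have "pmap (shift s w) g = Pairing (a - i) (b - i) (c - j) (e - j) p"
      using sh sh' gb by (simp add: G)
    then have "edge (pmap (shift s w) g) = (\<lambda>(x, y). (x - i, y - j)) ` edge g"
      using edge_translate[of a i b c j e p] by (simp add: G)
    also have "\<dots> = (\<lambda>(x, y). (shift s w x, shift s w y)) ` edge g"
    proof (intro image_cong refl)
      fix xy assume xy: "xy \<in> edge g"
      obtain x y where "xy = (x, y)" by (cases xy)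
      moreover from this have "x \<in> {a..b}" "y \<in> {c..e}"
        using xy gb by (auto simp: G edge_Pairing_iff split: if_splits)
      ultimately show "(case xy of (x, y) \<Rightarrow> (x - i, y - j)) = (case xy of (x, y) \<Rightarrow> (shift s w x, shift s w y))"
        using sh sh' by simp
    qed
    finally show ?thesis
      using disj gb by (cases p) (auto simp: G edge_Pairing_iff disjoint_iff)
  qed
  have fwd: "(\<eta> u, \<eta> v) \<in> conn gs" if "(u, v) \<in> conn ?gs" for u v
    using that
  proof (rule conn_retraction)
    fix g u v assume "g \<in> set ?gs" "(u, v) \<in> edge g"
    then obtain h where h: "h \<in> set gs" "(u, v) \<in> (\<lambda>(x, y). (shift s w x, shift s w y)) ` edge h"
      using edges by auto
    then obtain x y where xy: "(x, y) \<in> edge h" "u = shift s w x" "v = shift s w y" by auto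
    then have "\<eta> u = x" "\<eta> v = y" using edges[OF h(1)] \<eta>_shift by auto
    then show "(\<eta> u, \<eta> v) \<in> conn gs" using edge_conn[OF h(1)] xy by auto
  qed
  have bwd: "(shift s w x, shift s w y) \<in> conn ?gs" if "(x, y) \<in> conn gs" for x y
    using that
  proof (rule conn_retraction)
    fix g u v assume g: "g \<in> set gs" "(u, v) \<in> edge g"
    then have "(shift s w u, shift s w v) \<in> edge (pmap (shift s w) g)" using edges by force
    then show "(shift s w u, shift s w v) \<in> conn ?gs"
      using edge_conn[of "pmap (shift s w) g" ?gs] g(1) by auto
  qed
  have single: "conn gs `` {x} = {x}" if "x \<in> {r..s}" for x
  proof -
    have "x \<notin> cov gs" using that rs(5) by blast
    then show ?thesis using conn_isolated[OF _ gs, of x] by auto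
  qed
  have \<eta>_range: "\<eta> u \<in> {1..N} \<longleftrightarrow> u \<in> {1..N - w}" for u
    using rs by (auto simp: \<eta>_def)
  have cls: "conn gs `` {\<eta> u} \<inter> {1..N} = \<eta> ` (conn ?gs `` {u} \<inter> {1..N - w})" for u
  proof (intro equalityI subsetI)
    fix y assume y: "y \<in> conn gs `` {\<eta> u} \<inter> {1..N}"
    have "y \<notin> {r..s}"
    proof
      assume "y \<in> {r..s}"
      then have "conn gs `` {y} = {y}" by (rule single)
      moreover have "\<eta> u \<in> conn gs `` {y}" using y conn_sym[of "\<eta> u" y] by auto
      ultimately show False using \<open>y \<in> {r..s}\<close> \<eta>_out by auto
    qed
    then have "y = \<eta> (shift s w y)" using \<eta>_shift by simp
    moreover have "(u, shift s w y) \<in> conn ?gs" using bwd[of "\<eta> u" y] y shift_\<eta> by auto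
    moreover have "shift s w y \<in> {1..N - w}" using \<eta>_range[of "shift s w y"] calculation(1) y by auto
    ultimately show "y \<in> \<eta> ` (conn ?gs `` {u} \<inter> {1..N - w})" by (intro image_eqI) auto
  next
    fix y assume "y \<in> \<eta> ` (conn ?gs `` {u} \<inter> {1..N - w})"
    then obtain v where "y = \<eta> v" "(u, v) \<in> conn ?gs" "v \<in> {1..N - w}" by auto
    then show "y \<in> conn gs `` {\<eta> u} \<inter> {1..N}" using fwd[of u v] \<eta>_range[of v] by simp
  qed
  have orb: "orbits N gs = (\<lambda>x. {x}) ` {r..s} \<union> (`) \<eta> ` orbits (N - w) ?gs"
  proof -
    have "{1..N} = {r..s} \<union> \<eta> ` {1..N - w}"
    proof (intro equalityI subsetI)
      fix x assume x: "x \<in> {1..N}"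
      show "x \<in> {r..s} \<union> \<eta> ` {1..N - w}"
      proof (cases "x \<in> {r..s}")
        case False
        then have eq: "x = \<eta> (shift s w x)" using \<eta>_shift by simp
        then have "shift s w x \<in> {1..N - w}" using \<eta>_range[of "shift s w x"] x by simp
        then show ?thesis using eq by blast
      qed simp
    next
      fix x assume "x \<in> {r..s} \<union> \<eta> ` {1..N - w}"
      then consider "x \<in> {r..s}" | v where "x = \<eta> v" "v \<in> {1..N - w}" by auto
      then show "x \<in> {1..N}" using rs(1,3) \<eta>_range by cases auto
    qed
    then have "orbits N gs = (\<lambda>x. conn gs `` {x} \<inter> {1..N}) ` ({r..s} \<union> \<eta> ` {1..N - w})"
      unfolding orbits_conn by (rule image_cong) simp
    also have "\<dots> = (\<lambda>x. {x}) ` {r..s} \<union> (\<lambda>u. \<eta> ` (conn ?gs `` {u} \<inter> {1..N - w})) ` {1..N - w}"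
      unfolding image_Un image_image
      by (intro arg_cong2[of _ _ _ _ "(\<union>)"] image_cong) (use rs in \<open>auto simp: single cls\<close>)
    finally show ?thesis by (simp add: orbits_conn image_image)
  qed
  have disj: "(\<lambda>x. {x}) ` {r..s} \<inter> (`) \<eta> ` orbits (N - w) ?gs = {}"
  proof (rule ccontr)
    assume "\<not> ?thesis"
    then obtain x X where "x \<in> {r..s}" "{x} = \<eta> ` X" by blast
    then have "x \<in> \<eta> ` X" by blast
    then show False using \<eta>_out \<open>x \<in> {r..s}\<close> by blast
  qed
  have wt: "weight_at d ?L u = weight_at d L (\<eta> u)" for u
    unfolding \<eta>_def using rs by (intro weight_at_contract) auto
  have ow: "orbit_weight d L (\<eta> ` X) = orbit_weight d ?L X" for X
    unfolding orbit_weight_def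
    by (intro map_cong refl) (simp add: sum.reindex[OF inj_on_subset[OF inj subset_UNIV]] wt)
  have "orbit_weights N gs d L = image_mset (orbit_weight d L) (mset_set ((\<lambda>x. {x}) ` {r..s})) +
      image_mset (orbit_weight d L) (mset_set ((`) \<eta> ` orbits (N - w) ?gs))"
    unfolding orbit_weights_def orb using disj by (subst mset_set_Union) auto
  also have "mset_set ((\<lambda>x. {x}) ` {r..s}) = image_mset (\<lambda>x. {x}) (mset_set {r..s})"
    by (rule image_mset_mset_set[symmetric]) simp
  also have "image_mset (orbit_weight d L) (image_mset (\<lambda>x. {x}) (mset_set {r..s})) =
      image_mset (\<lambda>x. z) (mset_set {r..s})"
    unfolding multiset.map_comp o_def
  proof (intro image_mset_cong)
    fix x assume "x \<in># mset_set {r..s}"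
    then have "weight_at d L x = z" using L(2) by simp
    then show "orbit_weight d L {x} = z"
      using length_weight_at[OF L(1), of x] map_nth[of "weight_at d L x"] by (simp add: orbit_weight_def)
  qed
  also have "\<dots> = replicate_mset (nat w) z" using rs by (simp add: image_mset_const_eq)
  also have "mset_set ((`) \<eta> ` orbits (N - w) ?gs) = image_mset ((`) \<eta>) (mset_set (orbits (N - w) ?gs))"
    using inj by (intro image_mset_mset_set[symmetric]) (meson inj_image_eq_iff inj_onI)
  also have "image_mset (orbit_weight d L) \<dots> = orbit_weights (N - w) ?gs d ?L"
    by (simp add: orbit_weights_def multiset.map_comp o_def ow)
  finally show ?thesis .
qed

text \<open>
  The possible ends of static intervals of constant weight. Each contraction identifies two of
  them, namely \<open>r\<close> and \<open>s + 1\<close>; this bounds the number of contractions as well as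
  the number of intervals of constant weight afterwards.
\<close>

definition marks :: "int \<Rightarrow> pairing list \<Rightarrow> weights \<Rightarrow> int set" where
  "marks N gs L = starts L \<union> {1, N + 1} \<union> (\<Union>g\<in>set gs. {dom_lo g, ran_lo g, dom_hi g + 1, ran_hi g + 1})"

lemma finite_marks [simp]: "finite (marks N gs L)"
  by (simp add: marks_def)

lemma card_marks:
  assumes "chain d 1 L N"
  shows "length L \<le> card (marks N gs L)" and "card (marks N gs L) \<le> length L + 2 + 4 * length gs"
proof -
  have S: "card (starts L) = length L" using chain_starts[OF assms] by simp
  show "length L \<le> card (marks N gs L)"
    unfolding S[symmetric] by (intro card_mono) (auto simp: marks_def)
  have "card (\<Union>g\<in>set gs. {dom_lo g, ran_lo g, dom_hi g + 1, ran_hi g + 1})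
      \<le> (\<Sum>g\<in>set gs. card {dom_lo g, ran_lo g, dom_hi g + 1, ran_hi g + 1})"
    by (rule card_UN_le) simp
  also have "\<dots> \<le> (\<Sum>g\<in>set gs. 4)" by (intro sum_mono) (auto simp: card_insert_if)
  also have "\<dots> \<le> 4 * length gs" using card_length[of gs] by simp
  finally have 1: "card (\<Union>g\<in>set gs. {dom_lo g, ran_lo g, dom_hi g + 1, ran_hi g + 1}) \<le> 4 * length gs" .
  have 2: "card {1, N + 1} \<le> 2" by (auto simp: card_insert_if)
  have "card (marks N gs L) \<le> card (starts L) + card {1, N + 1} +
      card (\<Union>g\<in>set gs. {dom_lo g, ran_lo g, dom_hi g + 1, ran_hi g + 1})"
    unfolding marks_def by (meson add_mono card_Un_le le_refl order_trans)
  then show "card (marks N gs L) \<le> length L + 2 + 4 * length gs" using 1 2 S by simp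
qed

text \<open>
  The displacement maps the remaining marks onto the new ones and identifies \<open>r\<close> with \<open>s + 1\<close>.
\<close>

lemma card_marks_contract:
  assumes L: "chain d 1 L N" and rs: "1 \<le> r" "r \<le> s" "s \<le> N" "w = s - r + 1" "{r..s} \<inter> cov gs = {}"
    and gs: "\<forall>g\<in>set gs. is_pairing N g"
    and mem: "r \<in> marks N gs L" "s + 1 \<in> marks N gs L"
  shows "card (marks (N - w) (map (pmap (shift s w)) gs) (contract_weights r s w L)) < card (marks N gs L)"
proof -
  let ?K = "marks N gs L"
  have r: "collapse r s r = r" "collapse r s (s + 1) = r" using rs by (auto simp: collapse_def)
  have pt: "shift s w x = collapse r s x \<and> shift s w x + 1 = collapse r s (x + 1)" if "x \<in> cov gs" for x
  proof -
    have "x \<notin> {r..s}" using that rs by auto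
    then show ?thesis using rs by (auto simp: collapse_def shift_def)
  qed
  have "marks (N - w) (map (pmap (shift s w)) gs) (contract_weights r s w L) \<subseteq> collapse r s ` ?K"
  proof -
    have "starts (contract_weights r s w L) \<subseteq> collapse r s ` ?K"
      using starts_contract[OF L rs(2,4)] mem(1) r(1) by (force simp: marks_def)
    moreover have "1 \<in> collapse r s ` ?K" "N - w + 1 \<in> collapse r s ` ?K"
    proof -
      have "1 = collapse r s 1" "N - w + 1 = collapse r s (N + 1)" using rs by (auto simp: collapse_def)
      then show "1 \<in> collapse r s ` ?K" "N - w + 1 \<in> collapse r s ` ?K"
        by (auto simp: marks_def intro!: image_eqI)
    qed
    moreover have "{dom_lo g', ran_lo g', dom_hi g' + 1, ran_hi g' + 1} \<subseteq> collapse r s ` ?K"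
      if g': "g' \<in> set (map (pmap (shift s w)) gs)" for g'
    proof -
      obtain g where g: "g \<in> set gs" "g' = pmap (shift s w) g" using g' by auto
      obtain a b c e p where G: "g = Pairing a b c e p" by (cases g)
      have "a \<le> b" "c \<le> e" using gs g G by auto
      then have "a \<in> cov gs" "b \<in> cov gs" "c \<in> cov gs" "e \<in> cov gs"
        using g(1) G by (force simp: cov_def)+
      moreover have "a \<in> ?K" "c \<in> ?K" "b + 1 \<in> ?K" "e + 1 \<in> ?K"
        using g(1) G by (force simp: marks_def)+
      ultimately have "shift s w a \<in> collapse r s ` ?K" "shift s w c \<in> collapse r s ` ?K"
        "shift s w b + 1 \<in> collapse r s ` ?K" "shift s w e + 1 \<in> collapse r s ` ?K"
        using pt by (metis imageI)+
      then show ?thesis by (simp add: g(2) G)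
    qed
    ultimately show ?thesis unfolding marks_def[of "N - w"] by blast
  qed
  then have "card (marks (N - w) (map (pmap (shift s w)) gs) (contract_weights r s w L)) \<le> card (collapse r s ` ?K)"
    by (intro card_mono) auto
  also have "collapse r s ` ?K = collapse r s ` (?K - {s + 1})"
    using r mem rs(2) by (auto simp: image_iff) (metis DiffI add_le_same_cancel1 insert_iff empty_iff not_one_le_zero singletonD order_refl)
  also have "card \<dots> \<le> card (?K - {s + 1})" by (intro card_image_le) simp
  also have "\<dots> < card ?K" using mem(2) by (intro card_Diff1_less) auto
  finally show ?thesis .
qed

lemma abs_sum_contract:
  assumes "1 \<le> r" "r \<le> s" "s \<le> N" "w = s - r + 1"
  shows "abs_sum d (contract_weights r s w L) i (N - w) \<le> abs_sum d L i N"
proof -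
  define \<eta> where "\<eta> u = (if u < r then u else u + w)" for u
  have inj: "inj_on \<eta> {1..N - w}" using assms by (auto simp: inj_on_def \<eta>_def split: if_splits)
  have "abs_sum d (contract_weights r s w L) i (N - w) = (\<Sum>u\<in>{1..N - w}. \<bar>weight_at d L (\<eta> u) ! i\<bar>)"
    unfolding abs_sum_def \<eta>_def weight_at_contract[OF assms(2,4)] ..
  also have "\<dots> = (\<Sum>x\<in>\<eta> ` {1..N - w}. \<bar>weight_at d L x ! i\<bar>)"
    using inj by (simp add: sum.reindex)
  also have "\<dots> \<le> abs_sum d L i N"
    unfolding abs_sum_def using assms by (intro sum_mono2) (auto simp: \<eta>_def)
  finally show ?thesis .
qed

lemma weight_le_abs_sum: "x \<in> {1..N} \<Longrightarrow> \<bar>weight_at d L x ! i\<bar> \<le> abs_sum d L i N"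
  unfolding abs_sum_def by (rule member_le_sum) auto

lemma pmap_id [simp]: "pmap id = id"
proof
  show "pmap id g = id g" for g by (cases g) simp
qed

lemma pmap_comp: "pmap f (pmap g h) = pmap (f \<circ> g) h"
  by (cases h) simp

lemma contract_static_step:
  assumes N: "0 < N" and gs: "\<forall>g\<in>set gs. is_pairing N g" and L: "chain d 1 L N"
    and r: "result (find_static_t N gs (result (start_points_t gs))) = Some r"
  obtains s w z where
    "result (contract_static_t (State N gs L L')) =
      result (contract_static_t (State (N - w) (map (pmap (shift s w)) gs)
        (contract_weights r s w L) (result (add_at_end_t 0 L' w z))))"
    and "z = fst (result (weight_run_t r L))"
    and "s = min (result (static_end_t r gs N)) (snd (result (weight_run_t r L)))"
    and "1 \<le> r" "r \<le> s" "s \<le> N" "w = s - r + 1" "{r..s} \<inter> cov gs = {}" "length z = d"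
    and "\<forall>x\<in>{r..s}. weight_at d L x = z" "r \<in> marks N gs L" "s + 1 \<in> marks N gs L"
proof -
  define e where "e = result (static_end_t r gs N)"
  define z where "z = fst (result (weight_run_t r L))"
  define e' where "e' = snd (result (weight_run_t r L))"
  have ze': "(z, e') = result (weight_run_t r L)" by (simp add: z_def e'_def)
  have rs: "r \<in> set (result (start_points_t gs))" "r \<le> N" "r \<notin> cov gs"
    using find_static_Some[OF r] by auto
  have r1: "1 \<le> r"
  proof -
    have "1 \<le> dom_hi g \<and> 1 \<le> ran_hi g" if "g \<in> set gs" for g
      using gs that by (cases g) auto
    then show ?thesis using rs(1) unfolding start_points by fastforce
  qed
  have ok: "\<forall>g\<in>set gs. dom_lo g \<le> dom_hi g \<and> ran_lo g \<le> ran_hi g"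
  proof
    fix g assume "g \<in> set gs"
    then have "is_pairing N g" using gs by blast
    then show "dom_lo g \<le> dom_hi g \<and> ran_lo g \<le> ran_hi g" by (cases g) auto
  qed
  note se = static_end[OF e_def rs(3,2) ok]
  note wr = weight_run[OF L r1 rs(2) ze']
  define s where "s = min e e'"
  define w where "w = s - r + 1"
  have sr: "r \<le> s" "s \<le> N" using se wr by (auto simp: s_def)
  have w: "s + 1 - r = w" "0 < w" using sr by (simp_all add: w_def)
  have zr: "result (weight_run_t r L) = (z, min e' e') \<and> True" using ze' by simp
  have eq: "result (contract_static_t (State N gs L L')) =
      result (contract_static_t (State (N - w) (map (pmap (shift s w)) gs)
        (contract_weights r s w L) (result (add_at_end_t 0 L' w z))))"
    by (subst contract_static_t.simps)
      (simp add: N r w ze'[symmetric] flip: e_def s_def)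
  have dis: "{r..s} \<inter> cov gs = {}" using se by (auto simp: s_def)
  have const: "\<forall>x\<in>{r..s}. weight_at d L x = z" using wr by (auto simp: s_def)
  have mr: "r \<in> marks N gs L" using rs(1) unfolding start_points marks_def by blast
  have "e + 1 \<in> marks N gs L" using se unfolding marks_def by auto
  moreover have "e' + 1 \<in> marks N gs L" using wr unfolding marks_def by auto
  ultimately have ms: "s + 1 \<in> marks N gs L" by (simp add: s_def min_def)
  show thesis
  proof (rule that[OF eq z_def _ r1 sr w_def dis _ const mr ms])
    show "s = min (result (static_end_t r gs N)) (snd (result (weight_run_t r L)))"
      by (simp add: s_def e_def e'_def)
    show "length z = d" using wr by blast
  qed
qed

definition contracted :: "nat \<Rightarrow> state \<Rightarrow> (int \<Rightarrow> int) \<Rightarrow> state \<Rightarrow> bool" where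
  "contracted d S f S' \<longleftrightarrow>
    pairings S' = map (pmap f) (pairings S) \<and>
    squeezes f (cov (pairings S) \<union> {len S + 1}) (cov (pairings S') \<union> {len S' + 1}) \<and>
    f (len S + 1) = len S' + 1 \<and> 0 \<le> len S' \<and> len S' \<le> len S \<and> {1..len S'} \<subseteq> cov (pairings S') \<and>
    chain d 1 (wts S') (len S') \<and>
    (\<forall>n. chain d 1 (outp S) n \<longrightarrow> chain d 1 (outp S') (n + (len S - len S'))) \<and>
    output_weights d (outp S') + orbit_weights (len S') (pairings S') d (wts S') =
      output_weights d (outp S) + orbit_weights (len S) (pairings S) d (wts S) \<and>
    (\<forall>i. i < d \<longrightarrow> abs_sum d (wts S') i (len S') \<le> abs_sum d (wts S) i (len S)) \<and>
    length (wts S') \<le> card (marks (len S) (pairings S) (wts S)) \<and>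
    length (outp S') \<le> length (outp S) + card (marks (len S) (pairings S) (wts S))"

lemma contractedD:
  assumes "contracted d S f S'"
  shows "pairings S' = map (pmap f) (pairings S)"
    and "squeezes f (cov (pairings S) \<union> {len S + 1}) (cov (pairings S') \<union> {len S' + 1})"
    and "f (len S + 1) = len S' + 1" "0 \<le> len S'" "len S' \<le> len S" "{1..len S'} \<subseteq> cov (pairings S')"
    and "chain d 1 (wts S') (len S')"
    and "chain d 1 (outp S) n \<Longrightarrow> chain d 1 (outp S') (n + (len S - len S'))"
    and "output_weights d (outp S') + orbit_weights (len S') (pairings S') d (wts S') =
      output_weights d (outp S) + orbit_weights (len S) (pairings S) d (wts S)"
    and "i < d \<Longrightarrow> abs_sum d (wts S') i (len S') \<le> abs_sum d (wts S) i (len S)"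
    and "length (wts S') \<le> card (marks (len S) (pairings S) (wts S))"
    and "length (outp S') \<le> length (outp S) + card (marks (len S) (pairings S) (wts S))"
  using assms unfolding contracted_def by blast+

lemma contract_static:
  assumes "0 \<le> N" "\<forall>g\<in>set gs. is_pairing N g" "chain d 1 L N" "\<exists>n. chain d 1 L' n"
  shows "\<exists>f. contracted d (State N gs L L') f (result (contract_static_t (State N gs L L')))"
  using assms
proof (induction "nat N" arbitrary: N gs L L' rule: less_induct)
  case less
  show ?case
  proof (cases "0 < N \<and> result (find_static_t N gs (result (start_points_t gs))) \<noteq> None")
    case False
    then have "result (contract_static_t (State N gs L L')) = State N gs L L'"
      by (subst contract_static_t.simps) auto
    moreover have "{1..N} \<subseteq> cov gs"
    proof (cases "0 < N")
      case True
      then show ?thesis using False no_static by blast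
    qed auto
    ultimately show ?thesis
      using less.prems card_marks(1)[OF less.prems(3)]
      by (intro exI[of _ id]) (auto simp: contracted_def squeezes_id)
  next
    case True
    then obtain r where r: "result (find_static_t N gs (result (start_points_t gs))) = Some r" by auto
    obtain n where n: "chain d 1 L' n" using less.prems(4) by blast
    have N: "0 < N" using True by simp
    obtain s w z where eq: "result (contract_static_t (State N gs L L')) =
        result (contract_static_t (State (N - w) (map (pmap (shift s w)) gs)
          (contract_weights r s w L) (result (add_at_end_t 0 L' w z))))"
      and rs: "1 \<le> r" "r \<le> s" "s \<le> N" "w = s - r + 1" "{r..s} \<inter> cov gs = {}" "length z = d"
        "\<forall>x\<in>{r..s}. weight_at d L x = z" "r \<in> marks N gs L" "s + 1 \<in> marks N gs L"
      by (rule contract_static_step[OF N less.prems(2,3) r, where L' = L'], rule that)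
    let ?gs = "map (pmap (shift s w)) gs" and ?L = "contract_weights r s w L"
      and ?L' = "result (add_at_end_t 0 L' w z)"
    let ?S = "State (N - w) ?gs ?L ?L'"
    have w: "0 < w" "w \<le> N" using rs by auto
    have dis: "{r..s} \<inter> (cov gs \<union> {N + 1}) = {}" using rs by auto
    note sq0 = squeezes_shift[OF rs(1,2,4) dis]
    have cov1: "cov ?gs = shift s w ` cov gs"
      by (rule cov_pmap[OF sq0 _ less.prems(2)]) auto
    have sN: "shift s w (N + 1) = N - w + 1" using rs by (simp add: shift_def)
    have sq: "squeezes (shift s w) (cov gs \<union> {N + 1}) (cov ?gs \<union> {N - w + 1})"
      using sq0 by (simp add: cov1 sN)
    have gs1: "\<forall>g\<in>set ?gs. is_pairing (N - w) g"
      using pmap_is_pairing[OF sq sN] less.prems(2) by auto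
    have L1: "chain d 1 ?L (N - w)" by (rule chain_contract[OF less.prems(3) rs(1-4)])
    note out = output_weights_add_at_end[OF n w(1) rs(6)]
    note ow = orbit_weights_contract[OF rs(1-5) less.prems(2,3) rs(7)]
    note mk = card_marks_contract[OF less.prems(3) rs(1-5) less.prems(2) rs(8,9)]
    have "nat (N - w) < nat N" "0 \<le> N - w" using w by auto
    then obtain f where f: "contracted d ?S f (result (contract_static_t ?S))"
      using less.hyps[of "N - w" ?gs ?L ?L'] gs1 L1 out(1) by blast
    let ?S' = "result (contract_static_t ?S)"
    have as: "abs_sum d ?L i (N - w) \<le> abs_sum d L i N" for i
      by (rule abs_sum_contract[OF rs(1-4)])
    have app: "?L' = L' @ [((n + 1, n + w), z)]" using n by (intro add_at_end) simp
    note fD = contractedD[OF f, unfolded state.sel]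
    have "contracted d (State N gs L L') (f \<circ> shift s w) ?S'"
      unfolding contracted_def state.sel
    proof (intro conjI)
      show "pairings ?S' = map (pmap (f \<circ> shift s w)) gs"
        unfolding fD(1) by (simp add: pmap_comp comp_def)
      show "squeezes (f \<circ> shift s w) (cov gs \<union> {N + 1}) (cov (pairings ?S') \<union> {len ?S' + 1})"
        by (rule squeezes_comp[OF sq fD(2)])
      show "(f \<circ> shift s w) (N + 1) = len ?S' + 1" using fD(3) by (simp add: sN)
      show "0 \<le> len ?S'" by (rule fD(4))
      show "{1..len ?S'} \<subseteq> cov (pairings ?S')" by (rule fD(6))
      show "chain d 1 (wts ?S') (len ?S')" by (rule fD(7))
      show "len ?S' \<le> N" using fD(5) w by linarith
      show "\<forall>n. chain d 1 L' n \<longrightarrow> chain d 1 (outp ?S') (n + (N - len ?S'))"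
      proof (intro allI impI)
        fix m assume "chain d 1 L' m"
        then have "chain d 1 ?L' (m + w)" using output_weights_add_at_end(1) w(1) rs(6) by blast
        then have "chain d 1 (outp ?S') (m + w + (N - w - len ?S'))" by (rule fD(8))
        moreover have "m + w + (N - w - len ?S') = m + (N - len ?S')" by simp
        ultimately show "chain d 1 (outp ?S') (m + (N - len ?S'))" by (simp only:)
      qed
      show "output_weights d (outp ?S') + orbit_weights (len ?S') (pairings ?S') d (wts ?S') =
          output_weights d L' + orbit_weights N gs d L"
        unfolding fD(9) out(2) ow by (simp only: add_ac)
      show "\<forall>i. i < d \<longrightarrow> abs_sum d (wts ?S') i (len ?S') \<le> abs_sum d L i N"
        using fD(10) as by (meson order_trans)
      show "length (wts ?S') \<le> card (marks N gs L)" using fD(11) mk by linarith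
      show "length (outp ?S') \<le> length L' + card (marks N gs L)"
        using fD(12) mk unfolding app by simp
    qed
    then show ?thesis unfolding eq by blast
  qed
qed

section \<open>One cycle\<close>

subsection \<open>Selection of a maximal pairing\<close>

definition dominates :: "pairing \<Rightarrow> pairing \<Rightarrow> bool" where
  "dominates g h \<longleftrightarrow> ran_hi h < ran_hi g \<or> ran_hi h = ran_hi g \<and> ran_lo g \<le> ran_lo h"

lemma less_maximal:
  "result (less_maximal_t g h) \<Longrightarrow> dominates h g"
  "\<not> result (less_maximal_t g h) \<Longrightarrow> dominates g h"
  by (cases g; cases h; auto simp: dominates_def)+

lemma extract_maximal_None: "result (extract_maximal_t gs) = None \<longleftrightarrow> gs = []"
  by (induction gs) (auto split: option.splits)

lemma extract_maximal_Some:
  "result (extract_maximal_t gs) = Some (g, hs) \<Longrightarrow>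
    mset gs = add_mset g (mset hs) \<and> (\<forall>h\<in>set hs. dominates g h)"
proof (induction gs arbitrary: g hs)
  case (Cons k ks)
  show ?case
  proof (cases "result (extract_maximal_t ks)")
    case None
    then show ?thesis using Cons.prems extract_maximal_None[of ks] by simp
  next
    case (Some ghs)
    obtain h hs' where h: "ghs = (h, hs')" by (cases ghs)
    then have IH: "mset ks = add_mset h (mset hs')" "\<forall>h'\<in>set hs'. dominates h h'"
      using Cons.IH Some by auto
    show ?thesis
    proof (cases "result (less_maximal_t k h)")
      case True
      then show ?thesis using Cons.prems Some h IH less_maximal(1)[of k h] by auto
    next
      case False
      then have kh: "dominates k h" by (rule less_maximal(2))
      have "dominates k h'" if "dominates h h'" for h'
        using kh that by (auto simp: dominates_def)
      then show ?thesis using Cons.prems Some h IH kh False by auto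
    qed
  qed
qed simp

subsection \<open>Preparation of the pairings\<close>

definition prepare :: "state \<Rightarrow> state" where
  "prepare S = (let S' = result (contract_static_t (State (len S)
      (filter (\<lambda>g. \<not> is_identity g) (pairings S)) (wts S) (outp S)))
    in State (len S') (merge_all (map trim (pairings S'))) (wts S') (outp S'))"

definition valid :: "nat \<Rightarrow> state \<Rightarrow> bool" where
  "valid d S \<longleftrightarrow> 0 \<le> len S \<and> (\<forall>g\<in>set (pairings S). is_pairing (len S) g) \<and>
    chain d 1 (wts S) (len S) \<and> (\<exists>n. chain d 1 (outp S) n)"

definition all_weights :: "nat \<Rightarrow> state \<Rightarrow> int list multiset" where
  "all_weights d S = output_weights d (outp S) + orbit_weights (len S) (pairings S) d (wts S)"

definition unmergeable :: "pairing \<Rightarrow> pairing \<Rightarrow> bool" where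
  "unmergeable g h \<longleftrightarrow> merge_pair g h = None"

lemma orbit_weights_cong: "conn gs = conn hs \<Longrightarrow> orbit_weights N gs d L = orbit_weights N hs d L"
  by (simp add: orbit_weights_def orbits_conn)

lemma merge_pair_ran_hi: "merge_pair g h = Some k \<Longrightarrow> ran_hi k = max (ran_hi g) (ran_hi h)"
  by (cases g; cases h) (auto simp: merge_pair_Pairing split: if_splits)

lemma merge_into_ran_hi:
  "result (merge_into_t g hs) = Some hs' \<Longrightarrow> \<forall>h\<in>set (g # hs). ran_hi h \<le> N \<Longrightarrow>
    \<exists>h\<in>set (g # hs). ran_hi h = N \<Longrightarrow> \<exists>h\<in>set hs'. ran_hi h = N"
proof (induction g hs arbitrary: hs' rule: merge_into_t.induct)
  case (2 g h hs)
  show ?case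
  proof (cases "merge_pair g h")
    case None
    then obtain hs'' where hs'': "result (merge_into_t g hs) = Some hs''" "hs' = h # hs''"
      using "2.prems"(1) by (auto split: option.splits)
    show ?thesis
    proof (cases "ran_hi h = N")
      case False
      then have ex: "\<exists>k\<in>set (g # hs). ran_hi k = N" using "2.prems"(3) by auto
      have le: "\<forall>k\<in>set (g # hs). ran_hi k \<le> N" using "2.prems"(2) by auto
      have "\<exists>h\<in>set hs''. ran_hi h = N"
        by (rule "2.IH"[OF None[symmetric] refl hs''(1) le ex])
      then show ?thesis by (simp add: hs''(2))
    qed (simp add: hs''(2))
  next
    case (Some k)
    then have "hs' = k # hs" using "2.prems"(1) by simp
    moreover have "ran_hi k = N \<or> (\<exists>h\<in>set hs. ran_hi h = N)"
      using "2.prems"(2,3) unfolding merge_pair_ran_hi[OF Some] max_def by auto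
    ultimately show ?thesis by auto
  qed
qed simp

lemma merge_once_ran_hi:
  "result (merge_once_t gs) = Some gs' \<Longrightarrow> \<forall>h\<in>set gs. ran_hi h \<le> N \<Longrightarrow>
    \<exists>h\<in>set gs. ran_hi h = N \<Longrightarrow> \<exists>h\<in>set gs'. ran_hi h = N"
proof (induction gs arbitrary: gs' rule: merge_once_t.induct)
  case (2 g gs)
  show ?case
  proof (cases "result (merge_into_t g gs)")
    case None
    then obtain gs'' where gs'': "result (merge_once_t gs) = Some gs''" "gs' = g # gs''"
      using "2.prems"(1) by (auto split: option.splits)
    show ?thesis
    proof (cases "ran_hi g = N")
      case False
      then have ex: "\<exists>k\<in>set gs. ran_hi k = N" using "2.prems"(3) by auto
      have le: "\<forall>k\<in>set gs. ran_hi k \<le> N" using "2.prems"(2) by auto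
      have "\<exists>h\<in>set gs''. ran_hi h = N"
        by (rule "2.IH"[OF None[symmetric] refl gs''(1) le ex])
      then show ?thesis by (simp add: gs''(2))
    qed (simp add: gs''(2))
  next
    case (Some gs'')
    then have "gs'' = gs'" using "2.prems"(1) by simp
    then show ?thesis using merge_into_ran_hi[OF Some] "2.prems"(2,3) by blast
  qed
qed simp

lemma normal_ran_hi: "normal N g \<Longrightarrow> ran_hi g \<le> N"
  by (cases g) auto

lemma merge_all_ran_hi:
  "\<forall>h\<in>set gs. normal N h \<Longrightarrow> \<exists>h\<in>set gs. ran_hi h = N \<Longrightarrow> \<exists>h\<in>set (merge_all gs). ran_hi h = N"
proof (induction gs rule: length_induct)
  case (1 gs)
  show ?case
  proof (cases "result (merge_once_t gs)")
    case None
    then show ?thesis using 1 by (simp add: merge_all_t.simps[of gs])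
  next
    case (Some gs')
    have "length gs' < length gs" using length_merge_once[OF Some] by simp
    moreover have "\<forall>h\<in>set gs'. normal N h" using merge_once[OF 1(2) Some] by blast
    moreover have "\<exists>h\<in>set gs'. ran_hi h = N"
      using merge_once_ran_hi[OF Some _ 1(3)] 1(2) normal_ran_hi by blast
    ultimately have "\<exists>h\<in>set (merge_all gs'). ran_hi h = N" using 1(1) by blast
    then show ?thesis using Some by (simp add: merge_all_t.simps[of gs])
  qed
qed

lemma trim_ran_hi [simp]: "ran_hi (trim g) = ran_hi g"
  by (cases g) (simp add: trim_Pairing)

lemma conn_map_trim:
  assumes "\<forall>g\<in>set gs. is_pairing N g"
  shows "conn (map trim gs) = conn gs"
  using conn_map_eq[of gs "[]" trim] conn_trim assms by auto

lemma is_identity_pmap: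
  assumes f: "squeezes f (cov gs \<union> {N + 1}) C'" and g: "g \<in> set gs" "is_pairing N g"
  shows "is_identity (pmap f g) \<longleftrightarrow> is_identity g"
proof -
  obtain a b c d p where G: "g = Pairing a b c d p" by (cases g)
  have gb: "a \<le> b" "a \<le> c" "c \<le> d" using g G by auto
  then have mem: "a \<in> cov gs \<union> {N + 1}" "b \<in> cov gs \<union> {N + 1}" "c \<in> cov gs \<union> {N + 1}"
  proof -
    have "a \<in> {a..b}" "b \<in> {a..b}" "c \<in> {c..d}" using gb by auto
    then show "a \<in> cov gs \<union> {N + 1}" "b \<in> cov gs \<union> {N + 1}" "c \<in> cov gs \<union> {N + 1}"
      using cov_member[OF g(1)] unfolding G pairing.sel by blast+
  qed
  have "f a = f c \<longleftrightarrow> a = c" "f a = f b \<longleftrightarrow> a = b"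
    using squeezes_less[OF f mem(1,3)] squeezes_less[OF f mem(1,2)] gb by force+
  then show ?thesis by (simp add: G is_identity_Pairing)
qed

lemma prepare:
  assumes v: "valid d S"
  shows "\<exists>f. contracted d (State (len S) (filter (\<lambda>g. \<not> is_identity g) (pairings S)) (wts S) (outp S)) f
      (result (contract_static_t (State (len S) (filter (\<lambda>g. \<not> is_identity g) (pairings S)) (wts S) (outp S)))) \<and>
    pairings (prepare S) = merge_all (map (\<lambda>g. trim (pmap f g)) (filter (\<lambda>g. \<not> is_identity g) (pairings S)))"
    and "valid d (prepare S)" and "all_weights d (prepare S) = all_weights d S"
    and "\<forall>g\<in>set (pairings (prepare S)). normal (len (prepare S)) g"
    and "len (prepare S) = 0 \<or> (\<exists>g\<in>set (pairings (prepare S)). ran_hi g = len (prepare S))"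
    and "sorted_wrt unmergeable (pairings (prepare S))"
    and "length (pairings (prepare S)) \<le> length (pairings S)"
proof -
  let ?gs = "filter (\<lambda>g. \<not> is_identity g) (pairings S)"
  let ?S0 = "State (len S) ?gs (wts S) (outp S)"
  define S' where "S' = result (contract_static_t ?S0)"
  have gs: "\<forall>g\<in>set ?gs. is_pairing (len S) g" using v by (simp add: valid_def)
  obtain f where f: "contracted d ?S0 f S'"
    unfolding S'_def using contract_static[of "len S" ?gs d "wts S" "outp S"] v gs
    by (auto simp: valid_def)
  have prep: "prepare S = State (len S') (merge_all (map trim (pairings S'))) (wts S') (outp S')"
    by (simp add: prepare_def S'_def Let_def)
  note fD = contractedD[OF f, unfolded state.sel]
  note gs' = fD(1)
  note sq = fD(2,3)
  have p': "\<forall>g\<in>set (pairings S'). is_pairing (len S') g \<and> \<not> is_identity g"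
    using pmap_is_pairing[OF sq] is_identity_pmap[OF sq(1)] gs by (auto simp: gs')
  then have tn: "\<forall>g\<in>set (map trim (pairings S')). normal (len S') g"
    by (auto intro: trim_normal)
  note m = merge_all[OF tn]
  show "\<exists>f. contracted d ?S0 f (result (contract_static_t ?S0)) \<and>
    pairings (prepare S) = merge_all (map (\<lambda>g. trim (pmap f g)) ?gs)"
    using f by (intro exI[of _ f]) (simp add: prep gs' comp_def flip: S'_def)
  show nm: "\<forall>g\<in>set (pairings (prepare S)). normal (len (prepare S)) g" using m by (simp add: prep)
  obtain n where "chain d 1 (outp S) n" using v by (auto simp: valid_def)
  then have "chain d 1 (outp S') (n + (len S - len S'))" by (rule fD(8))
  then show "valid d (prepare S)"
    using fD(4,7) nm normal_is_pairing by (auto simp: prep valid_def)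
  have "conn (merge_all (map trim (pairings S'))) = conn (pairings S')"
    using m conn_map_trim[of "pairings S'" "len S'"] p' by auto
  then have "orbit_weights (len S') (merge_all (map trim (pairings S'))) d (wts S') =
      orbit_weights (len S') (pairings S') d (wts S')" by (rule orbit_weights_cong)
  moreover have "orbit_weights (len S) ?gs d (wts S) = orbit_weights (len S) (pairings S) d (wts S)"
    using v by (intro orbit_weights_cong conn_delete_identities[where N = "len S"]) (simp add: valid_def)
  ultimately show "all_weights d (prepare S) = all_weights d S"
    unfolding all_weights_def prep state.sel using fD(9) by (simp only:)
  show "len (prepare S) = 0 \<or> (\<exists>g\<in>set (pairings (prepare S)). ran_hi g = len (prepare S))"
  proof (cases "len S' = 0")
    case False
    then have "len S' \<in> {1..len S'}" using fD(4) by simp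
    then have "len S' \<in> cov (pairings S')" using fD(6) by blast
    then obtain g where g: "g \<in> set (pairings S')" "len S' \<in> {dom_lo g..dom_hi g} \<union> {ran_lo g..ran_hi g}"
      by (auto simp: cov_def)
    have "is_pairing (len S') g" using p' g(1) by blast
    then have "ran_hi g = len S'" using g(2) by (cases g) auto
    then have "\<exists>h\<in>set (map trim (pairings S')). ran_hi h = len S'" using g(1) by auto
    then show ?thesis using merge_all_ran_hi[OF tn] by (simp add: prep)
  qed (simp add: prep)
  show "sorted_wrt unmergeable (pairings (prepare S))"
    using m by (simp add: prep unmergeable_def[abs_def])
  show "length (pairings (prepare S)) \<le> length (pairings S)"
  proof -
    have "length (pairings (prepare S)) \<le> length (map trim (pairings S'))" using m by (simp add: prep)
    also have "\<dots> = length ?gs" by (simp add: gs')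
    also have "\<dots> \<le> length (pairings S)" by (rule length_filter_le)
    finally show ?thesis .
  qed
qed

subsection \<open>Transmission, transfer and truncation\<close>

definition transmit_within :: "int \<Rightarrow> pairing \<Rightarrow> pairing \<Rightarrow> pairing" where
  "transmit_within N g h =
    (if ran_lo g \<le> ran_lo h \<and> ran_hi h \<le> N then result (transmit_t g h) else h)"

lemma result_transmit_if_contained [simp]:
  "result (transmit_if_contained_t N g h) = transmit_within N g h"
  by (simp add: transmit_if_contained_t_def transmit_within_def contained_t_def)

definition reduce :: "state \<Rightarrow> state" where
  "reduce S = (case result (extract_maximal_t (pairings S)) of
      None \<Rightarrow> S
    | Some (g, hs) \<Rightarrow> let N = len S; hs' = map (transmit_within N g) hs;
          M = result (cut_point_t (ran_lo g) hs') - 1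
        in State M (with_truncated N M g hs')
             (restrict_weights 1 M (result (transfer_t N g (wts S)))) (outp S))"

lemma result_cycle: "result (cycle_t S) = reduce (prepare S)"
  by (auto simp: cycle_t_def reduce_def prepare_def Let_def comp_def split: option.splits prod.splits)

lemma cut_point:
  "c = result (cut_point_t x hs) \<Longrightarrow>
    x \<le> c \<and> (\<forall>h\<in>set hs. ran_hi h < c) \<and> (c = x \<or> (\<exists>h\<in>set hs. c = ran_hi h + 1))"
proof (induction x hs arbitrary: c rule: cut_point_t.induct)
  case (2 x h hs)
  define x' where "x' = max x (ran_hi h + 1)"
  have "c = result (cut_point_t x' hs)" using "2.prems" by (simp add: x'_def)
  then have "x' \<le> c \<and> (\<forall>h\<in>set hs. ran_hi h < c) \<and> (c = x' \<or> (\<exists>h\<in>set hs. c = ran_hi h + 1))"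
    using "2.IH"[of "ran_hi h + 1" x'] by (simp add: x'_def)
  then show ?case by (auto simp: x'_def max_def split: if_splits)
qed simp

text \<open>
  After the transmissions all ranges except that of the maximal pairing start to the left of the
  maximal range. A transmitted pairing arises from a possibly unordered pair of intervals
  \<open>[a',b']\<close>, \<open>[c',d']\<close> by renaming the left one as the domain.
\<close>

definition transmitted :: "pairing \<Rightarrow> pairing \<Rightarrow> pairing \<Rightarrow> bool" where
  "transmitted g h h' \<longleftrightarrow> (\<exists>a' b' c' d' p'. h' = result (orient_t a' b' c' d' p') \<and>
    1 \<le> a' \<and> 1 \<le> c' \<and> a' < ran_lo g \<and> c' < ran_lo g \<and> b' \<le> dom_hi h \<and> d' < ran_hi h \<and>
    b' - a' = dom_hi h - dom_lo h \<and> d' - c' = dom_hi h - dom_lo h \<and>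
    (preserving g \<longrightarrow> p' = preserving h \<and> d' \<le> ran_hi h - (ran_lo g - dom_lo g)) \<and>
    (\<not> preserving g \<longrightarrow> d' < ran_lo g \<and> (p' = (\<not> preserving h) \<or> b' < ran_lo g)))"

lemma transmit_within:
  assumes g: "normal N g" "ran_hi g = N" and h: "normal N h"
  shows "conn [g, transmit_within N g h] = conn [g, h]"
    and "ran_lo h < ran_lo g \<and> transmit_within N g h = h \<or>
      ran_lo g \<le> ran_lo h \<and> transmitted g h (transmit_within N g h)"
proof -
  have hN: "ran_hi h \<le> N" using h by (rule normal_ran_hi)
  have "conn [g, transmit_within N g h] = conn [g, h] \<and> (ran_lo h < ran_lo g \<and> transmit_within N g h = h \<or>
      ran_lo g \<le> ran_lo h \<and> transmitted g h (transmit_within N g h))"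
  proof (cases "ran_lo g \<le> ran_lo h")
    case False
    then show ?thesis by (simp add: transmit_within_def)
  next
    case True
    then have eq: "transmit_within N g h = result (transmit_t g h)"
      using hN by (simp add: transmit_within_def)
    have hg: "ran_hi h \<le> ran_hi g" using hN g by simp
    have pos: "dom_lo g < ran_lo g" "ran_lo h \<le> ran_hi h" using g h by (cases g; cases h; auto)+
    from transmit[OF g(1) h True hg] obtain a' b' c' d' p' where
      T: "result (transmit_t g h) = result (orient_t a' b' c' d' p')"
      "1 \<le> a'" "1 \<le> c'" "a' < ran_lo g" "c' < ran_lo g" "b' \<le> dom_hi h"
      "b' - a' = dom_hi h - dom_lo h" "d' - c' = dom_hi h - dom_lo h"
      "conn [g, result (transmit_t g h)] = conn [g, h]"
      "preserving g \<Longrightarrow> p' = preserving h"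
      "preserving g \<Longrightarrow> d' \<le> ran_hi h - (ran_lo g - dom_lo g)"
      "\<not> preserving g \<Longrightarrow> d' < ran_lo g"
      "\<not> preserving g \<Longrightarrow> p' = (\<not> preserving h) \<or> b' < ran_lo g"
      by metis
    have "d' < ran_hi h" using T(11,12) pos True by (cases "preserving g") auto
    then have "transmitted g h (result (transmit_t g h))"
      unfolding transmitted_def using T by blast
    then show ?thesis using T(9) True by (simp add: eq)
  qed
  then show "conn [g, transmit_within N g h] = conn [g, h]"
    and "ran_lo h < ran_lo g \<and> transmit_within N g h = h \<or>
      ran_lo g \<le> ran_lo h \<and> transmitted g h (transmit_within N g h)" by blast+
qed

lemma transmit_within_is_pairing:
  assumes g: "normal N g" "ran_hi g = N" and h: "normal N h"
  shows "is_pairing N (transmit_within N g h)" and "ran_lo (transmit_within N g h) < ran_lo g"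
    and "dom_hi (transmit_within N g h) - dom_lo (transmit_within N g h) = dom_hi h - dom_lo h"
proof -
  let ?h = "transmit_within N g h"
  have hb: "dom_hi h \<le> N" "dom_lo h \<le> dom_hi h" "ran_hi h \<le> N" using h by (cases h; auto)+
  from transmit_within(2)[OF g h]
  have "is_pairing N ?h \<and> ran_lo ?h < ran_lo g \<and> dom_hi ?h - dom_lo ?h = dom_hi h - dom_lo h"
  proof
    assume "ran_lo h < ran_lo g \<and> ?h = h"
    then show ?thesis using normal_is_pairing[OF h] by simp
  next
    assume "ran_lo g \<le> ran_lo h \<and> transmitted g h ?h"
    then obtain a' b' c' d' p' where T: "?h = result (orient_t a' b' c' d' p')"
      "1 \<le> a'" "1 \<le> c'" "a' < ran_lo g" "c' < ran_lo g" "b' \<le> dom_hi h" "d' < ran_hi h"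
      "b' - a' = dom_hi h - dom_lo h" "d' - c' = dom_hi h - dom_lo h"
      unfolding transmitted_def by metis
    then show ?thesis using hb by (auto simp: result_orient)
  qed
  then show "is_pairing N ?h" "ran_lo ?h < ran_lo g" "dom_hi ?h - dom_lo ?h = dom_hi h - dom_lo h"
    by blast+
qed

text \<open>
  The ranges of the other pairings end to the left of the points that are cut off, and so do
  their domains, which makes the truncation legitimate. As every point is covered, the maximal
  range ends at the end of the interval; its domain starts before it, so that \<open>M \<ge> 1\<close>.
\<close>

lemma reduce_Some:
  assumes v: "valid d S" and nm: "\<forall>g\<in>set (pairings S). normal (len S) g"
    and top: "len S = 0 \<or> (\<exists>g\<in>set (pairings S). ran_hi g = len S)"
    and ex: "result (extract_maximal_t (pairings S)) = Some (g, hs)"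
  obtains M hs' where "reduce S = State M (with_truncated (len S) M g hs')
      (restrict_weights 1 M (result (transfer_t (len S) g (wts S)))) (outp S)"
    and "hs' = map (transmit_within (len S) g) hs"
    and "mset (pairings S) = add_mset g (mset hs)" "normal (len S) g" "ran_hi g = len S"
    and "\<forall>h\<in>set hs. normal (len S) h \<and> dominates g h"
    and "ran_lo g \<le> M + 1" "M \<le> len S" "1 \<le> M" "\<forall>h\<in>set hs'. ran_hi h \<le> M"
    and "M = ran_lo g - 1 \<or> (\<exists>h\<in>set hs'. ran_hi h = M)"
    and "\<And>h u v. h \<in> set hs' \<Longrightarrow> (u, v) \<in> edge h \<Longrightarrow> u \<le> M \<and> v \<le> M"
    and "\<forall>h\<in>set (with_truncated (len S) M g hs'). is_pairing M h"
proof -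
  let ?N = "len S"
  define hs' where "hs' = map (transmit_within ?N g) hs"
  define M where "M = result (cut_point_t (ran_lo g) hs') - 1"
  note m = extract_maximal_Some[OF ex]
  have mem: "set (pairings S) = insert g (set hs)" using m by (metis set_mset_add_mset_insert set_mset_mset)
  then have g: "normal ?N g" and hs: "\<forall>h\<in>set hs. normal ?N h \<and> dominates g h" using nm m by auto
  have gb: "1 \<le> dom_lo g" "dom_lo g < ran_lo g" "ran_lo g \<le> ran_hi g" "ran_hi g \<le> ?N"
    using g by (cases g; auto)+
  have gN: "ran_hi g = ?N"
  proof -
    from top gb obtain h where h: "h \<in> insert g (set hs)" "ran_hi h = ?N" unfolding mem by fastforce
    then show ?thesis using hs gb by (auto simp: dominates_def)
  qed
  have hs'p: "\<forall>h\<in>set hs'. is_pairing ?N h \<and> ran_lo h < ran_lo g"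
    unfolding hs'_def using transmit_within_is_pairing[OF g gN] hs by auto
  note c = cut_point[of "M + 1" "ran_lo g" hs', unfolded M_def, simplified, folded M_def]
  have rh: "\<forall>h\<in>set hs'. ran_hi h \<le> M" using c by (auto simp: M_def)
  have M1: "ran_lo g \<le> M + 1" using c by (simp add: M_def)
  have M2: "M = ran_lo g - 1 \<or> (\<exists>h\<in>set hs'. ran_hi h = M)" using c by (auto simp: M_def)
  have MN: "M \<le> ?N"
    using M2
  proof
    assume "\<exists>h\<in>set hs'. ran_hi h = M"
    then obtain h where h: "h \<in> set hs'" "ran_hi h = M" by blast
    then have "is_pairing ?N h" using hs'p by blast
    then show ?thesis using h(2) by (cases h) auto
  qed (use gb in simp)
  have hp: "is_pairing M h" if "h \<in> set hs'" for h
  proof -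
    have "is_pairing ?N h" "ran_hi h \<le> M" using hs'p rh that by auto
    then show ?thesis by (cases h) auto
  qed
  have ed: "u \<le> M \<and> v \<le> M" if "h \<in> set hs'" "(u, v) \<in> edge h" for h u v
    using hp[OF that(1)] that(2) by (cases h) (auto simp: edge_Pairing_iff split: if_splits)
  have gt: "is_pairing M g'" if "truncate ?N M g = Some g'" for g'
    using that g gN M1 MN by (cases g) (auto simp: truncate_Pairing split: if_splits)
  have eq: "reduce S = State M (with_truncated ?N M g hs')
      (restrict_weights 1 M (result (transfer_t ?N g (wts S)))) (outp S)"
    unfolding M_def hs'_def by (simp add: reduce_def ex Let_def)
  have pp: "\<forall>h\<in>set (with_truncated ?N M g hs'). is_pairing M h"
    using hp gt by (auto split: option.splits)
  have "1 \<le> M" using gb M1 by linarith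
  show thesis
    by (rule that[OF eq hs'_def conjunct1[OF m] g gN hs M1 MN \<open>1 \<le> M\<close> rh M2 ed pp])
qed

lemma reduce_None:
  assumes "len S = 0 \<or> (\<exists>g\<in>set (pairings S). ran_hi g = len S)"
    and "result (extract_maximal_t (pairings S)) = None"
  shows "reduce S = S" and "len S = 0" and "pairings S = []"
  using assms extract_maximal_None[of "pairings S"] by (auto simp: reduce_def)

lemma conn_transmit_within:
  assumes "normal N g" "ran_hi g = N" "\<forall>h\<in>set hs. normal N h"
  shows "conn (g # map (transmit_within N g) hs) = conn (g # hs)"
  using conn_map_eq[of hs "[g]" "transmit_within N g"] transmit_within(1)[OF assms(1,2)] assms(3)
  by simp

definition bounded_by :: "nat \<Rightarrow> int \<Rightarrow> state \<Rightarrow> bool" where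
  "bounded_by d B S \<longleftrightarrow> (\<forall>i<d. abs_sum d (wts S) i (len S) \<le> B)"

lemma reduce_valid:
  assumes v: "valid d S" and nm: "\<forall>g\<in>set (pairings S). normal (len S) g"
    and top: "len S = 0 \<or> (\<exists>g\<in>set (pairings S). ran_hi g = len S)"
  shows "valid d (reduce S) \<and> all_weights d (reduce S) = all_weights d S \<and>
    (\<forall>B. bounded_by d B S \<longrightarrow> bounded_by d B (reduce S)) \<and>
    length (pairings (reduce S)) \<le> length (pairings S) \<and>
    length (wts (reduce S)) \<le> length (wts S) + 7 \<and> outp (reduce S) = outp S \<and> len (reduce S) \<le> len S"
proof (cases "result (extract_maximal_t (pairings S))")
  case None
  then show ?thesis using reduce_None[OF top None] v by simp
next
  case (Some ghs)
  then obtain g hs where ex: "result (extract_maximal_t (pairings S)) = Some (g, hs)" by (cases ghs) auto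
  show ?thesis
  proof (rule reduce_Some[OF v nm top ex], goal_cases)
    case (1 M hs')
    note R = this
    have L: "chain d 1 (wts S) (len S)" using v by (simp add: valid_def)
    let ?L' = "restrict_weights 1 M (result (transfer_t (len S) g (wts S)))"
    have t1: "chain d 1 ?L' M"
      by (rule truncation_orbit_weights(1)[OF L R(4,5,7,8)]) (use R(12) in blast)
    have t2: "length ?L' \<le> length (wts S) + 7"
      by (rule truncation_orbit_weights(2)[OF L R(4,5,7,8)]) (use R(12) in blast)
    have t3: "orbit_weights M (with_truncated (len S) M g hs') d ?L' = orbit_weights (len S) (g # hs') d (wts S)"
      by (rule truncation_orbit_weights(3)[OF L R(4,5,7,8)]) (use R(12) in blast)
    have t4: "abs_sum d ?L' i M \<le> abs_sum d (wts S) i (len S)" if "i < d" for i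
      by (rule truncation_orbit_weights(4)[OF L R(4,5,7,8) _ that]) (use R(12) in blast)
    have "conn (g # hs') = conn (g # hs)" unfolding R(2)
      using R(6) by (intro conn_transmit_within R(4,5)) auto
    also have "\<dots> = conn (pairings S)"
      using R(3) by (intro conn_cong) (metis list.simps(15) set_mset_add_mset_insert set_mset_mset)
    finally have "orbit_weights (len S) (g # hs') d (wts S) = orbit_weights (len S) (pairings S) d (wts S)"
      by (rule orbit_weights_cong)
    then have "all_weights d (reduce S) = all_weights d S" using t3 R(1) by (simp add: all_weights_def)
    moreover have "valid d (reduce S)" using v t1 R(1,9,13) by (simp add: valid_def)
    moreover have "bounded_by d B S \<longrightarrow> bounded_by d B (reduce S)" for B
      using t4 R(1) by (auto simp: bounded_by_def intro: order_trans)
    moreover have "length (pairings (reduce S)) \<le> length (pairings S)"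
    proof -
      have "length (pairings S) = Suc (length hs)" using arg_cong[OF R(3), of size] by simp
      then show ?thesis using R(1,2) by (simp split: option.splits)
    qed
    ultimately show ?thesis using t2 R(1,8) by simp
  qed
qed

lemma prepare_bounds:
  assumes v: "valid d S"
  shows "bounded_by d B S \<Longrightarrow> bounded_by d B (prepare S)"
    and "length (wts (prepare S)) \<le> length (wts S) + 2 + 4 * length (pairings S)"
    and "length (outp (prepare S)) \<le> length (outp S) + length (wts S) + 2 + 4 * length (pairings S)"
    and "len (prepare S) \<le> len S"
    and "chain d 1 (outp S) n \<Longrightarrow> chain d 1 (outp (prepare S)) (n + (len S - len (prepare S)))"
proof -
  let ?gs = "filter (\<lambda>g. \<not> is_identity g) (pairings S)"
  let ?S0 = "State (len S) ?gs (wts S) (outp S)"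
  obtain f where f: "contracted d ?S0 f (result (contract_static_t ?S0))"
    using prepare(1)[OF v] by blast
  note fD = contractedD[OF f, unfolded state.sel]
  have L: "chain d 1 (wts S) (len S)" using v by (simp add: valid_def)
  have mk: "card (marks (len S) ?gs (wts S)) \<le> length (wts S) + 2 + 4 * length (pairings S)"
    using card_marks(2)[OF L, of ?gs] length_filter_le[of "\<lambda>g. \<not> is_identity g" "pairings S"] by linarith
  have prep: "len (prepare S) = len (result (contract_static_t ?S0))"
    "wts (prepare S) = wts (result (contract_static_t ?S0))"
    "outp (prepare S) = outp (result (contract_static_t ?S0))"
    by (simp_all add: prepare_def Let_def)
  show "bounded_by d B (prepare S)" if B: "bounded_by d B S"
    unfolding bounded_by_def prep
  proof (intro allI impI)
    fix i assume i: "i < d"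
    show "abs_sum d (wts (result (contract_static_t ?S0))) i (len (result (contract_static_t ?S0))) \<le> B"
      using order_trans[OF fD(10)[OF i]] B i by (simp add: bounded_by_def)
  qed
  show "length (wts (prepare S)) \<le> length (wts S) + 2 + 4 * length (pairings S)"
    using fD(11,12) mk unfolding prep by linarith
  show "length (outp (prepare S)) \<le> length (outp S) + length (wts S) + 2 + 4 * length (pairings S)"
    using fD(11,12) mk unfolding prep by linarith
  show "len (prepare S) \<le> len S" unfolding prep by (rule fD(5))
  show "chain d 1 (outp S) n \<Longrightarrow> chain d 1 (outp (prepare S)) (n + (len S - len (prepare S)))"
    unfolding prep by (rule fD(8))
qed

lemma cycle_valid:
  assumes v: "valid d S"
  defines "S' \<equiv> result (cycle_t S)"
  shows "valid d S'" and "all_weights d S' = all_weights d S"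
    and "bounded_by d B S \<Longrightarrow> bounded_by d B S'"
    and "length (pairings S') \<le> length (pairings S)"
    and "length (wts S') \<le> length (wts S) + 9 + 4 * length (pairings S)"
    and "length (outp S') \<le> length (outp S) + length (wts S) + 2 + 4 * length (pairings S)"
    and "len S' \<le> len S"
proof -
  note p = prepare[OF v]
  note r = reduce_valid[OF p(2,4,5)]
  note b = prepare_bounds[OF v]
  show "valid d S'" "all_weights d S' = all_weights d S"
    using r p(3) by (simp_all add: S'_def result_cycle)
  show "bounded_by d B S \<Longrightarrow> bounded_by d B S'" using r b(1) by (simp add: S'_def result_cycle)
  show "length (pairings S') \<le> length (pairings S)"
    using r p(7) by (simp add: S'_def result_cycle)
  show "length (wts S') \<le> length (wts S) + 9 + 4 * length (pairings S)"
    using r b(2) by (simp add: S'_def result_cycle)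
  show "length (outp S') \<le> length (outp S) + length (wts S) + 2 + 4 * length (pairings S)"
    using r b(3) by (simp add: S'_def result_cycle)
  show "len S' \<le> len S" using r b(4) by (simp add: S'_def result_cycle)
qed

section \<open>The length of a phase\<close>

text \<open>
  A phase is a sequence of cycles in which no pairing disappears and no width shrinks by more
  than the factor \<open>1 - \<epsilon>\<close>, \<open>\<epsilon> = 1 / (32 k\<^sup>2)\<close>. Pairings carry labels \<open>i < k\<close>. At stage \<open>s\<close>,
  \<open>p s\<close> is the label of the maximal pairing, \<open>tau s\<close> the number of points that are truncated,
  \<open>w s i\<close> the width, \<open>dR s i\<close> and \<open>dD s i\<close> the distances of range and domain from the right
  end of the current interval, \<open>t s i\<close> the translation distance; \<open>cont s i\<close> says
  that the range of \<open>i\<close> lies in that of \<open>p s\<close>, and \<open>val s i\<close> is a quantity which controls the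
  cycles in which the maximal pairing stays the same.
\<close>

locale phase =
  fixes k T R :: nat and eps :: real and p :: "nat \<Rightarrow> nat" and tau :: "nat \<Rightarrow> int"
    and w dR dD t val :: "nat \<Rightarrow> nat \<Rightarrow> int" and pres cont :: "nat \<Rightarrow> nat \<Rightarrow> bool"
  assumes eps_def: "eps = 1 / (32 * real k ^ 2)"
    and p_less: "s \<le> T \<Longrightarrow> p s < k"
    and w_pos: "s \<le> T \<Longrightarrow> i < k \<Longrightarrow> 1 \<le> w s i"
    and w_mono: "s < T \<Longrightarrow> i < k \<Longrightarrow> w (Suc s) i \<le> w s i"
    and w_eps: "s \<le> T \<Longrightarrow> i < k \<Longrightarrow> (1 - eps) * w 0 i \<le> w s i"
    and tau_nonneg: "s < T \<Longrightarrow> 0 \<le> tau s"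
    and w_max: "s < T \<Longrightarrow> w (Suc s) (p s) = w s (p s) - tau s"
    and dR_nonneg: "s \<le> T \<Longrightarrow> i < k \<Longrightarrow> 0 \<le> dR s i"
    and dD_nonneg: "s \<le> T \<Longrightarrow> i < k \<Longrightarrow> 0 \<le> dD s i"
    and dR_max: "s \<le> T \<Longrightarrow> dR s (p s) = 0"
    and dR_max': "s < T \<Longrightarrow> dR (Suc s) (p s) = 0"
    and dD_max: "s < T \<Longrightarrow> min (dD s (p s) - tau s) (w (Suc s) (p s)) \<le> dD (Suc s) (p s)"
    and move: "s < T \<Longrightarrow> i < k \<Longrightarrow> i \<noteq> p s \<Longrightarrow>
      X = max (dR s i) (if \<not> cont s i then 0 else if pres s (p s) then t s (p s) else w s (p s)) \<Longrightarrow>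
      min (X - tau s) (w (Suc s) (p s)) \<le> dR (Suc s) i \<and> min (dD s i - tau s) (w (Suc s) (p s)) \<le> dD (Suc s) i \<or>
      min (X - tau s) (w (Suc s) (p s)) \<le> dD (Suc s) i \<and> min (dD s i - tau s) (w (Suc s) (p s)) \<le> dR (Suc s) i"
    and change: "s < T \<Longrightarrow> p (Suc s) \<noteq> p s \<Longrightarrow>
      cont (Suc s) (p s) \<and> w (Suc s) (p s) \<le> w (Suc s) (p (Suc s))"
    and pres_max: "s < T \<Longrightarrow> pres (Suc s) (p s) = pres s (p s)"
    and t_max: "s < T \<Longrightarrow> pres s (p s) \<Longrightarrow> t (Suc s) (p s) \<le> t s (p s)"
    and t_pos: "s \<le> T \<Longrightarrow> i < k \<Longrightarrow> 0 < t s i"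
    and apart: "s \<le> T \<Longrightarrow> i < k \<Longrightarrow> i \<noteq> p s \<Longrightarrow> cont s i \<Longrightarrow> pres s i \<Longrightarrow> pres s (p s) \<Longrightarrow>
      t s i \<le> w s i \<Longrightarrow> t s (p s) \<le> w s (p s) \<Longrightarrow> w s i < t s (p s)"
    and stay_val: "s < T \<Longrightarrow> p (Suc s) = p s \<Longrightarrow> \<exists>i<k. i \<noteq> p s \<and> 1 \<le> val s i"
    and stay_halves: "s < T \<Longrightarrow> p (Suc s) = p s \<Longrightarrow> i < k \<Longrightarrow> i \<noteq> p s \<Longrightarrow>
      val (Suc s) i \<le> max (val s i) 1 div 2"
    and val_less: "s \<le> T \<Longrightarrow> i < k \<Longrightarrow> val s i < 2 ^ R"
begin

lemma k_pos: "1 \<le> k" using p_less[of 0] by simp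

lemma eps_bounds: "0 < eps" "eps \<le> 1 / 32" "real k ^ 2 * eps \<le> 1 / 32" "real k * eps \<le> 1 / 32"
proof -
  have k1: "1 \<le> real k" using k_pos by simp
  then have "1 \<le> real k ^ 2" by simp
  then show "0 < eps" "eps \<le> 1 / 32" "real k ^ 2 * eps \<le> 1 / 32"
    using k1 unfolding eps_def by (auto simp: field_simps)
  have "real k * eps = 1 / (32 * real k)" unfolding eps_def using k1 by (simp add: power2_eq_square)
  also have "\<dots> \<le> 1 / 32" using k1 by (simp add: field_simps)
  finally show "real k * eps \<le> 1 / 32" .
qed

lemma w_le: "s \<le> T \<Longrightarrow> i < k \<Longrightarrow> w s i \<le> w 0 i"
proof (induction s)
  case (Suc s)
  then show ?case using w_mono[of s i] by simp
qed simp

text \<open>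
  The maximal range of the next stage contains what is left of the present one. So the widths
  of successive maximal pairings hardly decrease; repeated labels can be cut out of a sequence of
  successors, so that they hardly decrease over arbitrarily long times.
\<close>

lemma width_next: "s < T \<Longrightarrow> (1 - eps) * w 0 (p s) \<le> w 0 (p (Suc s))"
proof (cases "p (Suc s) = p s")
  case True
  assume s: "s < T"
  have "0 \<le> real_of_int (w 0 (p s))" using w_pos[of 0 "p s"] p_less[of s] s by simp
  then show ?thesis using True eps_bounds(1) by (simp add: algebra_simps)
next
  case False
  assume s: "s < T"
  have "(1 - eps) * w 0 (p s) \<le> w (Suc s) (p s)" using w_eps[of "Suc s" "p s"] p_less[of s] s by simp
  also have "\<dots> \<le> w (Suc s) (p (Suc s))" using change[OF s False] by simp
  also have "\<dots> \<le> w 0 (p (Suc s))" using w_le[of "Suc s"] p_less[of "Suc s"] s by simp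
  finally show ?thesis .
qed

lemma width_later:
  assumes "s \<le> s'" "s' \<le> T"
  shows "3 / 4 * w 0 (p s) \<le> w 0 (p s')"
proof -
  define E where "E = {(i, j). i < k \<and> j < k \<and> (1 - eps) * w 0 i \<le> w 0 j}"
  have sub: "E \<subseteq> {..<k} \<times> {..<k}" by (auto simp: E_def)
  then have fin: "finite E" by (rule finite_subset) simp
  have cardE: "card E \<le> k ^ 2"
    using card_mono[OF _ sub] by (simp add: power2_eq_square)
  have path: "s' \<le> T \<Longrightarrow> (p s, p s') \<in> E\<^sup>*"
    using assms(1)
  proof (induction s' rule: dec_induct)
    case (step n)
    then have "(p n, p (Suc n)) \<in> E"
      using width_next[of n] p_less[of n] p_less[of "Suc n"] by (simp add: E_def)
    then show ?case using step by (simp add: rtrancl.rtrancl_into_rtrancl)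
  qed simp
  then obtain n where n: "n \<le> card E" "(p s, p s') \<in> E ^^ n"
    using rtrancl_finite_eq_relpow[OF fin] assms(2) by auto
  have pw: "(i, j) \<in> E ^^ n \<Longrightarrow> (1 - eps) ^ n * w 0 i \<le> w 0 j" for n i j
  proof (induction n arbitrary: j)
    case (Suc n)
    then obtain l where l: "(i, l) \<in> E ^^ n" "(l, j) \<in> E" by auto
    have "(1 - eps) ^ Suc n * w 0 i = (1 - eps) * ((1 - eps) ^ n * w 0 i)" by simp
    also have "\<dots> \<le> (1 - eps) * w 0 l"
      using Suc.IH[OF l(1)] eps_bounds(2) by (intro mult_left_mono) auto
    also have "\<dots> \<le> w 0 j" using l(2) by (simp add: E_def)
    finally show ?case .
  qed simp
  have W: "0 \<le> real_of_int (w 0 (p s))" using w_pos[of 0 "p s"] p_less[of s] assms by simp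
  have "real n * eps \<le> real k ^ 2 * eps"
    using n(1) cardE eps_bounds(1) by (intro mult_right_mono) (auto simp flip: of_nat_power)
  then have "3 / 4 \<le> 1 + real n * (- eps)" using eps_bounds(3) by simp
  also have "\<dots> \<le> (1 + - eps) ^ n" by (rule Bernoulli_inequality) (use eps_bounds(2) in simp)
  finally have "3 / 4 * w 0 (p s) \<le> (1 - eps) ^ n * w 0 (p s)"
    using W by (intro mult_right_mono) simp_all
  also have "\<dots> \<le> w 0 (p s')" by (rule pw[OF n(2)])
  finally show ?thesis .
qed

text \<open>The total number of truncated points is small compared with the present maximal width.\<close>

definition Tsum :: "nat \<Rightarrow> int" where
  "Tsum s = (\<Sum>s'<s. tau s')"

lemma Tsum_Suc: "Tsum (Suc s) = Tsum s + tau s"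
  by (simp add: Tsum_def)

lemma truncated_label:
  "s \<le> T \<Longrightarrow> i < k \<Longrightarrow> (\<Sum>s'<s. if p s' = i then tau s' else 0) \<le> w 0 i - w s i"
proof (induction s)
  case (Suc s)
  then have "s < T" by simp
  then show ?case using Suc w_mono[of s i] w_max[of s] by (cases "p s = i") auto
qed simp

lemma Tsum_small:
  assumes "Suc s \<le> T"
  shows "Tsum (Suc s) \<le> w 0 (p s) / 24"
proof -
  let ?W = "real_of_int (w 0 (p s))"
  have W: "0 \<le> ?W" using w_pos[of 0 "p s"] p_less[of s] assms by simp
  have "(\<Sum>i<k. if p s' = i then tau s' else 0) = tau s'" if "s' < Suc s" for s'
    using p_less[of s'] that assms by simp
  then have "Tsum (Suc s) = (\<Sum>s'<Suc s. \<Sum>i<k. if p s' = i then tau s' else 0)"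
    unfolding Tsum_def by (intro sum.cong) auto
  also have "\<dots> = (\<Sum>i<k. \<Sum>s'<Suc s. if p s' = i then tau s' else 0)" by (rule sum.swap)
  finally have T: "real_of_int (Tsum (Suc s)) =
      (\<Sum>i<k. real_of_int (\<Sum>s'<Suc s. if p s' = i then tau s' else 0))" by simp
  have "real_of_int (\<Sum>s'<Suc s. if p s' = i then tau s' else 0) \<le> eps * (4 / 3 * ?W)" if i: "i < k" for i
  proof (cases "i \<in> p ` {..<Suc s}")
    case True
    then obtain s' where "s' < Suc s" "i = p s'" by blast
    then have s': "s' \<le> s" "i = p s'" by simp_all
    have "3 / 4 * w 0 i \<le> ?W" using width_later[of s' s] s' assms by simp
    then have "w 0 i \<le> 4 / 3 * ?W" by simp
    then have "eps * w 0 i \<le> eps * (4 / 3 * ?W)"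
      using eps_bounds(1) by (intro mult_left_mono) auto
    moreover have "real_of_int (\<Sum>s'<Suc s. if p s' = i then tau s' else 0) \<le> w 0 i - w (Suc s) i"
      using truncated_label[OF assms i] by (metis of_int_diff of_int_le_iff)
    moreover have "w 0 i - w (Suc s) i \<le> eps * w 0 i"
      using w_eps[OF assms i] by (simp add: algebra_simps)
    ultimately show ?thesis by linarith
  next
    case False
    then have "(\<Sum>s'<Suc s. if p s' = i then tau s' else 0) = 0" by (intro sum.neutral) auto
    then show ?thesis using W eps_bounds(1) by simp
  qed
  then have "real_of_int (Tsum (Suc s)) \<le> (\<Sum>i<k. eps * (4 / 3 * ?W))"
    unfolding T by (intro sum_mono) auto
  also have "\<dots> = (real k * eps) * (4 / 3 * ?W)" by simp
  also have "\<dots> \<le> 1 / 32 * (4 / 3 * ?W)"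
    using eps_bounds(4) W by (intro mult_right_mono) auto
  finally show ?thesis by simp
qed

text \<open>
  An interval is spent once its distance from the right end, corrected by the truncations so far,
  is a fixed fraction of its width. It remains spent, as contractions only take
  place to the left of the maximal range; so it never becomes maximal again.
\<close>

definition spent :: "nat \<Rightarrow> nat \<Rightarrow> int \<Rightarrow> nat" where
  "spent j s x = (if w 0 j / 8 \<le> x + Tsum s then 1 else 0)"

definition count :: "nat \<Rightarrow> nat \<Rightarrow> nat" where
  "count j s = spent j s (dR s j) + spent j s (dD s j)"

lemma window_large:
  assumes "s0 \<le> s" "s < T" "p s0 = j"
  shows "w 0 j / 8 \<le> w (Suc s) (p s)"
proof -
  have W: "0 \<le> real_of_int (w 0 (p s))" using w_pos[of 0 "p s"] p_less[of s] assms by simp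
  have "3 / 4 * w 0 j \<le> w 0 (p s)" using width_later[of s0 s] assms by simp
  moreover have "(1 - eps) * w 0 (p s) \<le> w (Suc s) (p s)" using w_eps[of "Suc s" "p s"] p_less[of s] assms by simp
  moreover have "eps * w 0 (p s) \<le> 1 / 32 * w 0 (p s)"
    using eps_bounds(2) W by (intro mult_right_mono) auto
  moreover have "0 \<le> real_of_int (w 0 j)" using w_pos[of 0 j] p_less[of s0] assms by simp
  ultimately show ?thesis by (simp add: algebra_simps)
qed

lemma spent_step:
  assumes "s0 \<le> s" "s < T" "p s0 = j" "min (x - tau s) (w (Suc s) (p s)) \<le> x'"
  shows "spent j s x \<le> spent j (Suc s) x'"
proof (cases "w 0 j / 8 \<le> x + Tsum s")
  case True
  have nn: "0 \<le> Tsum (Suc s)" unfolding Tsum_def using assms(2) by (intro sum_nonneg tau_nonneg) auto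
  have "w 0 j / 8 \<le> x' + Tsum (Suc s)"
  proof (cases "x - tau s \<le> w (Suc s) (p s)")
    case True
    then have "x + Tsum s \<le> x' + Tsum (Suc s)" using assms(4) by (simp add: Tsum_Suc)
    then have "real_of_int (x + Tsum s) \<le> real_of_int (x' + Tsum (Suc s))" by (rule of_int_le_iff[THEN iffD2])
    then show ?thesis using \<open>w 0 j / 8 \<le> x + Tsum s\<close> by linarith
  next
    case False
    then have "w (Suc s) (p s) \<le> x' + Tsum (Suc s)" using assms(4) nn by simp
    then have "real_of_int (w (Suc s) (p s)) \<le> real_of_int (x' + Tsum (Suc s))" by (rule of_int_le_iff[THEN iffD2])
    then show ?thesis using window_large[OF assms(1-3)] by linarith
  qed
  then show ?thesis by (simp add: spent_def)
qed (simp add: spent_def)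

lemma count_mono:
  assumes "s0 \<le> s" "s < T" "p s0 = j"
  shows "count j s \<le> count j (Suc s)"
proof -
  note st = spent_step[OF assms]
  have j: "j < k" using p_less[of s0] assms by simp
  show ?thesis
  proof (cases "j = p s")
    case True
    have "w (Suc s) (p s) \<ge> 0" using w_pos[of "Suc s" "p s"] p_less[of s] assms by simp
    then have "spent j s (dR s j) \<le> spent j (Suc s) (dR (Suc s) j)"
      using dR_max[of s] dR_max'[of s] tau_nonneg[of s] assms True by (intro st) auto
    moreover have "spent j s (dD s j) \<le> spent j (Suc s) (dD (Suc s) j)"
      using dD_max[of s] assms True by (intro st) auto
    ultimately show ?thesis by (simp add: count_def)
  next
    case False
    define K where "K = (if \<not> cont s j then 0 else if pres s (p s) then t s (p s) else w s (p s))"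
    define X where "X = max (dR s j) K"
    have "min (dR s j - tau s) (w (Suc s) (p s)) \<le> min (X - tau s) (w (Suc s) (p s))"
      by (simp add: X_def)
    then show ?thesis
      using move[OF assms(2) j False, folded K_def, OF X_def]
        st[of "dR s j" "dR (Suc s) j"] st[of "dR s j" "dD (Suc s) j"]
        st[of "dD s j" "dR (Suc s) j"] st[of "dD s j" "dD (Suc s) j"]
      unfolding count_def by fastforce
  qed
qed

text \<open>
  An event: the pairing which was maximal in the stage before is transmitted by a distance of
  at least half its width. This makes its range spent.
\<close>

definition event :: "nat \<Rightarrow> nat \<Rightarrow> bool" where
  "event s j \<longleftrightarrow> (\<exists>s'. s = Suc s' \<and> p s' = j) \<and> s < T \<and> p s \<noteq> j \<and> cont s j \<and>
    w s j \<le> 2 * (if pres s (p s) then t s (p s) else w s (p s))"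

lemma event_count:
  assumes "event s j"
  shows "count j s < count j (Suc s)"
proof -
  obtain s' where s': "s = Suc s'" "p s' = j" and s: "s < T" "p s \<noteq> j" "cont s j"
    "w s j \<le> 2 * (if pres s (p s) then t s (p s) else w s (p s))"
    using assms by (auto simp: event_def)
  have j: "j < k" using p_less[of s'] s' s by simp
  have W: "1 \<le> real_of_int (w 0 j)" using w_pos[of 0 j] j by simp
  have s'T: "s' < T" using s s' by simp
  have d0: "dR s j = 0" using dR_max'[OF s'T] s' by simp
  have Ts: "Tsum s \<le> w 0 j / 24" using Tsum_small[of s'] s' s by simp
  then have old: "spent j s (dR s j) = 0" using d0 W by (simp add: spent_def)
  have w1: "s' \<le> s" using s' by simp
  note st = spent_step[OF w1 s(1) s'(2)]
  have le1: "spent j (Suc s) y \<le> 1" for y by (simp add: spent_def)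
  have gain: "spent j (Suc s) x = 1" if x: "min (max (dR s j) K - tau s) (w (Suc s) (p s)) \<le> x"
    and K: "K = (if \<not> cont s j then 0 else if pres s (p s) then t s (p s) else w s (p s))" for x K
  proof -
    have K2: "w s j \<le> 2 * K" using s K by simp
    have ws: "(1 - eps) * w 0 j \<le> w s j" using w_eps[of s j] s j by simp
    have "eps * w 0 j \<le> 1 / 32 * w 0 j" using eps_bounds(2) W by (intro mult_right_mono) auto
    then have "31 / 32 * w 0 j \<le> w s j" using ws by (simp add: algebra_simps)
    moreover have "real_of_int (w s j) \<le> real_of_int (2 * K)" using K2 by (rule of_int_le_iff[THEN iffD2])
    ultimately have "31 / 64 * w 0 j \<le> K" by simp
    moreover have "0 \<le> real_of_int (Tsum s)" unfolding Tsum_def of_int_sum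
      using s(1) tau_nonneg by (intro sum_nonneg) auto
    ultimately have "w 0 j / 8 \<le> K + Tsum s" using W by simp
    then have "spent j s K = 1" by (simp add: spent_def)
    moreover have "spent j s K \<le> spent j (Suc s) x" using x by (intro st) auto
    ultimately show ?thesis using le1[of x] by linarith
  qed
  have neq: "j \<noteq> p s" using s by simp
  show ?thesis
    using move[OF s(1) j neq refl]
  proof (elim disjE conjE)
    assume "min (max (dR s j) (if \<not> cont s j then 0 else if pres s (p s) then t s (p s) else w s (p s)) - tau s)
        (w (Suc s) (p s)) \<le> dR (Suc s) j"
      and "min (dD s j - tau s) (w (Suc s) (p s)) \<le> dD (Suc s) j"
    from gain[OF this(1) refl] st[OF this(2)] old show ?thesis by (simp add: count_def)
  next
    assume "min (max (dR s j) (if \<not> cont s j then 0 else if pres s (p s) then t s (p s) else w s (p s)) - tau s)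
        (w (Suc s) (p s)) \<le> dD (Suc s) j"
      and "min (dD s j - tau s) (w (Suc s) (p s)) \<le> dR (Suc s) j"
    from gain[OF this(1) refl] st[OF this(2)] old show ?thesis by (simp add: count_def)
  qed
qed

lemma event_max: "event s j \<Longrightarrow> \<exists>s0<s. p s0 = j"
  by (auto simp: event_def)

definition events :: "nat \<Rightarrow> nat \<Rightarrow> nat" where
  "events j s = card {s'. s' < s \<and> event s' j}"

lemma events_Suc: "events j (Suc s) = events j s + (if event s j then 1 else 0)"
proof -
  have "{s'. s' < Suc s \<and> event s' j} = {s'. s' < s \<and> event s' j} \<union> (if event s j then {s} else {})"
    by (auto simp: less_Suc_eq)
  then show ?thesis by (simp add: events_def)
qed

lemma events_count: "s \<le> T \<Longrightarrow> events j s \<le> count j s \<or> events j s = 0"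
proof (induction s)
  case 0
  then show ?case by (simp add: events_def)
next
  case (Suc s)
  then have IH: "events j s \<le> count j s \<or> events j s = 0" and s: "s < T" by auto
  show ?case
  proof (cases "events j s = 0")
    case True
    then show ?thesis using event_count[of s j] by (auto simp: events_Suc)
  next
    case False
    then have "{s'. s' < s \<and> event s' j} \<noteq> {}" by (metis card.empty events_def)
    then obtain s'' where "s'' < s" "event s'' j" by blast
    moreover from event_max[OF this(2)] obtain s0 where "s0 < s''" "p s0 = j" by blast
    ultimately have "s0 \<le> s" "p s0 = j" by simp_all
    then have "count j s \<le> count j (Suc s)" using count_mono s by blast
    then show ?thesis using IH False event_count[of s j] by (auto simp: events_Suc)
  qed
qed

text \<open>
  The range and the domain of a pairing can be spent only once each, and every event spends one of
  them.
\<close>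

lemma events_le_2: "s \<le> T \<Longrightarrow> events j s \<le> 2"
  using events_count[of s j] by (auto simp: count_def spent_def split: if_splits)

text \<open>The maximal pairing cannot stay the same for long.\<close>

lemma maximal_changes:
  assumes "s + R + 1 \<le> T"
  shows "\<exists>s'. s \<le> s' \<and> s' \<le> s + R \<and> p (Suc s') \<noteq> p s'"
proof (rule ccontr)
  assume "\<not> ?thesis"
  then have stay: "p (Suc s') = p s'" if "s \<le> s'" "s' \<le> s + R" for s' using that by blast
  have ps: "p (s + m) = p s" if "m \<le> R" for m using that
    by (induction m) (use stay in auto)
  have "m \<le> R \<Longrightarrow> i < k \<Longrightarrow> i \<noteq> p s \<Longrightarrow> val (s + m) i < 2 ^ (R - m)" for m i
  proof (induction m)
    case 0
    then show ?case using val_less[of s i] assms by simp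
  next
    case (Suc m)
    then have IH: "val (s + m) i < 2 ^ (R - m)" by simp
    have "R - m = Suc (R - Suc m)" using Suc.prems by simp
    then have "val (s + m) i < 2 * 2 ^ (R - Suc m)" using IH by simp
    moreover have one: "(1::int) \<le> 2 ^ (R - Suc m)" by simp
    have "(1::int) < 2 * 2 ^ (R - Suc m)" using one by linarith
    ultimately have "max (val (s + m) i) 1 < 2 * 2 ^ (R - Suc m)" by (simp only: max_less_iff_conj)
    then have "max (val (s + m) i) 1 div 2 < 2 ^ (R - Suc m)" by linarith
    moreover have "val (Suc (s + m)) i \<le> max (val (s + m) i) 1 div 2"
      using Suc.prems ps[of m] stay[of "s + m"] assms by (intro stay_halves) auto
    ultimately show ?case by simp
  qed
  from this[of R] have "\<forall>i<k. i \<noteq> p s \<longrightarrow> val (s + R) i < 1" by simp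
  moreover have "\<exists>i<k. i \<noteq> p (s + R) \<and> 1 \<le> val (s + R) i"
    using assms stay[of "s + R"] by (intro stay_val) auto
  ultimately show False using ps[of R] by fastforce
qed

text \<open>
  If the new maximal pairing \<open>q\<close> moves the old one by less than half its width, then \<open>q\<close> is
  periodic with a small period. It remains so until it is itself transmitted; the periodic
  intervals of pairings which cannot be merged overlap little, so it is then moved by more
  than its width.
\<close>

lemma event_exists:
  assumes "s + 2 * R + 3 \<le> T"
  shows "\<exists>e j. s < e \<and> e \<le> s + 2 * R + 2 \<and> event e j"
proof -
  obtain s1 where s1: "s \<le> s1" "s1 \<le> s + R" "p (Suc s1) \<noteq> p s1"
    using maximal_changes[of s] assms by auto
  define j q where "j = p s1" and "q = p (Suc s1)"
  have s1T: "s1 < T" "Suc s1 < T" using s1 assms by auto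
  have ch: "cont (Suc s1) j" "w (Suc s1) j \<le> w (Suc s1) q"
    using change[OF s1T(1) s1(3)] by (auto simp: j_def q_def)
  show ?thesis
  proof (cases "pres (Suc s1) q \<and> 2 * t (Suc s1) q < w (Suc s1) j")
    case False
    have "1 \<le> w (Suc s1) q" using w_pos[of "Suc s1" q] p_less[of "Suc s1"] s1T by (simp add: q_def)
    then have "event (Suc s1) j"
      using False s1T s1(3) ch by (auto simp: event_def j_def q_def)
    then show ?thesis using s1 by (intro exI[of _ "Suc s1"] exI[of _ j]) simp
  next
    case True
    define P where "P s' \<longleftrightarrow> Suc s1 \<le> s' \<and> p (Suc s') \<noteq> p s'" for s'
    obtain s'' where "P s''" "s'' \<le> Suc s1 + R"
      using maximal_changes[of "Suc s1"] s1 assms by (auto simp: P_def)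
    define s2 where "s2 = (LEAST s'. P s')"
    have s2: "P s2" "s2 \<le> Suc s1 + R"
      unfolding s2_def using LeastI[of P, OF \<open>P s''\<close>] Least_le[of P, OF \<open>P s''\<close>] \<open>s'' \<le> Suc s1 + R\<close>
      by linarith+
    have s2_least: "\<not> P s'" if "s' < s2" for s'
      using that unfolding s2_def by (rule not_less_Least)
    have s2T: "s2 < T" "Suc s2 < T" using s2(2) s1 assms by auto
    have const: "Suc s1 \<le> s' \<Longrightarrow> s' \<le> s2 \<Longrightarrow> p s' = q" for s'
    proof (induction s' rule: dec_induct)
      case (step n)
      then have "\<not> P n" using s2_least[of n] by simp
      then show ?case using step by (simp add: P_def)
    qed (simp add: q_def)
    have inv: "Suc s1 \<le> s' \<Longrightarrow> s' \<le> Suc s2 \<Longrightarrow> pres s' q \<and> t s' q \<le> t (Suc s1) q" for s'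
    proof (induction s' rule: dec_induct)
      case (step n)
      then have "p n = q" "n < T" using const[of n] s2T by auto
      then show ?case using step pres_max[of n] t_max[of n] by auto
    qed (use True in simp)
    have s12: "Suc s1 \<le> s2" using s2(1) by (simp add: P_def)
    have pq: "p s2 = q" using const[of s2] s12 by simp
    define q' where "q' = p (Suc s2)"
    have nq: "q' \<noteq> q" using s2(1) pq by (simp add: P_def q'_def)
    have ch2: "cont (Suc s2) q" "w (Suc s2) q \<le> w (Suc s2) q'"
      using change[OF s2T(1)] s2(1) pq by (auto simp: P_def q'_def)
    have qk: "q < k" using p_less[of "Suc s1"] s1T by (simp add: q_def)
    have Wq: "1 \<le> real_of_int (w 0 q)" using w_pos[of 0 q] qk by simp
    have "(1 - eps) * w 0 q \<le> w (Suc s2) q" using w_eps[of "Suc s2" q] qk s2T by simp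
    moreover have "eps * w 0 q \<le> 1 / 32 * w 0 q" using eps_bounds(2) Wq by (intro mult_right_mono) auto
    moreover have "w (Suc s1) q \<le> w 0 q" using w_le[of "Suc s1" q] qk s1T by simp
    ultimately have "31 / 32 * w (Suc s1) q \<le> w (Suc s2) q" by (simp add: algebra_simps)
    moreover have "2 * t (Suc s1) q < w (Suc s1) q" using True ch(2) by simp
    moreover have "0 < t (Suc s1) q" using t_pos[of "Suc s1" q] qk s1T by simp
    ultimately have "t (Suc s1) q \<le> w (Suc s2) q" by linarith
    then have per: "pres (Suc s2) q" "t (Suc s2) q \<le> w (Suc s2) q" using inv[of "Suc s2"] s12 by auto
    have "w (Suc s2) q \<le> 2 * (if pres (Suc s2) q' then t (Suc s2) q' else w (Suc s2) q')"
    proof (cases "pres (Suc s2) q'")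
      case True
      have "w (Suc s2) q < t (Suc s2) q'"
      proof (cases "t (Suc s2) q' \<le> w (Suc s2) q'")
        case True
        then show ?thesis
          using apart[of "Suc s2" q] s2T qk nq ch2 per \<open>pres (Suc s2) q'\<close> by (simp add: q'_def)
      qed (use ch2 in simp)
      moreover have "1 \<le> w (Suc s2) q" using w_pos[of "Suc s2" q] qk s2T by simp
      ultimately show ?thesis using True by simp
    next
      case False
      moreover have "1 \<le> w (Suc s2) q" using w_pos[of "Suc s2" q] qk s2T by simp
      ultimately show ?thesis using ch2 by simp
    qed
    then have "event (Suc s2) q"
      using s2T nq ch2(1) pq by (auto simp: event_def q'_def)
    then show ?thesis using s1 s2 s12 by (intro exI[of _ "Suc s2"] exI[of _ q]) simp
  qed
qed

text \<open>
  Events follow each other within \<open>2 R + 3\<close> stages, but each of the \<open>k\<close> labels admits only two.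
\<close>

theorem phase_length: "T < (2 * k + 1) * (2 * R + 3)"
proof (rule ccontr)
  define Q where "Q = 2 * R + 3"
  assume "\<not> ?thesis"
  then have T: "(2 * k + 1) * Q \<le> T" by (simp add: Q_def)
  have "\<exists>e j. m * Q < e \<and> e < (m + 1) * Q \<and> event e j" if "m < 2 * k + 1" for m
  proof -
    have "(m + 1) * Q \<le> (2 * k + 1) * Q" using that by (intro mult_right_mono) auto
    then have "(m + 1) * Q \<le> T" using T by linarith
    then have "m * Q + 2 * R + 3 \<le> T" by (simp add: Q_def)
    from event_exists[OF this] obtain e j where "m * Q < e" "e \<le> m * Q + 2 * R + 2" "event e j" by blast
    then show ?thesis by (intro exI[of _ e] exI[of _ j]) (simp add: Q_def)
  qed
  then obtain e j where e: "\<And>m. m < 2 * k + 1 \<Longrightarrow> m * Q < e m \<and> e m < (m + 1) * Q \<and> event (e m) (j m)"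
    by metis
  have div: "e m div Q = m" if "m < 2 * k + 1" for m
    using e[OF that] by (intro div_nat_eqI) (auto simp: mult.commute)
  define A where "A = (\<Union>i<k. {s'. s' < T \<and> event s' i})"
  have "e ` {..<2 * k + 1} \<subseteq> A"
  proof
    fix x assume "x \<in> e ` {..<2 * k + 1}"
    then obtain m where m: "m < 2 * k + 1" "x = e m" by auto
    have ev: "event x (j m)" using e[OF m(1)] m(2) by simp
    then have "x < T" by (simp add: event_def)
    moreover from event_max[OF ev] obtain s0 where "s0 < x" "p s0 = j m" by blast
    ultimately have "x < T" "j m < k" using p_less[of s0] by auto
    then show "x \<in> A" using ev by (auto simp: A_def)
  qed
  moreover have "inj_on e {..<2 * k + 1}" by (rule inj_onI) (metis div lessThan_iff)
  moreover have "finite A" by (auto simp: A_def)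
  ultimately have "2 * k + 1 \<le> card A"
    using card_mono[of A "e ` {..<2 * k + 1}"] by (simp add: card_image)
  also have "card A \<le> (\<Sum>i<k. card {s'. s' < T \<and> event s' i})"
    unfolding A_def by (rule card_UN_le) simp
  also have "\<dots> \<le> (\<Sum>i<k. 2)"
    using events_le_2[of T] by (intro sum_mono) (simp add: events_def)
  finally show False by simp
qed

end

section \<open>The number of cycles\<close>

subsection \<open>Labelled pairings\<close>

abbreviation wd :: "pairing \<Rightarrow> int" where
  "wd g \<equiv> dom_hi g - dom_lo g + 1"

definition labelled :: "nat \<Rightarrow> (nat \<Rightarrow> pairing) \<Rightarrow> pairing list \<Rightarrow> bool" where
  "labelled k G gs \<longleftrightarrow> image_mset G (mset_set {..<k}) = mset gs"

lemma labelled_nth: "labelled (length gs) (\<lambda>i. gs ! i) gs"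
proof -
  have "mset gs = mset (map (\<lambda>i. gs ! i) [0..<length gs])" by (simp add: map_nth)
  also have "\<dots> = image_mset (\<lambda>i. gs ! i) (mset_set {..<length gs})"
    by (simp add: lessThan_atLeast0)
  finally show ?thesis by (simp add: labelled_def)
qed

lemma labelled_set: "labelled k G gs \<Longrightarrow> set gs = G ` {..<k}"
  unfolding labelled_def by (metis finite_lessThan finite_set_mset_mset_set set_image_mset set_mset_mset)

lemma labelled_length: "labelled k G gs \<Longrightarrow> length gs = k"
  unfolding labelled_def by (metis card_lessThan size_image_mset size_mset size_mset_set)

lemma mset_set_remove_lessThan: "(p::nat) < k \<Longrightarrow> mset_set {..<k} = add_mset p (mset_set ({..<k} - {p}))"
  using mset_set.remove[of "{..<k}" p] by simp

lemma labelled_split: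
  assumes "labelled k G gs" "mset gs = add_mset g (mset hs)"
  obtains p where "p < k" "G p = g" "image_mset G (mset_set ({..<k} - {p})) = mset hs"
proof -
  have "g \<in> set gs" using assms(2) by (metis set_mset_mset union_single_eq_member)
  then obtain p where p: "p < k" "G p = g" using labelled_set[OF assms(1)] by auto
  have "add_mset g (image_mset G (mset_set ({..<k} - {p}))) = add_mset g (mset hs)"
    using assms p unfolding labelled_def by (simp add: mset_set_remove_lessThan[OF p(1)])
  then show thesis using that[OF p] by simp
qed

lemma sorted_wrt_pair:
  assumes "sorted_wrt R gs" "\<And>x y. R x y \<Longrightarrow> R y x" "mset gs = add_mset x (add_mset y A)"
  shows "R x y"
proof -
  obtain i where i: "i < length gs" "gs ! i = x"
    using assms(3) by (metis in_set_conv_nth set_mset_mset union_single_eq_member)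
  have "mset gs = add_mset x (mset (take i gs @ drop (Suc i) gs))"
    using i id_take_nth_drop[of i gs] by (metis mset.simps(2) mset_append union_mset_add_mset_right)
  then have eq: "mset (take i gs @ drop (Suc i) gs) = add_mset y A" using assms(3) by simp
  have "y \<in># mset (take i gs @ drop (Suc i) gs)" unfolding eq by simp
  then have "y \<in> set (take i gs @ drop (Suc i) gs)" by (simp only: set_mset_mset)
  then consider "y \<in> set (take i gs)" | "y \<in> set (drop (Suc i) gs)" by auto
  then show ?thesis
  proof cases
    case 1
    then obtain j where "j < i" "gs ! j = y" using i(1) by (auto simp: in_set_conv_nth)
    then show ?thesis using assms(1,2) i by (metis sorted_wrt_nth_less)
  next
    case 2
    then obtain j where "j < length gs - Suc i" "gs ! (Suc i + j) = y" using i(1) by (auto simp: in_set_conv_nth)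
    then show ?thesis using sorted_wrt_nth_less[OF assms(1), of i "Suc i + j"] i by simp
  qed
qed

lemma unmergeable_sym: "unmergeable g h \<Longrightarrow> unmergeable h g"
  unfolding unmergeable_def
  by (cases g; cases h) (auto simp: merge_pair_Pairing min.commute max.commute split: if_splits)

text \<open>
  The passage from one stage, after the mergers, to the next one if no pairing disappears: \<open>H i\<close> is the
  pairing with label \<open>i\<close> at the end of the cycle, and \<open>f\<close> the effect of the contractions.
\<close>

definition stage_step ::
  "nat \<Rightarrow> int \<Rightarrow> (nat \<Rightarrow> pairing) \<Rightarrow> nat \<Rightarrow> int \<Rightarrow> (nat \<Rightarrow> pairing) \<Rightarrow> (int \<Rightarrow> int) \<Rightarrow> int set \<Rightarrow> int \<Rightarrow> (nat \<Rightarrow> pairing) \<Rightarrow> bool"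
  where "stage_step k N G p M H f C N' G' \<longleftrightarrow>
    p < k \<and> (\<forall>i<k. normal N (G i)) \<and> ran_hi (G p) = N \<and>
    (\<forall>i<k. i \<noteq> p \<longrightarrow> dominates (G p) (G i) \<and> unmergeable (G p) (G i)) \<and>
    truncate N M (G p) = Some (H p) \<and> (\<forall>i<k. i \<noteq> p \<longrightarrow> H i = transmit_within N (G p) (G i)) \<and>
    ran_lo (G p) \<le> M \<and> M \<le> N \<and> (\<exists>i<k. i \<noteq> p \<and> ran_hi (H i) = M) \<and>
    (\<forall>i<k. is_pairing M (H i) \<and> \<not> is_identity (H i) \<and>
      {dom_lo (H i)..dom_hi (H i)} \<subseteq> C \<and> {ran_lo (H i)..ran_hi (H i)} \<subseteq> C) \<and>
    M + 1 \<in> C \<and> squeezes f C (f ` C) \<and> f (M + 1) = N' + 1 \<and>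
    (\<forall>i<k. G' i = trim (pmap f (H i)))"

lemma stage_step_exists:
  assumes v: "valid d S" and P: "P = prepare S" and P': "P' = prepare (reduce P)"
    and len: "length (pairings P') = length (pairings P)" "pairings P \<noteq> []"
    and lab: "labelled k G (pairings P)"
  shows "\<exists>p M H f C G'. stage_step k (len P) G p M H f C (len P') G' \<and> labelled k G' (pairings P')"
proof -
  let ?N = "len P"
  note prep = prepare[OF v, folded P]
  note rv = reduce_valid[OF prep(2,4,5)]
  obtain g hs where ex: "result (extract_maximal_t (pairings P)) = Some (g, hs)"
    using len(2) extract_maximal_None[of "pairings P"] by (cases "result (extract_maximal_t (pairings P))") auto
  show ?thesis
  proof (rule reduce_Some[OF prep(2,4,5) ex], goal_cases)
    case (1 M hs')
    note R = this
    from labelled_split[OF lab R(3)] obtain p where p: "p < k" "G p = g"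
      "image_mset G (mset_set ({..<k} - {p})) = mset hs" by blast
    have k: "length (pairings P) = k" by (rule labelled_length[OF lab])
    have hsk: "Suc (length hs') = k" using arg_cong[OF R(3), of size] k R(2) by simp
    have vr: "valid d (reduce P)" using rv by blast
    note prep' = prepare[OF vr, folded P']
    let ?gs1 = "filter (\<lambda>g. \<not> is_identity g) (pairings (reduce P))"
    obtain f where f: "contracted d (State (len (reduce P)) ?gs1 (wts (reduce P)) (outp (reduce P))) f
        (result (contract_static_t (State (len (reduce P)) ?gs1 (wts (reduce P)) (outp (reduce P)))))"
      and pP': "pairings P' = merge_all (map (\<lambda>g. trim (pmap f g)) ?gs1)"
      using prep'(1) by blast
    note fD = contractedD[OF f, unfolded state.sel]
    have lr: "len (reduce P) = M" "pairings (reduce P) = with_truncated ?N M g hs'" using R(1) by simp_all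
    have pr: "\<forall>h\<in>set ?gs1. is_pairing M h \<and> \<not> is_identity h" using R(13) lr by auto
    have sq: "squeezes f (cov ?gs1 \<union> {M + 1}) (cov (map (pmap f) ?gs1) \<union> {len P' + 1})"
      "f (M + 1) = len P' + 1"
    proof -
      have "len P' = len (result (contract_static_t (State (len (reduce P)) ?gs1 (wts (reduce P)) (outp (reduce P)))))"
        by (simp add: P' prepare_def Let_def)
      then show "squeezes f (cov ?gs1 \<union> {M + 1}) (cov (map (pmap f) ?gs1) \<union> {len P' + 1})"
        "f (M + 1) = len P' + 1" using fD(1,2,3) lr(1) by simp_all
    qed
    have pm: "\<forall>h\<in>set ?gs1. is_pairing (len P') (pmap f h) \<and> \<not> is_identity (pmap f h)"
      using pmap_is_pairing[OF sq] is_identity_pmap[OF sq(1)] pr by blast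
    then have "\<forall>h\<in>set (map (\<lambda>g. trim (pmap f g)) ?gs1). normal (len P') h"
      by (auto intro: trim_normal)
    note m = merge_all[OF this]
    have "length (pairings P') \<le> length ?gs1" using m pP' by simp
    moreover have "length ?gs1 \<le> length (pairings (reduce P))" by (rule length_filter_le)
    moreover have "length (pairings (reduce P)) \<le> Suc (length hs')" by (simp add: lr split: option.splits)
    ultimately have lens: "length (pairings P') = length ?gs1" "length ?gs1 = length (pairings (reduce P))"
      "length (pairings (reduce P)) = Suc (length hs')"
      using len(1) k hsk by linarith+
    have noid: "?gs1 = pairings (reduce P)"
      using lens(2) by (simp add: filter_id_conv length_filter_less) (metis length_filter_less less_irrefl)
    have mP': "pairings P' = map (\<lambda>g. trim (pmap f g)) (pairings (reduce P))"
      using m lens pP' noid by simp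
    obtain g' where g': "truncate ?N M g = Some g'"
      using lens(3) lr by (cases "truncate ?N M g") auto
    then have pred: "pairings (reduce P) = g' # hs'" using lr by simp
    define H where "H i = (if i = p then g' else transmit_within ?N (G p) (G i))" for i
    have lab_H: "labelled k H (g' # hs')"
    proof -
      have "image_mset H (mset_set ({..<k} - {p})) =
          image_mset (transmit_within ?N g) (image_mset G (mset_set ({..<k} - {p})))"
        unfolding multiset.map_comp by (intro image_mset_cong) (auto simp: H_def p(2))
      then show ?thesis
        unfolding labelled_def mset_set_remove_lessThan[OF p(1)] p(3) R(2) by (simp add: H_def)
    qed
    define G' where "G' i = trim (pmap f (H i))" for i
    have lab_G': "labelled k G' (pairings P')"
    proof -
      have "image_mset G' (mset_set {..<k}) = image_mset (\<lambda>g. trim (pmap f g)) (image_mset H (mset_set {..<k}))"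
        unfolding multiset.map_comp by (intro image_mset_cong) (simp add: G'_def)
      then show ?thesis using lab_H unfolding labelled_def mP' pred by simp
    qed
    have others: "G i \<in> set hs" if "i < k" "i \<noteq> p" for i
    proof -
      have "i \<in># mset_set ({..<k} - {p})" using that by simp
      then have "G i \<in># image_mset G (mset_set ({..<k} - {p}))" by (rule in_image_mset[THEN iffD2, OF imageI])
      then show ?thesis using p(3) by simp
    qed
    have unm: "unmergeable (G p) (G i)" if ik: "i < k" "i \<noteq> p" for i
    proof -
      obtain A where "mset hs = add_mset (G i) A"
        using others[OF ik] by (metis insert_DiffM set_mset_mset)
      then have "mset (pairings P) = add_mset (G p) (add_mset (G i) A)" using R(3) p(2) by simp
      then show ?thesis using sorted_wrt_pair[OF prep(6) unmergeable_sym] by blast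
    qed
    have Hmem: "H i \<in> set ?gs1" if "i < k" for i
      unfolding noid unfolding pred using labelled_set[OF lab_H] that by blast
    have rl: "ran_lo g \<le> M"
      using g' R(7) by (cases g) (auto simp: truncate_Pairing split: if_splits)
    have top: "\<exists>i<k. i \<noteq> p \<and> ran_hi (H i) = M"
    proof -
      obtain h where h: "h \<in> set hs'" "ran_hi h = M" using R(11) rl by auto
      then obtain h0 where "h0 \<in> set hs" "h = transmit_within ?N g h0" using R(2) by auto
      moreover from this obtain i where "i \<in> {..<k} - {p}" "h0 = G i"
        using arg_cong[OF p(3), of set_mset] by auto
      ultimately show ?thesis using h(2) p(2) by (intro exI[of _ i]) (auto simp: H_def)
    qed
    have "stage_step k ?N G p M H f (cov ?gs1 \<union> {M + 1}) (len P') G'"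
      unfolding stage_step_def
    proof (intro conjI allI impI)
      show "normal ?N (G i)" if "i < k" for i
        using prep(4) labelled_set[OF lab] that by blast
      show "dominates (G p) (G i)" if "i < k" "i \<noteq> p" for i
        using others[OF that] R(6) p(2) by blast
      show "{dom_lo (H i)..dom_hi (H i)} \<subseteq> cov ?gs1 \<union> {M + 1}"
        "{ran_lo (H i)..ran_hi (H i)} \<subseteq> cov ?gs1 \<union> {M + 1}" if "i < k" for i
        using cov_member[OF Hmem[OF that]] by blast+
      show "is_pairing M (H i)" "\<not> is_identity (H i)" if "i < k" for i
        using pr Hmem[OF that] by blast+
      show "squeezes f (cov ?gs1 \<union> {M + 1}) (f ` (cov ?gs1 \<union> {M + 1}))"
        using sq(1) squeezes_image[OF sq(1)] by simp
      show "ran_hi (G p) = ?N" using p(2) R(5) by simp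
      show "truncate ?N M (G p) = Some (H p)" using g' p(2) by (simp add: H_def)
      show "ran_lo (G p) \<le> M" using rl p(2) by simp
    qed (use p(1) unm R(8) top sq(2) in \<open>auto simp: H_def G'_def\<close>)
    then show ?thesis using lab_G' by blast
  qed
qed

subsection \<open>The numbers attached to a stage\<close>

lemma pmap_sel [simp]:
  "dom_lo (pmap f g) = f (dom_lo g)" "dom_hi (pmap f g) = f (dom_hi g)"
  "ran_lo (pmap f g) = f (ran_lo g)" "ran_hi (pmap f g) = f (ran_hi g)"
  "preserving (pmap f g) = preserving g"
  by (cases g; simp)+

lemma trim_shrinks:
  assumes "is_pairing N g" "\<not> is_identity g"
  shows "wd (trim g) \<le> wd g" "dom_hi (trim g) \<le> dom_hi g" "dom_lo (trim g) = dom_lo g"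
    and "preserving (trim g) = preserving g"
    and "preserving g \<or> dom_hi g < ran_lo g \<Longrightarrow> trim g = g"
    and "\<not> (preserving g \<or> dom_hi g < ran_lo g) \<Longrightarrow>
      ran_lo (trim g) = (dom_lo g + ran_hi g) div 2 + 1 \<and> dom_hi (trim g) = (dom_lo g + ran_hi g - 1) div 2"
  using assms by (cases g; auto simp: trim_Pairing is_identity_Pairing)+

definition contained_in :: "pairing \<Rightarrow> pairing \<Rightarrow> bool" where
  "contained_in q g \<longleftrightarrow> ran_lo q \<le> ran_lo g"

text \<open>
  The maximal pairing \<open>q\<close> stays maximal only if some other pairing \<open>g\<close> again ends at the end of the
  interval after it has been transmitted and trimmed. It is then reversing. If \<open>q\<close> preserves
  orientation, the value is the amount by which the domain of \<open>g\<close> reaches into the range of \<open>q\<close>, and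
  trimming halves it. If \<open>q\<close> reverses orientation, \<open>g\<close> must have preserved it before, which happens
  at most once.
\<close>

definition stay_value :: "pairing \<Rightarrow> pairing \<Rightarrow> int" where
  "stay_value q g = (if \<not> contained_in q g then 0
    else if preserving q then (if preserving g then 0 else max 0 (dom_hi g - ran_lo q + 2))
    else (if preserving g then 1 else 0))"

lemma normal_widths: "normal N g \<Longrightarrow> ran_hi g - ran_lo g + 1 = wd g \<and> 1 \<le> wd g \<and> ran_hi g \<le> N \<and>
    dom_hi g \<le> N \<and> 1 \<le> dom_lo g \<and> dom_lo g < ran_lo g \<and> (\<not> preserving g \<longrightarrow> dom_hi g < ran_lo g)"
  by (cases g) auto

lemma is_pairing_widths: "is_pairing N g \<Longrightarrow> ran_hi g - ran_lo g + 1 = wd g \<and> 1 \<le> wd g \<and> ran_hi g \<le> N \<and>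
    dom_hi g \<le> N \<and> 1 \<le> dom_lo g \<and> dom_lo g \<le> ran_lo g"
  by (cases g) auto

lemma unmergeable_apart:
  assumes q: "normal N q" "ran_hi q = N" and g: "normal N g" and u: "unmergeable q g"
    and c: "contained_in q g" and per: "preserving q" "preserving g"
    and t: "ran_lo q - dom_lo q \<le> wd q" "ran_lo g - dom_lo g \<le> wd g"
  shows "wd g < ran_lo q - dom_lo q"
proof -
  obtain a b c' e p where Q: "q = Pairing a b c' e p" by (cases q)
  obtain a2 b2 c2 d2 p2 where G: "g = Pairing a2 b2 c2 d2 p2" by (cases g)
  have "periodic q" "periodic g"
    using q g per t unfolding Q G by (auto simp: periodic_Pairing)
  then have "min e d2 + 1 - max a a2 < (c' - a) + (c2 - a2)"
    using u unfolding unmergeable_def Q G merge_pair_Pairing by (auto split: if_splits)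
  then show ?thesis using q g c per t unfolding Q G contained_in_def
    by (auto simp: min_def max_def split: if_splits)
qed

context
  fixes k N G p M H f C N' G'
  assumes step: "stage_step k N G p M H f C N' G'"
begin

lemma stage_facts:
  shows "p < k" and "i < k \<Longrightarrow> normal N (G i)" and "ran_hi (G p) = N"
    and "i < k \<Longrightarrow> i \<noteq> p \<Longrightarrow> dominates (G p) (G i) \<and> unmergeable (G p) (G i)"
    and "truncate N M (G p) = Some (H p)" and "i < k \<Longrightarrow> i \<noteq> p \<Longrightarrow> H i = transmit_within N (G p) (G i)"
    and "ran_lo (G p) \<le> M" "M \<le> N" and "\<exists>i<k. i \<noteq> p \<and> ran_hi (H i) = M"
    and "i < k \<Longrightarrow> is_pairing M (H i)" "i < k \<Longrightarrow> \<not> is_identity (H i)"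
    and "i < k \<Longrightarrow> {dom_lo (H i)..dom_hi (H i)} \<subseteq> C" "i < k \<Longrightarrow> {ran_lo (H i)..ran_hi (H i)} \<subseteq> C"
    and "M + 1 \<in> C" "squeezes f C (f ` C)" "f (M + 1) = N' + 1" "i < k \<Longrightarrow> G' i = trim (pmap f (H i))"
  using step unfolding stage_step_def by blast+

lemma H_max:
  "ran_lo (H p) = ran_lo (G p)" "ran_hi (H p) = M" "preserving (H p) = preserving (G p)"
  "wd (H p) = wd (G p) - (N - M)" "wd (H p) = M - ran_lo (G p) + 1"
  "preserving (G p) \<Longrightarrow> dom_lo (H p) = dom_lo (G p) \<and> dom_hi (H p) = dom_hi (G p) - (N - M)"
  "\<not> preserving (G p) \<Longrightarrow> dom_hi (H p) = dom_hi (G p) \<and> dom_hi (H p) < ran_lo (H p)"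
proof -
  obtain a b c e q where Gp: "G p = Pairing a b c e q" by (cases "G p")
  have e: "e = N" using stage_facts(3) Gp by simp
  have gb: "N - c = b - a" "\<not> q \<Longrightarrow> b < c" using stage_facts(2)[OF stage_facts(1)] unfolding Gp e by auto
  have Hp: "H p = (if q then Pairing a (b - (N - M)) c M q else Pairing (a + (N - M)) b c M q)"
    using stage_facts(5) unfolding Gp truncate_Pairing by (simp split: if_splits)
  show "ran_lo (H p) = ran_lo (G p)" "ran_hi (H p) = M" "preserving (H p) = preserving (G p)"
    "wd (H p) = wd (G p) - (N - M)" "wd (H p) = M - ran_lo (G p) + 1"
    "preserving (G p) \<Longrightarrow> dom_lo (H p) = dom_lo (G p) \<and> dom_hi (H p) = dom_hi (G p) - (N - M)"
    "\<not> preserving (G p) \<Longrightarrow> dom_hi (H p) = dom_hi (G p) \<and> dom_hi (H p) < ran_lo (H p)"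
    unfolding Hp Gp using gb by simp_all
qed

lemma endpoints: "i < k \<Longrightarrow> dom_lo (H i) \<in> C \<and> dom_hi (H i) \<in> C \<and> ran_lo (H i) \<in> C \<and> ran_hi (H i) \<in> C"
proof -
  assume i: "i < k"
  have "dom_lo (H i) \<in> {dom_lo (H i)..dom_hi (H i)}" "dom_hi (H i) \<in> {dom_lo (H i)..dom_hi (H i)}"
    "ran_lo (H i) \<in> {ran_lo (H i)..ran_hi (H i)}" "ran_hi (H i) \<in> {ran_lo (H i)..ran_hi (H i)}"
    using is_pairing_widths[OF stage_facts(10)[OF i]] by auto
  then show ?thesis using stage_facts(12,13)[OF i] by blast
qed

lemma window: "{ran_lo (G p)..M + 1} \<subseteq> C"
proof -
  have "{ran_lo (G p)..M + 1} \<subseteq> {ran_lo (H p)..ran_hi (H p)} \<union> {M + 1}"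
    by (auto simp: H_max(1,2))
  then show ?thesis using stage_facts(13)[OF stage_facts(1)] stage_facts(14) by blast
qed

lemma distance:
  assumes "x \<in> C" "x \<le> M"
  shows "min (M - x) (M - ran_lo (G p) + 1) \<le> N' - f x"
proof (cases "ran_lo (G p) \<le> x")
  case True
  then have "{x..M + 1} \<subseteq> C" using window by (auto intro: order_trans)
  then have "f (M + 1) - f x = M + 1 - x" using squeezes_rigid[OF stage_facts(15)] assms by simp
  then show ?thesis using stage_facts(16) by simp
next
  case False
  have c: "ran_lo (G p) \<in> C" using endpoints[OF stage_facts(1)] H_max(1) by simp
  have "f (M + 1) - f (ran_lo (G p)) = M + 1 - ran_lo (G p)"
    using squeezes_rigid[OF stage_facts(15) window] stage_facts(7) by simp
  moreover have "f x < f (ran_lo (G p))" using squeezes_less[OF stage_facts(15) assms(1) c] False by simp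
  ultimately show ?thesis using stage_facts(16) by simp
qed

lemma pmap_H: "i < k \<Longrightarrow> is_pairing N' (pmap f (H i)) \<and> \<not> is_identity (pmap f (H i))"
proof -
  assume i: "i < k"
  note e = endpoints[OF i]
  note w = is_pairing_widths[OF stage_facts(10)[OF i]]
  have "f (dom_hi (H i)) - f (dom_lo (H i)) = dom_hi (H i) - dom_lo (H i)"
    "f (ran_hi (H i)) - f (ran_lo (H i)) = ran_hi (H i) - ran_lo (H i)"
    using squeezes_rigid[OF stage_facts(15)] stage_facts(12,13)[OF i] w by auto
  moreover have "1 \<le> f (dom_lo (H i))" using squeezes_pos[OF stage_facts(15)] e w by auto
  moreover have "f (dom_lo (H i)) \<le> f (ran_lo (H i))" using squeezes_le[OF stage_facts(15)] e w by auto
  moreover have "f (ran_hi (H i)) < f (M + 1)" using squeezes_less[OF stage_facts(15) _ stage_facts(14)] e w by auto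
  ultimately have 1: "is_pairing N' (pmap f (H i))" using w stage_facts(16) by (cases "H i") auto
  have "f (dom_lo (H i)) = f (ran_lo (H i)) \<longleftrightarrow> dom_lo (H i) = ran_lo (H i)"
    using squeezes_less[OF stage_facts(15), of "dom_lo (H i)" "ran_lo (H i)"] e w by force
  moreover have "f (dom_lo (H i)) = f (dom_hi (H i)) \<longleftrightarrow> dom_lo (H i) = dom_hi (H i)"
    using squeezes_less[OF stage_facts(15), of "dom_lo (H i)" "dom_hi (H i)"] e w by force
  ultimately have "\<not> is_identity (pmap f (H i))"
    using stage_facts(11)[OF i] by (cases "H i") (auto simp: is_identity_Pairing)
  with 1 show ?thesis by blast
qed

lemma wd_pmap: "i < k \<Longrightarrow> wd (pmap f (H i)) = wd (H i)"
  using squeezes_rigid[OF stage_facts(15) stage_facts(12)] is_pairing_widths[OF stage_facts(10)] by simp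

lemma G'_eq: "i < k \<Longrightarrow> G' i = trim (pmap f (H i))"
  by (rule stage_facts(17))

lemma G'_max: "G' p = pmap f (H p)"
proof -
  have "preserving (pmap f (H p)) \<or> dom_hi (pmap f (H p)) < ran_lo (pmap f (H p))"
    using H_max(3,7) endpoints[OF stage_facts(1)] squeezes_less[OF stage_facts(15), of "dom_hi (H p)" "ran_lo (H p)"] by auto
  then show ?thesis unfolding G'_eq[OF stage_facts(1)] using trim_shrinks(5) pmap_H[OF stage_facts(1)] by blast
qed

lemma step_width: "i < k \<Longrightarrow> wd (G' i) \<le> wd (G i)"
proof -
  assume i: "i < k"
  have "wd (G' i) \<le> wd (H i)"
    unfolding G'_eq[OF i] using trim_shrinks(1) pmap_H[OF i] wd_pmap[OF i] by metis
  also have "wd (H i) \<le> wd (G i)"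
  proof (cases "i = p")
    case True
    then show ?thesis using H_max(4) stage_facts(8) by simp
  next
    case False
    then show ?thesis
      using stage_facts(6)[OF i False] transmit_within_is_pairing(3)[OF stage_facts(2)[OF stage_facts(1)] stage_facts(3) stage_facts(2)[OF i]] by simp
  qed
  finally show ?thesis .
qed

lemma step_width_max: "wd (G' p) = wd (G p) - (N - M)" "wd (G' p) = M - ran_lo (G p) + 1"
  unfolding G'_max using wd_pmap[OF stage_facts(1)] H_max(4,5) by simp_all

lemma step_ran_hi_max: "ran_hi (G' p) = N'"
  unfolding G'_max using squeezes_rigid[OF stage_facts(15), of M "M + 1"] window stage_facts(7,16) H_max(2)
  by (auto simp: subset_iff)

lemma step_dom_hi_max: "min (N - dom_hi (G p) - (N - M)) (wd (G' p)) \<le> N' - dom_hi (G' p)"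
proof -
  have "dom_hi (H p) \<le> M" "dom_hi (H p) \<le> dom_hi (G p)"
    using is_pairing_widths[OF stage_facts(10)[OF stage_facts(1)]] H_max(6,7) stage_facts(8) by (cases "preserving (G p)"; simp)+
  then have "min (M - dom_hi (H p)) (M - ran_lo (G p) + 1) \<le> N' - f (dom_hi (H p))"
    using distance endpoints[OF stage_facts(1)] by blast
  moreover have "dom_hi (G' p) = f (dom_hi (H p))" by (simp add: G'_max)
  ultimately show ?thesis using step_width_max(2) \<open>dom_hi (H p) \<le> dom_hi (G p)\<close> by linarith
qed

lemma step_preserving_max: "preserving (G' p) = preserving (G p)"
  by (simp add: G'_max H_max(3))

lemma step_translation_max:
  "preserving (G p) \<Longrightarrow> ran_lo (G' p) - dom_lo (G' p) \<le> ran_lo (G p) - dom_lo (G p)"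
  using squeezes_dist[OF stage_facts(15), of "dom_lo (H p)" "ran_lo (H p)"] endpoints[OF stage_facts(1)]
    is_pairing_widths[OF stage_facts(10)[OF stage_facts(1)]] H_max(1,6) by (simp add: G'_max)

lemma transmitted_shape:
  assumes i: "i < k" "i \<noteq> p"
  obtains (same) "\<not> contained_in (G p) (G i)" "H i = G i"
    | (moved) a' b' c' d' p' where "contained_in (G p) (G i)"
      "H i = (if c' < a' then Pairing c' d' a' b' p' else Pairing a' b' c' d' p')"
      "a' < ran_lo (G p)" "c' < ran_lo (G p)" "b' \<le> dom_hi (G i)" "d' - c' = b' - a'" "a' \<le> b'"
      "d' < ran_hi (G i)" "b' \<le> M" "d' \<le> M"
      "preserving (G p) \<Longrightarrow> p' = preserving (G i)"
      "preserving (G p) \<Longrightarrow> d' \<le> ran_hi (G i) - (ran_lo (G p) - dom_lo (G p))"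
      "\<not> preserving (G p) \<Longrightarrow> d' < ran_lo (G p)"
      "\<not> preserving (G p) \<Longrightarrow> p' = (\<not> preserving (G i)) \<or> b' < ran_lo (G p)"
  using transmit_within(2)[OF stage_facts(2)[OF stage_facts(1)] stage_facts(3) stage_facts(2)[OF i(1)]]
proof
  assume "ran_lo (G i) < ran_lo (G p) \<and> transmit_within N (G p) (G i) = G i"
  then show thesis using same stage_facts(6)[OF i] by (simp add: contained_in_def)
next
  assume c: "ran_lo (G p) \<le> ran_lo (G i) \<and> transmitted (G p) (G i) (transmit_within N (G p) (G i))"
  then obtain a' b' c' d' p' where T: "transmit_within N (G p) (G i) = result (orient_t a' b' c' d' p')"
    "a' < ran_lo (G p)" "c' < ran_lo (G p)" "b' \<le> dom_hi (G i)" "d' < ran_hi (G i)"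
    "b' - a' = dom_hi (G i) - dom_lo (G i)" "d' - c' = dom_hi (G i) - dom_lo (G i)"
    "preserving (G p) \<Longrightarrow> p' = preserving (G i)"
    "preserving (G p) \<Longrightarrow> d' \<le> ran_hi (G i) - (ran_lo (G p) - dom_lo (G p))"
    "\<not> preserving (G p) \<Longrightarrow> d' < ran_lo (G p)"
    "\<not> preserving (G p) \<Longrightarrow> p' = (\<not> preserving (G i)) \<or> b' < ran_lo (G p)"
    unfolding transmitted_def by metis
  have H: "H i = (if c' < a' then Pairing c' d' a' b' p' else Pairing a' b' c' d' p')"
    using stage_facts(6)[OF i] T(1) by (simp add: result_orient)
  have "b' \<le> M" "d' \<le> M" using is_pairing_widths[OF stage_facts(10)[OF i(1)]] unfolding H by (auto split: if_splits)
  moreover have "a' \<le> b'" using T(6) normal_widths[OF stage_facts(2)[OF i(1)]] by simp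
  moreover have "d' - c' = b' - a'" using T(6,7) by simp
  ultimately show thesis using moved[OF _ H T(2,3,4) _ _ T(5) _ _ T(8-11)] c by (simp add: contained_in_def)
qed

lemma step_move:
  assumes i: "i < k" "i \<noteq> p"
    and X: "X = max (N - ran_hi (G i)) (if \<not> contained_in (G p) (G i) then 0
      else if preserving (G p) then ran_lo (G p) - dom_lo (G p) else wd (G p))"
  shows "min (X - (N - M)) (wd (G' p)) \<le> N' - ran_hi (G' i) \<and>
      min (N - dom_hi (G i) - (N - M)) (wd (G' p)) \<le> N' - dom_hi (G' i) \<or>
    min (X - (N - M)) (wd (G' p)) \<le> N' - dom_hi (G' i) \<and>
      min (N - dom_hi (G i) - (N - M)) (wd (G' p)) \<le> N' - ran_hi (G' i)"
proof -
  have r: "ran_hi (G' i) = f (ran_hi (H i))" "dom_hi (G' i) \<le> f (dom_hi (H i))"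
    using trim_shrinks(2)[of N' "pmap f (H i)"] pmap_H[OF i(1)] by (simp_all add: G'_eq[OF i(1)])
  note gi = normal_widths[OF stage_facts(2)[OF i(1)]]
  note gp = normal_widths[OF stage_facts(2)[OF stage_facts(1)]]
  have le: "ran_hi (H i) \<le> M" "dom_hi (H i) \<le> M"
    using is_pairing_widths[OF stage_facts(10)[OF i(1)]] by auto
  note dR = distance[OF _ le(1)] and dD = distance[OF _ le(2)]
  have mem: "ran_hi (H i) \<in> C" "dom_hi (H i) \<in> C" using endpoints[OF i(1)] by auto
  note dR = dR[OF mem(1), folded step_width_max(2)] and dD = dD[OF mem(2), folded step_width_max(2)]
  from i show ?thesis
  proof (cases rule: transmitted_shape)
    case same
    then have "X = N - ran_hi (G i)" using X gi by simp
    then show ?thesis using dR dD r same by (auto simp: min_def split: if_splits)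
  next
    case (moved a' b' c' d' p')
    have "X \<le> N - d'"
    proof (cases "preserving (G p)")
      case True
      then show ?thesis using X moved(1,8,12) gi gp by simp
    next
      case False
      then show ?thesis using X moved(1,8,13) gi gp stage_facts(3) by simp
    qed
    moreover have "N - dom_hi (G i) \<le> N - b'" using moved(5) by simp
    ultimately show ?thesis using dR dD r moved(2) by (auto simp: min_def split: if_splits)
  qed
qed

text \<open>
  A transmitted pairing whose range still starts in the maximal range in the next stage
  has been trimmed, that is, its two images under the transmission overlap.
\<close>

lemma trimmed_back:
  assumes i: "i < k" "i \<noteq> p" and again: "ran_lo (G' p) \<le> ran_lo (G' i)"
  shows "\<not> preserving (G' i)" and "contained_in (G p) (G i)"
    and "stay_value (G' p) (G' i) \<le> max (stay_value (G p) (G i)) 1 div 2"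
    and "ran_hi (H i) = M \<Longrightarrow> 1 \<le> stay_value (G p) (G i)"
proof -
  define c where "c = ran_lo (G p)"
  have fc: "ran_lo (G' p) = f c" by (simp add: G'_max H_max(1) c_def)
  have cC: "c \<in> C" using endpoints[OF stage_facts(1)] H_max(1) by (simp add: c_def)
  note pH = pmap_H[OF i(1)]
  note less = squeezes_less[OF stage_facts(15)]
  have trimmed: "\<not> (preserving (H i) \<or> f (dom_hi (H i)) < f (ran_lo (H i)))"
    if "ran_lo (H i) < c"
  proof
    assume "preserving (H i) \<or> f (dom_hi (H i)) < f (ran_lo (H i))"
    then have "G' i = pmap f (H i)"
      unfolding G'_eq[OF i(1)] using trim_shrinks(5)[of N' "pmap f (H i)"] pH by simp
    then show False using again fc less[OF _ cC that] endpoints[OF i(1)] by simp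
  qed
  have "\<not> preserving (G' i) \<and> contained_in (G p) (G i) \<and>
      stay_value (G' p) (G' i) \<le> max (stay_value (G p) (G i)) 1 div 2 \<and>
      (ran_hi (H i) = M \<longrightarrow> 1 \<le> stay_value (G p) (G i))"
    using i
  proof (cases rule: transmitted_shape)
    case same
    then have "ran_lo (H i) < c" by (simp add: contained_in_def c_def)
    moreover have "preserving (H i) \<or> f (dom_hi (H i)) < f (ran_lo (H i))"
      using normal_widths[OF stage_facts(2)[OF i(1)]] same less[of "dom_hi (H i)" "ran_lo (H i)"] endpoints[OF i(1)]
      by auto
    ultimately show ?thesis using trimmed by blast
  next
    case (moved a' b' c' d' p')
    define A B X Y where "A = f a'" "B = f b'" "X = f c'" "Y = f d'"
    have mem: "a' \<in> C" "b' \<in> C" "c' \<in> C" "d' \<in> C"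
      using endpoints[OF i(1)] unfolding moved(2) by (auto split: if_splits)
    have sub: "{c'..d'} \<subseteq> C" "{a'..b'} \<subseteq> C"
      using stage_facts(12,13)[OF i(1)] unfolding moved(2) by (auto split: if_splits)
    have AX: "A < f c" "X < f c" using less[OF mem(1) cC] less[OF mem(3) cC] moved(3,4) by (simp_all add: A_B_X_Y_def c_def)
    have len: "B - A = b' - a'" "Y - X = d' - c'"
      using squeezes_rigid[OF stage_facts(15)] sub moved(6,7) by (auto simp: A_B_X_Y_def)
    have rl: "ran_lo (H i) < c" using moved(2,3,4) by (simp add: c_def)
    have tr: "\<not> (preserving (pmap f (H i)) \<or> dom_hi (pmap f (H i)) < ran_lo (pmap f (H i)))"
      using trimmed[OF rl] by simp
    have p': "\<not> p'" using tr moved(2) by (auto split: if_splits)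
    have "dom_lo (pmap f (H i)) + ran_hi (pmap f (H i)) = X + B"
      using moved(2,6) len by (auto simp: A_B_X_Y_def split: if_splits)
    then have new: "ran_lo (G' i) = (X + B) div 2 + 1" "dom_hi (G' i) = (X + B - 1) div 2"
      using trim_shrinks(6)[OF conjunct1[OF pH] conjunct2[OF pH] tr] by (simp_all add: G'_eq[OF i(1)])
    have pG': "\<not> preserving (G' i)"
      using trim_shrinks(4)[of N' "pmap f (H i)"] pH tr by (simp add: G'_eq[OF i(1)])
    have cAX: "c' < a' \<longleftrightarrow> X < A"
    proof
      show "c' < a' \<Longrightarrow> X < A" using less[OF mem(3,1)] by (simp add: A_B_X_Y_def)
      assume "X < A"
      then have "\<not> a' \<le> c'" using squeezes_le[OF stage_facts(15) mem(1,3)] by (auto simp: A_B_X_Y_def)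
      then show "c' < a'" by simp
    qed
    have XB: "X \<le> B"
      using tr moved(2) len moved(6,7) cAX by (auto simp: A_B_X_Y_def split: if_splits)
    have total: "2 * f c - 2 \<le> X + B" using again fc new(1) by linarith
    then have B: "f c - 1 \<le> B" using AX by linarith
    have B_val: "B - f c + 2 \<le> b' - c + 2" if "c \<le> b'"
      using squeezes_dist[OF stage_facts(15) cC mem(2) that] by (simp add: A_B_X_Y_def)
    have B_low: "B = f c - 1" if "b' < c"
      using less[OF mem(2) cC that] B by (simp add: A_B_X_Y_def)
    show ?thesis
    proof (cases "preserving (G p)")
      case True
      then have rev: "\<not> preserving (G i)" using moved(11) p' by simp
      have val: "stay_value (G p) (G i) = max 0 (dom_hi (G i) - c + 2)"
        using True rev moved(1) by (simp add: stay_value_def c_def)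
      have "stay_value (G' p) (G' i) = max 0 ((X + B - 1) div 2 - f c + 2)"
        using True step_preserving_max pG' again by (simp add: stay_value_def contained_in_def fc new(2))
      also have "(X + B - 1) div 2 - f c + 2 \<le> (B - f c + 2) div 2" using AX by linarith
      finally have val': "stay_value (G' p) (G' i) \<le> (B - f c + 2) div 2" using B by simp
      have "B - f c + 2 \<le> max (stay_value (G p) (G i)) 1"
      proof (cases "c \<le> b'")
        case True
        then show ?thesis using B_val val moved(5) by simp
      next
        case False
        then show ?thesis using B_low by simp
      qed
      then have "(B - f c + 2) div 2 \<le> max (stay_value (G p) (G i)) 1 div 2" by (rule zdiv_mono1) simp
      moreover have "1 \<le> stay_value (G p) (G i)" if top: "ran_hi (H i) = M"
      proof (cases "c \<le> b'")
        case True
        then show ?thesis using val moved(5) by simp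
      next
        case False
        then have "B = f c - 1" using B_low by simp
        have "c \<le> M" using stage_facts(7) by (simp add: c_def)
        then have d': "d' = M"
          using top False moved(2,6,7) by (auto split: if_splits)
        have "c' \<le> b'" using less[OF mem(2,3)] XB by (force simp: A_B_X_Y_def)
        then have "{b'..c} \<subseteq> C" using sub(1) d' \<open>c \<le> M\<close> False by (auto simp: subset_iff)
        then have "f c - f b' = c - b'" using squeezes_rigid[OF stage_facts(15)] False by simp
        then have "b' = c - 1" using \<open>B = f c - 1\<close> by (simp add: A_B_X_Y_def)
        then show ?thesis using val moved(5) by simp
      qed
      ultimately show ?thesis using pG' moved(1) val' by linarith
    next
      case False
      have "preserving (G i)"
      proof (rule ccontr)
        assume "\<not> preserving (G i)"
        then have b': "b' < c" using moved(14)[OF False] p' by (simp add: c_def)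
        have d': "d' < c" using moved(13)[OF False] by (simp add: c_def)
        have "Y < f c" using less[OF mem(4) cC d'] by (simp add: A_B_X_Y_def)
        moreover have "B = f c - 1" using B_low[OF b'] .
        moreover have "X = f c - 1" using total AX \<open>B = f c - 1\<close> by linarith
        ultimately have "Y = X" "A = B" "A = X" using len moved(6,7) by linarith+
        then have "a' = c'" "a' = b'" "c' = d'"
          using less[OF mem(1,3)] less[OF mem(3,1)] less[OF mem(1,2)] len moved(6,7)
          by (auto simp: A_B_X_Y_def) (metis less_irrefl linorder_neqE)
        then have "is_identity (H i)" using moved(2) by (simp add: is_identity_Pairing)
        then show False using stage_facts(11)[OF i(1)] by blast
      qed
      moreover have "stay_value (G' p) (G' i) = 0"
        using False step_preserving_max pG' by (simp add: stay_value_def)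
      ultimately show ?thesis using False moved(1) pG' by (simp add: stay_value_def)
    qed
  qed
  then show "\<not> preserving (G' i)" "contained_in (G p) (G i)"
    "stay_value (G' p) (G' i) \<le> max (stay_value (G p) (G i)) 1 div 2"
    "ran_hi (H i) = M \<Longrightarrow> 1 \<le> stay_value (G p) (G i)" by blast+
qed

lemma step_stay_halves:
  assumes i: "i < k" "i \<noteq> p"
  shows "stay_value (G' p) (G' i) \<le> max (stay_value (G p) (G i)) 1 div 2"
proof (cases "contained_in (G' p) (G' i)")
  case True
  then show ?thesis using trimmed_back(3)[OF i] by (simp add: contained_in_def)
next
  case False
  then have "stay_value (G' p) (G' i) = 0" by (simp add: stay_value_def)
  also have "0 \<le> max (stay_value (G p) (G i)) 1 div 2" by (simp add: pos_imp_zdiv_nonneg_iff)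
  finally show ?thesis .
qed

lemma step_stay_value:
  assumes "\<And>i. i < k \<Longrightarrow> i \<noteq> p \<Longrightarrow> dominates (G' p) (G' i)"
  shows "\<exists>i<k. i \<noteq> p \<and> 1 \<le> stay_value (G p) (G i)"
proof -
  obtain i where i: "i < k" "i \<noteq> p" "ran_hi (H i) = M" using stage_facts(9) by blast
  have "ran_hi (G' i) = f M" by (simp add: G'_eq[OF i(1)] i(3))
  also have "\<dots> = N'" using step_ran_hi_max by (simp add: G'_max H_max(2))
  finally have "ran_lo (G' p) \<le> ran_lo (G' i)"
    using assms[OF i(1,2)] step_ran_hi_max by (simp add: dominates_def)
  then show ?thesis using trimmed_back(4)[OF i(1,2) _ i(3)] i by blast
qed

end

lemma phase_bound:
  assumes steps: "\<And>s. s \<le> T \<Longrightarrow>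
      stage_step k (N s) (G s) (p s) (M s) (H s) (f s) (C s) (N (Suc s)) (G (Suc s))"
    and eps: "\<And>s i. s \<le> T \<Longrightarrow> i < k \<Longrightarrow> (1 - 1 / (32 * real k ^ 2)) * wd (G 0 i) \<le> wd (G s i)"
    and R: "\<And>s. s \<le> T \<Longrightarrow> N s + 1 < 2 ^ R"
  shows "T < (2 * k + 1) * (2 * R + 3)"
proof -
  have nw: "ran_hi (G s i) - ran_lo (G s i) + 1 = wd (G s i) \<and> 1 \<le> wd (G s i) \<and> ran_hi (G s i) \<le> N s \<and>
    dom_hi (G s i) \<le> N s \<and> 1 \<le> dom_lo (G s i) \<and> dom_lo (G s i) < ran_lo (G s i)"
    if "s \<le> T" "i < k" for s i
    using normal_widths[OF stage_facts(2)[OF steps[OF that(1)] that(2)]] by blast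
  have dom: "dominates (G s (p s)) (G s i)" if "s \<le> T" "i < k" "i \<noteq> p s" for s i
    using stage_facts(4)[OF steps[OF that(1)] that(2,3)] by blast
  interpret phase k T R "1 / (32 * real k ^ 2)" p "\<lambda>s. N s - M s" "\<lambda>s i. wd (G s i)"
    "\<lambda>s i. N s - ran_hi (G s i)" "\<lambda>s i. N s - dom_hi (G s i)" "\<lambda>s i. ran_lo (G s i) - dom_lo (G s i)"
    "\<lambda>s i. stay_value (G s (p s)) (G s i)" "\<lambda>s i. preserving (G s i)"
    "\<lambda>s i. contained_in (G s (p s)) (G s i)"
  proof (unfold_locales, goal_cases)
    case (2 s)
    then show ?case by (rule stage_facts(1)[OF steps])
  next
    case (3 s i)
    then show ?case using nw by blast
  next
    case (4 s i)
    then show ?case by (intro step_width[OF steps]) auto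
  next
    case (5 s i)
    then show ?case by (rule eps)
  next
    case (6 s)
    then show ?case using stage_facts(8)[OF steps, of s] by simp
  next
    case (7 s)
    then show ?case by (intro step_width_max(1)[OF steps]) simp
  next
    case (8 s i)
    then show ?case using nw[of s i] by simp
  next
    case (9 s i)
    then show ?case using nw[of s i] by simp
  next
    case (10 s)
    then show ?case using stage_facts(3)[OF steps, of s] by simp
  next
    case (11 s)
    then show ?case using step_ran_hi_max[OF steps, of s] by simp
  next
    case (12 s)
    then show ?case by (intro step_dom_hi_max[OF steps]) simp
  next
    case (13 s i X)
    then show ?case by (intro step_move[OF steps]) auto
  next
    case (14 s)
    then have s: "s \<le> T" "Suc s \<le> T" and pk: "p s < k" "p (Suc s) < k"
      using stage_facts(1)[OF steps] by auto
    have d: "dominates (G (Suc s) (p (Suc s))) (G (Suc s) (p s))" using dom[OF s(2) pk(1)] 14 by simp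
    moreover have "ran_hi (G (Suc s) (p s)) = N (Suc s)" by (rule step_ran_hi_max[OF steps[OF s(1)]])
    moreover have "ran_hi (G (Suc s) (p (Suc s))) = N (Suc s)" by (rule stage_facts(3)[OF steps[OF s(2)]])
    ultimately show ?case using nw[OF s(2) pk(1)] nw[OF s(2) pk(2)]
      by (auto simp: dominates_def contained_in_def)
  next
    case (15 s)
    then show ?case by (intro step_preserving_max[OF steps]) simp
  next
    case (16 s)
    then show ?case by (intro step_translation_max[OF steps]) auto
  next
    case (17 s i)
    then show ?case using nw[of s i] by simp
  next
    case (18 s i)
    note s = steps[OF 18(1)]
    show ?case
      by (rule unmergeable_apart[OF stage_facts(2)[OF s stage_facts(1)[OF s]] stage_facts(3)[OF s] stage_facts(2)[OF s 18(2)]])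
        (use 18 stage_facts(4)[OF s] in auto)
  next
    case (19 s)
    have "dominates (G (Suc s) (p s)) (G (Suc s) i)" if "i < k" "i \<noteq> p s" for i
      using dom[of "Suc s" i] 19 that by simp
    then show ?case using 19 by (intro step_stay_value[OF steps]) auto
  next
    case (20 s i)
    then show ?case using step_stay_halves[OF steps[of s], of i] by simp
  next
    case (21 s i)
    have "1 < (2::int) ^ R" using R[OF 21(1)] nw[OF 21] by simp
    then show ?case using nw[OF 21] nw[OF 21(1) stage_facts(1)[OF steps[OF 21(1)]]] R[OF 21(1)]
      by (simp add: stay_value_def)
  qed simp
  show ?thesis by (rule phase_length)
qed

subsection \<open>The sequence of states\<close>

primrec run :: "state \<Rightarrow> nat \<Rightarrow> state" where
  "run S 0 = S"
| "run S (Suc n) = result (cycle_t (run S n))"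

abbreviation stage :: "state \<Rightarrow> nat \<Rightarrow> state" where
  "stage S n \<equiv> prepare (run S n)"

lemma stage_Suc: "stage S (Suc n) = prepare (reduce (stage S n))"
  by (simp add: result_cycle)

lemma run_add: "run (run S n) m = run S (n + m)"
  by (induction m) simp_all

lemma run_valid: "valid d S \<Longrightarrow> valid d (run S n)"
  by (induction n) (auto intro: cycle_valid(1))

lemma run_all_weights: "valid d S \<Longrightarrow> all_weights d (run S n) = all_weights d S"
  by (induction n) (simp_all add: cycle_valid(2)[OF run_valid])

lemma run_bounded: "valid d S \<Longrightarrow> bounded_by d B S \<Longrightarrow> bounded_by d B (run S n)"
  by (induction n) (simp_all add: cycle_valid(3)[OF run_valid])

lemma run_len: "valid d S \<Longrightarrow> len (run S n) \<le> len S"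
  by (induction n) (auto intro: order_trans cycle_valid(7)[OF run_valid])

lemma run_pairings: "valid d S \<Longrightarrow> length (pairings (run S n)) \<le> length (pairings S)"
  by (induction n) (auto intro: order_trans cycle_valid(4)[OF run_valid])

lemma run_wts:
  assumes "valid d S"
  shows "length (wts (run S n)) \<le> length (wts S) + n * (9 + 4 * length (pairings S))"
proof (induction n)
  case (Suc n)
  have "length (wts (run S (Suc n))) \<le> length (wts (run S n)) + 9 + 4 * length (pairings (run S n))"
    using cycle_valid(5)[OF run_valid[OF assms, of n]] by simp
  then show ?case using Suc run_pairings[OF assms, of n] by simp
qed simp

lemma run_outp:
  assumes "valid d S"
  shows "length (outp (run S n)) \<le>
    length (outp S) + n * (length (wts S) + n * (9 + 4 * length (pairings S)) + 2 + 4 * length (pairings S))"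
proof -
  let ?a = "length (wts S) + n * (9 + 4 * length (pairings S)) + 2 + 4 * length (pairings S)"
  have "m \<le> n \<Longrightarrow> length (outp (run S m)) \<le> length (outp S) + m * ?a" for m
  proof (induction m)
    case (Suc m)
    have "length (outp (run S (Suc m))) \<le>
        length (outp (run S m)) + length (wts (run S m)) + 2 + 4 * length (pairings (run S m))"
      using cycle_valid(6)[OF run_valid[OF assms, of m]] by simp
    moreover have "length (wts (run S m)) \<le> length (wts S) + n * (9 + 4 * length (pairings S))"
    proof -
      have "m * (9 + 4 * length (pairings S)) \<le> n * (9 + 4 * length (pairings S))"
        using Suc.prems by (intro mult_le_mono1) simp
      then show ?thesis using run_wts[OF assms, of m] by linarith
    qed
    ultimately show ?case using Suc run_pairings[OF assms, of m] by simp
  qed simp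
  then show ?thesis by blast
qed

lemma stage_len_le: "valid d S \<Longrightarrow> len (stage S n) \<le> len S"
  using prepare_bounds(4)[OF run_valid, of d S n] run_len[of d S n] by simp

lemma stage_pairings_Suc:
  assumes "valid d S"
  shows "length (pairings (stage S (Suc n))) \<le> length (pairings (stage S n))"
proof -
  note p = prepare[OF run_valid[OF assms, of n]]
  note r = reduce_valid[OF p(2,4,5)]
  have "valid d (reduce (stage S n))" using r by blast
  then have "length (pairings (prepare (reduce (stage S n)))) \<le> length (pairings (reduce (stage S n)))"
    by (rule prepare(7))
  then show ?thesis unfolding stage_Suc using r by linarith
qed

lemma stage_pairings_mono:
  assumes "valid d S" "n \<le> m"
  shows "length (pairings (stage S m)) \<le> length (pairings (stage S n))"
  using assms(2)
proof (induction m rule: dec_induct)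
  case (step m)
  then show ?case using stage_pairings_Suc[OF assms(1), of m] by linarith
qed simp

text \<open>
  A potential for the number of phases: each phase multiplies a width by at most \<open>1 - \<epsilon>\<close>, while
  the widths lie between \<open>1\<close> and \<open>N\<close>.
\<close>

definition log_widths :: "pairing list \<Rightarrow> real" where
  "log_widths gs = (\<Sum>g\<in>#mset gs. ln (real_of_int (wd g)))"

lemma log_widths_labelled: "labelled k G gs \<Longrightarrow> log_widths gs = (\<Sum>i<k. ln (real_of_int (wd (G i))))"
  unfolding log_widths_def labelled_def
  by (metis (no_types, lifting) comp_apply multiset.map_comp sum.cong sum_unfold_sum_mset)

lemma log_widths_nonneg:
  assumes "\<forall>g\<in>set gs. normal N g"
  shows "0 \<le> log_widths gs" and "1 \<le> N \<Longrightarrow> log_widths gs \<le> real (length gs) * ln N"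
proof -
  have lab: "labelled (length gs) (\<lambda>i. gs ! i) gs" by (rule labelled_nth)
  have w: "1 \<le> wd (gs ! i) \<and> wd (gs ! i) \<le> N" if "i < length gs" for i
  proof -
    have "normal N (gs ! i)" using assms that by simp
    then show ?thesis by (cases "gs ! i") auto
  qed
  show "0 \<le> log_widths gs"
    unfolding log_widths_labelled[OF lab] using w by (intro sum_nonneg) (auto intro!: ln_ge_zero)
  assume N: "1 \<le> N"
  have "log_widths gs \<le> (\<Sum>i<length gs. ln (real_of_int N))"
    unfolding log_widths_labelled[OF lab]
  proof (intro sum_mono)
    fix i assume "i \<in> {..<length gs}"
    then have "1 \<le> wd (gs ! i)" "wd (gs ! i) \<le> N" using w by auto
    then show "ln (real_of_int (wd (gs ! i))) \<le> ln (real_of_int N)" by (intro ln_mono) auto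
  qed
  then show "log_widths gs \<le> real (length gs) * ln N" by simp
qed

text \<open>As long as no pairing disappears, every phase multiplies some width by at most \<open>1 - \<epsilon>\<close>.\<close>

lemma log_widths_drop:
  assumes v: "valid d S" and k: "length (pairings (stage S 0)) = k" "0 < k"
    and const: "\<And>n. n \<le> Q \<Longrightarrow> length (pairings (stage S n)) = k"
    and Q: "(2 * k + 1) * (2 * R + 3) < Q" and R: "len S + 1 < 2 ^ R"
  shows "log_widths (pairings (stage S Q)) \<le> log_widths (pairings (stage S 0)) - 1 / (32 * real k ^ 2)"
proof -
  let ?N = "\<lambda>n. len (stage S n)" and ?gs = "\<lambda>n. pairings (stage S n)"
  have "\<exists>G. \<forall>n. (n \<le> Q \<longrightarrow> labelled k (G n) (?gs n)) \<and>
      (n < Q \<longrightarrow> (\<exists>p M H f C. stage_step k (?N n) (G n) p M H f C (?N (Suc n)) (G (Suc n))))"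
  proof (rule dependent_nat_choice)
    show "\<exists>G. 0 \<le> Q \<longrightarrow> labelled k G (?gs 0)" using labelled_nth[of "?gs 0"] k(1) by auto
  next
    fix G n assume lab: "n \<le> Q \<longrightarrow> labelled k G (?gs n)"
    show "\<exists>G'. (Suc n \<le> Q \<longrightarrow> labelled k G' (?gs (Suc n))) \<and>
        (n < Q \<longrightarrow> (\<exists>p M H f C. stage_step k (?N n) G p M H f C (?N (Suc n)) G'))"
    proof (cases "n < Q")
      case True
      have "?gs n \<noteq> []" using const[of n] k(2) True by auto
      moreover have "length (?gs (Suc n)) = length (?gs n)" using const[of n] const[of "Suc n"] True by simp
      moreover have "labelled k G (?gs n)" using lab True by simp
      ultimately show ?thesis
        using stage_step_exists[OF run_valid[OF v, of n] refl stage_Suc] True by blast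
    qed auto
  qed
  then obtain G where lab: "\<And>n. n \<le> Q \<Longrightarrow> labelled k (G n) (?gs n)"
    and ex: "\<And>n. n < Q \<Longrightarrow> \<exists>p M H f C. stage_step k (?N n) (G n) p M H f C (?N (Suc n)) (G (Suc n))"
    by blast
  then obtain p M H f C where
    steps: "\<And>n. n < Q \<Longrightarrow> stage_step k (?N n) (G n) (p n) (M n) (H n) (f n) (C n) (?N (Suc n)) (G (Suc n))"
    by metis
  define T where "T = (2 * k + 1) * (2 * R + 3)"
  have mono: "n \<le> m \<Longrightarrow> m \<le> Q \<Longrightarrow> i < k \<Longrightarrow> wd (G m i) \<le> wd (G n i)" for n m i
  proof (induction m rule: dec_induct)
    case (step m)
    then show ?case using step_width[OF steps[of m], of i] by simp
  qed simp
  have pos: "1 \<le> wd (G n i)" if "n \<le> Q" "i < k" for n i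
  proof -
    have "G n i \<in> set (?gs n)" using labelled_set[OF lab[OF that(1)]] that(2) by blast
    then have "normal (?N n) (G n i)" using prepare(4)[OF run_valid[OF v]] by blast
    then show ?thesis using normal_widths by blast
  qed
  let ?e = "1 / (32 * real k ^ 2)"
  have e: "0 < ?e" "?e < 1"
  proof -
    have "1 \<le> real k ^ 2" using k(2) by simp
    then have "1 < 32 * real k ^ 2" by linarith
    then show "0 < ?e" "?e < 1" using k(2) by (simp_all add: divide_less_eq)
  qed
  have "\<exists>s i. s \<le> T \<and> i < k \<and> real_of_int (wd (G s i)) < (1 - ?e) * wd (G 0 i)"
  proof (rule ccontr)
    assume "\<not> ?thesis"
    then have "s \<le> T \<Longrightarrow> i < k \<Longrightarrow> (1 - ?e) * wd (G 0 i) \<le> wd (G s i)" for s i by force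
    moreover have "s \<le> T \<Longrightarrow> ?N s + 1 < 2 ^ R" for s using stage_len_le[OF v, of s] R by linarith
    moreover have "s \<le> T \<Longrightarrow> stage_step k (?N s) (G s) (p s) (M s) (H s) (f s) (C s) (?N (Suc s)) (G (Suc s))" for s
      using steps[of s] Q by (simp add: T_def)
    ultimately have "T < (2 * k + 1) * (2 * R + 3)" by (intro phase_bound[of T k "?N" G p M H f C R]) auto
    then show False by (simp add: T_def)
  qed
  then obtain s i where si: "s \<le> T" "i < k" "real_of_int (wd (G s i)) < (1 - ?e) * wd (G 0 i)" by blast
  have drop: "ln (real_of_int (wd (G Q i))) \<le> ln (real_of_int (wd (G 0 i))) - ?e"
  proof -
    have "real_of_int (wd (G Q i)) \<le> wd (G s i)" using mono[of s Q i] si Q by (simp add: T_def)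
    then have "real_of_int (wd (G Q i)) \<le> (1 - ?e) * wd (G 0 i)" using si(3) by linarith
    then have "ln (real_of_int (wd (G Q i))) \<le> ln ((1 - ?e) * wd (G 0 i))"
      using pos[of Q i] si by (intro ln_mono) auto
    also have "\<dots> = ln (1 - ?e) + ln (real_of_int (wd (G 0 i)))"
      using e pos[of 0 i] si by (intro ln_mult_pos) auto
    also have "ln (1 - ?e) \<le> - ?e" using ln_le_minus_one[of "1 - ?e"] e by simp
    finally show ?thesis by simp
  qed
  have "log_widths (?gs Q) = (\<Sum>j<k. ln (real_of_int (wd (G Q j))))"
    by (rule log_widths_labelled[OF lab]) simp
  also have "\<dots> \<le> (\<Sum>j<k. ln (real_of_int (wd (G 0 j))) - (if j = i then ?e else 0))"
  proof (intro sum_mono)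
    fix j assume "j \<in> {..<k}"
    then have "ln (real_of_int (wd (G Q j))) \<le> ln (real_of_int (wd (G 0 j)))"
      using mono[of 0 Q j] pos[of Q j] by (intro ln_mono) auto
    then show "ln (real_of_int (wd (G Q j))) \<le> ln (real_of_int (wd (G 0 j))) - (if j = i then ?e else 0)"
      using drop by simp
  qed
  also have "\<dots> = (\<Sum>j<k. ln (real_of_int (wd (G 0 j)))) - ?e" using si(2) by (simp add: sum_subtractf)
  also have "(\<Sum>j<k. ln (real_of_int (wd (G 0 j)))) = log_widths (?gs 0)"
    by (rule log_widths_labelled[OF lab, symmetric]) simp
  finally show ?thesis .
qed

text \<open>
  The number of pairings drops at most \<open>K\<close> times. As long as it is constant, there are at most
  \<open>32 K\<^sup>3 ln V + 1\<close> phases of bounded length, since each phase lowers \<open>log_widths\<close>, which is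
  at most \<open>K ln V\<close>, by \<open>1 / (32 K\<^sup>2)\<close>.
\<close>

definition cycle_bound :: "nat \<Rightarrow> int \<Rightarrow> nat \<Rightarrow> nat" where
  "cycle_bound K V R = K * (nat \<lfloor>32 * real K ^ 3 * ln V\<rfloor> + 1) * ((2 * K + 1) * (2 * R + 3) + 1) + 1"

lemma terminates:
  assumes v: "valid d S" and K: "length (pairings S) \<le> K" and V: "len S \<le> V" "1 \<le> V" and R: "V + 1 < 2 ^ R"
  shows "len (run S (cycle_bound K V R)) = 0"
proof -
  define Q where "Q = (2 * K + 1) * (2 * R + 3) + 1"
  define m where "m = nat \<lfloor>32 * real K ^ 3 * ln V\<rfloor> + 1"
  let ?l = "\<lambda>n. length (pairings (stage S n))"
  have lK: "?l n \<le> K" for n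
    using prepare(7)[OF run_valid[OF v, of n]] run_pairings[OF v, of n] K by simp
  have dec: "?l (n + m * Q) < ?l n" if pos: "0 < ?l n" for n
  proof (rule ccontr)
    assume "\<not> ?thesis"
    then have "?l n \<le> ?l (n + m * Q)" by simp
    then have const: "?l (n + j) = ?l n" if "j \<le> m * Q" for j
      using stage_pairings_mono[OF v, of n "n + j"] stage_pairings_mono[OF v, of "n + j" "n + m * Q"] that
      by simp
    let ?k = "?l n"
    have Kk: "1 \<le> ?k" "?k \<le> K" using pos lK[of n] by linarith+
    have e: "1 / (32 * real K ^ 2) \<le> 1 / (32 * real ?k ^ 2)"
      using Kk by (intro divide_left_mono mult_left_mono power_mono mult_pos_pos zero_less_power) auto
    have "j \<le> m \<Longrightarrow> log_widths (pairings (stage S (n + j * Q))) \<le>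
        log_widths (pairings (stage S n)) - real j * (1 / (32 * real K ^ 2))" for j
    proof (induction j)
      case (Suc j)
      let ?S = "run S (n + j * Q)"
      have jm: "Suc j * Q \<le> m * Q" using Suc.prems by (rule mult_le_mono1)
      have c: "length (pairings (stage ?S i)) = ?k" if "i \<le> Q" for i
      proof -
        have "j * Q + i \<le> m * Q" using jm that by simp
        then show ?thesis using const[of "j * Q + i"] by (simp add: run_add add.assoc)
      qed
      have "(2 * ?k + 1) * (2 * R + 3) \<le> (2 * K + 1) * (2 * R + 3)" using Kk by (intro mult_le_mono1) simp
      then have Q': "(2 * ?k + 1) * (2 * R + 3) < Q" unfolding Q_def by linarith
      have R': "len ?S + 1 < 2 ^ R" using run_len[OF v, of "n + j * Q"] V R by linarith
      have "log_widths (pairings (stage ?S Q)) \<le> log_widths (pairings (stage ?S 0)) - 1 / (32 * real ?k ^ 2)"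
        by (rule log_widths_drop[OF run_valid[OF v] c[OF le0] pos c Q' R'])
      moreover have "stage ?S Q = stage S (n + Suc j * Q)" by (simp add: run_add algebra_simps)
      moreover have "stage ?S 0 = stage S (n + j * Q)" by simp
      ultimately have "log_widths (pairings (stage S (n + Suc j * Q))) \<le>
          log_widths (pairings (stage S (n + j * Q))) - 1 / (32 * real ?k ^ 2)" by (simp only:)
      also have "\<dots> \<le> log_widths (pairings (stage S n)) - real j * (1 / (32 * real K ^ 2)) - 1 / (32 * real K ^ 2)"
        using Suc e by simp
      finally show ?case by (simp add: algebra_simps add_divide_distrib)
    qed simp
    from this[of m] have "real m * (1 / (32 * real K ^ 2)) \<le>
        log_widths (pairings (stage S n)) - log_widths (pairings (stage S (n + m * Q)))" by simp
    also have "\<dots> \<le> log_widths (pairings (stage S n))"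
      using log_widths_nonneg(1)[OF prepare(4)[OF run_valid[OF v, of "n + m * Q"]]] by simp
    also have "\<dots> \<le> real ?k * ln V"
    proof -
      have "\<forall>g\<in>set (pairings (stage S n)). normal V g"
      proof
        fix g assume "g \<in> set (pairings (stage S n))"
        then have "normal (len (stage S n)) g" using prepare(4)[OF run_valid[OF v, of n]] by blast
        then show "normal V g" using stage_len_le[OF v, of n] V by (cases g) auto
      qed
      then show ?thesis using log_widths_nonneg(2) V by blast
    qed
    also have "\<dots> \<le> real K * ln V" using Kk V by (intro mult_right_mono ln_ge_zero) auto
    finally have "real m \<le> 32 * real K ^ 3 * ln V"
      using Kk by (simp add: field_simps power2_eq_square power3_eq_cube)
    then show False unfolding m_def by linarith
  qed
  have "?l (j * (m * Q)) \<le> K - j" for j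
  proof (induction j)
    case 0
    then show ?case using lK[of 0] by simp
  next
    case (Suc j)
    show ?case
    proof (cases "0 < ?l (j * (m * Q))")
      case True
      then show ?thesis using dec[OF True] Suc by (simp add: add.commute)
    next
      case False
      then show ?thesis using stage_pairings_mono[OF v, of "j * (m * Q)" "Suc j * (m * Q)"] by simp
    qed
  qed
  from this[of K] have "pairings (stage S (K * (m * Q))) = []" by simp
  then have "result (extract_maximal_t (pairings (stage S (K * (m * Q))))) = None"
    by (simp add: extract_maximal_None)
  from reduce_None(1,2)[OF prepare(5)[OF run_valid[OF v]] this]
  have "len (run S (Suc (K * (m * Q)))) = 0" by (simp add: result_cycle)
  moreover have "Suc (K * (m * Q)) = cycle_bound K V R"
    unfolding cycle_bound_def m_def Q_def by (simp only: mult.assoc add_Suc_right Nat.add_0_right Suc_eq_plus1)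
  ultimately show ?thesis by (simp only:)
qed

section \<open>Correctness\<close>

lemma iterate_cycle:
  "((\<lambda>m. do { S \<leftarrow> m; cycle_t S }) ^^ n) (ret S) = TM (run S n) (1 + (\<Sum>j<n. cost (cycle_t (run S j))))"
  by (induction n) (simp_all add: ret_def bind_tm_def)

lemma weighted_orbit_counting_eq:
  assumes "len (run (State N gs L []) c) = 0"
  obtains n where "n \<le> c" "len (run (State N gs L []) n) = 0"
    and "weighted_orbit_counting N gs L = Some (TM (outp (run (State N gs L []) n))
      (2 + (\<Sum>j<n. cost (cycle_t (run (State N gs L []) j)))))"
proof -
  let ?S = "State N gs L []"
  define n where "n = (LEAST n. len (run ?S n) = 0)"
  have n: "len (run ?S n) = 0" "n \<le> c" unfolding n_def using assms by (rule LeastI, rule Least_le)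
  have "while_option (\<lambda>m. len (result m) \<noteq> 0) (\<lambda>m. do { S \<leftarrow> m; cycle_t S }) (ret ?S) =
      Some (TM (run ?S n) (1 + (\<Sum>j<n. cost (cycle_t (run ?S j)))))"
    unfolding while_option_def iterate_cycle using n by (auto simp: n_def)
  then have "weighted_orbit_counting N gs L = Some (TM (outp (run ?S n))
      (2 + (\<Sum>j<n. cost (cycle_t (run ?S j)))))"
    by (simp add: weighted_orbit_counting_def bind_tm_def ret_def)
  then show thesis using that n by blast
qed

lemma initial_valid:
  assumes "1 \<le> N" "\<forall>g\<in>set gs. is_pairing N g" "weight_list d L" "support L = {1..N}"
  shows "valid d (State N gs L [])"
  using assms weight_list_chain[of d L 1 N] by (auto simp: valid_def intro: exI[of _ 0])

lemma final_lists_orbits: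
  assumes v: "valid d (State N gs L [])" and fin: "len (run (State N gs L []) n) = 0"
  shows "lists_orbits N gs d L (outp (run (State N gs L []) n))"
proof -
  let ?S = "State N gs L []"
  define L' where "L' = outp (run ?S n)"
  obtain m where c: "chain d 1 L' m" using run_valid[OF v, of n] by (auto simp: valid_def L'_def)
  have "all_weights d (run ?S n) = all_weights d ?S" by (rule run_all_weights[OF v])
  moreover have "orbits 0 (pairings (run ?S n)) = {}" by (simp add: orbits_conn)
  ultimately have eq: "image_mset (weight_at d L') (mset_set (support L')) =
      image_mset (orbit_weight d L) (mset_set (orbits N gs))"
    by (simp add: all_weights_def fin orbit_weights_def output_weights_def L'_def)
  have "finite (support L')" using chain_support[OF c] by simp
  then obtain h where h: "bij_betw h (support L') (orbits N gs)"
    "\<forall>x\<in>support L'. orbit_weight d L (h x) = weight_at d L' x"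
    using image_mset_eq_bij[OF _ finite_orbits eq] by blast
  have "orbit_weight d L (h x) = z" if "((r, s), z) \<in> set L'" "x \<in> {r..s}" for r s z x
  proof -
    have "weight_at d L' x = z" "x \<in> {1..m}" using chain_entries[OF c that(1)] that(2) by auto
    then show ?thesis using h(2) chain_support[OF c] by auto
  qed
  then have "lists_orbits N gs d L L'"
    unfolding lists_orbits_def using h(1) chain_weight_list[OF c] by auto
  then show ?thesis by (simp add: L'_def)
qed

section \<open>Running time\<close>

subsection \<open>Sizes of integers\<close>

lemma isize_mono: "\<bar>x\<bar> \<le> \<bar>y\<bar> \<Longrightarrow> isize x \<le> isize y"
  unfolding isize_def bitlen_def by (simp add: floorlog_mono nat_mono)

lemma isize_nonneg_log:
  assumes "0 \<le> x"
  shows "real (isize x) \<le> log 2 (real_of_int (x + 1)) + 2"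
proof (cases "x = 0")
  case True
  then show ?thesis by (simp add: isize_def bitlen_def floorlog_def)
next
  case False
  then have x: "0 < x" using assms by simp
  then have "isize x = nat (\<lfloor>log 2 x\<rfloor> + 1) + 1"
    by (simp add: isize_def bitlen_def floorlog_def nat_add_distrib)
  moreover have "0 \<le> log 2 x" using x by simp
  ultimately have "real (isize x) \<le> log 2 x + 2" by linarith
  also have "log 2 x \<le> log 2 (real_of_int (x + 1))" using x by simp
  finally show ?thesis by simp
qed

text \<open>
  \<open>N\<close> bounds the positions, \<open>W\<close> the coordinates of the weights and \<open>V\<close> all intermediate results,
  which therefore have at most \<open>B\<close> bits. Costs are counted in units of \<open>u\<close>, which pays
  for any one operation.
\<close>

locale bit_bounds =
  fixes N W V :: int and d B u :: nat
  assumes N: "1 \<le> N" and W: "0 \<le> W" and V: "8 * (N + 1) + W \<le> V"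
    and B: "isize V \<le> B" and u_def: "u = B * B + 2 * B + 1"
begin

lemma V_bounds: "8 * (N + 1) \<le> V" "W \<le> V" "16 \<le> V"
  using V W N by simp_all

lemma isize_le: "\<bar>x\<bar> \<le> V \<Longrightarrow> isize x \<le> B"
  using isize_mono[of x V] B by simp

definition ok :: "int \<Rightarrow> bool" where
  "ok x \<longleftrightarrow> \<bar>x\<bar> \<le> V"

lemma ok_const [simp]: "ok 0" "ok 1" "ok 2"
  using V_bounds(3) by (simp_all add: ok_def)

lemma ok_minmax: "ok x \<Longrightarrow> ok y \<Longrightarrow> ok (min x y)" "ok x \<Longrightarrow> ok y \<Longrightarrow> ok (max x y)"
  by (simp_all add: min_def max_def)

definition steps :: "'a tm \<Rightarrow> nat \<Rightarrow> bool" where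
  "steps m n \<longleftrightarrow> cost m \<le> n * u"

lemma steps_mono: "steps m n \<Longrightarrow> n \<le> n' \<Longrightarrow> steps m n'"
  unfolding steps_def by (meson le_trans mult_le_mono1)

lemma u_pos: "1 \<le> u"
  unfolding u_def by simp

lemma steps_ret: "1 \<le> n \<Longrightarrow> steps (ret x) n"
  unfolding steps_def cost_ret using u_pos mult_le_mono[of 1 n 1 u] by simp

lemma steps_bind:
  assumes "steps m K" "steps (f (result m)) (n - K)" "K \<le> n"
  shows "steps (bind_tm m f) n"
proof -
  have "cost m + cost (f (result m)) \<le> K * u + (n - K) * u"
    using assms by (intro add_mono) (simp_all add: steps_def)
  also have "\<dots> = n * u" using assms(3) by (simp flip: add_mult_distrib)
  finally show ?thesis by (simp add: steps_def)
qed

lemma steps_if: "(b \<Longrightarrow> steps m n) \<Longrightarrow> (\<not> b \<Longrightarrow> steps m' n) \<Longrightarrow> steps (if b then m else m') n"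
  by simp

lemma steps_op:
  assumes "ok x" "ok y"
  shows "steps (add_t x y) 1" "steps (sub_t x y) 1" "steps (mul_t x y) 1" "steps (div_t x y) 1"
    "steps (mod_t x y) 1" "steps (le_t x y) 1" "steps (less_t x y) 1" "steps (eq_t x y) 1"
    "steps (min_t x y) 1" "steps (max_t x y) 1"
proof -
  have "isize x \<le> B" "isize y \<le> B" using assms by (simp_all add: isize_le ok_def)
  moreover from this have "isize x * isize y \<le> B * B" by (rule mult_le_mono)
  ultimately have "isize x + isize y + 1 \<le> u" "isize x * isize y \<le> u"
    unfolding u_def by linarith+
  then show "steps (add_t x y) 1" "steps (sub_t x y) 1" "steps (mul_t x y) 1" "steps (div_t x y) 1"
    "steps (mod_t x y) 1" "steps (le_t x y) 1" "steps (less_t x y) 1" "steps (eq_t x y) 1"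
    "steps (min_t x y) 1" "steps (max_t x y) 1"
    by (simp_all add: steps_def)
qed

lemmas steps_intros = steps_ret steps_if steps_op[THEN steps_bind] steps_op[THEN steps_mono]

lemma steps_map_t:
  assumes "\<And>x. x \<in> set xs \<Longrightarrow> steps (f x) K"
  shows "steps (map_t f xs) ((K + 1) * length xs + 1)"
  using assms
proof (induction xs)
  case (Cons x xs)
  then have IH: "steps (map_t f xs) ((K + 1) * length xs + 1)" "steps (f x) K" by auto
  show ?case
    unfolding map_t.simps
    by (rule steps_bind[OF IH(2)], rule steps_bind[OF IH(1)]) (auto intro!: steps_ret)
qed (simp add: steps_ret)

lemma steps_append_t: "steps (append_t xs ys) (length xs + 1)"
proof (induction xs ys rule: append_t.induct)
  case (2 x xs ys)
  then show ?case unfolding append_t.simps by (rule steps_bind) (auto intro!: steps_ret)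
qed (simp add: steps_ret)

lemma steps_vec_add_t:
  "\<forall>x\<in>set xs. ok x \<Longrightarrow> \<forall>y\<in>set ys. ok y \<Longrightarrow> steps (vec_add_t xs ys) (2 * length xs + 1)"
proof (induction xs ys rule: vec_add_t.induct)
  case (1 x xs y ys)
  then have IH: "steps (vec_add_t xs ys) (2 * length xs + 1)" by simp
  show ?case unfolding vec_add_t.simps
    by (rule steps_op(1)[THEN steps_bind], use 1 in simp, use 1 in simp, rule steps_bind[OF IH])
      (auto intro!: steps_ret)
qed (auto intro!: steps_ret)

lemma steps_vec_eq_t:
  "\<forall>x\<in>set xs. ok x \<Longrightarrow> \<forall>y\<in>set ys. ok y \<Longrightarrow> steps (vec_eq_t xs ys) (length xs + 1)"
proof (induction xs ys rule: vec_eq_t.induct)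
  case (2 x xs y ys)
  show ?case unfolding vec_eq_t.simps
    by (rule steps_op(8)[THEN steps_bind], use 2 in simp, use 2 in simp)
      (use 2 in \<open>auto intro!: steps_ret simp: eq_t_def\<close>)
qed (auto intro!: steps_ret)

lemma bitlen_half: "0 \<le> y \<Longrightarrow> 2 * y < x \<Longrightarrow> bitlen y + 1 \<le> bitlen x"
proof -
  assume y: "0 \<le> y" "2 * y < x"
  then have "nat y * 2 \<le> nat x" by simp
  show ?thesis
  proof (cases "y = 0")
    case True
    then show ?thesis using y bitlen_nonneg[of x] bitlen_eq_zero_iff[of x] by (simp add: bitlen_def floorlog_def)
  next
    case False
    then have "bitlen (y * 2 ^ 1) = bitlen y + 1" using y bitlen_pow2[of y 1] by simp
    moreover have "bitlen (y * 2 ^ 1) \<le> bitlen x"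
      unfolding bitlen_def using y by (simp add: floorlog_mono nat_mono)
    ultimately show ?thesis by simp
  qed
qed

text \<open>In the Euclidean algorithm the second argument is halved after two steps.\<close>

lemma steps_gcd_t:
  "0 \<le> x \<Longrightarrow> x \<le> V \<Longrightarrow> 0 \<le> y \<Longrightarrow> y \<le> V \<Longrightarrow> steps (gcd_t x y) (2 * (2 * nat (bitlen y) + 1))"
proof (induction "nat y" arbitrary: x y rule: less_induct)
  case less
  note prems = less.prems
  show ?case
  proof (cases "y = 0")
    case True
    then show ?thesis using prems V_bounds
      by (subst gcd_t.simps) (auto intro!: steps_op(8)[THEN steps_bind] steps_ret simp: ok_def)
  next
    case y0: False
    define r where "r = x mod y"
    have r: "0 \<le> r" "r < y" using y0 prems by (simp_all add: r_def)
    have b1: "1 \<le> bitlen y" using bitlen_half[of 0 y] y0 prems by (simp add: bitlen_def floorlog_def)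
    have "steps (gcd_t y r) (2 * (2 * nat (bitlen y)))"
    proof (cases "r = 0")
      case True
      have "steps (gcd_t y 0) 2" using prems V_bounds
        by (subst gcd_t.simps) (auto intro!: steps_op(8)[THEN steps_bind] steps_ret simp: ok_def)
      then show ?thesis using True b1 by (auto elim!: steps_mono)
    next
      case False
      define r2 where "r2 = y mod r"
      have r2: "0 \<le> r2" "r2 < r" using False r by (simp_all add: r2_def)
      have "2 * r2 < y"
      proof -
        have "y = r * (y div r) + r2" by (simp add: r2_def)
        moreover have "1 \<le> y div r" using r False by (simp add: pos_imp_zdiv_pos_iff int_one_le_iff_zero_less)
        then have "r \<le> r * (y div r)" using r False by (simp add: mult_le_cancel_left1)
        ultimately show ?thesis using r2 by linarith
      qed
      then have b2: "bitlen r2 + 1 \<le> bitlen y" using r2 by (intro bitlen_half)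
      have "steps (gcd_t r r2) (2 * (2 * nat (bitlen r2) + 1))"
        using r r2 prems by (intro less.hyps) auto
      moreover have "2 * (2 * nat (bitlen r2) + 1) \<le> 2 * (2 * nat (bitlen y)) - 2"
        using b2 bitlen_nonneg[of r2] by simp
      ultimately have "steps (gcd_t r r2) (2 * (2 * nat (bitlen y)) - 1 - 1)"
        unfolding diff_diff_left one_add_one by (rule steps_mono)
      then show ?thesis
        by (subst gcd_t.simps, intro steps_op(8)[THEN steps_bind] steps_if steps_ret steps_op(5)[THEN steps_bind])
          (use False r r2 prems V_bounds b1 in \<open>auto simp: r2_def ok_def\<close>)
    qed
    then have "steps (gcd_t y r) (2 * (2 * nat (bitlen y) + 1) - 1 - 1)" by simp
    then show ?thesis
      by (subst gcd_t.simps, intro steps_op(8)[THEN steps_bind] steps_if steps_ret steps_op(5)[THEN steps_bind])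
        (use y0 r prems V_bounds in \<open>auto simp: r_def ok_def\<close>)
  qed
qed

lemma steps_gcd_t': "0 \<le> x \<Longrightarrow> x \<le> V \<Longrightarrow> 0 \<le> y \<Longrightarrow> y \<le> V \<Longrightarrow> steps (gcd_t x y) (4 * B)"
proof -
  assume *: "0 \<le> x" "x \<le> V" "0 \<le> y" "y \<le> V"
  have "nat (bitlen y) + 1 \<le> B" using isize_le[of y] * by (simp add: isize_def)
  then show ?thesis using steps_gcd_t[OF *] by (auto elim!: steps_mono)
qed

subsection \<open>Operations on weight lists\<close>

text \<open>The factor \<open>2\<close> leaves room for the points next to the interval and for widths.\<close>

definition near :: "int \<Rightarrow> bool" where
  "near x \<longleftrightarrow> \<bar>x\<bar> \<le> 2 * (N + 1)"

definition small_entries :: "int \<Rightarrow> weights \<Rightarrow> bool" where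
  "small_entries b L \<longleftrightarrow>
    (\<forall>((p, q), z)\<in>set L. near p \<and> near q \<and> length z = d \<and> (\<forall>x\<in>set z. \<bar>x\<bar> \<le> b))"

lemma near_ok:
  "near x \<Longrightarrow> ok x" "near x \<Longrightarrow> ok (x + 1)" "near x \<Longrightarrow> ok (x - 1)"
  "near x \<Longrightarrow> near y \<Longrightarrow> ok (x - y)" "near x \<Longrightarrow> near y \<Longrightarrow> ok (x + y)"
  using V_bounds N by (auto simp: near_def ok_def)

lemma small_entries_Cons: "small_entries b (((p, q), z) # L) \<longleftrightarrow>
    near p \<and> near q \<and> length z = d \<and> (\<forall>x\<in>set z. \<bar>x\<bar> \<le> b) \<and> small_entries b L"
  by (auto simp: small_entries_def)

lemma steps_piece_t: "ok p \<Longrightarrow> ok q \<Longrightarrow> steps (piece_t p q z L) 2"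
  unfolding piece_t_def by (intro steps_intros) simp_all

lemma steps_restrict_weights_t:
  "small_entries b L \<Longrightarrow> near x \<Longrightarrow> near y \<Longrightarrow> steps (restrict_weights_t x y L) (4 * length L + 1)"
proof (induction x y L rule: restrict_weights_t.induct)
  case (2 x y p q z L)
  then have IH: "steps (restrict_weights_t x y L) (4 * length L + 1)" and pq: "near p" "near q"
    by (simp_all add: small_entries_Cons)
  show ?case unfolding restrict_weights_t.simps
    by (rule steps_bind[OF IH], intro steps_intros steps_piece_t[THEN steps_mono])
      (simp_all add: pq "2.prems" near_ok ok_minmax)
qed (simp add: steps_ret)

lemma steps_add_weight_t:
  "small_entries b L \<Longrightarrow> b \<le> V \<Longrightarrow> near x \<Longrightarrow> near y \<Longrightarrow> \<forall>c\<in>set v. ok c \<Longrightarrow>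
    steps (add_weight_t x y v L) ((2 * d + 14) * length L + 1)"
proof (induction x y v L rule: add_weight_t.induct)
  case (2 x y v p q z L)
  then have IH: "steps (add_weight_t x y v L) ((2 * d + 14) * length L + 1)" and pq: "near p" "near q"
    and z: "length z = d" "\<forall>c\<in>set z. ok c"
    by (auto simp: small_entries_Cons ok_def)
  have va: "steps (vec_add_t z v) (2 * d + 1)" using steps_vec_add_t[of z v] z "2.prems" by simp
  have "2 * d + 13 \<le> (2 * d + 14) * length (((p, q), z) # L) + 1 - ((2 * d + 14) * length L + 1)"
    by simp
  then have n: "m \<le> 2 * d + 13 \<Longrightarrow>
      m \<le> (2 * d + 14) * length (((p, q), z) # L) + 1 - ((2 * d + 14) * length L + 1)" for m by linarith
  have "steps (do {
     y' \<leftarrow> add_t y 1;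
     p3 \<leftarrow> max_t p y';
     L1 \<leftarrow> piece_t p3 q z (add_weight x y v L);
     p2 \<leftarrow> max_t p x;
     q2 \<leftarrow> min_t q y;
     zv \<leftarrow> vec_add_t z v;
     L2 \<leftarrow> piece_t p2 q2 zv L1;
     x' \<leftarrow> sub_t x 1;
     q1 \<leftarrow> min_t q x';
     piece_t p q1 z L2
   }) (2 * d + 13)"
    by (intro steps_op[THEN steps_bind] steps_piece_t[THEN steps_bind] va[THEN steps_bind]
        steps_piece_t[THEN steps_mono])
      (simp_all add: pq "2.prems" near_ok ok_minmax)
  then show ?case unfolding add_weight_t.simps
    by (intro steps_bind[OF IH] steps_mono[OF _ n[OF order_refl]]) simp_all
qed (simp add: steps_ret)

lemma steps_contract_weights_t:
  "small_entries b L \<Longrightarrow> near r \<Longrightarrow> near s \<Longrightarrow> near w \<Longrightarrow>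
    steps (contract_weights_t r s w L) (10 * length L + 1)"
proof (induction r s w L rule: contract_weights_t.induct)
  case (2 r s w p q z L)
  then have IH: "steps (contract_weights_t r s w L) (10 * length L + 1)" and pq: "near p" "near q"
    by (simp_all add: small_entries_Cons)
  have m: "ok (max p (s + 1) - w)"
    using pq "2.prems" V_bounds N unfolding near_def ok_def max_def by (auto split: if_splits)
  show ?case unfolding contract_weights_t.simps
    by (rule steps_bind[OF IH], intro steps_op[THEN steps_bind] steps_piece_t[THEN steps_bind] steps_piece_t[THEN steps_mono])
      (simp_all add: pq "2.prems" near_ok ok_minmax m)
qed (simp add: steps_ret)

lemma length_restrict_weights: "length (restrict_weights x y L) \<le> length L"
  by (induction x y L rule: restrict_weights_t.induct) (auto simp: piece_def)

lemma steps_zero_weights_t: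
  assumes L: "small_entries b L" "b \<le> V" and xy: "near n" "near x" "near y" "near (x - 1)" "near (y + 1)"
  shows "steps (zero_weights_t n x y L) (9 * length L + 2 * d + 6)"
proof -
  have n1: "near 1" using N by (simp add: near_def)
  have r: "steps (restrict_weights_t 1 (x - 1) L) (4 * length L + 1)"
    "steps (restrict_weights_t (y + 1) n L) (4 * length L + 1)"
    by (rule steps_restrict_weights_t[OF L(1)]; simp add: n1 xy)+
  have z: "steps (case L of [] \<Rightarrow> ret [] | (I, z) # _ \<Rightarrow> map_t (mul_t 0) z) (2 * d + 1)"
  proof (cases L)
    case (Cons e L')
    obtain p q z where e: "e = ((p, q), z)" by (metis surj_pair)
    have zd: "length z = d" "\<forall>x\<in>set z. ok x" using L Cons e by (auto simp: small_entries_Cons ok_def)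
    have "steps (map_t (mul_t 0) z) ((1 + 1) * length z + 1)"
      using zd by (intro steps_map_t steps_op) auto
    then show ?thesis using Cons e zd by (simp add: mult_2)
  qed (simp add: steps_ret)
  have a: "steps (append_t (restrict_weights 1 (x - 1) L) ys) n" if "length L + 1 \<le> n" for ys n
    by (rule steps_mono[OF steps_append_t]) (use that length_restrict_weights[of 1 "x - 1" L] in linarith)
  show ?thesis unfolding zero_weights_t_def
    apply (rule steps_bind[OF steps_op(2)], (simp add: near_ok xy)+)
     apply (rule steps_bind[OF steps_op(1)], (simp add: near_ok xy)+)
      apply (rule steps_bind[OF r(1)])
       apply (rule steps_bind[OF r(2)])
        apply (rule steps_bind[OF z], rule a)
          apply simp_all
    done
qed

lemma steps_add_at_end_t:
  "chain d (e + 1) L n \<Longrightarrow> 0 \<le> e \<Longrightarrow> n \<le> N \<Longrightarrow> near w \<Longrightarrow> steps (add_at_end_t e L w z) (length L + 3)"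
proof (induction e L w z rule: add_at_end_t.induct)
  case (1 e w z)
  then have "near e" using N by (simp add: near_def)
  then show ?case unfolding add_at_end_t.simps
    by (intro steps_op[THEN steps_bind] steps_ret) (simp_all add: "1.prems" near_ok)
next
  case (2 e r s v L w z)
  then have IH: "steps (add_at_end_t s L w z) (length L + 3)" by simp
  show ?case unfolding add_at_end_t.simps by (rule steps_bind[OF IH]) (auto intro!: steps_ret)
qed

lemma small_entries_chain:
  assumes L: "chain d 1 L n" and n: "n \<le> N" and W: "\<And>i. i < d \<Longrightarrow> abs_sum d L i n \<le> W"
  shows "small_entries W L"
  unfolding small_entries_def
proof (intro ballI, clarify)
  fix p q z assume e: "((p, q), z) \<in> set L"
  note c = chain_entries[OF L e]
  have "weight_at d L p = z" using c by auto
  then have "\<bar>z ! i\<bar> \<le> W" if "i < d" for i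
    using weight_le_abs_sum[of p n d L i] W[OF that] c by auto
  then show "near p \<and> near q \<and> length z = d \<and> (\<forall>x\<in>set z. \<bar>x\<bar> \<le> W)"
    using c n N by (auto simp: near_def in_set_conv_nth)
qed

lemma length_add_weight:
  assumes "chain d l L n" "x \<le> y" "length v = d"
  shows "length (add_weight x y v L) \<le> length L + 2"
proof -
  have "length (add_weight x y v L) = card (starts (add_weight x y v L))"
    using chain_starts[OF chain_add_weight[OF assms]] by simp
  also have "\<dots> \<le> card (starts L \<union> {x, y + 1})"
    by (intro card_mono starts_add_weight) simp
  also have "\<dots> \<le> card (starts L) + card {x, y + 1}" by (rule card_Un_le)
  also have "\<dots> \<le> length L + 2" using chain_starts[OF assms(1)] by (simp add: card_insert_if)
  finally show ?thesis .
qed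

subsection \<open>Operations on pairings\<close>

lemma steps_option:
  "(o1 = None \<Longrightarrow> steps m n) \<Longrightarrow> (\<And>x. o1 = Some x \<Longrightarrow> steps (f x) n) \<Longrightarrow>
    steps (case o1 of None \<Rightarrow> m | Some x \<Rightarrow> f x) n"
  by (cases o1) simp_all

lemma inside_ok:
  "1 \<le> x \<Longrightarrow> x \<le> N \<Longrightarrow> ok x" "\<bar>x\<bar> \<le> 4 * N \<Longrightarrow> ok x"
  using V_bounds N by (simp_all add: ok_def)

lemma steps_is_identity_t: "is_pairing N g \<Longrightarrow> steps (is_identity_t g) 3"
  by (cases g) (auto simp: is_identity_t.simps inside_ok intro!: steps_intros)

lemma steps_delete_identities_t:
  "\<forall>g\<in>set gs. is_pairing N g \<Longrightarrow> steps (delete_identities_t gs) (4 * length gs + 1)"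
proof (induction gs)
  case (Cons g gs)
  then have "steps (delete_identities_t gs) (4 * length gs + 1)" by simp
  then show ?case using Cons.prems unfolding delete_identities_t.simps
    by (intro steps_bind[where K = "4 * length gs + 1"] steps_bind[OF steps_is_identity_t] steps_ret) simp_all
qed (simp add: steps_ret)

lemma ok_half: "ok x \<Longrightarrow> ok (x div 2)"
  unfolding ok_def by linarith

lemma steps_trim_t: "is_pairing N g \<Longrightarrow> steps (trim_t g) 8"
proof (cases g)
  case (Pairing a b c d' p)
  assume "is_pairing N g"
  then have *: "1 \<le> a" "a \<le> N" "1 \<le> b" "b \<le> N" "1 \<le> c" "c \<le> N" "1 \<le> d'" "d' \<le> N" using Pairing by auto
  then have "ok (a + d')" "ok (a + d' - 1)" by (simp_all add: inside_ok)
  then show ?thesis using * unfolding Pairing trim_t.simps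
    by (intro steps_intros) (simp_all add: inside_ok ok_half)
qed

lemma steps_periodic_t: "is_pairing N g \<Longrightarrow> steps (periodic_t g) 4"
  by (cases g) (auto simp: periodic_t.simps inside_ok intro!: steps_intros)

lemma steps_merge_pair_t:
  assumes "is_pairing N g" "is_pairing N h"
  shows "steps (merge_pair_t g h) (40 + 4 * B)"
proof -
  obtain a1 b1 c1 d1 p1 a2 b2 c2 d2 p2 where gh: "g = Pairing a1 b1 c1 d1 p1" "h = Pairing a2 b2 c2 d2 p2"
    by (metis pairing.exhaust)
  have *: "1 \<le> a1" "a1 \<le> N" "a1 \<le> c1" "1 \<le> c1" "c1 \<le> N" "1 \<le> d1" "d1 \<le> N"
    "1 \<le> a2" "a2 \<le> N" "a2 \<le> c2" "1 \<le> c2" "c2 \<le> N" "1 \<le> d2" "d2 \<le> N"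
    using assms gh by auto
  have t: "0 \<le> gcd (c1 - a1) (c2 - a2)" "gcd (c1 - a1) (c2 - a2) \<le> N"
  proof -
    show "gcd (c1 - a1) (c2 - a2) \<le> N"
    proof (cases "c1 = a1")
      case False
      then have "gcd (c1 - a1) (c2 - a2) \<le> c1 - a1" using * by (intro gcd_le1_int) simp
      then show ?thesis using * by linarith
    qed (use * in simp)
  qed simp
  have m: "ok (min d1 d2 + 1 - max a1 a2)"
    by (rule inside_ok(2)) (use * in \<open>auto simp: min_def max_def\<close>)
  have m': "ok (min d1 d2 + 1)" "ok (max a1 a2)"
    by (rule inside_ok(2); use * in \<open>auto simp: min_def max_def\<close>)+
  have okd: "ok a1" "ok c1" "ok d1" "ok a2" "ok c2" "ok d2" "ok (c1 - a1)" "ok (c2 - a2)"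
    "ok (c1 - a1 + (c2 - a2))" "ok (gcd (c1 - a1) (c2 - a2))"
    by (rule inside_ok(2); use * t in linarith)+
  have v: "c1 - a1 \<le> V" "c2 - a2 \<le> V" using * V_bounds(1) by simp_all
  show ?thesis unfolding gh merge_pair_t.simps
    by (intro steps_bind[OF steps_periodic_t] steps_bind[OF steps_gcd_t'] steps_intros)
      (simp_all add: ok_minmax okd m m' v *(3,10) assms[unfolded gh] del: is_pairing.simps)
qed

abbreviation merge_cost :: nat where
  "merge_cost \<equiv> 41 + 4 * B"

lemma steps_merge_into_t:
  assumes "is_pairing N g"
  shows "\<forall>h\<in>set hs. is_pairing N h \<Longrightarrow> steps (merge_into_t g hs) (merge_cost * length hs + 1)"
proof (induction hs)
  case (Cons h hs)
  then have IH: "steps (merge_into_t g hs) (merge_cost * length hs + 1)" by simp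
  show ?case using assms Cons.prems unfolding merge_into_t.simps
    by (intro steps_bind[OF steps_merge_pair_t] steps_option steps_ret steps_bind[OF IH]) simp_all
qed (simp add: steps_ret)

lemma steps_merge_once_t:
  "\<forall>h\<in>set hs. is_pairing N h \<Longrightarrow> length hs \<le> k \<Longrightarrow>
    steps (merge_once_t hs) ((merge_cost * k + 2) * length hs + 1)"
proof (induction hs)
  case (Cons h hs)
  then have IH: "steps (merge_once_t hs) ((merge_cost * k + 2) * length hs + 1)" by simp
  have "merge_cost * length hs \<le> merge_cost * k" using Cons.prems by (intro mult_le_mono) simp_all
  then have 1: "steps (merge_into_t h hs) (merge_cost * k + 1)"
    using steps_merge_into_t[of h hs] Cons.prems by (auto elim!: steps_mono)
  show ?case unfolding merge_once_t.simps
    by (rule steps_bind[OF 1], intro steps_option steps_ret steps_bind[OF IH]) simp_all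
qed (simp add: steps_ret)

lemma steps_merge_all_t:
  "\<forall>h\<in>set hs. normal N h \<Longrightarrow> length hs \<le> k \<Longrightarrow>
    steps (merge_all_t hs) (((merge_cost * k + 2) * k + 2) * (length hs + 1))"
proof (induction hs rule: merge_all_t.induct)
  case (1 hs)
  have "(merge_cost * k + 2) * length hs \<le> (merge_cost * k + 2) * k" using "1.prems" by (intro mult_le_mono) simp_all
  then have s: "steps (merge_once_t hs) ((merge_cost * k + 2) * k + 1)"
    using steps_merge_once_t[of hs k] "1.prems" by (auto elim!: steps_mono simp: normal_is_pairing)
  show ?case
    unfolding merge_all_t.simps[of hs]
  proof (rule steps_bind[OF s], rule steps_option, goal_cases)
    case 1
    show ?case by (rule steps_ret) simp
  next
    case (2 gs)
    have len: "length hs = Suc (length gs)" using length_merge_once 2 by metis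
    have "\<forall>h\<in>set gs. normal N h" using merge_once "1.prems" 2 by blast
    then have "steps (merge_all_t gs) (((merge_cost * k + 2) * k + 2) * (length gs + 1))"
      using "1.prems" len by (intro "1.IH"[OF refl 2]) simp_all
    then show ?case by (rule steps_mono) (simp add: len)
  next
    case 3
    show ?case by simp
  qed
qed

lemma steps_less_maximal_t: "is_pairing N g \<Longrightarrow> is_pairing N h \<Longrightarrow> steps (less_maximal_t g h) 7"
  by (cases g; cases h) (auto simp: inside_ok intro!: steps_intros)

lemma steps_extract_maximal_t:
  "\<forall>h\<in>set hs. is_pairing N h \<Longrightarrow> steps (extract_maximal_t hs) (8 * length hs + 1)"
proof (induction hs)
  case (Cons g gs)
  then have IH: "steps (extract_maximal_t gs) (8 * length gs + 1)" by simp
  have "is_pairing N h" if "result (extract_maximal_t gs) = Some (h, hs)" for h hs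
    using extract_maximal_Some[OF that] Cons.prems
    by (metis list.set_intros(2) set_mset_mset union_single_eq_member)
  then show ?case using Cons.prems unfolding extract_maximal_t.simps
    by (intro steps_bind[OF IH] steps_option)
      (auto intro!: steps_ret steps_bind[OF steps_less_maximal_t])
qed (simp add: steps_ret)

lemma steps_contained_t:
  "ok x \<Longrightarrow> ok y \<Longrightarrow> ok l \<Longrightarrow> ok v \<Longrightarrow> steps (contained_t x y l v) 3"
  unfolding contained_t_def by (intro steps_intros) simp_all

lemma steps_orient_t: "ok a \<Longrightarrow> ok c \<Longrightarrow> steps (orient_t a b c d' p) 2"
  unfolding orient_t_def by (intro steps_intros) simp_all

lemma steps_pull_back_t:
  assumes g: "is_pairing N g" and xy: "1 \<le> x" "x \<le> N" "1 \<le> y" "y \<le> N" "preserving g \<Longrightarrow> ran_lo g \<le> x"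
  shows "steps (pull_back_t g x y) 9"
    and "ok (fst (result (pull_back_t g x y)))" "ok (snd (result (pull_back_t g x y)))"
proof -
  obtain a b c d' p where gp: "g = Pairing a b c d' p" by (cases g)
  have *: "1 \<le> a" "a \<le> c" "c \<le> N" "1 \<le> c" "1 \<le> d'" "d' \<le> N" using g gp by auto
  have r: "0 \<le> (x - c) div (c - a)" "(x - c) div (c - a) \<le> x"
    "0 \<le> ((x - c) div (c - a) + 1) * (c - a)" "((x - c) div (c - a) + 1) * (c - a) \<le> x - a" if p
  proof -
    have cx: "c \<le> x" using xy(5) gp that by simp
    then show r0: "0 \<le> (x - c) div (c - a)" using * by (simp add: div_int_pos_iff)
    show "(x - c) div (c - a) \<le> x"
      using zdiv_mono2[of "x - c" 1 "c - a"] cx * by (cases "c = a") simp_all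
    show "0 \<le> ((x - c) div (c - a) + 1) * (c - a)" using r0 * by simp
    show "((x - c) div (c - a) + 1) * (c - a) \<le> x - a"
    proof (cases "c = a")
      case False
      then have "0 \<le> (x - c) mod (c - a)" using * by simp
      moreover have "(x - c) div (c - a) * (c - a) + (x - c) mod (c - a) = x - c" by (rule div_mult_mod_eq)
      moreover have "((x - c) div (c - a) + 1) * (c - a) = (x - c) div (c - a) * (c - a) + (c - a)"
        by (simp add: distrib_right)
      ultimately show ?thesis by linarith
    qed (use cx in simp)
  qed
  define q where "q = (x - c) div (c - a)"
  define k where "k = (q + 1) * (c - a)"
  show "steps (pull_back_t g x y) 9"
    unfolding gp pull_back_t.simps
    by (intro steps_intros)
      (use * xy r in \<open>simp_all add: inside_ok flip: q_def k_def\<close>)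
  show "ok (fst (result (pull_back_t g x y)))" "ok (snd (result (pull_back_t g x y)))"
    using r * xy by (cases p; simp add: gp inside_ok flip: q_def k_def)+
qed

lemma trim_id: "normal n g \<Longrightarrow> trim g = g"
  by (cases g) (auto simp: trim_Pairing)

lemma steps_transmit_t:
  assumes g: "normal N g" and h: "is_pairing N h" and c: "ran_lo g \<le> ran_lo h"
  shows "steps (transmit_t g h) 31"
proof -
  obtain a b c d' p where hp: "h = Pairing a b c d' p" by (cases h)
  have *: "1 \<le> a" "a \<le> N" "1 \<le> b" "b \<le> N" "1 \<le> c" "c \<le> N" "1 \<le> d'" "d' \<le> N" using h hp by auto
  have gN: "is_pairing N g" using g by (rule normal_is_pairing)
  then have gr: "ok (ran_lo g)" "ok (ran_hi g)" by (cases g; simp add: inside_ok)+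
  note pb = steps_pull_back_t[OF gN]
  show ?thesis
    unfolding hp transmit_t.simps
    apply (rule steps_bind[OF steps_trim_t[OF gN]])
     apply (simp only: trim_id[OF g])
     apply (rule steps_bind[OF pb(1)])
          apply (use * c hp in simp_all)[5]
      apply (simp only: case_prod_beta)
      apply (rule steps_bind[OF steps_contained_t])
           apply (use * gr in \<open>simp_all add: inside_ok\<close>)[4]
       apply (rule steps_if)
        apply (rule steps_bind[OF pb(1)])
             apply (use * c hp in \<open>simp_all add: contained_t_def\<close>)[5]
         apply (simp only: case_prod_beta)
         apply (rule steps_mono[OF steps_orient_t])
           apply (use * c hp in \<open>simp_all add: inside_ok pb contained_t_def\<close>)[3]
        apply simp
       apply (rule steps_mono[OF steps_orient_t])
         apply (use * c hp in \<open>simp_all add: inside_ok pb\<close>)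
    done
qed

lemma steps_transmit_if_contained_t:
  assumes "normal N g" "is_pairing N h" "1 \<le> n" "n \<le> N"
  shows "steps (transmit_if_contained_t n g h) 35"
proof -
  have "ok (ran_lo g)" "ok (ran_lo h)" "ok (ran_hi h)" "ok n"
    using assms by (cases g; cases h; simp add: inside_ok)+
  then show ?thesis unfolding transmit_if_contained_t_def
    using assms by (intro steps_bind[OF steps_contained_t] steps_if steps_mono[OF steps_transmit_t] steps_ret)
      (simp_all add: contained_t_def)
qed

lemma steps_cut_point_t:
  "\<forall>h\<in>set hs. is_pairing N h \<Longrightarrow> 1 \<le> x \<Longrightarrow> x \<le> N + 1 \<Longrightarrow> steps (cut_point_t x hs) (2 * length hs + 1)"
proof (induction hs arbitrary: x)
  case (Cons h hs)
  have h: "1 \<le> ran_hi h" "ran_hi h \<le> N" using Cons.prems by (cases h; auto)+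
  have "steps (cut_point_t (max x (ran_hi h + 1)) hs) (2 * length hs + 1)"
    using Cons.prems h by (intro Cons.IH) auto
  then show ?case using h Cons.prems N unfolding cut_point_t.simps
    by (intro steps_op[THEN steps_bind]) (simp_all add: inside_ok)
qed (simp add: steps_ret)

lemma steps_truncate_t:
  assumes "is_pairing N g" "0 \<le> n" "n \<le> N" "0 \<le> M" "M \<le> N"
  shows "steps (truncate_t n M g) 6"
  using assms N by (cases g) (auto simp: truncate_t.simps inside_ok intro!: steps_intros)

lemma steps_shift_t: "ok s \<Longrightarrow> ok w \<Longrightarrow> ok x \<Longrightarrow> steps (shift_t s w x) 2"
  unfolding shift_t_def by (intro steps_intros) simp_all

lemma steps_contract_pairing_t:
  "is_pairing N g \<Longrightarrow> ok s \<Longrightarrow> ok w \<Longrightarrow> steps (contract_pairing_t s w g) 9"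
  by (cases g) (auto simp: inside_ok intro!: steps_intros steps_bind[OF steps_shift_t])

subsection \<open>Static intervals\<close>

lemma steps_covered_t:
  "\<forall>h\<in>set gs. is_pairing N h \<Longrightarrow> ok x \<Longrightarrow> steps (covered_t x gs) (7 * length gs + 1)"
proof (induction gs)
  case (Cons g gs)
  obtain a b c d' p where g: "g = Pairing a b c d' p" by (cases g)
  have ok: "ok a" "ok b" "ok c" "ok d'" using Cons.prems g by (simp_all add: inside_ok)
  have IH: "steps (covered_t x gs) m" if "7 * length gs + 1 \<le> m" for m
    using Cons that by (auto elim!: steps_mono)
  show ?case unfolding covered_t.simps g
    by (intro steps_bind[OF steps_contained_t] steps_if steps_ret IH) (use ok Cons.prems in simp_all)
qed (simp add: steps_ret)

lemma steps_start_points_t: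
  "\<forall>h\<in>set gs. is_pairing N h \<Longrightarrow> steps (start_points_t gs) (3 * length gs + 1)"
proof (induction gs rule: start_points_t.induct)
  case (2 a b c d' p gs)
  then have IH: "steps (start_points_t gs) (3 * length gs + 1)" by simp
  show ?case using "2.prems" unfolding start_points_t.simps
    by (intro steps_bind[OF IH] steps_intros) (simp_all add: inside_ok)
qed (simp add: steps_ret)

lemma length_start_points: "length (result (start_points_t gs)) = 2 * length gs + 1"
  by (induction gs rule: start_points_t.induct) simp_all

lemma steps_find_static_t:
  "\<forall>h\<in>set gs. is_pairing N h \<Longrightarrow> ok n \<Longrightarrow> \<forall>x\<in>set xs. ok x \<Longrightarrow>
    steps (find_static_t n gs xs) ((7 * length gs + 3) * length xs + 1)"
proof (induction n gs xs rule: find_static_t.induct)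
  case (2 n gs x xs)
  then have x: "ok x" "ok n" "\<forall>h\<in>set gs. is_pairing N h" "\<forall>x\<in>set xs. ok x" by simp_all
  have "steps (find_static_t n gs xs) ((7 * length gs + 3) * length xs + 1)" if "\<not> x \<le> n \<or> x \<in> cov gs"
    using that "2.IH" x by auto
  then have IH: "steps (find_static_t n gs xs) m" if "\<not> x \<le> n \<or> x \<in> cov gs"
    "(7 * length gs + 3) * length xs + 1 \<le> m" for m using that steps_mono by blast
  show ?case unfolding find_static_t.simps
    by (intro steps_op[THEN steps_bind] steps_if IH steps_bind[OF steps_covered_t] steps_ret)
      (use x in simp_all)
qed (simp add: steps_ret)

lemma steps_static_end_t:
  "\<forall>h\<in>set gs. is_pairing N h \<Longrightarrow> ok r \<Longrightarrow> ok e \<Longrightarrow> steps (static_end_t r gs e) (7 * length gs + 1)"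
proof (induction r gs e rule: static_end_t.induct)
  case (2 r a b c d' p gs e)
  have s: "steps (stop_before_t r x e) 3" "ok (result (stop_before_t r x e))" if "ok r" "1 \<le> x" "x \<le> N" "ok e" for x e
  proof -
    have x: "ok x" "ok (x - 1)" using that by (simp_all add: inside_ok)
    show "steps (stop_before_t r x e) 3"
      unfolding stop_before_t_def by (intro steps_intros) (simp_all add: x that)
    show "ok (result (stop_before_t r x e))" by (simp add: x that ok_minmax)
  qed
  have a: "1 \<le> a" "a \<le> N" "1 \<le> c" "c \<le> N" using "2.prems" by auto
  let ?e1 = "result (stop_before_t r a e)"
  have e1: "ok ?e1" using s a "2.prems" by simp
  have e2: "ok (result (stop_before_t r c ?e1))" by (rule s(2)[OF "2.prems"(2) a(3,4) e1])
  have "steps (static_end_t r gs (result (stop_before_t r c ?e1))) (7 * length gs + 1)"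
    by (rule "2.IH"[OF refl refl]) (use "2.prems" e2 in simp_all)
  then show ?case unfolding static_end_t.simps
    by (intro steps_bind[OF s(1)]) (use "2.prems" a e1 in \<open>auto elim!: steps_mono\<close>)
qed (simp add: steps_ret)

lemma steps_extend_run_t:
  "small_entries V L \<Longrightarrow> length z = d \<Longrightarrow> \<forall>x\<in>set z. ok x \<Longrightarrow> steps (extend_run_t z s L) ((d + 2) * length L + 1)"
proof (induction z s L rule: extend_run_t.induct)
  case (2 z s p q v L)
  then have v: "length v = d" "\<forall>x\<in>set v. ok x" and sL: "small_entries V L"
    by (auto simp: small_entries_Cons ok_def)
  have 1: "steps (vec_eq_t v z) (d + 1)" using steps_vec_eq_t[of v z] v "2.prems" by simp
  have IH: "steps (extend_run_t z q L) m" if "v = z" "(d + 2) * length L + 1 \<le> m" for m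
    using that "2.IH" sL "2.prems" steps_mono by (metis result_vec_eq_t)
  show ?case unfolding extend_run_t.simps
    by (intro steps_bind[OF 1] steps_if steps_ret IH) simp_all
qed (simp add: steps_ret)

lemma steps_weight_run_t:
  "small_entries V L \<Longrightarrow> ok r \<Longrightarrow> steps (weight_run_t r L) ((d + 3) * length L + 1)"
proof (induction r L rule: weight_run_t.induct)
  case (2 r p q z L)
  then have v: "length z = d" "\<forall>x\<in>set z. ok x" "near p" "near q" and sL: "small_entries V L"
    by (auto simp: small_entries_Cons ok_def)
  have IH: "steps (weight_run_t r L) m" if "\<not> r \<le> q" "(d + 3) * length L + 1 \<le> m" for m
    using that "2.IH" sL "2.prems" steps_mono by simp blast
  show ?case unfolding weight_run_t.simps
    by (intro steps_op[THEN steps_bind] steps_if steps_bind[OF steps_extend_run_t] steps_ret IH)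
      (use v sL "2.prems" near_ok in \<open>simp_all add: algebra_simps\<close>)
qed (simp add: steps_ret)

lemma is_pairing_mono: "is_pairing n g \<Longrightarrow> n \<le> N \<Longrightarrow> is_pairing N g"
  by (cases g) auto

lemma normal_mono: "normal n g \<Longrightarrow> n \<le> N \<Longrightarrow> normal N g"
  by (cases g) auto

lemma ok_between: "- (4 * N) \<le> x \<Longrightarrow> x \<le> 4 * N \<Longrightarrow> ok x"
  by (rule inside_ok(2)) linarith

definition contract_cost :: "nat \<Rightarrow> nat \<Rightarrow> nat \<Rightarrow> nat" where
  "contract_cost k r v = (7 * k + 3) * (2 * k + 1) + (d + 13) * r + v + 20 * k + 20"

text \<open>
  Every contraction lowers the number of marks, which therefore bounds the depth of the recursion;
  it also bounds the growth of the output.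
\<close>

lemma steps_contract_static_t:
  "0 \<le> n \<Longrightarrow> n \<le> N \<Longrightarrow> \<forall>g\<in>set gs. is_pairing n g \<Longrightarrow> chain d 1 L n \<Longrightarrow>
    chain d 1 L' e \<Longrightarrow> e + n \<le> N \<Longrightarrow> \<forall>i<d. abs_sum d L i n \<le> W \<Longrightarrow> length gs \<le> k \<Longrightarrow>
    card (marks n gs L) \<le> j \<Longrightarrow> j \<le> r \<Longrightarrow> length L' + j \<le> v \<Longrightarrow>
    steps (contract_static_t (State n gs L L')) ((j + 1) * contract_cost k r v)"
proof (induction j arbitrary: n gs L L' e rule: less_induct)
  case (less j)
  note prems = less.prems
  have gsN: "\<forall>g\<in>set gs. is_pairing N g" using prems is_pairing_mono by blast
  have n: "ok n" using prems V_bounds N by (simp add: ok_def)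
  have sL: "small_entries W L" using prems by (intro small_entries_chain) auto
  then have sLV: "small_entries V L" using V_bounds(2) unfolding small_entries_def by fastforce
  have lenL: "length L \<le> r" using card_marks(1)[OF prems(4), of gs] prems by linarith
  define p1 where "p1 = (7 * k + 3) * (2 * k + 1)"
  define p2 where "p2 = (d + 3) * r"
  define rest where "rest = j * contract_cost k r v"
  have n_eq: "(j + 1) * contract_cost k r v = p1 + p2 + 10 * r + v + 20 * k + 20 + rest"
    by (simp add: p1_def p2_def rest_def contract_cost_def algebra_simps)
  have sp: "steps (start_points_t gs) (3 * k + 1)"
    using steps_start_points_t[OF gsN] prems(8) by (auto elim!: steps_mono)
  have sp_ok: "\<forall>x\<in>set (result (start_points_t gs)). ok x"
  proof -
    have "ok (dom_hi g + 1) \<and> ok (ran_hi g + 1)" if "g \<in> set gs" for g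
      using gsN that V_bounds by (cases g) (auto simp: ok_def)
    then show ?thesis unfolding start_points by auto
  qed
  have "steps (find_static_t n gs (result (start_points_t gs)))
      ((7 * length gs + 3) * (2 * length gs + 1) + 1)"
    using steps_find_static_t[OF gsN n sp_ok] unfolding length_start_points .
  moreover have "(7 * length gs + 3) * (2 * length gs + 1) \<le> p1"
    unfolding p1_def using prems(8) by (intro mult_le_mono) simp_all
  ultimately have fs: "steps (find_static_t n gs (result (start_points_t gs))) (p1 + 1)"
    by (auto elim!: steps_mono)
  show ?case unfolding n_eq
  proof (subst contract_static_t.simps, rule steps_bind[OF steps_op(7)], goal_cases)
    case 3
    show ?case
    proof (rule steps_if, goal_cases)
      case 1
      show ?case by (rule steps_ret) simp
    next
      case 2
      then have n0: "0 < n" by simp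
      show ?case
      proof (rule steps_bind[OF sp], rule steps_bind[OF fs], rule steps_option, goal_cases)
        case 1
        show ?case by (rule steps_ret) simp
      next
        case (2 x)
        define en where "en = result (static_end_t x gs n)"
        define e' where "e' = snd (result (weight_run_t x L))"
        obtain s w z where z: "z = fst (result (weight_run_t x L))" and s0: "s = min (result (static_end_t x gs n)) (snd (result (weight_run_t x L)))"
          and rs: "1 \<le> x" "x \<le> s" "s \<le> n" "w = s - x + 1" "{x..s} \<inter> cov gs = {}" "length z = d"
            "\<forall>y\<in>{x..s}. weight_at d L y = z" "x \<in> marks n gs L" "s + 1 \<in> marks n gs L"
          by (rule contract_static_step[OF n0 prems(3,4) 2, where L' = L'], rule that)
        note s = s0[folded en_def e'_def]
        have wr_eq: "result (weight_run_t x L) = (z, e')" by (simp add: z e'_def)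
        have wr: "steps (weight_run_t x L) (p2 + 1)"
        proof (rule steps_mono[OF steps_weight_run_t[OF sLV]])
          show "ok x" using rs prems by (simp add: inside_ok)
          have "(d + 3) * length L \<le> (d + 3) * r" using lenL by (intro mult_le_mono) simp_all
          then show "(d + 3) * length L + 1 \<le> p2 + 1" by (simp add: p2_def)
        qed
        have x: "ok x" "ok s" "ok (s + 1)" "ok w" "near w" "near x" "near s" "ok n"
          using rs prems V_bounds N by (simp_all add: ok_def near_def)
        have se: "steps (static_end_t x gs n) (7 * k + 1)"
          using steps_static_end_t[OF gsN x(1,8)] prems(8) by (auto elim!: steps_mono)
        have en: "ok en" "ok e'"
        proof -
          have no: "x \<notin> cov gs" using rs by auto
          have nd: "\<forall>g\<in>set gs. dom_lo g \<le> dom_hi g \<and> ran_lo g \<le> ran_hi g"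
          proof
            fix g assume "g \<in> set gs"
            then have "is_pairing n g" using prems(3) by blast
            then show "dom_lo g \<le> dom_hi g \<and> ran_lo g \<le> ran_hi g" by (cases g) auto
          qed
          have "x \<le> en \<and> en \<le> n" using static_end[OF en_def no _ nd] rs by auto
          moreover have "x \<le> e' \<and> e' \<le> n"
            using weight_run[OF prems(4) rs(1) _ wr_eq[symmetric]] rs by auto
          ultimately show "ok en" "ok e'" using rs prems by (simp_all add: inside_ok)
        qed
        have ae: "steps (add_at_end_t 0 L' w z) (v + 3)"
          by (rule steps_mono[OF steps_add_at_end_t[where n = e]]) (use prems x in auto)
        have cp: "steps (map_t (contract_pairing_t s w) gs) (10 * k + 1)"
        proof (rule steps_mono[OF steps_map_t])
          show "steps (contract_pairing_t s w g) 9" if "g \<in> set gs" for g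
            using gsN that x by (intro steps_contract_pairing_t) auto
        qed (use prems(8) in simp)
        have cw: "steps (contract_weights_t x s w L) (10 * r + 1)"
          by (rule steps_mono[OF steps_contract_weights_t[OF sL]]) (use x lenL in auto)
        let ?gs = "map (pmap (shift s w)) gs" and ?L = "contract_weights x s w L"
          and ?L' = "result (add_at_end_t 0 L' w z)"
        have IH: "steps (contract_static_t (State (n - w) ?gs ?L ?L')) rest"
        proof -
          have dis: "{x..s} \<inter> (cov gs \<union> {n + 1}) = {}" using rs by auto
          note sq0 = squeezes_shift[OF rs(1,2,4) dis]
          have cov1: "cov ?gs = shift s w ` cov gs"
            by (rule cov_pmap[OF sq0 _ prems(3)]) auto
          have sN: "shift s w (n + 1) = n - w + 1" using rs by (simp add: shift_def)
          have sq: "squeezes (shift s w) (cov gs \<union> {n + 1}) (cov ?gs \<union> {n - w + 1})"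
            using sq0 by (simp add: cov1 sN)
          have gs1: "\<forall>g\<in>set ?gs. is_pairing (n - w) g"
            using pmap_is_pairing[OF sq sN] prems(3) by auto
          have L1: "chain d 1 ?L (n - w)" by (rule chain_contract[OF prems(4) rs(1-4)])
          have L1': "chain d 1 ?L' (e + w)"
            using output_weights_add_at_end(1)[OF prems(5), of w z] rs by simp
          have lenL': "length ?L' = length L' + 1"
            using add_at_end[of d 0 L' e w z] prems(5) by simp
          have mono: "\<forall>i<d. abs_sum d ?L i (n - w) \<le> W"
            using abs_sum_contract[OF rs(1-4)] prems(7) order_trans by blast
          have card: "card (marks (n - w) ?gs ?L) < card (marks n gs L)"
            by (rule card_marks_contract[OF prems(4) rs(1-5) prems(3) rs(8,9)])
          have "steps (contract_static_t (State (n - w) ?gs ?L ?L')) ((j - 1 + 1) * contract_cost k r v)"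
            by (rule less.IH[of "j - 1" "n - w" ?gs ?L ?L' "e + w", OF _ _ _ gs1 L1 L1' _ mono])
              (use card prems(1,2,6,8-11) rs(1-4) lenL' in simp_all)
          moreover have "j - 1 + 1 = j" using card prems(9) by linarith
          ultimately show ?thesis by (simp only: rest_def)
        qed
        have ws: "s + 1 - x = w" and w0: "0 < w" using rs by simp_all
        show ?case
          apply (rule steps_bind[OF se], fold en_def)
           apply (rule steps_bind[OF wr])
            apply (simp only: wr_eq prod.case)
            apply (rule steps_bind[OF steps_op(9)[OF en]])
             apply (simp only: result_arith s[symmetric])
             apply (rule steps_bind[OF steps_op(1)[OF x(2) ok_const(2)]])
              apply (rule steps_bind[OF steps_op(2)])
                 apply (simp only: result_arith x)
                apply (rule x(1))
               apply (simp only: result_arith ws)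
               apply (rule steps_bind[OF steps_op(7)[OF ok_const(1) x(4)]])
                apply (simp only: result_arith w0 not_True_eq_False if_False)
                apply (rule steps_bind[OF ae])
                 apply (rule steps_bind[OF cp])
                  apply (rule steps_bind[OF cw])
                   apply (rule steps_bind[OF steps_op(2)[OF x(8,4)]])
                    apply (simp only: result_arith result_map_t result_contract_pairing)
                    apply (rule steps_mono[OF IH])
                    apply simp_all
          done
      qed simp_all
    qed
  qed (use n in simp_all)
qed

subsection \<open>Transferring weights\<close>

definition add_cost :: "nat \<Rightarrow> nat" where
  "add_cost q = (2 * d + 14) * q + 1"

lemma steps_add_weight_chain:
  assumes "chain d 1 L n" "n \<le> N" "\<forall>i<d. abs_sum d L i n \<le> W" "length L \<le> q"
    and "near x" "near y" "\<forall>c\<in>set v. ok c"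
  shows "steps (add_weight_t x y v L) (add_cost q)"
proof -
  have "small_entries W L" using assms by (intro small_entries_chain) auto
  then have "steps (add_weight_t x y v L) ((2 * d + 14) * length L + 1)"
    using V_bounds(2) assms by (intro steps_add_weight_t) auto
  moreover have "(2 * d + 14) * length L \<le> (2 * d + 14) * q" using assms(4) by (intro mult_le_mono) simp_all
  ultimately show ?thesis unfolding add_cost_def by (elim steps_mono) simp
qed

text \<open>
  The weight that a periodic pairing distributes over \<open>[a,c - 1]\<close> has the same total absolute
  value as the weight that it removes, so that no intermediate coordinate exceeds \<open>W\<close>.
\<close>

lemma steps_transfer_periodic_t:
  assumes L: "chain d 1 L n" "n \<le> N" "\<forall>i<d. abs_sum d L i n + \<bar>v ! i\<bar> * (s - r + 1) \<le> W"
    and q: "length L + 4 \<le> q"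
    and g: "1 \<le> a" "a < c" "c \<le> r" "r \<le> s" "s \<le> n" "length v = d"
  shows "steps (transfer_periodic_t a c ((r, s), v) L) (3 * add_cost q + 2 * d + 30)"
proof -
  define t where "t = c - a"
  define w where "w = s + 1 - r"
  have t: "0 < t" "t \<le> n" and w: "0 < w" "w \<le> n" using g by (simp_all add: t_def w_def)
  have wq: "w = (w div t) * t + w mod t" by simp
  have m: "0 \<le> w mod t" "w mod t < t" using t by simp_all
  have k0: "0 \<le> w div t" using w t by (simp add: pos_imp_zdiv_nonneg_iff)
  have kt: "w div t \<le> w div t * t" using k0 t by (simp add: mult_le_cancel_left1)
  have kw: "w div t \<le> w" using kt wq m by linarith
  have vW: "\<bar>v ! i\<bar> * w \<le> W" "abs_sum d L i n \<le> W" if "i < d" for i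
  proof -
    have "0 \<le> \<bar>v ! i\<bar> * w" "0 \<le> abs_sum d L i n" using w abs_sum_nonneg by simp_all
    moreover have "abs_sum d L i n + \<bar>v ! i\<bar> * w \<le> W"
      using L(3) that by (simp add: w_def algebra_simps)
    ultimately show "\<bar>v ! i\<bar> * w \<le> W" "abs_sum d L i n \<le> W" by linarith+
  qed
  have vW': "\<bar>v ! i\<bar> * u \<le> W" if "i < d" "0 \<le> u" "u \<le> w" for i u
    using vW(1)[OF that(1)] mult_left_mono[OF that(3), of "\<bar>v ! i\<bar>"] by simp
  have okv: "\<forall>x\<in>set v. ok x"
    using vW'[of _ 1] w V_bounds(2) g(6) unfolding ok_def by (fastforce simp: in_set_conv_nth)
  define nv where "nv = map ((*) (w div t)) v"
  have nv: "length nv = d" "\<And>i. i < d \<Longrightarrow> nv ! i = w div t * v ! i" using g by (simp_all add: nv_def)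
  have oknv: "\<forall>x\<in>set nv. ok x"
  proof
    fix x assume "x \<in> set nv"
    then obtain i where i: "i < d" "x = w div t * v ! i" using nv by (auto simp: in_set_conv_nth)
    then have "\<bar>x\<bar> = \<bar>v ! i\<bar> * (w div t)" using k0 by (simp add: abs_mult mult.commute)
    then show "ok x" using vW'[OF i(1) k0 kw] V_bounds(2) unfolding ok_def by linarith
  qed
  have mapv: "steps (map_t (mul_t (w div t)) v) (2 * d + 1)"
  proof (rule steps_mono[OF steps_map_t])
    show "steps (mul_t (w div t) x) 1" if "x \<in> set v" for x
      using that okv k0 kw w L(2) N by (intro steps_op) (auto intro: inside_ok)
  qed (simp add: g)
  have near: "near x" if "0 \<le> x" "x \<le> n + 1" for x using that L(2) N by (simp add: near_def)
  define L1 where "L1 = add_weight a (c - 1) nv L"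
  have L1: "chain d 1 L1 n" unfolding L1_def using L g nv by (intro chain_add_weight) auto
  have len1: "length L1 \<le> length L + 2" unfolding L1_def using g nv by (intro length_add_weight[OF L(1)]) auto
  have sum1: "abs_sum d L1 i n \<le> abs_sum d L i n + \<bar>v ! i\<bar> * (w div t * t)" if "i < d" for i
  proof -
    have "abs_sum d L1 i n \<le> abs_sum d L i n + \<bar>nv ! i\<bar> * (c - 1 - a + 1)"
      unfolding L1_def using L g nv that by (intro abs_sum_add_weight) auto
    also have "\<bar>nv ! i\<bar> * (c - 1 - a + 1) = \<bar>v ! i\<bar> * (w div t * t)"
      using k0 nv(2)[OF that] by (simp add: abs_mult t_def mult_ac)
    finally show ?thesis .
  qed
  have total: "abs_sum d L i n + \<bar>v ! i\<bar> * (w div t * t) + \<bar>v ! i\<bar> * (w mod t) \<le> W" if "i < d" for i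
  proof -
    have "\<bar>v ! i\<bar> * (w div t * t) + \<bar>v ! i\<bar> * (w mod t) = \<bar>v ! i\<bar> * w"
      unfolding distrib_left[symmetric] using wq by simp
    moreover have "abs_sum d L i n + \<bar>v ! i\<bar> * w \<le> W"
      using L(3) that by (simp add: w_def algebra_simps)
    ultimately show ?thesis by linarith
  qed
  have W1: "\<forall>i<d. abs_sum d L1 i n \<le> W"
  proof (intro allI impI)
    fix i assume i: "i < d"
    have "0 \<le> \<bar>v ! i\<bar> * (w mod t)" using m by simp
    then show "abs_sum d L1 i n \<le> W" using sum1[OF i] total[OF i] by linarith
  qed
  define x where "x = a + (r - a) mod t"
  have x: "a \<le> x" "x \<le> c - 1" using pos_mod_sign[OF t(1), of "r - a"] pos_mod_bound[OF t(1), of "r - a"]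
    unfolding x_def t_def by linarith+
  define y where "y = x + w mod t - 1"
  have y: "y \<le> c + t" "a \<le> y + 1" "y < x + t" "y - t \<le> n" proof -
    have c: "c = a + t" by (simp add: t_def)
    show "y \<le> c + t" using m x unfolding y_def c by linarith
    show "a \<le> y + 1" using m x unfolding y_def by linarith
    show "y < x + t" using m unfolding y_def by linarith
    show "y - t \<le> n" using m x g unfolding y_def by linarith
  qed
  define L2 where "L2 = add_weight x (c - 1) v L1"
  have L2: "chain d 1 L2 n" unfolding L2_def using L1 x g by (intro chain_add_weight) auto
  have len2: "length L2 \<le> length L + 4"
    using length_add_weight[OF L1 x(2) g(6)] len1 unfolding L2_def by linarith
  have W2: "\<forall>i<d. abs_sum d L2 i n \<le> W" if out: "\<not> y \<le> c - 1"
  proof (intro allI impI)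
    fix i assume i: "i < d"
    have "abs_sum d L2 i n \<le> abs_sum d L1 i n + \<bar>v ! i\<bar> * (c - 1 - x + 1)"
      unfolding L2_def using L1 x g i by (intro abs_sum_add_weight) auto
    also have "\<bar>v ! i\<bar> * (c - 1 - x + 1) \<le> \<bar>v ! i\<bar> * (w mod t)"
      using out by (intro mult_left_mono) (simp_all add: y_def)
    finally show "abs_sum d L2 i n \<le> W" using sum1[OF i] total[OF i] by linarith
  qed
  have A0: "steps (add_weight_t a (c - 1) nv L) (add_cost q)"
    using L q g vW(2) oknv near by (intro steps_add_weight_chain) auto
  have A1: "steps (add_weight_t x y v L1) (add_cost q)" if "y \<le> c - 1"
    using that L1 L W1 len1 q okv near x y g by (intro steps_add_weight_chain) auto
  have A2: "steps (add_weight_t x (c - 1) v L1) (add_cost q)"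
    using L1 L W1 len1 q okv near x y g by (intro steps_add_weight_chain) auto
  have A3: "steps (add_weight_t a (y - t) v L2) (add_cost q)" if "\<not> y \<le> c - 1"
    using that L2 L W2 len2 q okv near x y g by (intro steps_add_weight_chain) (auto simp: t_def)
  have okr: "ok a" "ok c" "ok r" "ok s" "ok (s + 1)" "ok t" "ok w" "ok (c - 1)" "ok (r - a)"
    "ok ((r - a) mod t)" "ok (w mod t)" "ok x" "ok (x + w mod t)" "ok y"
    using g L(2) m x y t w x_def y_def by (intro ok_between; linarith)+
  show ?thesis
    unfolding transfer_periodic_t.simps
    apply (rule steps_bind[OF steps_op(2)[OF okr(2,1)]], unfold result_arith, fold t_def)
     apply (rule steps_bind[OF steps_op(2)[OF okr(2) ok_const(2)]], unfold result_arith)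
      apply (rule steps_bind[OF steps_op(1)[OF okr(4) ok_const(2)]], unfold result_arith)
       apply (rule steps_bind[OF steps_op(2)[OF okr(5,3)]], unfold result_arith, fold w_def)
        apply (rule steps_bind[OF steps_op(4)[OF okr(7,6)]], unfold result_arith)
         apply (rule steps_bind[OF mapv], unfold result_map_t result_arith, fold nv_def)
          apply (rule steps_bind[OF A0], fold L1_def)
           apply (rule steps_bind[OF steps_op(5)[OF okr(7,6)]], unfold result_arith)
            apply (rule steps_bind[OF steps_op(8)[OF okr(11) ok_const(1)]], unfold result_arith)
             apply (rule steps_if)
              apply (rule steps_ret, simp)
             apply (rule steps_bind[OF steps_op(2)[OF okr(3,1)]], unfold result_arith)
              apply (rule steps_bind[OF steps_op(5)[OF okr(9,6)]], unfold result_arith)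
               apply (rule steps_bind[OF steps_op(1)[OF okr(1,10)]], unfold result_arith, fold x_def)
                apply (rule steps_bind[OF steps_op(1)[OF okr(12,11)]], unfold result_arith)
                 apply (rule steps_bind[OF steps_op(2)[OF okr(13) ok_const(2)]], unfold result_arith, fold y_def)
                  apply (rule steps_bind[OF steps_op(6)[OF okr(14,8)]], unfold result_arith)
                   apply (rule steps_if)
                    apply (rule steps_mono[OF A1], assumption, simp)
                   apply (rule steps_bind[OF A2], fold L2_def)
                    apply (rule steps_bind[OF steps_op(2)[OF okr(14,6)]], unfold result_arith)
                     apply (rule steps_mono[OF A3], assumption)
                     apply simp_all
    done
qed

lemma steps_transfer_entry_t:
  assumes L: "chain d 1 L n" "n \<le> N" "\<forall>i<d. abs_sum d L i n + \<bar>v ! i\<bar> * (s - r + 1) \<le> W"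
    and q: "length L + 4 \<le> q" and g: "normal n g" "ran_hi g = n"
    and e: "ran_lo g \<le> r" "r \<le> s" "s \<le> n" "length v = d"
  shows "steps (transfer_entry_t g ((r, s), v) L) (3 * add_cost q + 2 * d + 36)"
proof -
  obtain a b c p where G: "g = Pairing a b c n p" using g by (cases g) auto
  have gb: "1 \<le> a" "a \<le> b" "a < c" "n - c = b - a" "\<not> p \<Longrightarrow> b < c" "c \<le> r"
    using g e unfolding G by auto
  have vW: "\<bar>v ! i\<bar> \<le> W" "abs_sum d L i n \<le> W" if "i < d" for i
  proof -
    have "\<bar>v ! i\<bar> * 1 \<le> \<bar>v ! i\<bar> * (s - r + 1)" using e by (intro mult_left_mono) simp_all
    then show "\<bar>v ! i\<bar> \<le> W" "abs_sum d L i n \<le> W"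
      using abs_sum_nonneg[of d L i n] L(3)[rule_format, OF that] by linarith+
  qed
  have okv: "\<forall>x\<in>set v. ok x"
    using vW(1) V_bounds(2) e(4) unfolding ok_def by (fastforce simp: in_set_conv_nth)
  have A: "steps (add_weight_t x y v L) (add_cost q)" if "0 \<le> x" "x \<le> n + 1" "0 \<le> y" "y \<le> n + 1" for x y
  proof -
    have "near x" "near y" using that L(2) N by (simp_all add: near_def)
    then show ?thesis using L q vW(2) okv by (intro steps_add_weight_chain) auto
  qed
  have P: "steps (transfer_periodic_t a c ((r, s), v) L) (3 * add_cost q + 2 * d + 30)"
    using gb e by (intro steps_transfer_periodic_t[OF L q]) auto
  have okr: "ok a" "ok b" "ok c" "ok n" "ok r" "ok s" "ok (c - a)" "ok (a + n)"
    using gb e L(2) by (intro inside_ok(2); linarith)+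
  show ?thesis
  proof (cases p)
    case True
    show ?thesis unfolding G transfer_entry_t.simps using True
      apply (simp only: if_True)
      apply (rule steps_bind[OF steps_op(7)[OF okr(2,3)]])
       apply (rule steps_if)
        apply (rule steps_bind[OF steps_op(2)[OF okr(3,1)]], unfold result_arith)
         apply (rule steps_bind[OF steps_op(2)[OF okr(5,7)]], unfold result_arith)
          apply (rule steps_bind[OF steps_op(2)[OF okr(6,7)]], unfold result_arith)
           apply (rule steps_mono[OF A])
               apply (use gb e in simp_all)[5]
          apply simp_all[3]
       apply (rule steps_mono[OF P])
       apply simp_all
      done
  next
    case False
    show ?thesis unfolding G transfer_entry_t.simps using False gb(5)
      apply (simp only: if_False)
      apply (rule steps_bind[OF steps_op(1)[OF okr(1,4)]], unfold result_arith)
       apply (rule steps_bind[OF steps_op(2)[OF okr(8,6)]], unfold result_arith)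
        apply (rule steps_bind[OF steps_op(2)[OF okr(8,5)]], unfold result_arith)
         apply (rule steps_mono[OF A])
             apply (use gb e in simp_all)
      done
  qed
qed

text \<open>
  The weights still to be transferred count towards the bound \<open>W\<close>, and each transfer adds at most
  four breakpoints.
\<close>

lemma steps_transfer_entries_t:
  assumes g: "normal n g" "ran_hi g = n" and n: "n \<le> N"
  shows "chain d 1 L n \<Longrightarrow> chain d l es n \<Longrightarrow> ran_lo g \<le> l \<Longrightarrow>
    \<forall>i<d. abs_sum d L i n + (\<Sum>((r, s), v)\<leftarrow>es. \<bar>v ! i\<bar> * (s - r + 1)) \<le> W \<Longrightarrow>
    length L + 4 * length es + 4 \<le> q \<Longrightarrow>
    steps (transfer_entries_t g es L) ((3 * add_cost q + 2 * d + 37) * length es + 1)"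
proof (induction es arbitrary: L l)
  case (Cons e es)
  obtain r s v where e: "e = ((r, s), v)" by (metis surj_pair)
  have ch: "r = l" "l \<le> s" "length v = d" "chain d (s + 1) es n" using Cons.prems(2) by (auto simp: e)
  have sn: "s \<le> n" using chain_le[OF ch(4)] by simp
  have rest: "0 \<le> (\<Sum>((r, s), v)\<leftarrow>es. \<bar>v ! i\<bar> * (s - r + 1))" for i
  proof (rule sum_list_nonneg)
    fix x assume "x \<in> set (map (\<lambda>((r, s), v). \<bar>v ! i\<bar> * (s - r + 1)) es)"
    then obtain p q z where "((p, q), z) \<in> set es" "x = \<bar>z ! i\<bar> * (q - p + 1)" by auto
    then show "0 \<le> x" using chain_entries[OF ch(4), of p q z] by simp
  qed
  have W0: "\<forall>i<d. abs_sum d L i n + \<bar>v ! i\<bar> * (s - r + 1) \<le> W"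
  proof (intro allI impI)
    fix i assume "i < d"
    then show "abs_sum d L i n + \<bar>v ! i\<bar> * (s - r + 1) \<le> W"
      using Cons.prems(4)[rule_format, of i] rest[of i] by (simp add: e)
  qed
  let ?L = "result (transfer_entry_t g ((r, s), v) L)"
  have lr: "ran_lo g \<le> r" "r \<le> s" using ch Cons.prems(3) by auto
  note te = transfer_entry[OF Cons.prems(1) g lr sn ch(3)]
  have E: "steps (transfer_entry_t g ((r, s), v) L) (3 * add_cost q + 2 * d + 36)"
    using Cons.prems(5) by (intro steps_transfer_entry_t[OF Cons.prems(1) n W0 _ g lr sn ch(3)]) simp
  have "length ?L = card (starts ?L)" using chain_starts[OF te(1)] by simp
  also have "\<dots> \<le> card (starts L \<union> {dom_lo g, ran_lo g} \<union> {push g r, push g (s + 1)})"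
    by (intro card_mono te(2)) simp
  also have "\<dots> \<le> card (starts L) + card {dom_lo g, ran_lo g} + card {push g r, push g (s + 1)}"
    by (intro order_trans[OF card_Un_le] add_right_mono card_Un_le)
  also have "\<dots> \<le> length L + 4"
    using chain_starts[OF Cons.prems(1)] by (simp add: card_insert_if)
  finally have len: "length ?L \<le> length L + 4" .
  have "\<forall>i<d. abs_sum d ?L i n + (\<Sum>((r, s), v)\<leftarrow>es. \<bar>v ! i\<bar> * (s - r + 1)) \<le> W"
  proof (intro allI impI)
    fix i assume i: "i < d"
    show "abs_sum d ?L i n + (\<Sum>((r, s), v)\<leftarrow>es. \<bar>v ! i\<bar> * (s - r + 1)) \<le> W"
      using Cons.prems(4)[rule_format, OF i] te(5)[OF i] by (simp add: e)
  qed
  then have IH: "steps (transfer_entries_t g es ?L) ((3 * add_cost q + 2 * d + 37) * length es + 1)"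
    using len Cons.prems(3,5) ch by (intro Cons.IH[OF te(1) ch(4)]) auto
  show ?case unfolding transfer_entries_t.simps e
    by (rule steps_bind[OF E], rule steps_mono[OF IH]) (simp_all add: algebra_simps)
qed (simp add: steps_ret)

definition transfer_cost :: "nat \<Rightarrow> nat" where
  "transfer_cost r = (3 * add_cost (6 * r + 5) + 2 * d + 37) * r + 13 * r + 2 * d + 16"

lemma steps_transfer_t:
  assumes L: "chain d 1 L n" "n \<le> N" "\<forall>i<d. abs_sum d L i n \<le> W" "length L \<le> r"
    and g: "normal n g" "ran_hi g = n"
  shows "steps (transfer_t n g L) (transfer_cost r)"
proof -
  have c: "1 \<le> ran_lo g" "ran_lo g \<le> n" using g by (cases g; auto)+
  define es where "es = restrict_weights (ran_lo g) n L"
  define L0 where "L0 = zero_weights n (ran_lo g) n L"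
  have es: "chain d (ran_lo g) es n" unfolding es_def using c by (intro chain_restrict[OF L(1)]) auto
  have L0: "chain d 1 L0 n" unfolding L0_def using zero_weights[OF L(1) c order_refl] by blast
  have len: "length es \<le> r" "length L0 \<le> 2 * r + 1"
    using length_restrict_weights[of "ran_lo g" n L] length_restrict_weights[of 1 "ran_lo g - 1" L]
      length_restrict_weights[of "n + 1" n L] L(4) c
    unfolding es_def L0_def zero_weights_eq[OF L(1) order_trans[OF c]] by simp_all
  have gN: "is_pairing N g" using g L by (auto intro: normal_is_pairing is_pairing_mono)
  have sL: "small_entries W L" using L(3) by (intro small_entries_chain[OF L(1,2)]) auto
  have near: "near x" if "0 \<le> x" "x \<le> n + 1" for x using that L(2) N by (simp add: near_def)
  have 1: "steps (restrict_weights_t (ran_lo g) n L) (4 * r + 1)"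
    by (rule steps_mono[OF steps_restrict_weights_t[OF sL]]) (use near c L(4) in auto)
  have 2: "steps (zero_weights_t n (ran_lo g) n L) (9 * r + 2 * d + 6)"
    by (rule steps_mono[OF steps_zero_weights_t[OF sL V_bounds(2)]]) (use near c L(4) in auto)
  have "steps (transfer_entries_t g es L0) ((3 * add_cost (6 * r + 5) + 2 * d + 37) * length es + 1)"
    using abs_sum_zero_weights[OF L(1) c] L(3) len
    by (intro steps_transfer_entries_t[OF g L(2) L0 es]) (auto simp: es_def L0_def)
  moreover have "(3 * add_cost (6 * r + 5) + 2 * d + 37) * length es \<le> (3 * add_cost (6 * r + 5) + 2 * d + 37) * r"
    using len(1) by (intro mult_le_mono) simp_all
  ultimately have 3: "steps (transfer_entries_t g es L0) ((3 * add_cost (6 * r + 5) + 2 * d + 37) * r + 1)"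
    by (elim steps_mono) simp
  define p where "p = (3 * add_cost (6 * r + 5) + 2 * d + 37) * r"
  show ?thesis
    unfolding transfer_t_def transfer_cost_def
    apply (rule steps_bind[OF steps_trim_t[OF gN]], unfold trim_id[OF g(1)] g(2))
     apply (rule steps_bind[OF 1], fold es_def)
      apply (rule steps_bind[OF 2], fold L0_def)
       apply (rule steps_mono[OF 3], fold p_def)
       apply simp_all
    done
qed

subsection \<open>One cycle of the algorithm\<close>

definition cycle_cost :: "nat \<Rightarrow> nat \<Rightarrow> nat \<Rightarrow> nat" where
  "cycle_cost k r v = (let q = r + 2 + 4 * k in
    (q + 1) * contract_cost k q (v + q) + ((merge_cost * k + 2) * k + 2) * (k + 1) +
    transfer_cost q + 60 * k + 4 * q + 60)"

lemma steps_cycle_t: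
  assumes v: "valid d S" and bd: "bounded_by d W S" and n: "len S \<le> N"
    and out: "chain d 1 (outp S) e" "e + len S \<le> N"
    and k: "length (pairings S) \<le> k" and r: "length (wts S) \<le> r" and v': "length (outp S) \<le> v'"
  shows "steps (cycle_t S) (cycle_cost k r v')"
proof -
  define q where "q = r + 2 + 4 * k"
  define gs where "gs = filter (\<lambda>g. \<not> is_identity g) (pairings S)"
  define S1 where "S1 = result (contract_static_t (State (len S) gs (wts S) (outp S)))"
  have gsS: "\<forall>g\<in>set gs. is_pairing (len S) g"
    using v by (auto simp: gs_def valid_def)
  have lgs: "length gs \<le> k"
    unfolding gs_def using length_filter_le k by (rule order_trans)
  have v0: "0 \<le> len S" "chain d 1 (wts S) (len S)" "\<forall>g\<in>set (pairings S). is_pairing N g"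
    using v n is_pairing_mono by (auto simp: valid_def)
  have delete: "steps (delete_identities_t (pairings S)) (4 * k + 1)"
    using steps_delete_identities_t[OF v0(3)] k by (auto elim!: steps_mono)
  have card: "card (marks (len S) gs (wts S)) \<le> q"
    using card_marks(2)[OF v0(2), of gs] lgs r by (simp add: q_def)
  have contract: "steps (contract_static_t (State (len S) gs (wts S) (outp S)))
      ((q + 1) * contract_cost k q (v' + q))"
    using v0 n gsS out bd lgs card v'
    by (intro steps_contract_static_t[where e = e]) (auto simp: bounded_by_def)
  obtain f where f: "contracted d (State (len S) gs (wts S) (outp S)) f S1"
    using prepare(1)[OF v] unfolding gs_def S1_def by blast
  have pS1: "pairings S1 = map (pmap f) gs" using contractedD(1)[OF f] by simp
  have nS1: "len S1 \<le> N" using contractedD(5)[OF f] n by simp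
  have S1: "is_pairing (len S1) h \<and> \<not> is_identity h" if h: "h \<in> set (pairings S1)" for h
  proof -
    obtain g where g: "g \<in> set gs" "h = pmap f g" using h pS1 by auto
    note sq = contractedD(2)[OF f, unfolded state.sel] and fN = contractedD(3)[OF f, unfolded state.sel]
    have gp: "is_pairing (len S) g" using g gsS by blast
    have "is_pairing (len S1) h" using pmap_is_pairing[OF sq fN g(1) gp] g(2) by simp
    moreover have "\<not> is_identity h" using is_identity_pmap[OF sq g(1) gp] g by (simp add: gs_def)
    ultimately show ?thesis by blast
  qed
  have lS1: "length (pairings S1) \<le> k" using pS1 lgs by simp
  have trim: "steps (map_t trim_t (pairings S1)) (9 * k + 1)"
  proof (rule steps_mono[OF steps_map_t])
    show "steps (trim_t h) 8" if "h \<in> set (pairings S1)" for h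
      using S1[OF that] nS1 is_pairing_mono by (intro steps_trim_t) blast
  qed (use lS1 in simp)
  have "\<forall>h\<in>set (map trim (pairings S1)). normal N h"
    using S1 trim_normal normal_mono[OF _ nS1] by auto
  then have "steps (merge_all_t (map trim (pairings S1)))
      (((merge_cost * k + 2) * k + 2) * (length (map trim (pairings S1)) + 1))"
    using lS1 by (intro steps_merge_all_t) simp_all
  then have merge: "steps (merge_all_t (map trim (pairings S1))) (((merge_cost * k + 2) * k + 2) * (k + 1))"
    by (rule steps_mono, intro mult_le_mono order_refl) (use lS1 in simp)
  define P where "P = prepare S"
  have P: "P = State (len S1) (merge_all (map trim (pairings S1))) (wts S1) (outp S1)"
    by (simp add: P_def prepare_def S1_def gs_def Let_def)
  have Psel: "len P = len S1" "pairings P = merge_all (map trim (pairings S1))" "wts P = wts S1"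
    by (simp_all add: P)
  have vP: "valid d P" and nmP: "\<forall>g\<in>set (pairings P). normal (len P) g"
    and top: "len P = 0 \<or> (\<exists>g\<in>set (pairings P). ran_hi g = len P)"
    and lP: "length (pairings P) \<le> k"
    using prepare[OF v] k unfolding P_def by auto
  have nP: "len P \<le> N" using nS1 Psel by simp
  have bdP: "\<forall>i<d. abs_sum d (wts P) i (len P) \<le> W"
    using prepare_bounds(1)[OF v bd] unfolding P_def bounded_by_def by blast
  have wP: "chain d 1 (wts P) (len P)" "length (wts P) \<le> q"
    using vP prepare_bounds(2)[OF v] k r by (auto simp: valid_def P_def q_def)
  have pP: "\<forall>g\<in>set (pairings P). is_pairing N g"
    using nmP normal_mono[OF _ nP] normal_is_pairing by blast
  have maximal: "steps (extract_maximal_t (pairings P)) (8 * k + 1)"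
    using steps_extract_maximal_t[OF pP] lP by (auto elim!: steps_mono)
  have okP: "ok (len P)" using nP vP V_bounds(1) N by (auto simp: ok_def valid_def)
  define c0 where "c0 = (q + 1) * contract_cost k q (v' + q)"
  define m0 where "m0 = ((merge_cost * k + 2) * k + 2) * (k + 1)"
  define t0 where "t0 = transfer_cost q"
  have total: "cycle_cost k r v' = c0 + m0 + t0 + 60 * k + 4 * q + 60"
    by (simp add: cycle_cost_def Let_def c0_def m0_def t0_def q_def)
  have rest: "steps (case result (extract_maximal_t (pairings P)) of
       None \<Rightarrow> do { _ \<leftarrow> eq_t (len P) 0; ret (State (len P) (pairings P) (wts P) (outp S1)) }
     | Some (g, hs) \<Rightarrow> do {
         hs5 \<leftarrow> map_t (transmit_if_contained_t (len P) g) hs;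
         c \<leftarrow> cut_point_t (ran_lo g) hs5;
         L1 \<leftarrow> transfer_t (len P) g (wts P);
         M \<leftarrow> sub_t c 1;
         L2 \<leftarrow> restrict_weights_t 1 M L1;
         g' \<leftarrow> truncate_t (len P) M g;
         _ \<leftarrow> eq_t M 0;
         ret (State M (case g' of None \<Rightarrow> hs5 | Some g'' \<Rightarrow> g'' # hs5) L2 (outp S1))
       }) (t0 + 38 * k + 4 * q + 50)"
  proof (rule steps_option, goal_cases)
    case 1
    show ?case by (rule steps_bind[OF steps_op(8)[OF okP ok_const(1)]]) (simp_all add: steps_ret)
  next
    case (2 x)
    obtain g hs where x: "x = (g, hs)" by (cases x)
    note ex = 2[unfolded x]
    define hs' where "hs' = map (transmit_within (len P) g) hs"
    define M where "M = result (cut_point_t (ran_lo g) hs') - 1"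
    have red: "len (reduce P) = M" by (simp add: reduce_def ex Let_def M_def hs'_def)
    obtain M0 hs0 where R: "reduce P = State M0 (with_truncated (len P) M0 g hs0)
        (restrict_weights 1 M0 (result (transfer_t (len P) g (wts P)))) (outp P)"
      and gg: "mset (pairings P) = add_mset g (mset hs)" "normal (len P) g" "ran_hi g = len P"
        "\<forall>h\<in>set hs. normal (len P) h \<and> dominates g h"
      and M0: "M0 \<le> len P" "1 \<le> M0"
      by (rule reduce_Some[OF vP nmP top ex], rule that)
    have M: "M \<le> len P" "1 \<le> M" using R red M0 by simp_all
    have lhs: "length hs \<le> k" using arg_cong[OF gg(1), of size] lP by simp
    have gN: "normal N g" "is_pairing N g" using gg(2) normal_mono[OF _ nP] normal_is_pairing by blast+
    have transmits: "steps (map_t (transmit_if_contained_t (len P) g) hs) (36 * k + 1)"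
    proof (rule steps_mono[OF steps_map_t])
      show "steps (transmit_if_contained_t (len P) g h) 35" if "h \<in> set hs" for h
        using that gg(4) gN M nP normal_mono[OF _ nP] normal_is_pairing
        by (intro steps_transmit_if_contained_t) auto
    qed (use lhs in simp)
    have hs'_eq: "result (map_t (transmit_if_contained_t (len P) g) hs) = hs'" by (simp add: hs'_def)
    have lo: "1 \<le> ran_lo g" "ran_lo g \<le> N + 1" using gN(1) by (cases g; auto)+
    have "\<forall>h\<in>set hs'. is_pairing N h"
      unfolding hs'_def using transmit_within_is_pairing(1)[OF gg(2,3)] gg(4) is_pairing_mono[OF _ nP] by auto
    then have cut: "steps (cut_point_t (ran_lo g) hs') (2 * k + 1)"
      using lo lhs by (intro steps_mono[OF steps_cut_point_t]) (auto simp: hs'_def)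
    have tr: "steps (transfer_t (len P) g (wts P)) t0"
      unfolding t0_def using wP nP bdP gg by (intro steps_transfer_t) auto
    define L1 where "L1 = result (transfer_t (len P) g (wts P))"
    note tL = transfer[OF wP(1) gg(2,3), folded L1_def]
    have "small_entries W L1"
      using tL(1,5) nP bdP order_trans by (intro small_entries_chain[OF _ nP]) blast+
    moreover have "near 1" "near M" using M nP N by (simp_all add: near_def)
    ultimately have restrict: "steps (restrict_weights_t 1 M L1) (4 * (q + 6) + 1)"
      using tL(2) wP(2) by (intro steps_mono[OF steps_restrict_weights_t]) auto
    have okM: "ok M" "ok (M + 1)" using M nP by (simp_all add: inside_ok)
    have trunc: "steps (truncate_t (len P) M g) 6"
      using M nP gN by (intro steps_truncate_t) auto
    have cM: "result (cut_point_t (ran_lo g) hs') = M + 1" by (simp add: M_def)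
    show ?case
      unfolding x prod.case
      apply (rule steps_bind[OF transmits], unfold hs'_eq)
       apply (rule steps_bind[OF cut], unfold cM)
        apply (rule steps_bind[OF tr], fold L1_def)
         apply (rule steps_bind[OF steps_op(2)[OF okM(2) ok_const(2)]], unfold result_arith add_diff_cancel_right')
          apply (rule steps_bind[OF restrict])
           apply (rule steps_bind[OF trunc])
            apply (rule steps_bind[OF steps_op(8)[OF okM(1) ok_const(1)]])
             apply (rule steps_ret)
             apply simp_all
      done
  qed
  have gs_eq: "result (delete_identities_t (pairings S)) = gs" by (simp add: gs_def)
  have map_eq: "result (map_t trim_t (pairings S1)) = map trim (pairings S1)" by simp
  show ?thesis
    unfolding cycle_t_def total
    apply (rule steps_bind[OF delete], unfold gs_eq)
     apply (rule steps_bind[OF contract[folded c0_def]], fold S1_def)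
      apply (rule steps_bind[OF trim], unfold map_eq)
       apply (rule steps_bind[OF merge[folded m0_def]], fold Psel)
        apply (rule steps_bind[OF maximal])
         apply (rule steps_mono[OF rest])
         apply simp_all
    done
qed

end

subsection \<open>A polynomial bound\<close>

definition polynomially_bounded :: "(nat \<Rightarrow> nat) \<Rightarrow> bool" where
  "polynomially_bounded f \<longleftrightarrow> (\<exists>c q. \<forall>y. f y \<le> c * (y + 1) ^ q)"

lemma polynomially_bounded_const: "polynomially_bounded (\<lambda>y. a)"
  unfolding polynomially_bounded_def by (rule exI[of _ a], rule exI[of _ 0]) simp

lemma polynomially_bounded_id: "polynomially_bounded (\<lambda>y. y)"
  unfolding polynomially_bounded_def by (rule exI[of _ 1], rule exI[of _ 1]) simp

lemma polynomially_bounded_add: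
  assumes "polynomially_bounded f" "polynomially_bounded g"
  shows "polynomially_bounded (\<lambda>y. f y + g y)"
proof -
  obtain c q c' q' where f: "\<And>y. f y \<le> c * (y + 1) ^ q" and g: "\<And>y. g y \<le> c' * (y + 1) ^ q'"
    using assms unfolding polynomially_bounded_def by blast
  have "f y + g y \<le> (c + c') * (y + 1) ^ (q + q')" for y
  proof -
    have "c * (y + 1) ^ q \<le> c * (y + 1) ^ (q + q')" "c' * (y + 1) ^ q' \<le> c' * (y + 1) ^ (q + q')"
      by (intro mult_le_mono2 power_increasing; simp)+
    then show ?thesis using f[of y] g[of y] unfolding add_mult_distrib by linarith
  qed
  then show ?thesis unfolding polynomially_bounded_def by blast
qed

lemma polynomially_bounded_mult:
  assumes "polynomially_bounded f" "polynomially_bounded g"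
  shows "polynomially_bounded (\<lambda>y. f y * g y)"
proof -
  obtain c q c' q' where f: "\<And>y. f y \<le> c * (y + 1) ^ q" and g: "\<And>y. g y \<le> c' * (y + 1) ^ q'"
    using assms unfolding polynomially_bounded_def by blast
  have "f y * g y \<le> (c * c') * (y + 1) ^ (q + q')" for y
    using mult_le_mono[OF f[of y] g[of y]] by (simp add: power_add mult_ac)
  then show ?thesis unfolding polynomially_bounded_def by blast
qed

lemma polynomially_bounded_power:
  "polynomially_bounded f \<Longrightarrow> polynomially_bounded (\<lambda>y. f y ^ n)"
  by (induction n) (simp_all add: polynomially_bounded_const polynomially_bounded_mult)

lemmas polynomially_bounded_intros = polynomially_bounded_const polynomially_bounded_id
  polynomially_bounded_add polynomially_bounded_mult polynomially_bounded_power

context bit_bounds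
begin

text \<open>The outputs of the first \<open>n\<close> cycles occupy the positions released so far.\<close>

lemma run_outp_chain:
  assumes v: "valid d S" and out: "chain d 1 (outp S) e" "e + len S \<le> N"
  shows "\<exists>e. chain d 1 (outp (run S n)) e \<and> e + len (run S n) \<le> N"
proof (induction n)
  case 0
  then show ?case using out by auto
next
  case (Suc n)
  then obtain e where e: "chain d 1 (outp (run S n)) e" "e + len (run S n) \<le> N" by blast
  let ?P = "prepare (run S n)"
  have vn: "valid d (run S n)" using v by (rule run_valid)
  have "len (reduce ?P) \<le> len ?P \<and> outp (reduce ?P) = outp ?P"
    using reduce_valid[OF prepare(2,4,5)[OF vn]] by blast
  moreover have "run S (Suc n) = reduce ?P" by (simp add: result_cycle)
  ultimately show ?case using prepare_bounds(5)[OF vn e(1)] e(2) by (intro exI) auto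
qed

lemma cost_run:
  assumes v: "valid d S" and bd: "bounded_by d W S" and n: "len S \<le> N"
    and out: "outp S = []" and k: "length (pairings S) \<le> k" and m: "length (wts S) \<le> m" and j: "j \<le> c"
  defines "r \<equiv> m + c * (9 + 4 * k)"
  shows "cost (cycle_t (run S j)) \<le> cycle_cost k r (c * (r + 2 + 4 * k)) * u"
proof -
  obtain e where e: "chain d 1 (outp (run S j)) e" "e + len (run S j) \<le> N"
    using run_outp_chain[OF v, of 0 j] out n by auto
  have "j * (9 + 4 * length (pairings S)) \<le> c * (9 + 4 * k)" using j k by (intro mult_le_mono) simp_all
  then have w: "length (wts S) + j * (9 + 4 * length (pairings S)) \<le> r" using m by (simp add: r_def)
  have "j * (length (wts S) + j * (9 + 4 * length (pairings S)) + 2 + 4 * length (pairings S)) \<le> c * (r + 2 + 4 * k)"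
    using j k w by (intro mult_le_mono) simp_all
  then have o: "length (outp (run S j)) \<le> c * (r + 2 + 4 * k)"
    using run_outp[OF v, of j] out by simp
  show ?thesis
    using steps_cycle_t[OF run_valid[OF v] run_bounded[OF v bd] order_trans[OF run_len[OF v] n] e
        order_trans[OF run_pairings[OF v] k] order_trans[OF run_wts[OF v] w] o]
    unfolding steps_def .
qed

end

text \<open>The number of cycles and the costs, with every parameter replaced by one common bound.\<close>

definition rounds :: "nat \<Rightarrow> nat" where
  "rounds y = y * (32 * y ^ 3 * y + 1) * ((2 * y + 1) * (2 * y + 3) + 1) + 1"

definition time_bound :: "nat \<Rightarrow> nat" where
  "time_bound y = (let c = rounds y; r = y + c * (9 + 4 * y); o' = c * (r + 2 + 4 * y); q = r + 2 + 4 * y;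
     ac = (2 * y + 14) * (6 * q + 5) + 1
   in 2 + c * (((q + 1) * ((7 * y + 3) * (2 * y + 1) + (y + 13) * q + (o' + q) + 20 * y + 20) +
       (((41 + 4 * y) * y + 2) * y + 2) * (y + 1) + ((3 * ac + 2 * y + 37) * q + 13 * q + 2 * y + 16) +
       60 * y + 4 * q + 60) * (y * y + 2 * y + 1)))"

lemma time_bound_polynomial: "polynomially_bounded time_bound"
  unfolding time_bound_def rounds_def Let_def by (intro polynomially_bounded_intros)

lemma cycle_bound_le_rounds:
  assumes k: "k \<le> y" and V: "ln V \<le> real R" and R: "R \<le> y"
  shows "cycle_bound k V R \<le> rounds y"
proof -
  have "32 * real k ^ 3 * ln V \<le> 32 * real y ^ 3 * real y"
  proof (cases "0 \<le> ln (real_of_int V)")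
    case True
    then show ?thesis using k V R by (intro mult_mono power_mono) auto
  next
    case False
    then have "32 * real k ^ 3 * ln V \<le> 0" by (intro mult_nonneg_nonpos) auto
    also have "0 \<le> 32 * real y ^ 3 * real y" by simp
    finally show ?thesis .
  qed
  then have "\<lfloor>32 * real k ^ 3 * ln V\<rfloor> \<le> \<lfloor>real (32 * y ^ 3 * y)\<rfloor>" by (intro floor_mono) simp
  then have "nat \<lfloor>32 * real k ^ 3 * ln V\<rfloor> \<le> 32 * y ^ 3 * y" by linarith
  then show ?thesis
    unfolding cycle_bound_def rounds_def using k R
    by (intro add_mono mult_le_mono order_refl) auto
qed

lemma running_time:
  assumes gs: "\<forall>g\<in>set gs. is_pairing N g" and N: "1 \<le> N"
    and L: "weight_list d L" "support L = {1..N}"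
    and small: "\<forall>((p, q), z)\<in>set L. \<forall>x\<in>set z. \<bar>x\<bar> \<le> b"
    and y: "length gs \<le> y" "length L \<le> y" "d \<le> y" "isize (8 * (N + 1) + N * b) \<le> y"
      "N + 1 < 2 ^ R" "R \<le> y" and b: "0 \<le> b"
  obtains L' T where "weighted_orbit_counting N gs L = Some (TM L' T)"
    and "lists_orbits N gs d L L'" and "T \<le> time_bound y"
proof -
  let ?S = "State N gs L []"
  have v: "valid d ?S" using N gs L by (intro initial_valid)
  define c where "c = cycle_bound (length gs) N R"
  have lnN: "ln N \<le> real R"
  proof -
    have "real_of_int N < real_of_int (2 ^ R)" unfolding of_int_less_iff using y(5) by linarith
    then have "real_of_int N < 2 ^ R" by simp
    then have "ln N < ln (2 ^ R)" using N by (intro ln_less_cancel_iff[THEN iffD2]) auto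
    also have "\<dots> = real R * ln 2" by (simp add: ln_realpow)
    also have "\<dots> \<le> real R * 1" using ln_2_less_1 by (intro mult_left_mono) auto
    finally show ?thesis by simp
  qed
  have c: "c \<le> rounds y" unfolding c_def by (rule cycle_bound_le_rounds[OF y(1) lnN y(6)])
  have "len (run ?S c) = 0"
    unfolding c_def using v N y(5) by (intro terminates) auto
  then obtain n where n: "n \<le> c" "len (run ?S n) = 0"
    and res: "weighted_orbit_counting N gs L = Some (TM (outp (run ?S n))
      (2 + (\<Sum>j<n. cost (cycle_t (run ?S j)))))"
    by (rule weighted_orbit_counting_eq)
  define V where "V = 8 * (N + 1) + N * b"
  interpret bit_bounds N "N * b" V d y "y * y + 2 * y + 1"
    by unfold_locales (use N b y(4) in \<open>simp_all add: V_def\<close>)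
  have ch: "chain d 1 L N" using L N by (intro weight_list_chain) auto
  have "abs_sum d L i N \<le> N * b" if i: "i < d" for i
  proof -
    have "\<bar>weight_at d L x ! i\<bar> \<le> b" if "x \<in> {1..N}" for x
      using chain_singleton_weight[OF ch that] small i length_weight_at[OF ch, of x] by fastforce
    then have "abs_sum d L i N \<le> (\<Sum>x\<in>{1..N}. b)" unfolding abs_sum_def by (intro sum_mono) blast
    also have "\<dots> = N * b" using N by simp
    finally show ?thesis .
  qed
  then have bd: "bounded_by d (N * b) ?S" by (simp add: bounded_by_def)
  define r where "r = y + rounds y * (9 + 4 * y)"
  have cost: "cost (cycle_t (run ?S j)) \<le> cycle_cost y r (rounds y * (r + 2 + 4 * y)) * (y * y + 2 * y + 1)"
    if "j < n" for j
    unfolding r_def using that n(1) c y(1,2) by (intro cost_run[OF v bd]) auto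
  define t where "t = cycle_cost y r (rounds y * (r + 2 + 4 * y)) * (y * y + 2 * y + 1)"
  have "(\<Sum>j<n. cost (cycle_t (run ?S j))) \<le> (\<Sum>j<n. t)" using cost unfolding t_def by (intro sum_mono) auto
  also have "\<dots> \<le> rounds y * t" using n(1) c by (simp add: mult_le_mono1)
  finally have "2 + (\<Sum>j<n. cost (cycle_t (run ?S j))) \<le> 2 + rounds y * t" by simp
  also have "\<dots> \<le> time_bound y"
  proof -
    define q where "q = r + 2 + 4 * y"
    define o' where "o' = rounds y * q"
    have ac: "add_cost (6 * q + 5) \<le> (2 * y + 14) * (6 * q + 5) + 1"
      unfolding add_cost_def using y(3) by (intro add_mono mult_le_mono) auto
    have "transfer_cost q \<le> (3 * ((2 * y + 14) * (6 * q + 5) + 1) + 2 * y + 37) * q + 13 * q + 2 * y + 16"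
      unfolding transfer_cost_def using ac y(3) by (intro add_mono mult_le_mono order_refl) auto
    moreover have "(q + 1) * contract_cost y q (o' + q) \<le>
        (q + 1) * ((7 * y + 3) * (2 * y + 1) + (y + 13) * q + (o' + q) + 20 * y + 20)"
      unfolding contract_cost_def using y(3) by (intro add_mono mult_le_mono order_refl) auto
    ultimately have "cycle_cost y r o' \<le>
        (q + 1) * ((7 * y + 3) * (2 * y + 1) + (y + 13) * q + (o' + q) + 20 * y + 20) +
        (((41 + 4 * y) * y + 2) * y + 2) * (y + 1) +
        ((3 * ((2 * y + 14) * (6 * q + 5) + 1) + 2 * y + 37) * q + 13 * q + 2 * y + 16) + 60 * y + 4 * q + 60"
      unfolding cycle_cost_def Let_def q_def[symmetric] by linarith
    then show ?thesis
      unfolding time_bound_def Let_def t_def r_def[symmetric] q_def[symmetric] o'_def[symmetric]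
      by (intro add_mono mult_le_mono order_refl) 
  qed
  finally show thesis using res final_lists_orbits[OF v n(2)] by (rule that[rotated -1])
qed

text \<open>
  This estimate replaces a power of a sum of parameters by a sum of powers of single parameters.
\<close>

lemma power_sum_le:
  fixes f :: "'a \<Rightarrow> real"
  assumes "finite A" "A \<noteq> {}" and f: "\<And>x. x \<in> A \<Longrightarrow> 0 \<le> f x"
  shows "(sum f A) ^ n \<le> real (card A) ^ n * (\<Sum>x\<in>A. f x ^ n)"
proof -
  have "Max (f ` A) \<in> f ` A" using assms by (intro Max_in) auto
  then obtain a where a: "a \<in> A" "f a = Max (f ` A)" by force
  have "f x \<le> f a" if "x \<in> A" for x using a assms(1) that by simp
  then have "sum f A \<le> real (card A) * f a" by (rule sum_bounded_above)
  then have "(sum f A) ^ n \<le> (real (card A) * f a) ^ n"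
    using f by (intro power_mono sum_nonneg)
  also have "\<dots> = real (card A) ^ n * f a ^ n" by (rule power_mult_distrib)
  also have "\<dots> \<le> real (card A) ^ n * (\<Sum>x\<in>A. f x ^ n)"
    using assms(1) a(1) f by (intro mult_left_mono member_le_sum) auto
  finally show ?thesis .
qed

lemma abs_le_vec_norm: "x \<in> set z \<Longrightarrow> \<bar>real_of_int x\<bar> \<le> vec_norm z"
proof -
  assume "x \<in> set z"
  then obtain i where i: "i < length z" "z ! i = x" by (auto simp: in_set_conv_nth)
  have "(real_of_int (z ! i))\<^sup>2 \<le> (\<Sum>i<length z. (real_of_int (z ! i))\<^sup>2)"
    using i by (intro member_le_sum) auto
  then have "sqrt ((real_of_int x)\<^sup>2) \<le> vec_norm z"
    unfolding vec_norm_def L2_set_def i(2) by (rule real_sqrt_le_mono)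
  then show ?thesis by simp
qed

lemma vec_norm_le_total_weight: "(I, z) \<in> set L \<Longrightarrow> vec_norm z \<le> total_weight L"
proof (induction L)
  case (Cons e L)
  have nn: "0 \<le> vec_norm z" for z unfolding vec_norm_def by simp
  then have "0 \<le> total_weight L" unfolding total_weight_def by (intro sum_list_nonneg) auto
  moreover have "total_weight (e # L) = vec_norm (snd e) + total_weight L"
    by (simp add: total_weight_def case_prod_beta)
  ultimately show ?case using Cons nn[of "snd e"] by force
qed simp

text \<open>
  No coordinate of a weight exceeds \<open>D\<close> initially, so that the sum of the absolute values of a
  coordinate over all points is at most \<open>N \<lfloor>D\<rfloor>\<close>; the term \<open>8 (N + 1)\<close> accounts for the positions.
\<close>

lemma size_bounds:
  assumes N: "1 \<le> (N :: int)" and D: "1 \<le> (D :: real)"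
  shows "real (isize (8 * (N + 1) + N * \<lfloor>D\<rfloor>)) \<le> log 2 N + log 2 D + 7"
    and "N + 1 < 2 ^ nat (bitlen (N + 1))" "real (nat (bitlen (N + 1))) \<le> log 2 N + 3"
proof -
  have N': "1 \<le> real_of_int N" using N by simp
  have lN: "log 2 (real_of_int N * 4) = log 2 N + 2"
    using N' log_pow_cancel[of 2 2] by (simp add: log_mult)
  show "N + 1 < 2 ^ nat (bitlen (N + 1))" using bitlen_bounds[of "N + 1"] N by simp
  have "real (isize (N + 1)) \<le> log 2 (real_of_int (N + 1 + 1)) + 2"
    using N by (intro isize_nonneg_log) simp
  also have "log 2 (real_of_int (N + 1 + 1)) \<le> log 2 (real_of_int N * 4)" using N' by simp
  finally show "real (nat (bitlen (N + 1))) \<le> log 2 N + 3"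
    using N unfolding lN isize_def by simp
  define X where "X = 8 * (N + 1) + N * \<lfloor>D\<rfloor>"
  have "real_of_int \<lfloor>D\<rfloor> \<le> D" "0 \<le> \<lfloor>D\<rfloor>" using D by simp_all
  then have X: "0 \<le> X" using N by (simp add: X_def)
  have "real_of_int N * real_of_int \<lfloor>D\<rfloor> \<le> real_of_int N * D" "real_of_int N * 1 \<le> real_of_int N * D"
    using N' D by (intro mult_left_mono; simp)+
  moreover have "real_of_int (X + 1) = 8 * real_of_int N + 9 + real_of_int N * real_of_int \<lfloor>D\<rfloor>"
    by (simp add: X_def)
  ultimately have "real_of_int (X + 1) \<le> real_of_int N * D * 32"
    using N' by linarith
  then have "log 2 (real_of_int (X + 1)) \<le> log 2 (real_of_int N * D * 32)"
    using X N' D by simp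
  also have "\<dots> = log 2 N + log 2 D + 5"
    using N' D log_pow_cancel[of 2 5] by (simp add: log_mult)
  finally show "real (isize (8 * (N + 1) + N * \<lfloor>D\<rfloor>)) \<le> log 2 N + log 2 D + 7"
    using isize_nonneg_log[OF X] unfolding X_def by simp
qed

theorem theorem16:
  "\<exists>(E :: (nat \<times> nat \<times> nat \<times> nat \<times> nat) set) (\<gamma> :: nat \<times> nat \<times> nat \<times> nat \<times> nat \<Rightarrow> real).
     finite E \<and>
     (\<forall>(k :: nat) (m :: nat) (d :: nat) (D :: real) (N :: int) (gs :: pairing list) (L :: weights).
        1 \<le> N \<longrightarrow> 1 \<le> D \<longrightarrow>
        length gs = k \<longrightarrow> (\<forall>g \<in> set gs. is_pairing N g) \<longrightarrow>
        length L = m \<longrightarrow> weight_list d L \<longrightarrow> support L = {1..N} \<longrightarrow>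
        total_weight L \<le> D \<longrightarrow>
        (\<exists>L' T. weighted_orbit_counting N gs L = Some (TM L' T) \<and>
           lists_orbits N gs d L L' \<and>
           real T \<le> (\<Sum>(e1, e2, e3, e4, e5) \<in> E. \<gamma> (e1, e2, e3, e4, e5) *
             real k ^ e1 * real m ^ e2 * real d ^ e3 * log 2 D ^ e4 * log 2 (real_of_int N) ^ e5)))"
proof -
  obtain C q where Cq: "\<And>y. time_bound y \<le> C * (y + 1) ^ q"
    using time_bound_polynomial unfolding polynomially_bounded_def by blast
  define p where "p = Suc q"
  define E :: "(nat \<times> nat \<times> nat \<times> nat \<times> nat) set"
    where "E = {(0, 0, 0, 0, 0), (p, 0, 0, 0, 0), (0, p, 0, 0, 0), (0, 0, p, 0, 0), (0, 0, 0, p, 0), (0, 0, 0, 0, p)}"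
  define c where "c = real C * 11 ^ p * 6 ^ p"
  have E: "(\<Sum>(e1, e2, e3, e4, e5)\<in>E. c * real k ^ e1 * real m ^ e2 * real d ^ e3 * x ^ e4 * y ^ e5) =
      c * (1 + real k ^ p + real m ^ p + real d ^ p + x ^ p + y ^ p)" for k m d :: nat and x y
    by (simp add: E_def p_def distrib_left)
  have "\<exists>L' T. weighted_orbit_counting N gs L = Some (TM L' T) \<and> lists_orbits N gs d L L' \<and>
      real T \<le> c * (1 + real (length gs) ^ p + real (length L) ^ p + real d ^ p +
        log 2 D ^ p + log 2 (real_of_int N) ^ p)"
    if N: "1 \<le> N" and D: "1 \<le> D" and gs: "\<forall>g\<in>set gs. is_pairing N g"
      and L: "weight_list d L" "support L = {1..N}" "total_weight L \<le> D" for d D N gs L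
  proof -
    note sb = size_bounds[OF N D]
    define R where "R = nat (bitlen (N + 1))"
    define y where "y = length gs + length L + d + isize (8 * (N + 1) + N * \<lfloor>D\<rfloor>) + R"
    have small: "\<forall>((p, q), z)\<in>set L. \<forall>x\<in>set z. \<bar>x\<bar> \<le> \<lfloor>D\<rfloor>"
    proof (clarify)
      fix p q z x assume "((p, q), z) \<in> set L" "x \<in> set z"
      then have "real_of_int \<bar>x\<bar> \<le> D"
        using abs_le_vec_norm[of x z] vec_norm_le_total_weight[of "(p, q)" z L] L(3) by simp
      then show "\<bar>x\<bar> \<le> \<lfloor>D\<rfloor>" by (rule le_floor_iff[THEN iffD2])
    qed
    obtain L' T where T: "weighted_orbit_counting N gs L = Some (TM L' T)" "lists_orbits N gs d L L'"
      and Ty: "T \<le> time_bound y"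
      by (rule running_time[OF gs N L(1,2) small, of y R]) (use sb(2) D in \<open>simp_all add: y_def R_def\<close>)
    have lD: "0 \<le> log 2 D" and lN: "0 \<le> log 2 (real_of_int N)" using D N by simp_all
    define a where "a = [1, real (length gs), real (length L), real d, log 2 D, log 2 (real_of_int N)]"
    have sum_a: "(\<Sum>i<6. f (a ! i)) = f 1 + f (real (length gs)) + f (real (length L)) + f (real d) +
        f (log 2 D) + f (log 2 (real_of_int N))" for f :: "real \<Rightarrow> real"
      by (simp add: a_def eval_nat_numeral lessThan_Suc)
    have a0: "0 \<le> a ! i" if "i < 6" for i
      using that lD lN unfolding a_def by (auto simp: less_Suc_eq eval_nat_numeral)
    have "real y + 1 \<le> 11 * (\<Sum>i<6. a ! i)"
      unfolding sum_a[of "\<lambda>x. x"] y_def R_def using sb lD lN by simp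
    have "real T \<le> real C * (real y + 1) ^ p"
    proof -
      have "T \<le> C * (y + 1) ^ q" using Ty Cq[of y] by linarith
      also have "\<dots> \<le> C * (y + 1) ^ p" unfolding p_def by (intro mult_le_mono2 power_increasing) simp_all
      finally have "real T \<le> real (C * (y + 1) ^ p)" by (rule of_nat_mono)
      then show ?thesis by (simp add: add.commute)
    qed
    also have "(real y + 1) ^ p \<le> (11 * (\<Sum>i<6. a ! i)) ^ p"
      using \<open>real y + 1 \<le> _\<close> by (intro power_mono) simp_all
    also have "\<dots> = 11 ^ p * (\<Sum>i<6. a ! i) ^ p" by (rule power_mult_distrib)
    also have "(\<Sum>i<6. a ! i) ^ p \<le> 6 ^ p * (\<Sum>i<6. (a ! i) ^ p)"
      using power_sum_le[of "{..<6::nat}" "\<lambda>i. a ! i" p] a0 by (simp add: lessThan_empty_iff)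
    finally have "real T \<le> real C * (11 ^ p * (6 ^ p * (\<Sum>i<6. (a ! i) ^ p)))"
      by (simp add: mult_left_mono)
    also have "\<dots> = c * (1 + real (length gs) ^ p + real (length L) ^ p + real d ^ p +
        log 2 D ^ p + log 2 (real_of_int N) ^ p)"
      unfolding sum_a[of "\<lambda>x. x ^ p"] c_def by (simp add: mult_ac)
    finally show ?thesis using T by blast
  qed
  then show ?thesis
    by (intro exI[of _ E] exI[of _ "\<lambda>_. c"] conjI allI impI) (simp_all only: E, auto simp: E_def)
qed

end
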